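(* Let $m\geq 2$. Both of the following divergence operators are surjective: $$\mathrm{div}: L_1(\mathbb{R}^m;\mathbb{R}^m)\to \mathcal{F}(\mathbb{R}^m),\qquad \langle u,\mathrm{div}\,v\rangle=-\int_{\mathbb{R}^m}\nabla u\cdot v\,d\mathcal{L}^m\quad (u\in \mathrm{Lip}_0(\mathbb{R}^m)),$$ and $$\mathrm{div}: C_0(\mathbb{R}^m;\mathbb{R}^m)\to SCH_0(\mathbb{R}^m),\qquad \langle u,\mathrm{div}\,v\rangle=-\sum_{i=1}^m\int_{\mathbb{R}^m}v_i\,d(D_iu)\quad (u\in BV_{1^*}(\mathbb{R}^m)).$$
   Context: $\mathcal{L}^m$ is Lebesgue measure, $|\cdot|_2$ the Euclidean norm, $1^*=m/(m-1)$. $\mathrm{Lip}_0(\mathbb{R}^m)$ is the Banach space of Lipschitz functions $u:\mathbb{R}^m\to\mathbb{R}$ with $u(0)=0$, with norm $\|u\|_L=\mathrm{Lip}\,u$. For $x\in\mathbb{R}^m$ let $\boldsymbol\delta(x)\in \mathrm{Lip}_0(\mathbb{R}^m)^*$ be the evaluation at $x$. The Lipschitz-free space $\mathcal{F}(\mathbb{R}^m)$ is the norm closure in $\mathrm{Lip}_0(\mathbb{R}^m)^*$ of the linear span of $\{\boldsymbol\delta(x):x\in\mathbb{R}^m\}$. $BV_{1^*}(\mathbb{R}^m)$ is the space of $u\in L_{1^*}(\mathbb{R}^m)$ whose distributional partial derivatives are (finite) signed Borel measures $D_1u,\dots,D_mu$, with norm $\|Du\|(\mathbb{R}^m)=\sup\{\int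 u\,\mathrm{div}\,v\,d\mathcal{L}^m: v\in C_c^\infty(\mathbb{R}^m;\mathbb{R}^m),\ \sup_x|v(x)|_2\leq 1\}$; it is a Banach space. For $f\in L_m(\mathbb{R}^m)$ let $\Lambda_m(f)\in BV_{1^*}(\mathbb{R}^m)^*$ be $u\mapsto\int u f\,d\mathcal{L}^m$. $SCH_0(\mathbb{R}^m)$ is the norm closure in $BV_{1^*}(\mathbb{R}^m)^*$ of $\{\Lambda_m(f):f\in L_m(\mathbb{R}^m)\}$. $C_0(\mathbb{R}^m;\mathbb{R}^m)$ is the space of continuous vector fields vanishing at infinity, with the sup norm. The two operators are well defined, i.e. take values in the indicated spaces. *)

theory Defs
  imports "HOL-Analysis.Analysis" "HOL-Library.Cardinality"
begin

section \<open>Lipschitz functions vanishing at the origin and the Lipschitz-free space\<close>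

typedef ('n::finite) lip0 =
  "{u :: real^'n \<Rightarrow> real. u 0 = 0 \<and> (\<exists>L. L-lipschitz_on UNIV u)}"
  by (rule exI[of _ "\<lambda>_. 0"]) (auto intro: lipschitz_on_constant)

setup_lifting type_definition_lip0

definition Lip :: "(real^'n \<Rightarrow> real) \<Rightarrow> real" where
  "Lip u = Inf {L. L-lipschitz_on UNIV u}"

lemma Lip_lipschitz:
  fixes u :: "real^'n \<Rightarrow> real"
  assumes "L-lipschitz_on UNIV u"
  shows "(Lip u)-lipschitz_on UNIV u"
proof -
  let ?S = "{L. L-lipschitz_on UNIV u}"
  have ne: "?S \<noteq> {}" using assms by blast
  show ?thesis
  proof (rule lipschitz_onI)
    show "0 \<le> Lip u"
      unfolding Lip_def using ne by (intro cInf_greatest) (auto dest: lipschitz_on_nonneg)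
    fix x y :: "real^'n"
    show "dist (u x) (u y) \<le> Lip u * dist x y"
    proof (cases "x = y")
      case False
      then have d: "dist x y > 0" by simp
      have "dist (u x) (u y) / dist x y \<le> Lip u"
        unfolding Lip_def
      proof (rule cInf_greatest[OF ne])
        fix L assume "L \<in> ?S"
        then have "dist (u x) (u y) \<le> L * dist x y" by (auto dest: lipschitz_onD)
        then show "dist (u x) (u y) / dist x y \<le> L" using d by (simp add: field_simps)
      qed
      then show ?thesis using d by (simp add: field_simps)
    qed simp
  qed
qed

lemma Lip_le:
  fixes u :: "real^'n \<Rightarrow> real"
  assumes "L-lipschitz_on UNIV u"
  shows "Lip u \<le> L"
  unfolding Lip_def using assms
  by (intro cInf_lower bdd_belowI[of _ 0]) (auto dest: lipschitz_on_nonneg)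

instantiation lip0 :: (finite) real_normed_vector
begin

lift_definition zero_lip0 :: "'a lip0" is "\<lambda>_. 0"
  by (auto intro: lipschitz_on_constant)

lift_definition plus_lip0 :: "'a lip0 \<Rightarrow> 'a lip0 \<Rightarrow> 'a lip0" is "\<lambda>u v x. u x + v x"
  by (auto intro: lipschitz_on_add)

lift_definition minus_lip0 :: "'a lip0 \<Rightarrow> 'a lip0 \<Rightarrow> 'a lip0" is "\<lambda>u v x. u x - v x"
  by (auto intro: lipschitz_on_diff)

lift_definition uminus_lip0 :: "'a lip0 \<Rightarrow> 'a lip0" is "\<lambda>u x. - u x"
  by (auto intro: lipschitz_on_minus)

lift_definition scaleR_lip0 :: "real \<Rightarrow> 'a lip0 \<Rightarrow> 'a lip0" is "\<lambda>c u x. c * u x"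
  by (auto intro: lipschitz_on_cmult_real)

lift_definition norm_lip0 :: "'a lip0 \<Rightarrow> real" is Lip .

definition dist_lip0 :: "'a lip0 \<Rightarrow> 'a lip0 \<Rightarrow> real" where
  "dist_lip0 u v = norm (u - v)"

definition sgn_lip0 :: "'a lip0 \<Rightarrow> 'a lip0" where
  "sgn_lip0 u = scaleR (inverse (norm u)) u"

definition uniformity_lip0 :: "('a lip0 \<times> 'a lip0) filter" where
  "uniformity_lip0 = (INF e\<in>{0 <..}. principal {(x, y). dist x y < e})"

definition open_lip0 :: "'a lip0 set \<Rightarrow> bool" where
  "open_lip0 U = (\<forall>x\<in>U. eventually (\<lambda>(x', y). x' = x \<longrightarrow> y \<in> U) uniformity)"

instance
proof
  fix u v w :: "'a lip0" and c d :: real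
  show "u + v + w = u + (v + w)" by transfer (simp add: algebra_simps)
  show "u + v = v + u" by transfer (simp add: algebra_simps)
  show "0 + u = u" by transfer simp
  show "- u + u = 0" by transfer simp
  show "u - v = u + - v" by transfer simp
  show "c *\<^sub>R (u + v) = c *\<^sub>R u + c *\<^sub>R v" by transfer (simp add: algebra_simps)
  show "(c + d) *\<^sub>R u = c *\<^sub>R u + d *\<^sub>R u" by transfer (simp add: algebra_simps)
  show "c *\<^sub>R d *\<^sub>R u = (c * d) *\<^sub>R u" by transfer (simp add: algebra_simps)
  show "1 *\<^sub>R u = u" by transfer simp
  show "dist u v = norm (u - v)" by (rule dist_lip0_def)
  show "sgn u = scaleR (inverse (norm u)) u" by (rule sgn_lip0_def)
  show "(uniformity :: ('a lip0 \<times> 'a lip0) filter) = (INF e\<in>{0 <..}. principal {(x, y). dist x y < e})"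
    by (rule uniformity_lip0_def)
  show "open U = (\<forall>x\<in>U. eventually (\<lambda>(x', y). x' = x \<longrightarrow> y \<in> U) uniformity)" for U :: "'a lip0 set"
    by (rule open_lip0_def)
  show "norm u = 0 \<longleftrightarrow> u = 0"
  proof
    assume "norm u = 0"
    then show "u = 0"
    proof transfer
      fix u :: "real^'a \<Rightarrow> real"
      assume u: "u 0 = 0 \<and> (\<exists>L. L-lipschitz_on UNIV u)" and 0: "Lip u = 0"
      then have "0-lipschitz_on UNIV u" using Lip_lipschitz by metis
      then have "dist (u x) (u 0) \<le> 0 * dist x 0" for x by (rule lipschitz_onD) auto
      then show "u = (\<lambda>_. 0)" using u by (auto simp: fun_eq_iff)
    qed
  next
    assume "u = 0"
    moreover have "norm (0 :: 'a lip0) = 0"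
    proof transfer
      have l: "0-lipschitz_on UNIV (\<lambda>_::real^'a. 0::real)" by (rule lipschitz_on_constant)
      show "Lip (\<lambda>_::real^'a. 0) = 0"
        using Lip_le[OF l] lipschitz_on_nonneg[OF Lip_lipschitz[OF l]] by simp
    qed
    ultimately show "norm u = 0" by simp
  qed
  show "norm (u + v) \<le> norm u + norm v"
    by transfer (blast intro: Lip_le lipschitz_on_add Lip_lipschitz)
  show "norm (c *\<^sub>R u) = \<bar>c\<bar> * norm u"
  proof transfer
    fix c and u :: "real^'a \<Rightarrow> real"
    assume u: "u 0 = 0 \<and> (\<exists>L. L-lipschitz_on UNIV u)"
    have le: "Lip (\<lambda>x. c * w x) \<le> \<bar>c\<bar> * Lip w"
      if "\<exists>L. L-lipschitz_on UNIV w" for c and w :: "real^'a \<Rightarrow> real"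
      using that by (auto intro!: Lip_le lipschitz_on_cmult_real Lip_lipschitz)
    show "Lip (\<lambda>x. c * u x) = \<bar>c\<bar> * Lip u"
    proof (cases "c = 0")
      case True
      have "0 \<le> Lip (\<lambda>x. c * u x)"
        using u lipschitz_on_nonneg[OF Lip_lipschitz[OF lipschitz_on_cmult_real]] by blast
      with le[of u c] u True show ?thesis by auto
    next
      case False
      have "Lip (\<lambda>x. (1/c) * (c * u x)) \<le> \<bar>1/c\<bar> * Lip (\<lambda>x. c * u x)"
        using u by (intro le) (blast intro: lipschitz_on_cmult_real)
      with False have "\<bar>c\<bar> * Lip u \<le> Lip (\<lambda>x. c * u x)"
        by (simp add: field_simps abs_divide)
      with le[of u c] u show ?thesis by auto
    qed
  qed
qed

end

lift_definition lip_eval :: "real^'n \<Rightarrow> ('n lip0 \<Rightarrow>\<^sub>L real)" is "\<lambda>x u. Rep_lip0 u x"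
proof (rule bounded_linear_intro)
  fix x :: "real^'n" and u v :: "'n lip0" and c :: real
  show "Rep_lip0 (u + v) x = Rep_lip0 u x + Rep_lip0 v x" by transfer simp
  show "Rep_lip0 (c *\<^sub>R u) x = c *\<^sub>R Rep_lip0 u x" by transfer simp
  show "norm (Rep_lip0 u x) \<le> norm u * norm x"
  proof transfer
    fix u :: "real^'n \<Rightarrow> real" and x
    assume u: "u 0 = 0 \<and> (\<exists>L. L-lipschitz_on UNIV u)"
    then have "dist (u x) (u 0) \<le> Lip u * dist x 0"
      by (blast intro: lipschitz_onD[OF Lip_lipschitz])
    then show "norm (u x) \<le> Lip u * norm x" using u by simp
  qed
qed

definition lipschitz_free_space :: "('n::finite lip0 \<Rightarrow>\<^sub>L real) set" where
  "lipschitz_free_space = closure (span (range lip_eval))"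


section \<open>Partial derivatives and test functions\<close>

definition partial_deriv :: "'n::finite \<Rightarrow> (real^'n \<Rightarrow> real) \<Rightarrow> real^'n \<Rightarrow> real" where
  "partial_deriv i f x = frechet_derivative f (at x) (axis i 1)"

definition gradient :: "(real^'n \<Rightarrow> real) \<Rightarrow> real^'n \<Rightarrow> real^'n" where
  "gradient f x = (\<chi> i. partial_deriv i f x)"

definition divergence :: "(real^'n \<Rightarrow> real^'n) \<Rightarrow> real^'n \<Rightarrow> real" where
  "divergence v x = (\<Sum>i\<in>UNIV. partial_deriv i (\<lambda>y. v y $ i) x)"

primrec Ck :: "nat \<Rightarrow> (real^'n \<Rightarrow> real) \<Rightarrow> bool" where
  "Ck 0 f \<longleftrightarrow> continuous_on UNIV f"
| "Ck (Suc k) f \<longleftrightarrow> (\<forall>x. f differentiable (at x)) \<and> (\<forall>i. Ck k (partial_deriv i f))"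

definition smooth :: "(real^'n \<Rightarrow> real) \<Rightarrow> bool" where
  "smooth f \<longleftrightarrow> (\<forall>k. Ck k f)"

definition test_fun :: "(real^'n \<Rightarrow> real) \<Rightarrow> bool" where
  "test_fun \<phi> \<longleftrightarrow> smooth \<phi> \<and> (\<exists>K. compact K \<and> (\<forall>x. x \<notin> K \<longrightarrow> \<phi> x = 0))"

definition test_field :: "(real^'n \<Rightarrow> real^'n) \<Rightarrow> bool" where
  "test_field v \<longleftrightarrow> (\<forall>i. test_fun (\<lambda>x. v x $ i))"

lemma partial_deriv_eq:
  "(f has_derivative D) (at x) \<Longrightarrow> partial_deriv i f x = D (axis i 1)"
  unfolding partial_deriv_def by (metis frechet_derivative_at)

lemma Ck_continuous: "Ck k f \<Longrightarrow> continuous_on UNIV f"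
  by (cases k) (auto intro!: continuous_at_imp_continuous_on differentiable_imp_continuous_within)

lemma Ck_Suc_imp: "Ck (Suc k) f \<Longrightarrow> Ck k f"
  by (induction k arbitrary: f)
     (auto intro!: continuous_at_imp_continuous_on differentiable_imp_continuous_within)

lemma partial_deriv_const [simp]: "partial_deriv i (\<lambda>_. c) = (\<lambda>_. 0)"
  by (rule ext) (rule partial_deriv_eq[OF has_derivative_const, simplified])

lemma Ck_const [simp]: "Ck k (\<lambda>_. c)"
  by (induction k arbitrary: c) auto

lemma has_derivative_frechet:
  "f differentiable (at x) \<Longrightarrow> (f has_derivative frechet_derivative f (at x)) (at x)"
  by (simp add: frechet_derivative_works)

lemma partial_deriv_add:
  assumes "f differentiable (at x)" "g differentiable (at x)"
  shows "partial_deriv i (\<lambda>x. f x + g x) x = partial_deriv i f x + partial_deriv i g x"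
  unfolding partial_deriv_def
  using partial_deriv_eq[OF has_derivative_add[OF assms[THEN has_derivative_frechet]]]
  by (simp add: partial_deriv_def)

lemma partial_deriv_mult:
  assumes "f differentiable (at x)" "g differentiable (at x)"
  shows "partial_deriv i (\<lambda>x. f x * g x) x = f x * partial_deriv i g x + partial_deriv i f x * g x"
  using partial_deriv_eq[OF has_derivative_mult[OF assms[THEN has_derivative_frechet]]]
  by (simp add: partial_deriv_def)

lemma Ck_add: "Ck k f \<Longrightarrow> Ck k g \<Longrightarrow> Ck k (\<lambda>x. f x + g x)"
proof (induction k arbitrary: f g)
  case (Suc k)
  then have "partial_deriv i (\<lambda>x. f x + g x) = (\<lambda>x. partial_deriv i f x + partial_deriv i g x)" for i
    by (auto simp: fun_eq_iff partial_deriv_add)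
  with Suc show ?case by auto
qed (auto intro: continuous_intros)

lemma Ck_mult: "Ck k f \<Longrightarrow> Ck k g \<Longrightarrow> Ck k (\<lambda>x. f x * g x)"
proof (induction k arbitrary: f g)
  case (Suc k)
  then have *: "partial_deriv i (\<lambda>x. f x * g x)
      = (\<lambda>x. f x * partial_deriv i g x + partial_deriv i f x * g x)" for i
    by (auto simp: fun_eq_iff partial_deriv_mult)
  have "Ck k f" "Ck k g" using Suc.prems Ck_Suc_imp by blast+
  with Suc show ?case unfolding Ck.simps(2) * by (auto intro!: Ck_add)
qed (auto intro: continuous_intros)

lemma smooth_const [simp]: "smooth (\<lambda>_. c)"
  and smooth_add: "smooth f \<Longrightarrow> smooth g \<Longrightarrow> smooth (\<lambda>x. f x + g x)"
  and smooth_mult: "smooth f \<Longrightarrow> smooth g \<Longrightarrow> smooth (\<lambda>x. f x * g x)"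
  by (auto simp: smooth_def Ck_add Ck_mult)

lemma smooth_prod: "finite I \<Longrightarrow> (\<And>i. i \<in> I \<Longrightarrow> smooth (f i)) \<Longrightarrow> smooth (\<lambda>x. \<Prod>i\<in>I. f i x)"
  by (induction I rule: finite_induct) (auto intro: smooth_mult)

lemma smooth_differentiable: "smooth f \<Longrightarrow> f differentiable (at x)"
  unfolding smooth_def by (drule spec[of _ "Suc 0"]) simp

lemma smooth_continuous: "smooth f \<Longrightarrow> continuous_on UNIV f"
  unfolding smooth_def using Ck_continuous by blast

lemma smooth_partial: "smooth f \<Longrightarrow> smooth (partial_deriv i f)"
  unfolding smooth_def using Ck.simps(2) by blast

lemma smooth_of_deriv:
  assumes d: "\<And>x. (f has_derivative (\<lambda>h. h $ j * g x)) (at x)" and g: "smooth g"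
  shows "smooth f"
  unfolding smooth_def
proof
  fix k
  have *: "partial_deriv i f = (\<lambda>x. (if i = j then 1 else 0) * g x)" for i
    by (auto simp: fun_eq_iff partial_deriv_eq[OF d] axis_def)
  have "Ck k (partial_deriv i f)" for i
    unfolding * using g by (intro Ck_mult) (auto simp: smooth_def)
  then have "Ck (Suc k) f" using d by (auto simp: differentiable_def)
  then show "Ck k f" by (rule Ck_Suc_imp)
qed

lemma test_fun_partial:
  assumes "test_fun \<phi>" shows "test_fun (partial_deriv i \<phi>)"
proof -
  obtain K where K: "compact K" "\<And>x. x \<notin> K \<Longrightarrow> \<phi> x = 0"
    using assms by (auto simp: test_fun_def)
  have "partial_deriv i \<phi> x = 0" if "x \<notin> K" for x
  proof -
    have "((\<lambda>_. 0) has_derivative (\<lambda>_. 0)) (at x)" by simp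
    then have "(\<phi> has_derivative (\<lambda>_. 0)) (at x)"
      by (rule has_derivative_transform_within_open[where s="-K"])
         (use K that compact_imp_closed in auto)
    then show ?thesis by (simp add: partial_deriv_eq)
  qed
  then show ?thesis using assms K smooth_partial unfolding test_fun_def by blast
qed

lemma test_fun_bounded:
  assumes "test_fun \<phi>"
  obtains B where "B > 0" "\<And>x. \<bar>\<phi> x\<bar> \<le> B"
proof -
  obtain K where K: "compact K" "\<And>x. x \<notin> K \<Longrightarrow> \<phi> x = 0" and c: "continuous_on UNIV \<phi>"
    using assms smooth_continuous by (auto simp: test_fun_def)
  have "compact (\<phi> ` K)" using K(1) c by (meson compact_continuous_image continuous_on_subset subset_UNIV)
  then obtain B where "B > 0" "\<forall>y\<in>\<phi> ` K. norm y \<le> B"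
    using bounded_pos compact_imp_bounded by blast
  then have "\<bar>\<phi> x\<bar> \<le> B" for x using K(2)[of x] by (cases "x \<in> K") auto
  with \<open>B > 0\<close> show ?thesis using that by blast
qed

lemma test_fun_cmult: "test_fun \<phi> \<Longrightarrow> test_fun (\<lambda>x. c * \<phi> x)"
  unfolding test_fun_def using smooth_mult[OF smooth_const] by fastforce


section \<open>Functions of bounded variation\<close>

definition Lp :: "real \<Rightarrow> (real^'n \<Rightarrow> real) set" where
  "Lp p = {u. u \<in> borel_measurable lebesgue \<and> integrable lebesgue (\<lambda>x. \<bar>u x\<bar> powr p)}"

definition conj_exp :: "'n::finite itself \<Rightarrow> real" where
  "conj_exp _ = real CARD('n) / (real CARD('n) - 1)"

(* A finite signed Borel measure is encoded as a pair of finite Borel measures, standing for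
   their difference (Jordan decomposition); integrals against it do not depend on the pair. *)
definition signed_borel_measure :: "(real^'n) measure \<times> (real^'n) measure \<Rightarrow> bool" where
  "signed_borel_measure = (\<lambda>(\<mu>, \<nu>).
     finite_measure \<mu> \<and> sets \<mu> = sets borel \<and> finite_measure \<nu> \<and> sets \<nu> = sets borel)"

definition signed_integral ::
  "(real^'n) measure \<times> (real^'n) measure \<Rightarrow> (real^'n \<Rightarrow> real) \<Rightarrow> real" where
  "signed_integral = (\<lambda>(\<mu>, \<nu>) f. (LINT x|\<mu>. f x) - (LINT x|\<nu>. f x))"

definition is_distr_deriv ::
  "'n::finite \<Rightarrow> (real^'n \<Rightarrow> real) \<Rightarrow> (real^'n) measure \<times> (real^'n) measure \<Rightarrow> bool" where
  "is_distr_deriv i u \<sigma> \<longleftrightarrow> signed_borel_measure \<sigma> \<and>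
     (\<forall>\<phi>. test_fun \<phi> \<longrightarrow>
       (LINT x|lebesgue. u x * partial_deriv i \<phi> x) = - signed_integral \<sigma> \<phi>)"

definition BV_fun :: "(real^'n \<Rightarrow> real) set" where
  "BV_fun = {u \<in> Lp (conj_exp TYPE('n)). \<forall>i. \<exists>\<sigma>. is_distr_deriv i u \<sigma>}"

definition unit_fields :: "(real^'n \<Rightarrow> real^'n) set" where
  "unit_fields = {v. test_field v \<and> (\<forall>x. norm (v x) \<le> 1)}"

definition variation :: "(real^'n \<Rightarrow> real) \<Rightarrow> real" where
  "variation u = (SUP v\<in>unit_fields. LINT x|lebesgue. u x * divergence v x)"

subsection \<open>Linear structure\<close>

lemma Lp_measurable: "u \<in> Lp p \<Longrightarrow> u \<in> borel_measurable lebesgue"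
  by (simp add: Lp_def)

lemma Lp_zero: "(\<lambda>_. 0) \<in> Lp p"
  by (simp add: Lp_def)

lemma Lp_scale:
  assumes "u \<in> Lp p" shows "(\<lambda>x. c * u x) \<in> Lp p"
  using assms by (auto simp: Lp_def abs_mult powr_mult)

lemma Lp_add:
  fixes u v :: "real^'n \<Rightarrow> real"
  assumes p: "0 \<le> p" and u: "u \<in> Lp p" and v: "v \<in> Lp p"
  shows "(\<lambda>x. u x + v x) \<in> Lp p"
proof -
  note [measurable] = Lp_measurable[OF u] Lp_measurable[OF v]
  have "integrable lebesgue (\<lambda>x. \<bar>u x + v x\<bar> powr p)"
  proof (rule Bochner_Integration.integrable_bound)
    show "integrable lebesgue (\<lambda>x. 2 powr p * (\<bar>u x\<bar> powr p + \<bar>v x\<bar> powr p))"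
      using u v by (simp add: Lp_def)
    have "\<bar>a + b\<bar> powr p \<le> 2 powr p * (\<bar>a\<bar> powr p + \<bar>b\<bar> powr p)" for a b :: real
    proof -
      have "\<bar>a + b\<bar> powr p \<le> (2 * max \<bar>a\<bar> \<bar>b\<bar>) powr p"
        using p by (intro powr_mono2) auto
      also have "\<dots> = 2 powr p * max \<bar>a\<bar> \<bar>b\<bar> powr p"
        by (simp add: powr_mult)
      also have "\<dots> \<le> 2 powr p * (\<bar>a\<bar> powr p + \<bar>b\<bar> powr p)"
        by (intro mult_left_mono) (auto simp: max_def)
      finally show ?thesis .
    qed
    then show "AE x in lebesgue. norm (\<bar>u x + v x\<bar> powr p)
        \<le> norm (2 powr p * (\<bar>u x\<bar> powr p + \<bar>v x\<bar> powr p))"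
      by (auto intro!: AE_I2 simp del: powr_sum)
  qed measurable
  then show ?thesis by (simp add: Lp_def)
qed

lemma Lp_cong_AE:
  assumes u: "u \<in> Lp p" and m: "v \<in> borel_measurable lebesgue" and ae: "AE x in lebesgue. u x = v x"
  shows "v \<in> Lp p"
proof -
  note [measurable] = Lp_measurable[OF u] m
  have "integrable lebesgue (\<lambda>x. \<bar>v x\<bar> powr p)"
    using u ae by (subst integrable_cong_AE[where g="\<lambda>x. \<bar>u x\<bar> powr p"]) (auto simp: Lp_def)
  then show ?thesis using m by (simp add: Lp_def)
qed

lemma test_fun_borel: "test_fun g \<Longrightarrow> g \<in> borel_measurable borel"
  by (auto simp: test_fun_def intro: borel_measurable_continuous_onI smooth_continuous)

lemma test_fun_measurable: "test_fun g \<Longrightarrow> g \<in> borel_measurable lebesgue"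
  by (intro measurable_completion) (simp add: test_fun_borel)

lemma Lp_integrable_mult_test:
  fixes u :: "real^'n \<Rightarrow> real"
  assumes p: "1 \<le> p" and u: "u \<in> Lp p" and g: "test_fun g"
  shows "integrable lebesgue (\<lambda>x. u x * g x)"
proof -
  obtain K where K: "compact K" "\<And>x. x \<notin> K \<Longrightarrow> g x = 0"
    using g by (auto simp: test_fun_def)
  obtain B where B: "B > 0" "\<And>x. \<bar>g x\<bar> \<le> B" using test_fun_bounded[OF g] by blast
  have [measurable]: "g \<in> borel_measurable lebesgue"
    by (rule test_fun_measurable[OF g])
  note [measurable] = Lp_measurable[OF u]
  have Km: "K \<in> lmeasurable" using K(1) by (rule lmeasurable_compact)
  show ?thesis
  proof (rule Bochner_Integration.integrable_bound)
    show "integrable lebesgue (\<lambda>x. B * (indicator K x + \<bar>u x\<bar> powr p))"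
      using u Km by (auto simp: Lp_def lmeasurable_iff_integrable)
    have *: "\<bar>a\<bar> \<le> 1 + \<bar>a\<bar> powr p" for a :: real
    proof (cases "\<bar>a\<bar> \<le> 1")
      case True
      then show ?thesis by (simp add: add_increasing2)
    next
      case False
      then have "\<bar>a\<bar> powr 1 \<le> \<bar>a\<bar> powr p" using p by (intro powr_mono) auto
      then show ?thesis using False by simp
    qed
    have "\<bar>u x * g x\<bar> \<le> \<bar>B * (indicator K x + \<bar>u x\<bar> powr p)\<bar>" for x
    proof (cases "x \<in> K")
      case True
      have "\<bar>u x * g x\<bar> \<le> \<bar>u x\<bar> * B" unfolding abs_mult using B by (intro mult_left_mono) auto
      also have "\<dots> \<le> (1 + \<bar>u x\<bar> powr p) * B" using * B by (intro mult_right_mono) auto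
      finally show ?thesis using True B by (simp add: mult.commute abs_mult)
    qed (simp add: K)
    then show "AE x in lebesgue. norm (u x * g x) \<le> norm (B * (indicator K x + \<bar>u x\<bar> powr p))"
      by (auto intro!: AE_I2)
  qed measurable
qed

definition sum_measure :: "'a measure \<Rightarrow> 'a measure \<Rightarrow> 'a measure" where
  "sum_measure M N = measure_of (space M) (sets M) (\<lambda>A. emeasure M A + emeasure N A)"

lemma space_sum_measure [simp]: "space (sum_measure M N) = space M"
  and sets_sum_measure [simp, measurable_cong]: "sets (sum_measure M N) = sets M"
  by (simp_all add: sum_measure_def)

lemma emeasure_sum_measure:
  assumes s: "sets N = sets M" and A: "A \<in> sets M"
  shows "emeasure (sum_measure M N) A = emeasure M A + emeasure N A"
  unfolding sum_measure_def
proof (rule emeasure_measure_of_sigma)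
  show "countably_additive (sets M) (\<lambda>A. emeasure M A + emeasure N A)"
  proof (rule countably_additiveI)
    fix A :: "nat \<Rightarrow> _" assume A: "range A \<subseteq> sets M" "disjoint_family A"
    have "(\<Sum>i. emeasure M (A i) + emeasure N (A i)) = (\<Sum>i. emeasure M (A i)) + (\<Sum>i. emeasure N (A i))"
      by (intro suminf_add[symmetric]) auto
    then show "(\<Sum>i. emeasure M (A i) + emeasure N (A i)) = emeasure M (\<Union>i. A i) + emeasure N (\<Union>i. A i)"
      using A s by (simp add: suminf_emeasure)
  qed
qed (use A in \<open>auto simp: positive_def sets.sigma_algebra_axioms\<close>)

lemma nn_integral_sum_measure:
  assumes s: "sets N = sets M" and f: "f \<in> borel_measurable M"
  shows "nn_integral (sum_measure M N) f = nn_integral M f + nn_integral N f"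
  using f
proof induction
  case (cong f g)
  then show ?case
    using sets_eq_imp_space_eq[OF s]
      nn_integral_cong[of M f g] nn_integral_cong[of N f g] nn_integral_cong[of "sum_measure M N" f g]
    by simp
next
  case (set A)
  then show ?case using s by (simp add: emeasure_sum_measure)
next
  case (mult f c)
  then show ?case using s by (simp add: nn_integral_cmult distrib_left cong: measurable_cong_sets)
next
  case (add f g)
  have "f \<in> borel_measurable N" "g \<in> borel_measurable N"
    using add s by (simp_all cong: measurable_cong_sets)
  with add show ?case by (simp add: nn_integral_add ac_simps cong: measurable_cong_sets)
next
  case (seq U)
  have U: "U i \<in> borel_measurable N" for i
    using seq s by (simp cong: measurable_cong_sets)
  have US: "U i \<in> borel_measurable (sum_measure M N)" for i
    using seq by simp
  have inc: "incseq U" by fact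
  have *: "nn_integral K (SUP i. U i) = (SUP i. nn_integral K (U i))"
    if "\<And>i. U i \<in> borel_measurable K" for K
  proof -
    have "(SUP i. U i) = (\<lambda>x. SUP i. U i x)" by (simp add: fun_eq_iff image_comp)
    then show ?thesis using nn_integral_monotone_convergence_SUP[OF inc that] by simp
  qed
  have IH: "nn_integral (sum_measure M N) (U i) = nn_integral M (U i) + nn_integral N (U i)" for i
    by fact
  have "nn_integral (sum_measure M N) (SUP i. U i) = (SUP i. nn_integral M (U i) + nn_integral N (U i))"
    unfolding *[OF US] IH ..
  also have "\<dots> = (SUP i. nn_integral M (U i)) + (SUP i. nn_integral N (U i))"
    using inc by (intro ennreal_SUP_add) (auto simp: incseq_def le_fun_def intro!: nn_integral_mono)
  also have "\<dots> = nn_integral M (SUP i. U i) + nn_integral N (SUP i. U i)"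
    using seq U by (simp only: *)
  finally show ?case unfolding \<open>f = (SUP i. U i)\<close> .
qed

lemma finite_sum_measure:
  assumes "sets N = sets M" "finite_measure M" "finite_measure N"
  shows "finite_measure (sum_measure M N)"
  using assms sets_eq_imp_space_eq[OF assms(1)]
  by (intro finite_measureI)
     (simp add: emeasure_sum_measure finite_measure.emeasure_finite sets_eq_imp_space_eq[OF assms(1)])

lemma integral_sum_measure:
  fixes f :: "'a \<Rightarrow> real"
  assumes s: "sets N = sets M" and M: "integrable M f" and N: "integrable N f"
  shows "integral\<^sup>L (sum_measure M N) f = integral\<^sup>L M f + integral\<^sup>L N f"
proof -
  have [measurable]: "f \<in> borel_measurable M" using M by simp
  have fin: "(\<integral>\<^sup>+ x. ennreal (f x) \<partial>M) \<noteq> \<infinity>" "(\<integral>\<^sup>+ x. ennreal (f x) \<partial>N) \<noteq> \<infinity>"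
    "(\<integral>\<^sup>+ x. ennreal (- f x) \<partial>M) \<noteq> \<infinity>" "(\<integral>\<^sup>+ x. ennreal (- f x) \<partial>N) \<noteq> \<infinity>"
    using M N by (auto simp: real_integrable_def)
  have nn: "(\<integral>\<^sup>+ x. ennreal (f x) \<partial>sum_measure M N) = (\<integral>\<^sup>+ x. ennreal (f x) \<partial>M) + (\<integral>\<^sup>+ x. ennreal (f x) \<partial>N)"
    "(\<integral>\<^sup>+ x. ennreal (- f x) \<partial>sum_measure M N) = (\<integral>\<^sup>+ x. ennreal (- f x) \<partial>M) + (\<integral>\<^sup>+ x. ennreal (- f x) \<partial>N)"
    by (auto intro!: nn_integral_sum_measure s)
  have "integrable (sum_measure M N) f"
    using fin by (simp add: real_integrable_def nn)
  then show ?thesis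
    using M N fin by (simp add: real_lebesgue_integral_def nn enn2real_plus less_top)
qed

lemma test_fun_integrable_finite:
  assumes "test_fun g" "finite_measure \<mu>" "sets \<mu> = sets borel"
  shows "integrable \<mu> g"
proof -
  obtain B where B: "\<And>x. \<bar>g x\<bar> \<le> B" using test_fun_bounded[OF assms(1)] by blast
  have "g \<in> borel_measurable borel"
    by (rule test_fun_borel[OF assms(1)])
  then have "g \<in> borel_measurable \<mu>" using assms(3) by (simp cong: measurable_cong_sets)
  then show ?thesis
    using B assms(2) by (intro finite_measure.integrable_const_bound[where B=B]) auto
qed

lemma is_distr_deriv_zero:
  "is_distr_deriv i (\<lambda>_::real^'n. 0) (null_measure borel, null_measure borel)"
  unfolding is_distr_deriv_def
proof (intro conjI allI impI)
  have "finite_measure (null_measure (borel :: (real^'n) measure))"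
    by (intro finite_measureI) simp
  then show "signed_borel_measure (null_measure borel, null_measure (borel :: (real^'n) measure))"
    unfolding signed_borel_measure_def by simp
  fix \<phi> :: "real^'n \<Rightarrow> real"
  have "signed_integral (null_measure borel, null_measure borel) \<phi> = 0"
    unfolding signed_integral_def prod.case by (rule diff_self)
  then show "(LINT x|lebesgue. 0 * partial_deriv i \<phi> x) =
      - signed_integral (null_measure borel, null_measure borel) \<phi>"
    by simp
qed

lemma is_distr_deriv_add:
  assumes p: "1 \<le> p" "u \<in> Lp p" "v \<in> Lp p"
    and u: "is_distr_deriv i u (\<mu>, \<nu>)" and v: "is_distr_deriv i v (\<mu>', \<nu>')"
  shows "is_distr_deriv i (\<lambda>x. u x + v x) (sum_measure \<mu> \<mu>', sum_measure \<nu> \<nu>')"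
  unfolding is_distr_deriv_def
proof (intro conjI allI impI)
  show "signed_borel_measure (sum_measure \<mu> \<mu>', sum_measure \<nu> \<nu>')"
    using u v by (auto simp: is_distr_deriv_def signed_borel_measure_def finite_sum_measure)
  fix \<phi> :: "real^'a \<Rightarrow> real" assume \<phi>: "test_fun \<phi>"
  have "(LINT x|lebesgue. (u x + v x) * partial_deriv i \<phi> x) =
      (LINT x|lebesgue. u x * partial_deriv i \<phi> x) + (LINT x|lebesgue. v x * partial_deriv i \<phi> x)"
    unfolding distrib_right using p \<phi>
    by (intro Bochner_Integration.integral_add) (auto intro!: Lp_integrable_mult_test test_fun_partial)
  also have "\<dots> = - signed_integral (\<mu>, \<nu>) \<phi> - signed_integral (\<mu>', \<nu>') \<phi>"
    using u v \<phi> by (simp add: is_distr_deriv_def)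
  also have "\<dots> = - signed_integral (sum_measure \<mu> \<mu>', sum_measure \<nu> \<nu>') \<phi>"
    using u v \<phi> by (auto simp: is_distr_deriv_def signed_borel_measure_def signed_integral_def
        integral_sum_measure test_fun_integrable_finite)
  finally show "(LINT x|lebesgue. (u x + v x) * partial_deriv i \<phi> x) =
      - signed_integral (sum_measure \<mu> \<mu>', sum_measure \<nu> \<nu>') \<phi>" .
qed

lemma is_distr_deriv_minus:
  assumes "is_distr_deriv i u (\<mu>, \<nu>)"
  shows "is_distr_deriv i (\<lambda>x. - u x) (\<nu>, \<mu>)"
  unfolding is_distr_deriv_def
proof (intro conjI allI impI)
  show "signed_borel_measure (\<nu>, \<mu>)"
    using assms by (auto simp: is_distr_deriv_def signed_borel_measure_def)
  fix \<phi> :: "real^'a \<Rightarrow> real" assume "test_fun \<phi>"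
  then have "(LINT x|lebesgue. u x * partial_deriv i \<phi> x) = - signed_integral (\<mu>, \<nu>) \<phi>"
    using assms unfolding is_distr_deriv_def by blast
  then show "(LINT x|lebesgue. - u x * partial_deriv i \<phi> x) = - signed_integral (\<nu>, \<mu>) \<phi>"
    by (simp add: signed_integral_def)
qed

lemma is_distr_deriv_scale_nonneg:
  assumes c: "0 \<le> c" and u: "is_distr_deriv i u (\<mu>, \<nu>)"
  shows "is_distr_deriv i (\<lambda>x. c * u x) (density \<mu> (\<lambda>_. ennreal c), density \<nu> (\<lambda>_. ennreal c))"
proof -
  have fin: "finite_measure (density M (\<lambda>_. ennreal c))" if "finite_measure M" for M :: "(real^'a) measure"
    using that by (intro finite_measureI)
      (simp add: emeasure_density nn_integral_cmult_indicator finite_measure.emeasure_finite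
        ennreal_mult_eq_top_iff)
  have int: "(LINT x|density M (\<lambda>_. ennreal c). \<phi> x) = c * (LINT x|M. \<phi> x)"
    if "test_fun \<phi>" "finite_measure M" "sets M = sets borel" for M and \<phi> :: "real^'a \<Rightarrow> real"
    using borel_measurable_integrable[OF test_fun_integrable_finite[OF that]] c
    by (subst integral_density) auto
  show ?thesis
    unfolding is_distr_deriv_def
  proof (intro conjI allI impI)
    show "signed_borel_measure (density \<mu> (\<lambda>_. ennreal c), density \<nu> (\<lambda>_. ennreal c))"
      using u by (auto simp: is_distr_deriv_def signed_borel_measure_def fin)
    fix \<phi> :: "real^'a \<Rightarrow> real" assume \<phi>: "test_fun \<phi>"
    have "(LINT x|lebesgue. c * u x * partial_deriv i \<phi> x) = c * - signed_integral (\<mu>, \<nu>) \<phi>"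
      using u \<phi> by (simp add: is_distr_deriv_def mult.assoc)
    then show "(LINT x|lebesgue. c * u x * partial_deriv i \<phi> x) =
        - signed_integral (density \<mu> (\<lambda>_. ennreal c), density \<nu> (\<lambda>_. ennreal c)) \<phi>"
      using u \<phi> by (simp add: is_distr_deriv_def signed_borel_measure_def signed_integral_def int
          right_diff_distrib)
  qed
qed

lemma is_distr_deriv_scale:
  assumes u: "\<exists>\<sigma>. is_distr_deriv i u \<sigma>"
  shows "\<exists>\<sigma>. is_distr_deriv i (\<lambda>x. c * u x) \<sigma>"
proof -
  obtain \<mu> \<nu> where u: "is_distr_deriv i u (\<mu>, \<nu>)" using u by auto
  show ?thesis
  proof (cases "0 \<le> c")
    case True
    then show ?thesis using is_distr_deriv_scale_nonneg u by blast
  next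
    case False
    then show ?thesis
      using is_distr_deriv_scale_nonneg[OF _ is_distr_deriv_minus[OF u], of "-c"] by auto
  qed
qed

lemma is_distr_deriv_cong_AE:
  assumes "u \<in> borel_measurable lebesgue" "v \<in> borel_measurable lebesgue"
    and "AE x in lebesgue. u x = v x" "is_distr_deriv i u \<sigma>"
  shows "is_distr_deriv i v \<sigma>"
proof -
  note [measurable] = assms(1,2)
  have "(LINT x|lebesgue. u x * partial_deriv i \<phi> x) = (LINT x|lebesgue. v x * partial_deriv i \<phi> x)"
    if "test_fun \<phi>" for \<phi>
  proof -
    have [measurable]: "partial_deriv i \<phi> \<in> borel_measurable lebesgue"
      by (rule test_fun_measurable[OF test_fun_partial[OF that]])
    show ?thesis using assms(3) by (intro integral_cong_AE) auto
  qed
  then show ?thesis using assms(4) by (simp add: is_distr_deriv_def)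
qed

lemma conj_exp_gt_1: "1 < conj_exp TYPE('n::card2)"
  using two_le_card[where 'a='n] by (simp add: conj_exp_def field_simps)

lemma BV_fun_Lp: "u \<in> BV_fun \<Longrightarrow> (u :: (real, 'n::card2) vec \<Rightarrow> real) \<in> Lp (conj_exp TYPE('n))"
  by (simp add: BV_fun_def)

lemma BV_fun_zero: "(\<lambda>_::(real, 'n::card2) vec. 0) \<in> BV_fun"
  using is_distr_deriv_zero by (auto simp: BV_fun_def Lp_zero)

lemma BV_fun_scale:
  fixes u :: "(real, 'n::card2) vec \<Rightarrow> real"
  shows "u \<in> BV_fun \<Longrightarrow> (\<lambda>x. c * u x) \<in> BV_fun"
  unfolding BV_fun_def using Lp_scale is_distr_deriv_scale by blast

lemma BV_fun_add:
  fixes u v :: "(real, 'n::card2) vec \<Rightarrow> real"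
  assumes u: "u \<in> BV_fun" and v: "v \<in> BV_fun"
  shows "(\<lambda>x. u x + v x) \<in> BV_fun"
proof -
  note p = conj_exp_gt_1[where 'n='n]
  have "\<exists>\<sigma>. is_distr_deriv i (\<lambda>x. u x + v x) \<sigma>" for i
  proof -
    obtain \<mu> \<nu> where "is_distr_deriv i u (\<mu>, \<nu>)" using u by (fastforce simp: BV_fun_def)
    moreover obtain \<mu>' \<nu>' where "is_distr_deriv i v (\<mu>', \<nu>')" using v by (fastforce simp: BV_fun_def)
    ultimately show ?thesis
      using is_distr_deriv_add[OF _ BV_fun_Lp[OF u] BV_fun_Lp[OF v]] p by fastforce
  qed
  then show ?thesis using u v p by (simp add: BV_fun_def Lp_add)
qed

lemma BV_fun_cong_AE:
  fixes u v :: "(real, 'n::card2) vec \<Rightarrow> real"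
  assumes u: "u \<in> BV_fun" and v: "v \<in> borel_measurable lebesgue" and ae: "AE x in lebesgue. u x = v x"
  shows "v \<in> BV_fun"
proof -
  have "\<exists>\<sigma>. is_distr_deriv i v \<sigma>" for i
    using u is_distr_deriv_cong_AE[OF Lp_measurable[OF BV_fun_Lp[OF u]] v ae]
    unfolding BV_fun_def by blast
  then show ?thesis
    using Lp_cong_AE[OF BV_fun_Lp[OF u] v ae] by (simp add: BV_fun_def)
qed

subsection \<open>The total variation is a norm modulo null sets\<close>

lemma test_field_minus: "test_field v \<Longrightarrow> test_field (\<lambda>x. - v x)"
  unfolding test_field_def using test_fun_cmult[of "\<lambda>x. v x $ i" "-1" for i] by simp

lemma unit_fields_zero: "(\<lambda>_. 0) \<in> unit_fields"
  by (auto simp: unit_fields_def test_field_def test_fun_def)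

lemma unit_fields_minus: "v \<in> unit_fields \<Longrightarrow> (\<lambda>x. - v x) \<in> unit_fields"
  by (simp add: unit_fields_def test_field_minus)

lemma partial_deriv_minus:
  assumes "f differentiable (at x)"
  shows "partial_deriv i (\<lambda>x. - f x) x = - partial_deriv i f x"
  using partial_deriv_eq[OF has_derivative_minus[OF has_derivative_frechet[OF assms]]]
  by (simp add: partial_deriv_def)

lemma divergence_minus:
  assumes "test_field v" shows "divergence (\<lambda>x. - v x) x = - divergence v x"
  using assms
  by (auto simp: divergence_def test_field_def test_fun_def smooth_differentiable partial_deriv_minus
      sum_negf)

lemma divergence_zero [simp]: "divergence (\<lambda>_. 0) x = 0"
  by (simp add: divergence_def)

lemma integrable_mult_divergence:
  fixes u :: "(real, 'n::card2) vec \<Rightarrow> real"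
  assumes "u \<in> BV_fun" "test_field v"
  shows "integrable lebesgue (\<lambda>x. u x * divergence v x)"
  unfolding divergence_def sum_distrib_left
  using assms conj_exp_gt_1[where 'n='n]
  by (intro Bochner_Integration.integrable_sum Lp_integrable_mult_test[OF _ BV_fun_Lp])
     (auto intro: test_fun_partial simp: test_field_def)

lemma bdd_above_variation:
  fixes u :: "(real, 'n::card2) vec \<Rightarrow> real"
  assumes u: "u \<in> BV_fun"
  shows "bdd_above ((\<lambda>v. LINT x|lebesgue. u x * divergence v x) ` unit_fields)"
proof -
  have "\<forall>i. \<exists>\<mu> \<nu>. is_distr_deriv i u (\<mu>, \<nu>)" using u by (fastforce simp: BV_fun_def)
  then obtain \<mu> \<nu> where D: "\<And>i. is_distr_deriv i u (\<mu> i, \<nu> i)" by metis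
  have bound: "\<bar>LINT x|M. v x $ i\<bar> \<le> measure M (space M)"
    if "finite_measure M" "sets M = sets borel" "v \<in> unit_fields"
    for M i and v :: "(real, 'n) vec \<Rightarrow> (real, 'n) vec"
  proof -
    have le: "\<bar>v x $ i\<bar> \<le> 1" for x
      using that(3) order_trans[OF component_le_norm_cart[of "v x" i]] by (auto simp: unit_fields_def)
    have "integrable M (\<lambda>x. v x $ i)"
      using that by (intro test_fun_integrable_finite) (auto simp: unit_fields_def test_field_def)
    then have "\<bar>LINT x|M. v x $ i\<bar> \<le> (LINT x|M. 1)"
      using le that(1)
      by (intro order_trans[OF integral_abs_bound] integral_mono)
         (auto simp: finite_measure.integrable_const)
    then show ?thesis by simp
  qed
  show ?thesis
  proof (rule bdd_aboveI2)
    fix v :: "(real, 'n) vec \<Rightarrow> (real, 'n) vec" assume v: "v \<in> unit_fields"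
    have t: "test_fun (\<lambda>x. v x $ i)" for i using v by (auto simp: unit_fields_def test_field_def)
    have "(LINT x|lebesgue. u x * divergence v x)
        = (\<Sum>i\<in>UNIV. LINT x|lebesgue. u x * partial_deriv i (\<lambda>y. v y $ i) x)"
      unfolding divergence_def sum_distrib_left
      using t conj_exp_gt_1[where 'n='n]
      by (intro Bochner_Integration.integral_sum Lp_integrable_mult_test[OF _ BV_fun_Lp[OF u]])
         (auto intro: test_fun_partial)
    also have "\<dots> = (\<Sum>i\<in>UNIV. (LINT x|\<nu> i. v x $ i) - (LINT x|\<mu> i. v x $ i))"
      using D t by (simp add: is_distr_deriv_def signed_integral_def)
    also have "\<dots> \<le> (\<Sum>i\<in>UNIV. measure (\<nu> i) (space (\<nu> i)) + measure (\<mu> i) (space (\<mu> i)))"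
    proof (rule sum_mono)
      fix i
      have "finite_measure (\<mu> i)" "sets (\<mu> i) = sets borel" "finite_measure (\<nu> i)" "sets (\<nu> i) = sets borel"
        using D[of i] by (auto simp: is_distr_deriv_def signed_borel_measure_def)
      then show "(LINT x|\<nu> i. v x $ i) - (LINT x|\<mu> i. v x $ i)
          \<le> measure (\<nu> i) (space (\<nu> i)) + measure (\<mu> i) (space (\<mu> i))"
        using bound[of "\<mu> i" v i] bound[of "\<nu> i" v i] v by linarith
    qed
    finally show "(LINT x|lebesgue. u x * divergence v x)
      \<le> (\<Sum>i\<in>UNIV. measure (\<nu> i) (space (\<nu> i)) + measure (\<mu> i) (space (\<mu> i)))" .
  qed
qed

lemma variation_upper:
  fixes u :: "(real, 'n::card2) vec \<Rightarrow> real"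
  assumes "u \<in> BV_fun" "v \<in> unit_fields"
  shows "(LINT x|lebesgue. u x * divergence v x) \<le> variation u"
  unfolding variation_def using assms by (intro cSUP_upper bdd_above_variation)

lemma variation_least:
  assumes "\<And>v. v \<in> unit_fields \<Longrightarrow> (LINT x|lebesgue. u x * divergence v x) \<le> C"
  shows "variation u \<le> C"
  unfolding variation_def using assms unit_fields_zero by (intro cSUP_least) auto

lemma variation_nonneg:
  fixes u :: "(real, 'n::card2) vec \<Rightarrow> real"
  shows "u \<in> BV_fun \<Longrightarrow> 0 \<le> variation u"
  using variation_upper[OF _ unit_fields_zero] by simp

lemma variation_add:
  fixes u v :: "(real, 'n::card2) vec \<Rightarrow> real"
  assumes u: "u \<in> BV_fun" and v: "v \<in> BV_fun"
  shows "variation (\<lambda>x. u x + v x) \<le> variation u + variation v"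
proof (rule variation_least)
  fix w :: "(real, 'n) vec \<Rightarrow> (real, 'n) vec" assume w: "w \<in> unit_fields"
  then have t: "test_field w" by (simp add: unit_fields_def)
  have "(LINT x|lebesgue. (u x + v x) * divergence w x)
      = (LINT x|lebesgue. u x * divergence w x) + (LINT x|lebesgue. v x * divergence w x)"
    unfolding distrib_right using u v t
    by (intro Bochner_Integration.integral_add integrable_mult_divergence)
  then show "(LINT x|lebesgue. (u x + v x) * divergence w x) \<le> variation u + variation v"
    using variation_upper[OF u w] variation_upper[OF v w] by simp
qed

lemma variation_scale_le:
  fixes u :: "(real, 'n::card2) vec \<Rightarrow> real"
  assumes u: "u \<in> BV_fun"
  shows "variation (\<lambda>x. c * u x) \<le> \<bar>c\<bar> * variation u"
proof (rule variation_least)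
  fix w :: "(real, 'n) vec \<Rightarrow> (real, 'n) vec" assume w: "w \<in> unit_fields"
  then have t: "test_field w" by (simp add: unit_fields_def)
  let ?I = "LINT x|lebesgue. u x * divergence w x"
  have "\<bar>?I\<bar> \<le> variation u"
    using variation_upper[OF u w] variation_upper[OF u unit_fields_minus[OF w]]
    by (simp add: divergence_minus[OF t])
  then have "\<bar>c * ?I\<bar> \<le> \<bar>c\<bar> * variation u"
    unfolding abs_mult by (intro mult_left_mono) auto
  then show "(LINT x|lebesgue. c * u x * divergence w x) \<le> \<bar>c\<bar> * variation u"
    by (simp add: mult.assoc)
qed

lemma variation_scale:
  fixes u :: "(real, 'n::card2) vec \<Rightarrow> real"
  assumes u: "u \<in> BV_fun"
  shows "variation (\<lambda>x. c * u x) = \<bar>c\<bar> * variation u"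
proof (cases "c = 0")
  case True
  then show ?thesis
    using variation_scale_le[OF u, of c] variation_nonneg[OF BV_fun_scale[OF u, of c]] by simp
next
  case False
  have "variation (\<lambda>x. (1/c) * (c * u x)) \<le> \<bar>1/c\<bar> * variation (\<lambda>x. c * u x)"
    by (rule variation_scale_le[OF BV_fun_scale[OF u]])
  with False have "\<bar>c\<bar> * variation u \<le> variation (\<lambda>x. c * u x)"
    by (simp add: field_simps abs_divide)
  with variation_scale_le[OF u, of c] show ?thesis by simp
qed

lemma variation_cong_AE:
  assumes [measurable]: "u \<in> borel_measurable lebesgue" "v \<in> borel_measurable lebesgue"
    and ae: "AE x in lebesgue. u x = v x"
  shows "variation u = variation v"
proof -
  have "(LINT x|lebesgue. u x * divergence w x) = (LINT x|lebesgue. v x * divergence w x)"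
    if "w \<in> unit_fields" for w
  proof -
    have "test_fun (partial_deriv i (\<lambda>y. w y $ i))" for i
      using that by (auto simp: unit_fields_def test_field_def intro!: test_fun_partial)
    then have [measurable]: "partial_deriv i (\<lambda>y. w y $ i) \<in> borel_measurable lebesgue" for i
      by (rule test_fun_measurable)
    have [measurable]: "divergence w \<in> borel_measurable lebesgue"
      unfolding divergence_def[abs_def] by measurable
    show ?thesis using ae by (intro integral_cong_AE) auto
  qed
  then show ?thesis unfolding variation_def by (intro SUP_cong) auto
qed

subsection \<open>Definiteness of the total variation\<close>

(* If the variation of u vanishes, integrating u against a smooth bump is invariant under
   translation; u being in L_p with 1 < p < infinity, letting the translation tend to infinity
   shows that these integrals are zero. *)


lemma poly_times_exp_tendsto_0: "((\<lambda>s. poly P s * exp (- s)) \<longlongrightarrow> (0::real)) at_top"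
proof -
  have "((\<lambda>s. \<Sum>i\<le>degree P. coeff P i * (s ^ i / exp s)) \<longlongrightarrow> (\<Sum>i\<le>degree P. coeff P i * 0)) at_top"
    by (intro tendsto_intros tendsto_power_div_exp_0)
  then show ?thesis
    by (simp add: poly_altdef sum_distrib_right exp_minus divide_inverse mult.assoc)
qed

primrec flat_poly :: "nat \<Rightarrow> real poly" where
  "flat_poly 0 = 1"
| "flat_poly (Suc n) = [:0, 0, 1:] * (flat_poly n - pderiv (flat_poly n))"

definition flat :: "nat \<Rightarrow> real \<Rightarrow> real" where
  "flat n t = (if t > 0 then poly (flat_poly n) (1/t) * exp (- (1/t)) else 0)"

lemma flat_deriv: "(flat n has_real_derivative flat (Suc n) t) (at t)"
proof -
  consider "t > 0" | "t < 0" | "t = 0" by linarith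
  then show ?thesis
  proof cases
    case 1
    have "((\<lambda>t. poly (flat_poly n) (1/t) * exp (- (1/t))) has_real_derivative flat (Suc n) t) (at t)"
      using 1 by (auto intro!: derivative_eq_intros DERIV_chain'[OF _ poly_DERIV]
          simp: flat_def field_simps power2_eq_square)
    then show ?thesis
      by (rule has_field_derivative_transform_within_open[where S="{0<..}"])
         (use 1 in \<open>auto simp: flat_def\<close>)
  next
    case 2
    have "((\<lambda>t. 0) has_real_derivative flat (Suc n) t) (at t)"
      using 2 by (simp add: flat_def)
    then show ?thesis
      by (rule has_field_derivative_transform_within_open[where S="{..<0}"])
         (use 2 in \<open>auto simp: flat_def\<close>)
  next
    case 3
    have "((\<lambda>y. flat n y / y) \<longlongrightarrow> 0) (at_right 0)"
    proof -
      have "((\<lambda>y. poly (pCons 0 (flat_poly n)) (inverse y) * exp (- inverse y)) \<longlongrightarrow> 0) (at_right (0::real))"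
        by (rule filterlim_compose[OF poly_times_exp_tendsto_0 filterlim_inverse_at_top_right])
      then show ?thesis
        by (rule Lim_transform_eventually)
           (auto simp: eventually_at_filter flat_def divide_inverse algebra_simps)
    qed
    moreover have "((\<lambda>y. flat n y / y) \<longlongrightarrow> 0) (at_left 0)"
      by (rule Lim_transform_eventually[OF tendsto_const])
         (auto simp: eventually_at_filter flat_def)
    ultimately have "((\<lambda>y. flat n y / y) \<longlongrightarrow> 0) (at 0)"
      by (simp add: filterlim_at_split)
    then show ?thesis
      using 3 by (simp add: has_field_derivative_iff flat_def)
  qed
qed

lemma flat0_bounds: "0 \<le> flat 0 t" "flat 0 t \<le> 1"
  by (auto simp: flat_def)

lemma smooth_comp_coord:
  fixes g :: "nat \<Rightarrow> real \<Rightarrow> real" and i :: "'n::finite"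
  assumes g: "\<And>n t. (g n has_real_derivative g (Suc n) t) (at t)"
  shows "smooth (\<lambda>x::real^'n. g n (c * x $ i + d))"
proof -
  have d: "((\<lambda>x::real^'n. g n (c * x $ i + d)) has_derivative
      (\<lambda>h. h $ i * (c * g (Suc n) (c * x $ i + d)))) (at x)" for n x
  proof -
    have "((\<lambda>x::real^'n. c * x $ i + d) has_derivative (\<lambda>h. c * h $ i)) (at x)"
      by (auto intro!: derivative_eq_intros bounded_linear.has_derivative[OF bounded_linear_vec_nth])
    from has_derivative_compose[OF this, of "g n" "(*) (g (Suc n) (c * x $ i + d))"] g
    show ?thesis by (simp add: has_field_derivative_def ac_simps)
  qed
  have "Ck k (\<lambda>x::real^'n. g n (c * x $ i + d))" for k n
  proof (induction k arbitrary: n)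
    case 0
    have "(\<lambda>x::real^'n. g n (c * x $ i + d)) differentiable (at x)" for x
      using d by (auto simp: differentiable_def)
    then show ?case by (auto intro!: continuous_at_imp_continuous_on differentiable_imp_continuous_within)
  next
    case (Suc k)
    have *: "partial_deriv j (\<lambda>x::real^'n. g n (c * x $ i + d))
        = (\<lambda>x. (if i = j then c else 0) * g (Suc n) (c * x $ i + d))" for j
      by (auto simp: fun_eq_iff partial_deriv_eq[OF d] axis_def)
    show ?case using Suc d unfolding Ck.simps(2) * by (auto simp: differentiable_def intro!: Ck_mult)
  qed
  then show ?thesis by (simp add: smooth_def)
qed

lemma has_derivative_coord:
  fixes i :: "'n::finite" and F :: "real \<Rightarrow> real"
  assumes "\<And>t. (F has_real_derivative F' t) (at t)"
  shows "((\<lambda>x::real^'n. F (x $ i)) has_derivative (\<lambda>h. h $ i * F' (x $ i))) (at x)"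
proof -
  have "((\<lambda>x::real^'n. x $ i) has_derivative (\<lambda>h. h $ i)) (at x)"
    by (rule bounded_linear.has_derivative[OF bounded_linear_vec_nth has_derivative_ident])
  from has_derivative_compose[OF this, of F "(*) (F' (x $ i))"] assms
  show ?thesis by (simp add: has_field_derivative_def ac_simps)
qed

definition bump :: "real \<Rightarrow> real \<Rightarrow> real \<Rightarrow> real \<Rightarrow> real" where
  "bump k a b t = flat 0 (k * t + - k * a) * flat 0 (- k * t + k * b)"

lemma smooth_bump: "smooth (\<lambda>x::real^'n. bump k a b (x $ i))"
  unfolding bump_def by (intro smooth_mult smooth_comp_coord flat_deriv)

lemma smooth_bump_shift: "smooth (\<lambda>x::real^'n. bump k a b (x $ i - s))"
proof -
  have "(\<lambda>x::real^'n. bump k a b (x $ i - s)) =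
    (\<lambda>x. flat 0 (k * x $ i + (- k * s - k * a)) * flat 0 (- k * x $ i + (k * s + k * b)))"
    by (simp add: bump_def algebra_simps)
  then show ?thesis
    by (simp only:) (intro smooth_mult smooth_comp_coord flat_deriv)
qed

lemma bump_bounds: "0 \<le> bump k a b t" "bump k a b t \<le> 1"
  using flat0_bounds by (auto simp: bump_def mult_le_one)

lemma bump_outside: "k > 0 \<Longrightarrow> t \<le> a \<or> b \<le> t \<Longrightarrow> bump k a b t = 0"
  by (auto simp: bump_def flat_def zero_less_mult_iff simp flip: right_diff_distrib)

lemma bump_cont: "isCont (bump k a b) t"
proof -
  have f: "isCont (flat 0) t" for t using flat_deriv DERIV_isCont by blast
  show ?thesis unfolding bump_def[abs_def]
    by (intro continuous_intros isCont_o2[OF _ f])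
qed

lemma bump_tendsto:
  assumes "a < t" "t < b"
  shows "(\<lambda>k. bump (real (Suc k)) a b t) \<longlonglongrightarrow> 1"
proof -
  have *: "(\<lambda>k. flat 0 (real (Suc k) * s)) \<longlonglongrightarrow> 1" if "s > 0" for s
  proof -
    have "(\<lambda>k. exp (- (inverse (real (Suc k)) * inverse s))) \<longlonglongrightarrow> exp (- (0 * inverse s))"
      by (intro tendsto_intros LIMSEQ_inverse_real_of_nat)
    then show ?thesis using that by (simp add: flat_def divide_inverse)
  qed
  have "(\<lambda>k. flat 0 (real (Suc k) * (t - a)) * flat 0 (real (Suc k) * (b - t))) \<longlonglongrightarrow> 1 * 1"
    using assms by (intro tendsto_mult *) auto
  then show ?thesis by (simp add: bump_def algebra_simps)
qed

lemma test_fun_coordI: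
  assumes "smooth \<phi>" "\<And>x. \<phi> x \<noteq> 0 \<Longrightarrow> x \<in> cbox a b"
  shows "test_fun \<phi>"
  using assms compact_cbox unfolding test_fun_def by blast

lemma variation_zero_partial:
  fixes u :: "(real, 'n::card2) vec \<Rightarrow> real"
  assumes u: "u \<in> BV_fun" and 0: "variation u = 0" and \<psi>: "test_fun \<psi>"
  shows "(LINT x|lebesgue. u x * partial_deriv i \<psi> x) = 0"
proof -
  obtain B where B: "B > 0" "\<And>x. \<bar>\<psi> x\<bar> \<le> B" using test_fun_bounded[OF \<psi>] by blast
  have le: "c * (LINT x|lebesgue. u x * partial_deriv i \<psi> x) \<le> 0" if c: "\<bar>c\<bar> = 1 / B" for c
  proof -
    define v :: "(real, 'n) vec \<Rightarrow> (real, 'n) vec" where "v x = (c * \<psi> x) *\<^sub>R axis i 1" for x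
    have comp: "(\<lambda>x. v x $ j) = (\<lambda>x. (if j = i then c else 0) * \<psi> x)" for j
      by (auto simp: v_def axis_def)
    have "norm (v x) \<le> 1" for x
    proof -
      have "\<bar>c\<bar> * \<bar>\<psi> x\<bar> = \<bar>\<psi> x\<bar> / B" using c by simp
      also have "\<dots> \<le> 1" using B(1) B(2)[of x] by (simp add: divide_le_eq)
      finally show ?thesis by (simp add: v_def abs_mult)
    qed
    then have v: "v \<in> unit_fields"
      unfolding unit_fields_def test_field_def mem_Collect_eq comp
      using test_fun_cmult[OF \<psi>] by blast
    have pd: "partial_deriv i (\<lambda>x. d * \<psi> x) x = d * partial_deriv i \<psi> x" for d i x
      using partial_deriv_mult[of "\<lambda>_. d" x \<psi>] \<psi> by (simp add: test_fun_def smooth_differentiable)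
    have "divergence v x = c * partial_deriv i \<psi> x" for x
    proof -
      have "divergence v x = (\<Sum>j\<in>UNIV. if j = i then c * partial_deriv i \<psi> x else 0)"
        unfolding divergence_def comp pd by (intro sum.cong) auto
      then show ?thesis by simp
    qed
    then show ?thesis using variation_upper[OF u v] 0
      by (simp add: mult.left_commute)
  qed
  show ?thesis
    using le[of "1/B"] le[of "-1/B"] B(1) by (simp add: field_simps abs_divide)
qed

lemma variation_zero_shift:
  fixes u :: "(real, 'n::card2) vec \<Rightarrow> real" and a b :: "(real, 'n) vec" and j :: 'n
  assumes u: "u \<in> BV_fun" and 0: "variation u = 0" and k: "k > 0"
  defines "\<phi> \<equiv> (\<lambda>x::(real, 'n) vec. \<Prod>i\<in>UNIV. bump k (a $ i) (b $ i) (x $ i))"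
  assumes s: "s \<ge> 0"
  shows "test_fun \<phi>" "test_fun (\<lambda>x. \<phi> (x - axis j s))"
    "(LINT x|lebesgue. u x * \<phi> x) = (LINT x|lebesgue. u x * \<phi> (x - axis j s))"
proof -
  let ?\<eta> = "\<lambda>i. bump k (a $ i) (b $ i)"
  define R where "R x = (\<Prod>i\<in>UNIV - {j}. ?\<eta> i (x $ i))" for x :: "(real, 'n) vec"
  have R: "smooth R" unfolding R_def[abs_def] by (intro smooth_prod smooth_bump) auto
  have R0: "i = j" if "x $ i \<notin> {a $ i .. b $ i}" "R x \<noteq> 0" for i x
    using that bump_outside[OF k, of "x $ i" "a $ i" "b $ i"] by (fastforce simp: R_def)
  have \<phi>_R: "\<phi> x = ?\<eta> j (x $ j) * R x" for x
    unfolding \<phi>_def R_def by (rule prod.remove) auto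
  have Rshift: "R (x - axis j s) = R x" for x
    unfolding R_def by (intro prod.cong) (auto simp: axis_def)
  have \<phi>_shift: "\<phi> (x - axis j s) = ?\<eta> j (x $ j - s) * R x" for x
    unfolding \<phi>_R Rshift by simp
  have \<eta>0: "?\<eta> j t = 0" if "t \<notin> {a $ j .. b $ j}" for t
    using that bump_outside[OF k] by auto
  have box: "x \<in> cbox a (b + axis j s)"
    if "R x \<noteq> 0" "a $ j \<le> x $ j" "x $ j \<le> b $ j + s" for x
    unfolding mem_box_cart using that R0[of x] by (force simp: axis_def)
  show t1: "test_fun \<phi>"
  proof (rule test_fun_coordI)
    show "smooth \<phi>" unfolding \<phi>_def by (intro smooth_prod smooth_bump) auto
    show "x \<in> cbox a (b + axis j s)" if "\<phi> x \<noteq> 0" for x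
      using that s box[of x] \<eta>0[of "x $ j"] by (force simp: \<phi>_R)
  qed
  show t2: "test_fun (\<lambda>x. \<phi> (x - axis j s))"
  proof (rule test_fun_coordI)
    show "smooth (\<lambda>x. \<phi> (x - axis j s))"
      unfolding \<phi>_shift by (intro smooth_mult smooth_bump_shift R)
    show "x \<in> cbox a (b + axis j s)" if "\<phi> (x - axis j s) \<noteq> 0" for x
      using that s box[of x] \<eta>0[of "x $ j - s"] by (force simp: \<phi>_shift)
  qed
  have "\<exists>H. \<forall>t. (H has_real_derivative ?\<eta> j t) (at t)"
    using einterval_antiderivative[of "-\<infinity>" "\<infinity>" "?\<eta> j"] bump_cont
    by (auto simp: has_real_derivative_iff_has_vector_derivative)
  then obtain H where H: "\<And>t. (H has_real_derivative ?\<eta> j t) (at t)" by blast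
  define F where "F t = H t - H (t - s)" for t
  have F: "(F has_real_derivative (?\<eta> j t - ?\<eta> j (t - s))) (at t)" for t
  proof -
    have "((\<lambda>t. H (t - s)) has_real_derivative ?\<eta> j (t - s) * (1 - 0)) (at t)"
      by (rule DERIV_chain'[OF _ H]) (auto intro!: derivative_eq_intros)
    then show ?thesis unfolding F_def[abs_def] by (intro DERIV_diff H) simp
  qed
  have F0: "F t = 0" if "t \<notin> {a $ j .. b $ j + s}" for t
  proof -
    have S: "H y = H z" if "convex S" "y \<in> S" "z \<in> S" "\<And>t. t \<in> S \<Longrightarrow> ?\<eta> j t = 0" for S y z
    proof -
      have "\<exists>c. \<forall>x\<in>S. H x = c"
        using that(4) by (intro has_field_derivative_zero_constant[OF that(1)])
          (metis H has_field_derivative_at_within)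
      then show ?thesis using that by auto
    qed
    show ?thesis
    proof (cases "t < a $ j")
      case True
      then show ?thesis
        using S[of "{..<a $ j}" t "t - s"] s by (auto simp: F_def \<eta>0)
    next
      case False
      then show ?thesis
        using S[of "{b $ j<..}" t "t - s"] s that by (auto simp: F_def \<eta>0)
    qed
  qed
  define \<psi> where "\<psi> x = F (x $ j) * R x" for x
  note dF = has_derivative_coord[of F, OF F]
  have sF: "smooth (\<lambda>x::(real, 'n) vec. F (x $ j))"
  proof (rule smooth_of_deriv[OF dF])
    have "smooth (\<lambda>x::(real, 'n) vec. ?\<eta> j (x $ j) + (-1) * ?\<eta> j (x $ j - s))"
      by (intro smooth_add smooth_mult smooth_const smooth_bump smooth_bump_shift)
    then show "smooth (\<lambda>x::(real, 'n) vec. ?\<eta> j (x $ j) - ?\<eta> j (x $ j - s))" by simp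
  qed
  have \<psi>: "test_fun \<psi>"
  proof (rule test_fun_coordI)
    show "smooth \<psi>" unfolding \<psi>_def[abs_def] by (intro smooth_mult R sF)
    show "x \<in> cbox a (b + axis j s)" if "\<psi> x \<noteq> 0" for x
      using that box[of x] F0[of "x $ j"] by (force simp: \<psi>_def)
  qed
  have dR: "partial_deriv j R x = 0" for x
  proof -
    let ?e = "axis j 1 :: (real, 'n) vec"
    obtain D where D: "(R has_derivative D) (at x)"
      using smooth_differentiable[OF R] by (auto simp: differentiable_def)
    have "((\<lambda>t::real. x + t *\<^sub>R ?e) has_derivative (\<lambda>t. t *\<^sub>R ?e)) (at 0)"
      by (auto intro!: derivative_eq_intros)
    from has_derivative_compose[OF this, of R D] D
    have "((\<lambda>t. R (x + t *\<^sub>R ?e)) has_derivative (\<lambda>t. D (t *\<^sub>R ?e))) (at 0)"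
      by simp
    moreover have "R (x + t *\<^sub>R ?e) = R x" for t
      unfolding R_def by (intro prod.cong) (auto simp: axis_def)
    ultimately have "((\<lambda>t. R x) has_derivative (\<lambda>t. D (t *\<^sub>R ?e))) (at (0::real))" by simp
    then have "(\<lambda>t. D (t *\<^sub>R ?e)) = (\<lambda>t::real. 0)"
      using has_derivative_unique[OF _ has_derivative_const] by blast
    from fun_cong[OF this, of 1] show ?thesis by (simp add: partial_deriv_eq[OF D])
  qed
  have d\<psi>: "partial_deriv j \<psi> x = \<phi> x - \<phi> (x - axis j s)" for x
  proof -
    have "partial_deriv j \<psi> x = (?\<eta> j (x $ j) - ?\<eta> j (x $ j - s)) * R x"
      unfolding \<psi>_def[abs_def]
      using partial_deriv_mult[OF smooth_differentiable[OF sF] smooth_differentiable[OF R], of j x]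
      by (simp add: dR partial_deriv_eq[OF dF])
    then show ?thesis
      unfolding \<phi>_shift unfolding \<phi>_R by (simp add: left_diff_distrib)
  qed
  have int: "integrable lebesgue (\<lambda>x. u x * g x)" if "test_fun g" for g
    using Lp_integrable_mult_test[OF _ BV_fun_Lp[OF u] that] conj_exp_gt_1[where 'n='n] by simp
  show "(LINT x|lebesgue. u x * \<phi> x) = (LINT x|lebesgue. u x * \<phi> (x - axis j s))"
    using variation_zero_partial[OF u 0 \<psi>, of j] int[OF t1] int[OF t2]
    by (simp add: d\<psi> right_diff_distrib)
qed

lemma Lp_local_le:
  fixes t :: real
  assumes p: "1 < p" and e: "e > 0"
  shows "\<bar>t\<bar> \<le> e + e powr (1 - p) * \<bar>t\<bar> powr p"
proof (cases "\<bar>t\<bar> \<le> e")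
  case True
  then show ?thesis by (simp add: add_increasing2)
next
  case False
  then have t: "\<bar>t\<bar> > e" "\<bar>t\<bar> > 0" using e by auto
  have "\<bar>t\<bar> = \<bar>t\<bar> powr (1 - p) * \<bar>t\<bar> powr p"
    using t by (simp flip: powr_add)
  also have "\<dots> \<le> e powr (1 - p) * \<bar>t\<bar> powr p"
    using t e p by (intro mult_right_mono powr_mono2') auto
  finally show ?thesis using e by simp
qed

lemma variation_zero_bump:
  fixes u :: "(real, 'n::card2) vec \<Rightarrow> real" and a b :: "(real, 'n) vec"
  assumes u: "u \<in> BV_fun" and 0: "variation u = 0" and k: "k > 0"
  shows "(LINT x|lebesgue. u x * (\<Prod>i\<in>UNIV. bump k (a $ i) (b $ i) (x $ i))) = 0"
proof -
  define \<phi> where "\<phi> x = (\<Prod>i\<in>UNIV. bump k (a $ i) (b $ i) (x $ i))" for x :: "(real, 'n) vec"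
  let ?I = "LINT x|lebesgue. u x * \<phi> x"
  let ?p = "conj_exp TYPE('n)"
  fix j :: 'n
  define B where "B n = cbox (a + axis j (real n)) (b + axis j (real n))" for n
  note sh2 = variation_zero_shift(2)[OF u 0 k, where a=a and b=b and j=j, folded \<phi>_def]
  note sh3 = variation_zero_shift(3)[OF u 0 k, where a=a and b=b and j=j, folded \<phi>_def]
  note [measurable] = Lp_measurable[OF BV_fun_Lp[OF u]]
  have int: "integrable lebesgue (\<lambda>x. u x * g x)" if "test_fun g" for g
    using Lp_integrable_mult_test[OF _ BV_fun_Lp[OF u] that] conj_exp_gt_1[where 'n='n] by simp
  have p_int: "integrable lebesgue (\<lambda>x. \<bar>u x\<bar> powr ?p)"
    using BV_fun_Lp[OF u] by (simp add: Lp_def)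
  have \<phi>1: "\<bar>\<phi> x\<bar> \<le> 1" for x
    unfolding \<phi>_def abs_prod by (intro prod_le_1) (auto simp: bump_bounds abs_of_nonneg)
  have \<phi>0: "\<phi> x = 0" if x: "x \<notin> cbox a b" for x
  proof -
    obtain i where "x $ i \<le> a $ i \<or> b $ i \<le> x $ i"
      using x unfolding mem_box_cart by (meson linear)
    then have "bump k (a $ i) (b $ i) (x $ i) = 0" by (rule bump_outside[OF k])
    then show ?thesis unfolding \<phi>_def by (intro prod_zero) auto
  qed
  have \<phi>n: "\<bar>\<phi> (x - axis j (real n))\<bar> \<le> indicator (B n) x" for x n
  proof (cases "x \<in> B n")
    case False
    then have "x - axis j (real n) \<notin> cbox a b"
      by (auto simp: B_def mem_box_cart algebra_simps)
    then show ?thesis by (simp add: \<phi>0)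
  qed (simp add: \<phi>1)
  let ?m = "measure lebesgue (cbox a b)"
  have Bm: "measure lebesgue (B n) = ?m" for n
    unfolding B_def add.commute[of _ "axis j (real n)"] cbox_translation by (rule measure_translation)
  have [measurable]: "B n \<in> sets lebesgue" for n by (simp add: B_def)
  have Bint: "integrable lebesgue (indicator (B n) :: _ \<Rightarrow> real)" for n
    unfolding B_def using lmeasurable_cbox by (simp add: lmeasurable_iff_integrable)
  have lim: "(\<lambda>n. LINT x|lebesgue. indicator (B n) x * \<bar>u x\<bar> powr ?p) \<longlonglongrightarrow>
      integral\<^sup>L lebesgue (\<lambda>x::(real, 'n) vec. 0)"
  proof (rule integral_dominated_convergence[where w="\<lambda>x. \<bar>u x\<bar> powr ?p"])
    show "AE x in lebesgue. (\<lambda>n. indicator (B n) x * \<bar>u x\<bar> powr ?p) \<longlonglongrightarrow> 0"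
    proof (rule AE_I2)
      fix x :: "(real, 'n) vec"
      obtain N :: nat where N: "real N > x $ j - a $ j" using reals_Archimedean2 by blast
      have "x \<notin> B n" if "n \<ge> N" for n
      proof
        assume "x \<in> B n"
        then have "a $ j + real n \<le> x $ j"
          unfolding B_def mem_box_cart by (auto dest: spec[of _ j] simp: axis_def)
        then show False using N that by linarith
      qed
      then have "eventually (\<lambda>n. 0 = indicator (B n) x * \<bar>u x\<bar> powr ?p) sequentially"
        unfolding eventually_sequentially by (intro exI[of _ N]) auto
      then show "(\<lambda>n. indicator (B n) x * \<bar>u x\<bar> powr ?p) \<longlonglongrightarrow> 0"
        by (rule Lim_transform_eventually[OF tendsto_const])
    qed
  qed (auto simp: p_int indicator_def)
  have bound: "\<bar>?I\<bar> \<le> e * ?m" if e: "e > 0" for e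
  proof -
    have "\<bar>?I\<bar> \<le> e * ?m + e powr (1 - ?p) * (LINT x|lebesgue. indicator (B n) x * \<bar>u x\<bar> powr ?p)" for n
    proof -
      have i1: "integrable lebesgue (\<lambda>x. e * indicator (B n) x)"
        using Bint by simp
      have i2: "integrable lebesgue (\<lambda>x. e powr (1 - ?p) * (indicator (B n) x * \<bar>u x\<bar> powr ?p))"
        by (intro integrable_mult_right Bochner_Integration.integrable_bound[OF p_int])
           (auto simp: indicator_def)
      have "\<bar>?I\<bar> = \<bar>LINT x|lebesgue. u x * \<phi> (x - axis j (real n))\<bar>"
        using sh3[of "real n"] by simp
      also have "\<dots> \<le> (LINT x|lebesgue. \<bar>u x * \<phi> (x - axis j (real n))\<bar>)"
        by (rule integral_abs_bound)
      also have "\<dots> \<le> (LINT x|lebesgue. e * indicator (B n) x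
          + e powr (1 - ?p) * (indicator (B n) x * \<bar>u x\<bar> powr ?p))"
      proof (rule integral_mono)
        show "integrable lebesgue (\<lambda>x. \<bar>u x * \<phi> (x - axis j (real n))\<bar>)"
          using int[OF sh2[of "real n"]] by simp
        show "integrable lebesgue (\<lambda>x. e * indicator (B n) x
          + e powr (1 - ?p) * (indicator (B n) x * \<bar>u x\<bar> powr ?p))"
          using i1 i2 by simp
        fix x
        have "\<bar>u x * \<phi> (x - axis j (real n))\<bar> \<le> \<bar>u x\<bar> * indicator (B n) x"
          unfolding abs_mult by (intro mult_left_mono \<phi>n) auto
        also have "\<dots> \<le> (e + e powr (1 - ?p) * \<bar>u x\<bar> powr ?p) * indicator (B n) x"
          by (intro mult_right_mono Lp_local_le e conj_exp_gt_1) auto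
        finally show "\<bar>u x * \<phi> (x - axis j (real n))\<bar> \<le> e * indicator (B n) x
          + e powr (1 - ?p) * (indicator (B n) x * \<bar>u x\<bar> powr ?p)"
          by (simp add: algebra_simps)
      qed
      also have "\<dots> = e * ?m + e powr (1 - ?p) * (LINT x|lebesgue. indicator (B n) x * \<bar>u x\<bar> powr ?p)"
        using i1 i2 by (simp add: Bm)
      finally show ?thesis .
    qed
    moreover have "(\<lambda>n. e * ?m + e powr (1 - ?p) * (LINT x|lebesgue. indicator (B n) x * \<bar>u x\<bar> powr ?p))
        \<longlonglongrightarrow> e * ?m + e powr (1 - ?p) * 0"
      using lim by (intro tendsto_intros) simp
    ultimately show ?thesis
      by (intro LIMSEQ_le_const[where X="\<lambda>n. e * ?m + e powr (1 - ?p) * (LINT x|lebesgue. indicator (B n) x * \<bar>u x\<bar> powr ?p)"]) auto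
  qed
  have "\<bar>?I\<bar> \<le> 0"
  proof (rule tendsto_lowerbound)
    have "((\<lambda>e. e * ?m) \<longlongrightarrow> 0 * ?m) (at_right 0)" by (intro tendsto_intros)
    then show "((\<lambda>e. e * ?m) \<longlongrightarrow> 0) (at_right 0)" by simp
    show "eventually (\<lambda>e. \<bar>?I\<bar> \<le> e * ?m) (at_right 0)"
      using bound by (auto simp: eventually_at_filter)
  qed simp
  then show ?thesis by (simp add: \<phi>_def)
qed

lemma variation_zero_AE:
  fixes u :: "(real, 'n::card2) vec \<Rightarrow> real"
  assumes u: "u \<in> BV_fun" and 0: "variation u = 0"
  shows "AE x in lebesgue. u x = 0"
proof -
  note [measurable] = Lp_measurable[OF BV_fun_Lp[OF u]]
  let ?p = "conj_exp TYPE('n)"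
  have p_int: "integrable lebesgue (\<lambda>x. \<bar>u x\<bar> powr ?p)"
    using BV_fun_Lp[OF u] by (simp add: Lp_def)
  have [measurable]: "cbox a b \<in> sets lebesgue" "box a b \<in> sets lebesgue" for a b :: "(real, 'n) vec"
    by (simp_all add: fmeasurableD)
  have loc: "integrable lebesgue (\<lambda>x. indicator (cbox a b) x * u x)" for a b
  proof (rule Bochner_Integration.integrable_bound)
    show "integrable lebesgue (\<lambda>x. indicator (cbox a b) x + \<bar>u x\<bar> powr ?p)"
      using p_int lmeasurable_cbox[of a b] by (simp add: lmeasurable_iff_integrable)
    have "\<bar>t\<bar> \<le> 1 + \<bar>t\<bar> powr ?p" for t :: real
      using Lp_local_le[OF conj_exp_gt_1[where 'n='n], of 1 t] by simp
    then show "AE x in lebesgue. norm (indicator (cbox a b) x * u x)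
        \<le> norm (indicator (cbox a b) x + \<bar>u x\<bar> powr ?p)"
      by (auto intro!: AE_I2 simp: indicator_def)
  qed measurable
  have box0: "(LINT x|lebesgue. indicator (box a b) x * u x) = 0" for a b
  proof -
    define \<phi> where "\<phi> k x = (\<Prod>i\<in>UNIV. bump (real (Suc k)) (a $ i) (b $ i) (x $ i))" for k x
    have [measurable]: "\<phi> k \<in> borel_measurable lebesgue" for k
      using variation_zero_shift(1)[OF u 0, of "real (Suc k)" 0 a b]
      by (intro test_fun_measurable) (simp add: \<phi>_def[abs_def])
    have \<phi>0: "\<phi> k x = 0" if x: "x \<notin> box a b" for k x
    proof -
      obtain i where "x $ i \<le> a $ i \<or> b $ i \<le> x $ i"
        using x unfolding mem_box_cart by (meson not_less)
      then have "bump (real (Suc k)) (a $ i) (b $ i) (x $ i) = 0"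
        by (intro bump_outside) auto
      then show ?thesis unfolding \<phi>_def by (intro prod_zero) auto
    qed
    have \<phi>1: "0 \<le> \<phi> k x" "\<phi> k x \<le> 1" for k x
      unfolding \<phi>_def by (auto intro!: prod_nonneg prod_le_1 simp: bump_bounds)
    have "(\<lambda>k. LINT x|lebesgue. u x * \<phi> k x) \<longlonglongrightarrow> (LINT x|lebesgue. indicator (box a b) x * u x)"
    proof (rule integral_dominated_convergence[where w="\<lambda>x. \<bar>indicator (cbox a b) x * u x\<bar>"])
      show "integrable lebesgue (\<lambda>x. \<bar>indicator (cbox a b) x * u x\<bar>)" using loc by simp
      show "AE x in lebesgue. (\<lambda>k. u x * \<phi> k x) \<longlonglongrightarrow> indicator (box a b) x * u x"
      proof (rule AE_I2)
        fix x
        show "(\<lambda>k. u x * \<phi> k x) \<longlonglongrightarrow> indicator (box a b) x * u x"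
        proof (cases "x \<in> box a b")
          case True
          then have "(\<lambda>k. u x * \<phi> k x) \<longlonglongrightarrow> u x * (\<Prod>i\<in>(UNIV::'n set). 1)"
            unfolding \<phi>_def mem_box_cart by (intro tendsto_intros bump_tendsto) auto
          then show ?thesis using True by simp
        qed (simp add: \<phi>0)
      qed
      show "AE x in lebesgue. norm (u x * \<phi> k x) \<le> \<bar>indicator (cbox a b) x * u x\<bar>" for k
      proof (rule AE_I2)
        fix x
        show "norm (u x * \<phi> k x) \<le> \<bar>indicator (cbox a b) x * u x\<bar>"
        proof (cases "x \<in> box a b")
          case True
          then have "x \<in> cbox a b" using box_subset_cbox by blast
          then show ?thesis using \<phi>1[of k x] by (simp add: abs_mult mult_left_le)
        qed (simp add: \<phi>0)
      qed
    qed measurable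
    moreover have "(LINT x|lebesgue. u x * \<phi> k x) = 0" for k
      unfolding \<phi>_def by (rule variation_zero_bump[OF u 0]) simp
    ultimately show ?thesis using LIMSEQ_unique[OF _ tendsto_const] by simp
  qed
  have int0: "u integrable_on cbox a b \<and> integral (cbox a b) u = 0" for a b
  proof -
    have "(LINT x|lebesgue. indicator (cbox a b) x * u x) = (LINT x|lebesgue. indicator (box a b) x * u x)"
    proof (rule integral_cong_AE)
      have "negligible (cbox a b - box a b)" by (rule negligible_frontier_interval)
      then have "AE x in lebesgue. x \<notin> cbox a b - box a b"
        unfolding negligible_iff_null_sets by (rule AE_not_in)
      then show "AE x in lebesgue. indicator (cbox a b) x * u x = indicator (box a b) x * u x"
        using box_subset_cbox[of a b] by (auto elim!: eventually_mono simp: indicator_def)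
    qed measurable
    then have "(LINT x|lebesgue. indicator (cbox a b) x * u x) = 0" by (simp add: box0)
    moreover have "set_integrable lebesgue (cbox a b) u"
      using loc by (simp add: set_integrable_def)
    ultimately have "(u has_integral 0) (cbox a b)"
      using has_integral_set_lebesgue[of "cbox a b" u]
      by (simp add: set_lebesgue_integral_def)
    then show ?thesis by auto
  qed
  obtain N where N: "negligible N"
     "\<And>x e. \<lbrakk>x \<notin> N; 0 < e\<rbrakk> \<Longrightarrow>
        \<exists>d>0. \<forall>h. 0 < h \<and> h < d \<longrightarrow>
           norm (integral (cbox x (x + h *\<^sub>R One)) u /\<^sub>R h ^ DIM((real, 'n) vec) - u x) < e"
    using integrable_ccontinuous_explicit[of u] int0 by blast
  have "u x = 0" if x: "x \<notin> N" for x
  proof (rule ccontr)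
    assume "u x \<noteq> 0"
    then obtain d where d: "d > 0" "\<And>h. 0 < h \<and> h < d \<Longrightarrow>
        norm (integral (cbox x (x + h *\<^sub>R One)) u /\<^sub>R h ^ DIM((real, 'n) vec) - u x) < \<bar>u x\<bar>"
      using N(2)[OF x, of "\<bar>u x\<bar>"] by auto
    show False using d(2)[of "d/2"] d(1) int0 by simp
  qed
  moreover have "AE x in lebesgue. x \<notin> N"
    using N(1) unfolding negligible_iff_null_sets by (rule AE_not_in)
  ultimately show ?thesis by (auto elim!: eventually_mono)
qed

subsection \<open>The space as a quotient by equality almost everywhere\<close>

definition bv_rel :: "((real, 'n::card2) vec \<Rightarrow> real) \<Rightarrow> ((real, 'n) vec \<Rightarrow> real) \<Rightarrow> bool" where
  "bv_rel u v \<longleftrightarrow> u \<in> BV_fun \<and> v \<in> BV_fun \<and> (AE x in lebesgue. u x = v x)"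

(* The class card2 (at least two elements) encodes m >= 2; for m = 1 the exponent 1* is infinite. *)
quotient_type 'n bv = "(real, 'n::card2) vec \<Rightarrow> real" / partial: bv_rel
proof (rule part_equivpI)
  show "\<exists>u. bv_rel u u" using BV_fun_zero by (auto simp: bv_rel_def)
  show "symp bv_rel" by (auto simp: symp_def bv_rel_def elim!: eventually_mono)
  show "transp bv_rel" by (auto simp: transp_def bv_rel_def elim!: eventually_elim2)
qed

lemma bv_rel_BV: "bv_rel u v \<Longrightarrow> u \<in> BV_fun" "bv_rel u v \<Longrightarrow> v \<in> BV_fun"
  and bv_rel_AE: "bv_rel u v \<Longrightarrow> AE x in lebesgue. u x = v x"
  by (simp_all add: bv_rel_def)

lemma bv_rel_scale: "bv_rel u v \<Longrightarrow> bv_rel (\<lambda>x. c * u x) (\<lambda>x. c * v x)"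
  by (auto simp: bv_rel_def BV_fun_scale elim!: eventually_mono)

lemma bv_rel_add: "bv_rel u v \<Longrightarrow> bv_rel u' v' \<Longrightarrow> bv_rel (\<lambda>x. u x + u' x) (\<lambda>x. v x + v' x)"
  by (auto simp: bv_rel_def BV_fun_add elim!: eventually_elim2)

lemma bv_rel_refl: "u \<in> BV_fun \<Longrightarrow> bv_rel u u"
  by (simp add: bv_rel_def)

instantiation bv :: (card2) real_normed_vector
begin

lift_definition zero_bv :: "'a bv" is "\<lambda>_. 0"
  by (rule bv_rel_refl[OF BV_fun_zero])

lift_definition plus_bv :: "'a bv \<Rightarrow> 'a bv \<Rightarrow> 'a bv" is "\<lambda>u v x. u x + v x"
  by (rule bv_rel_add)

lift_definition minus_bv :: "'a bv \<Rightarrow> 'a bv \<Rightarrow> 'a bv" is "\<lambda>u v x. u x + (-1) * v x"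
  by (intro bv_rel_add bv_rel_scale)

lift_definition uminus_bv :: "'a bv \<Rightarrow> 'a bv" is "\<lambda>u x. (-1) * u x"
  by (rule bv_rel_scale)

lift_definition scaleR_bv :: "real \<Rightarrow> 'a bv \<Rightarrow> 'a bv" is "\<lambda>c u x. c * u x"
  by (rule bv_rel_scale)

lift_definition norm_bv :: "'a bv \<Rightarrow> real" is variation
  by (intro variation_cong_AE Lp_measurable[OF BV_fun_Lp] bv_rel_BV bv_rel_AE)

definition dist_bv :: "'a bv \<Rightarrow> 'a bv \<Rightarrow> real" where
  "dist_bv u v = norm (u - v)"

definition sgn_bv :: "'a bv \<Rightarrow> 'a bv" where
  "sgn_bv u = scaleR (inverse (norm u)) u"

definition uniformity_bv :: "('a bv \<times> 'a bv) filter" where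
  "uniformity_bv = (INF e\<in>{0 <..}. principal {(x, y). dist x y < e})"

definition open_bv :: "'a bv set \<Rightarrow> bool" where
  "open_bv U = (\<forall>x\<in>U. eventually (\<lambda>(x', y). x' = x \<longrightarrow> y \<in> U) uniformity)"

instance
proof
  fix u v w :: "'a bv" and c d :: real
  note intros = bv_rel_add bv_rel_scale bv_rel_refl[OF BV_fun_zero]
  have eqI: "bv_rel f g" if "bv_rel f f" "f = g" for f g :: "(real, 'a) vec \<Rightarrow> real"
    using that by simp
  show "u + v + w = u + (v + w)" by transfer (rule eqI, intro intros, auto)
  show "u + v = v + u" by transfer (rule eqI, intro intros, auto)
  show "0 + u = u" by transfer simp
  show "- u + u = 0"
    by transfer (rule eqI, intro intros, auto)
  show "u - v = u + - v" by transfer (intro intros)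
  show "c *\<^sub>R (u + v) = c *\<^sub>R u + c *\<^sub>R v"
    by transfer (rule eqI, intro intros, auto simp: algebra_simps)
  show "(c + d) *\<^sub>R u = c *\<^sub>R u + d *\<^sub>R u"
    by transfer (rule eqI, intro intros, auto simp: algebra_simps)
  show "c *\<^sub>R d *\<^sub>R u = (c * d) *\<^sub>R u"
    by transfer (rule eqI, intro intros, auto simp: algebra_simps)
  show "1 *\<^sub>R u = u" by transfer simp
  show "dist u v = norm (u - v)" by (rule dist_bv_def)
  show "sgn u = scaleR (inverse (norm u)) u" by (rule sgn_bv_def)
  show "(uniformity :: ('a bv \<times> 'a bv) filter) = (INF e\<in>{0 <..}. principal {(x, y). dist x y < e})"
    by (rule uniformity_bv_def)
  show "open U = (\<forall>x\<in>U. eventually (\<lambda>(x', y). x' = x \<longrightarrow> y \<in> U) uniformity)" for U :: "'a bv set"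
    by (rule open_bv_def)
  show "norm u = 0 \<longleftrightarrow> u = 0"
  proof
    show "norm u = 0 \<Longrightarrow> u = 0"
      by transfer (auto simp: bv_rel_def BV_fun_zero variation_zero_AE)
    have "variation (\<lambda>_::(real, 'a) vec. 0) = 0"
      using variation_scale[OF BV_fun_zero, of 0] by simp
    then have "norm (0 :: 'a bv) = 0"
      by (simp add: norm_bv.abs_eq zero_bv_def bv_rel_refl[OF BV_fun_zero])
    then show "u = 0 \<Longrightarrow> norm u = 0" by simp
  qed
  show "norm (u + v) \<le> norm u + norm v"
    by transfer (intro variation_add bv_rel_BV)
  show "norm (c *\<^sub>R u) = \<bar>c\<bar> * norm u"
    by transfer (intro variation_scale bv_rel_BV)
qed

end

(* Membership of the functional in the dual of the space is the Gagliardo-Nirenberg-Sobolev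
   inequality, so every f in L_m contributes exactly one functional here. *)
definition SCH0 :: "('n::card2 bv \<Rightarrow>\<^sub>L real) set" where
  "SCH0 = closure {T. \<exists>f \<in> Lp (real CARD('n)).
     \<forall>u. blinfun_apply T u = (LINT x|lebesgue. rep_bv u x * f x)}"

(* The difference of the two measures is determined by u, since test functions separate finite
   signed Borel measures; hence the choice does not affect integrals of bounded functions. *)
definition distr_deriv :: "'n::card2 \<Rightarrow> 'n bv \<Rightarrow> (real, 'n) vec measure \<times> (real, 'n) vec measure" where
  "distr_deriv i u = (SOME \<sigma>. is_distr_deriv i (rep_bv u) \<sigma>)"


section \<open>The divergence operators\<close>

(* The gradient of a Lipschitz function exists almost everywhere (Rademacher); its values
   elsewhere do not affect the integral. *)
definition div_L1 :: "(real^'n \<Rightarrow> real^'n) \<Rightarrow> 'n::finite lip0 \<Rightarrow> real" where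
  "div_L1 v u = - (LINT x|lebesgue. gradient (Rep_lip0 u) x \<bullet> v x)"

definition C0_fields :: "(real^'n \<Rightarrow> real^'n) set" where
  "C0_fields = {v. continuous_on UNIV v \<and> (v \<longlongrightarrow> 0) at_infinity}"

definition div_C0 :: "((real, 'n) vec \<Rightarrow> (real, 'n) vec) \<Rightarrow> 'n::card2 bv \<Rightarrow> real" where
  "div_C0 v u = - (\<Sum>i\<in>UNIV. signed_integral (distr_deriv i u) (\<lambda>x. v x $ i))"

end

theory Submission
  imports Defs
begin

text \<open>Both operators are bounded, so it suffices to solve approximately: for every functional \<open>T\<close> in the
  target and every \<open>e > 0\<close> there is a test field whose norm is at most a constant times \<open>norm T\<close>, up to \<open>e\<close>, and
  whose divergence is \<open>e\<close>-close to \<open>T\<close>. Solving for the remainders and summing the fields then gives \<open>T\<close> exactly.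

  The functional may be taken to be the pairing with a function \<open>f\<close>. Let \<open>h\<close> be the residual of the best
  approximation of \<open>f\<close> by divergences of fields in a ball: in \<open>L\<^sub>m\<close> for \<open>SCH\<^sub>0\<close>, in a weighted \<open>L\<^sub>2\<close> for the
  Lipschitz-free space. The variational inequality says that the dual function \<open>u\<close> (\<open>\<bar>h\<bar> ^ (m - 2) * h\<close>,
  respectively the weight times \<open>h\<close>) satisfies \<open>\<integral> u div v \<le> \<integral> u (f - h)\<close> on the ball, that is, after
  mollification it is a function of bounded variation, respectively a Lipschitz function, with a bound on its
  norm. Testing \<open>f\<close> against it gives \<open>\<integral> u f \<le> \<integral> u (f - h)\<close>, so \<open>\<integral> u h \<le> 0\<close> and \<open>h = 0\<close>. This takes the place of
  the Hahn--Banach theorem and of a description of the dual spaces.\<close>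

section \<open>Compactly supported functions and mollification\<close>

text \<open>The dual function \<open>u\<close> is at first only locally integrable, and all that is
  known about it is how it pairs with divergences of test fields, so it belongs to neither function
  space. Translating an admissible field leaves it admissible; hence \<open>conv u \<rho>\<close>
  inherits the bound, and being smooth it has an honest gradient. For bounded variation this
  gradient is in L_1 by duality, and the Gagliardo--Nirenberg inequality puts the function into
  \<open>Lp (conj_exp TYPE('n))\<close>. The same inequality makes the pairing with L_m continuous,
  so that closeness in L_m implies closeness in the dual norm. Fields are tested one coordinate at a
  time, which costs a factor \<open>CARD('n)\<close>; this is harmless, since any linear bound of
  the field by the functional makes the series of corrections converge. On the Lipschitz side the
  operator uses the pointwise gradient, and Rademacher's theorem identifies it with the weak one.
  The normalisation at 0 is reconciled with translation by taking \<open>f\<close> of integral 0,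
  against which constants are invisible.\<close>

definition Cc :: "(real^'n \<Rightarrow> real) \<Rightarrow> bool" where
  "Cc g \<longleftrightarrow> continuous_on UNIV g \<and> (\<exists>K. compact K \<and> (\<forall>x. x \<notin> K \<longrightarrow> g x = 0))"

text \<open>Borel functions and \<open>lborel\<close>, rather than \<open>lebesgue\<close>, because
  the translation and Fubini arguments are carried out there; Lebesgue measurable data enter through
  a Borel version equal to them almost everywhere.\<close>

definition loc_int :: "(real^'n \<Rightarrow> real) \<Rightarrow> bool" where
  "loc_int u \<longleftrightarrow> u \<in> borel_measurable borel \<and>
     (\<forall>K. compact K \<longrightarrow> integrable lborel (\<lambda>x. indicator K x * u x))"

definition conv :: "(real^'n \<Rightarrow> real) \<Rightarrow> (real^'n \<Rightarrow> real) \<Rightarrow> real^'n \<Rightarrow> real" where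
  "conv u \<rho> x = (LINT y|lborel. u y * \<rho> (x - y))"

lemma test_fun_Cc: "test_fun g \<Longrightarrow> Cc g"
  by (auto simp: test_fun_def Cc_def smooth_continuous)

lemma Cc_cont: "Cc g \<Longrightarrow> continuous_on UNIV g"
  by (simp add: Cc_def)

lemma Cc_borel [measurable_dest]: "Cc g \<Longrightarrow> g \<in> borel_measurable borel"
  by (auto simp: Cc_def intro: borel_measurable_continuous_onI)

lemma Cc_obtain:
  assumes "Cc g"
  obtains R B where "R > 0" "B > 0" "\<And>x. norm x \<ge> R \<Longrightarrow> g x = 0" "\<And>x. \<bar>g x\<bar> \<le> B"
proof -
  obtain K where K: "compact K" "\<And>x. x \<notin> K \<Longrightarrow> g x = 0" and c: "continuous_on UNIV g"
    using assms by (auto simp: Cc_def)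
  obtain R where R: "R > 0" "\<And>x. x \<in> K \<Longrightarrow> norm x < R"
    using bounded_pos_less[of K] compact_imp_bounded[OF K(1)] by blast
  have "compact (g ` K)" using K(1) c by (meson compact_continuous_image continuous_on_subset subset_UNIV)
  then obtain B where B: "B > 0" "\<forall>y\<in>g ` K. norm y \<le> B"
    using bounded_pos compact_imp_bounded by blast
  have "\<bar>g x\<bar> \<le> B" for x using B K(2)[of x] by (cases "x \<in> K") auto
  moreover have "g x = 0" if "norm x \<ge> R" for x using that R(2)[of x] K(2)[of x] by force
  ultimately show ?thesis using that R B by blast
qed

lemma CcI:
  assumes "continuous_on UNIV g" "\<And>x. norm x \<ge> R \<Longrightarrow> g x = 0"
  shows "Cc g"
proof -
  have "g x = 0" if "x \<notin> cball 0 R" for x using that by (intro assms(2)) auto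
  then show ?thesis using assms(1) compact_cball unfolding Cc_def by blast
qed

lemma test_funI:
  assumes "smooth g" "\<And>x. norm x \<ge> R \<Longrightarrow> g x = 0"
  shows "test_fun g"
proof -
  have "g x = 0" if "x \<notin> cball 0 R" for x using that by (intro assms(2)) auto
  then show ?thesis using assms(1) compact_cball unfolding test_fun_def by blast
qed

text \<open>Points at distance below 1 lie both in the compact ball of radius \<open>R + 1\<close>
  or both beyond radius \<open>R\<close>, where \<open>g\<close> vanishes.\<close>

lemma Cc_uniform:
  fixes g :: "real^'n \<Rightarrow> real"
  assumes g: "Cc g" and e: "e > 0"
  obtains d where "d > 0" "\<And>x y. dist x y < d \<Longrightarrow> \<bar>g x - g y\<bar> < e"
proof -
  obtain R B where R: "R > 0" "\<And>x. norm x \<ge> R \<Longrightarrow> g x = 0" using Cc_obtain[OF g] by metis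
  have "uniformly_continuous_on (cball 0 (R+1)) g"
    using Cc_cont[OF g] by (intro compact_uniformly_continuous) (auto intro: continuous_on_subset)
  then obtain d where d: "d > 0"
    "\<And>x y. x \<in> cball 0 (R+1) \<Longrightarrow> y \<in> cball 0 (R+1) \<Longrightarrow> dist x y < d \<Longrightarrow> dist (g x) (g y) < e"
    using e unfolding uniformly_continuous_on_def by metis
  show ?thesis
  proof
    show "min d 1 > 0" using d by simp
    fix x y :: "real^'n" assume xy: "dist x y < min d 1"
    show "\<bar>g x - g y\<bar> < e"
    proof (cases "norm x \<le> R + 1 \<and> norm y \<le> R + 1")
      case True then show ?thesis using d(2)[of x y] xy by (simp add: dist_real_def)
    next
      case False
      have "norm x \<le> norm y + dist x y" "norm y \<le> norm x + dist x y"
        by (metis dist_norm norm_minus_commute norm_triangle_sub)+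
      then have "norm x \<ge> R" "norm y \<ge> R" using False xy by linarith+
      then show ?thesis using R(2)[of x] R(2)[of y] e by simp
    qed
  qed
qed

text \<open>\<open>\<bar>s\<bar> = 1\<close> covers translation (\<open>s = 1\<close>) and
  reflection (\<open>s = -1\<close>), the two substitutions that occur in a convolution.\<close>

lemma Cc_affine:
  fixes g :: "real^'n \<Rightarrow> real"
  assumes g: "Cc g" and s: "\<bar>s\<bar> = 1"
  shows "Cc (\<lambda>x. g (a + s *\<^sub>R x))"
proof -
  obtain R B where R: "R > 0" "\<And>x. norm x \<ge> R \<Longrightarrow> g x = 0" using Cc_obtain[OF g] by metis
  show ?thesis
  proof (rule CcI)
    show "continuous_on UNIV (\<lambda>x. g (a + s *\<^sub>R x))"
      by (rule continuous_on_compose2[OF Cc_cont[OF g]]) (auto intro!: continuous_intros)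
    fix x :: "real^'n" assume "norm x \<ge> R + norm a"
    moreover have "norm x = norm (s *\<^sub>R x)" using s by simp
    moreover have "norm (s *\<^sub>R x) \<le> norm (a + s *\<^sub>R x) + norm a"
      by (metis add_diff_cancel_left' norm_triangle_ineq4)
    ultimately show "g (a + s *\<^sub>R x) = 0" by (intro R) linarith
  qed
qed

lemma Cc_shift: "Cc g \<Longrightarrow> Cc (\<lambda>x. g (x + z))"
  using Cc_affine[of g 1 z] by (simp add: add.commute)

lemma Cc_reflect: "Cc g \<Longrightarrow> Cc (\<lambda>y. g (x - y))"
  using Cc_affine[of g "-1" x] by simp

lemma Cc_mult: "Cc f \<Longrightarrow> continuous_on UNIV g \<Longrightarrow> Cc (\<lambda>x. f x * g x)"
  unfolding Cc_def by (fastforce intro: continuous_intros)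

lemma loc_int_borel [measurable_dest]: "loc_int u \<Longrightarrow> u \<in> borel_measurable borel"
  by (simp add: loc_int_def)

lemma loc_int_cball: "loc_int u \<Longrightarrow> integrable lborel (\<lambda>x. indicator (cball a r) x * u x)"
  by (simp add: loc_int_def)

lemma loc_int_bounded_mult:
  assumes u: "loc_int u" and g: "g \<in> borel_measurable borel" "\<And>x. norm x \<ge> R \<Longrightarrow> g x = 0" "\<And>x. \<bar>g x\<bar> \<le> B"
  shows "integrable lborel (\<lambda>x. u x * g x)"
proof (rule Bochner_Integration.integrable_bound)
  show "integrable lborel (\<lambda>x. B * (indicator (cball 0 R) x * u x))"
    using loc_int_cball[OF u] by simp
  note [measurable] = loc_int_borel[OF u] g(1)
  show "(\<lambda>x. u x * g x) \<in> borel_measurable lborel" by measurable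
  have "\<bar>u x * g x\<bar> \<le> \<bar>B * (indicator (cball 0 R) x * u x)\<bar>" for x
    using g(2)[of x] g(3)[of x] by (cases "norm x \<le> R")
      (auto simp: abs_mult indicator_def mult.commute[of "\<bar>u x\<bar>"] intro!: mult_right_mono order_trans[OF g(3)])
  then show "AE x in lborel. norm (u x * g x) \<le> norm (B * (indicator (cball 0 R) x * u x))" by simp
qed

lemma loc_int_mult:
  assumes u: "loc_int u" and g: "Cc g"
  shows "integrable lborel (\<lambda>x. u x * g x)"
proof -
  obtain R B where "\<And>x. norm x \<ge> R \<Longrightarrow> g x = 0" "\<And>x. \<bar>g x\<bar> \<le> B" using Cc_obtain[OF g] by metis
  then show ?thesis using loc_int_bounded_mult[OF u Cc_borel[OF g]] by blast
qed

lemma loc_int_const: "loc_int (\<lambda>_. c)"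
  unfolding loc_int_def
proof (intro conjI allI impI)
  fix K :: "(real^'n) set" assume "compact K"
  then have "integrable lborel (indicator K :: _ \<Rightarrow> real)"
    using emeasure_bounded_finite[OF compact_imp_bounded, of K]
    by (intro integrable_real_indicator) (auto simp: compact_imp_closed borel_closed)
  then show "integrable lborel (\<lambda>x. indicator K x * c)" by (rule integrable_mult_left)
qed simp

lemma continuous_loc_int:
  fixes u :: "real^'n \<Rightarrow> real"
  assumes "continuous_on UNIV u" shows "loc_int u"
  unfolding loc_int_def
proof (intro conjI allI impI)
  show [measurable]: "u \<in> borel_measurable borel" using assms by (rule borel_measurable_continuous_onI)
  fix K :: "(real^'n) set" assume K: "compact K"
  have "compact (u ` K)" using K assms by (meson compact_continuous_image continuous_on_subset subset_UNIV)
  then obtain B where B: "B > 0" "\<forall>y\<in>u ` K. norm y \<le> B"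
    using bounded_pos compact_imp_bounded by blast
  have [measurable]: "K \<in> sets borel" using K by (simp add: compact_imp_closed borel_closed)
  have "integrable lborel (\<lambda>x. indicator K x * B)"
    using loc_int_const[of B] K unfolding loc_int_def by blast
  then show "integrable lborel (\<lambda>x. indicator K x * u x)"
    by (rule Bochner_Integration.integrable_bound) (use B in \<open>auto simp: indicator_def intro!: AE_I2\<close>)
qed

lemma Cc_integrable: "Cc g \<Longrightarrow> integrable lborel g"
  using loc_int_mult[OF loc_int_const[of 1]] by simp

lemma conv_integrable: "loc_int u \<Longrightarrow> Cc \<rho> \<Longrightarrow> integrable lborel (\<lambda>y. u y * \<rho> (x - y))"
  by (intro loc_int_mult Cc_reflect)

section \<open>Differentiation of convolutions\<close>

text \<open>First-order Taylor expansion with an error uniform in the base point: the partial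
  derivatives have compact support and so are uniformly continuous, and the mean value inequality on
  a segment does the rest.\<close>

lemma gradient_bound_linearization:
  fixes \<rho> :: "real^'n \<Rightarrow> real"
  assumes \<rho>: "test_fun \<rho>" and e: "e > 0"
  obtains d where "d > 0"
    "\<And>z h. norm h < d \<Longrightarrow> \<bar>\<rho> (z + h) - \<rho> z - (\<Sum>i\<in>UNIV. h $ i * partial_deriv i \<rho> z)\<bar> \<le> e * norm h"
proof -
  let ?N = "real CARD('n)"
  have N: "?N > 0" by simp
  have "\<exists>d>0. \<forall>x y. dist x y < d \<longrightarrow> \<bar>partial_deriv i \<rho> x - partial_deriv i \<rho> y\<bar> < e / ?N" for i
    by (rule Cc_uniform[OF test_fun_Cc[OF test_fun_partial[OF \<rho>, of i]] divide_pos_pos[OF e N]]) blast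
  then obtain D where D: "\<And>i. D i > 0"
    "\<And>i x y. dist x y < D i \<Longrightarrow> \<bar>partial_deriv i \<rho> x - partial_deriv i \<rho> y\<bar> < e / ?N" by metis
  define d where "d = Min (range D)"
  have d: "d > 0" "\<And>i. d \<le> D i" using D(1) by (auto simp: d_def)
  have der: "(\<rho> has_derivative (\<lambda>h. \<Sum>i\<in>UNIV. h $ i * partial_deriv i \<rho> z)) (at z)" for z
  proof -
    have "\<rho> differentiable (at z)" using \<rho> by (simp add: test_fun_def smooth_differentiable)
    then have F: "(\<rho> has_derivative frechet_derivative \<rho> (at z)) (at z)" by (rule has_derivative_frechet)
    then have "linear (frechet_derivative \<rho> (at z))" by (rule has_derivative_linear)
    have "frechet_derivative \<rho> (at z) h = (\<Sum>i\<in>UNIV. h $ i * partial_deriv i \<rho> z)" for h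
    proof -
      have "h = (\<Sum>i\<in>UNIV. h $ i *\<^sub>R axis i 1)"
        using basis_expansion[of h] by (simp add: scalar_mult_eq_scaleR)
      then have "frechet_derivative \<rho> (at z) h = frechet_derivative \<rho> (at z) (\<Sum>i\<in>UNIV. h $ i *\<^sub>R axis i 1)" by simp
      also have "\<dots> = (\<Sum>i\<in>UNIV. h $ i * partial_deriv i \<rho> z)"
        using \<open>linear _\<close> by (simp add: linear_sum linear_cmul partial_deriv_def)
      finally show ?thesis .
    qed
    then have "frechet_derivative \<rho> (at z) = (\<lambda>h. \<Sum>i\<in>UNIV. h $ i * partial_deriv i \<rho> z)" by (rule ext)
    with F show ?thesis by simp
  qed
  show ?thesis
  proof
    show "d > 0" by fact
    fix z h :: "real^'n" assume h: "norm h < d"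
    let ?S = "closed_segment z (z + h)"
    \<comment> \<open>Subtracting the linear part frozen at \<open>z\<close> leaves a function whose
      partial derivatives on the segment are below \<open>e / ?N\<close>, so that its derivative has
      operator norm at most \<open>e\<close>.\<close>
    define g where "g x = \<rho> x - (\<Sum>i\<in>UNIV. x $ i * partial_deriv i \<rho> z)" for x
    have "norm (g (z + h) - g z) \<le> e * norm ((z + h) - z)"
    proof (rule differentiable_bound[where S="?S" and f="g" and f'="\<lambda>x h. \<Sum>i\<in>UNIV. h $ i * (partial_deriv i \<rho> x - partial_deriv i \<rho> z)"])
      show "(g has_derivative (\<lambda>h. \<Sum>i\<in>UNIV. h $ i * (partial_deriv i \<rho> x - partial_deriv i \<rho> z))) (at x within ?S)" for x
      proof -
        have "((\<lambda>x. \<rho> x - (\<Sum>i\<in>UNIV. x $ i * partial_deriv i \<rho> z)) has_derivative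
            (\<lambda>h. (\<Sum>i\<in>UNIV. h $ i * partial_deriv i \<rho> x) - (\<Sum>i\<in>UNIV. h $ i * partial_deriv i \<rho> z))) (at x within ?S)"
          by (intro has_derivative_diff has_derivative_at_withinI[OF der] has_derivative_sum
              has_derivative_mult_left bounded_linear_imp_has_derivative bounded_linear_vec_nth)
        then show ?thesis unfolding g_def by (simp add: right_diff_distrib sum_subtractf)
      qed
      fix x assume "x \<in> ?S"
      then have "dist x z \<le> dist z (z + h)"
        using dist_in_closed_segment by blast
      then have "dist x z \<le> norm h" by (simp add: dist_norm)
      then have xd: "dist x z < D i" for i using h d(2)[of i] by linarith
      show "onorm (\<lambda>h. \<Sum>i\<in>UNIV. h $ i * (partial_deriv i \<rho> x - partial_deriv i \<rho> z)) \<le> e"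
      proof (rule onorm_le)
        fix k :: "real^'n"
        have "norm (\<Sum>i\<in>UNIV. k $ i * (partial_deriv i \<rho> x - partial_deriv i \<rho> z)) \<le> (\<Sum>i\<in>(UNIV::'n set). norm k * (e / ?N))"
          unfolding real_norm_def using D(2)[OF xd] component_le_norm_cart[of k]
          by (intro order_trans[OF sum_abs] sum_mono) (unfold abs_mult, intro mult_mono, auto intro: less_imp_le)
        also have "\<dots> = e * norm k" by simp
        finally show "norm (\<Sum>i\<in>UNIV. k $ i * (partial_deriv i \<rho> x - partial_deriv i \<rho> z)) \<le> e * norm k" .
      qed
    qed auto
    then show "\<bar>\<rho> (z + h) - \<rho> z - (\<Sum>i\<in>UNIV. h $ i * partial_deriv i \<rho> z)\<bar> \<le> e * norm h"
      by (simp add: g_def algebra_simps sum.distrib)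
  qed
qed

text \<open>The derivative falls on the kernel alone. The uniform expansion of \<open>\<rho>\<close>
  bounds the error integrand by a small multiple of \<open>\<bar>u\<bar>\<close> on one fixed ball,
  so local integrability of \<open>u\<close> is the right hypothesis.\<close>

lemma has_derivative_conv:
  fixes u :: "real^'n \<Rightarrow> real"
  assumes u: "loc_int u" and \<rho>: "test_fun \<rho>"
  shows "(conv u \<rho> has_derivative (\<lambda>h. \<Sum>i\<in>UNIV. h $ i * conv u (partial_deriv i \<rho>) x)) (at x)"
proof -
  obtain R B where R: "R > 0" "\<And>x. norm x \<ge> R \<Longrightarrow> \<rho> x = 0" using Cc_obtain[OF test_fun_Cc[OF \<rho>]] by metis
  have R': "partial_deriv i \<rho> z = 0" if "norm z \<ge> R + 1" for i z
  proof -
    have "(\<rho> has_derivative (\<lambda>_. 0)) (at z)"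
      by (rule has_derivative_transform_within_open[OF has_derivative_const[of 0], where s="- cball 0 R"])
         (use that R in auto)
    then show ?thesis by (simp add: partial_deriv_eq)
  qed
  \<comment> \<open>Increments are shorter than 1, so for \<open>w\<close> outside this ball the
    kernel vanishes at \<open>x - w\<close> and at \<open>y - w\<close>, and its derivatives vanish
    at \<open>x - w\<close>.\<close>
  define C where "C = (LINT y|lborel. \<bar>indicator (cball x (R + 2)) y * u y\<bar>)"
  have Ci: "integrable lborel (\<lambda>y. \<bar>indicator (cball x (R + 2)) y * u y\<bar>)"
    using loc_int_cball[OF u] by simp
  have C: "C \<ge> 0" by (simp add: C_def)
  note int = conv_integrable[OF u test_fun_Cc]
  have bl: "bounded_linear (\<lambda>h. \<Sum>i\<in>UNIV. h $ i * conv u (partial_deriv i \<rho>) x)"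
    by (intro bounded_linear_sum bounded_linear_mult_const bounded_linear_vec_nth)
  show ?thesis
    unfolding has_derivative_at_alt
  proof (intro conjI bl allI impI)
    fix e :: real assume e: "e > 0"
    define e' where "e' = e / (C + 1)"
    have e': "e' > 0" "e' * C \<le> e"
    proof -
      show "e' > 0" using e C by (simp add: e'_def)
      have "e * C \<le> e * (C + 1)" using e by (intro mult_left_mono) auto
      then show "e' * C \<le> e" using C by (simp add: e'_def pos_divide_le_eq)
    qed
    obtain d where d: "d > 0"
      "\<And>z h. norm h < d \<Longrightarrow> \<bar>\<rho> (z + h) - \<rho> z - (\<Sum>i\<in>UNIV. h $ i * partial_deriv i \<rho> z)\<bar> \<le> e' * norm h"
      using gradient_bound_linearization[OF \<rho> e'(1)] by metis
    show "\<exists>d>0. \<forall>y. norm (y - x) < d \<longrightarrow>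
       norm (conv u \<rho> y - conv u \<rho> x - (\<Sum>i\<in>UNIV. (y - x) $ i * conv u (partial_deriv i \<rho>) x)) \<le> e * norm (y - x)"
    proof (intro exI[of _ "min d 1"] conjI allI impI)
      show "min d 1 > 0" using d by simp
      fix y :: "real^'n" assume y: "norm (y - x) < min d 1"
      define h where "h = y - x"
      let ?L = "\<lambda>w. \<rho> (y - w) - \<rho> (x - w) - (\<Sum>i\<in>UNIV. h $ i * partial_deriv i \<rho> (x - w))"
      have eq: "conv u \<rho> y - conv u \<rho> x - (\<Sum>i\<in>UNIV. h $ i * conv u (partial_deriv i \<rho>) x) = (LINT w|lborel. u w * ?L w)"
      proof -
        have i1: "integrable lborel (\<lambda>w. h $ i * (u w * partial_deriv i \<rho> (x - w)))" for i
          using int[OF test_fun_partial[OF \<rho>]] by simp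
        have "(LINT w|lborel. u w * \<rho> (y - w) - u w * \<rho> (x - w) - (\<Sum>i\<in>UNIV. h $ i * (u w * partial_deriv i \<rho> (x - w))))
          = conv u \<rho> y - conv u \<rho> x - (\<Sum>i\<in>UNIV. h $ i * conv u (partial_deriv i \<rho>) x)"
          using int[OF \<rho>] i1 by (simp add: conv_def Bochner_Integration.integral_sum)
        moreover have "u w * ?L w = u w * \<rho> (y - w) - u w * \<rho> (x - w) - (\<Sum>i\<in>UNIV. h $ i * (u w * partial_deriv i \<rho> (x - w)))" for w
          by (simp add: algebra_simps sum_distrib_left)
        ultimately show ?thesis by simp
      qed
      have pt: "\<bar>u w * ?L w\<bar> \<le> e' * norm h * \<bar>indicator (cball x (R + 2)) w * u w\<bar>" for w
      proof (cases "w \<in> cball x (R + 2)")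
        case True
        have "y - w = (x - w) + h" by (simp add: h_def)
        then have "\<bar>?L w\<bar> \<le> e' * norm h" using d(2)[of h "x - w"] y by (simp add: h_def)
        then show ?thesis using True by (simp add: abs_mult mult.commute mult_left_mono)
      next
        case False
        then have xw: "norm (x - w) > R + 2" by (simp add: dist_norm)
        have "norm (y - w) \<ge> norm (x - w) - norm (y - x)"
          by (metis add_diff_cancel diff_add_cancel norm_diff_ineq norm_minus_commute add_diff_eq)
        then have "norm (y - w) \<ge> R" using xw y by simp
        then show ?thesis using R(2)[of "y-w"] R(2)[of "x-w"] R'[of "x-w"] xw e' by simp
      qed
      have "\<bar>LINT w|lborel. u w * ?L w\<bar> \<le> (LINT w|lborel. e' * norm h * \<bar>indicator (cball x (R + 2)) w * u w\<bar>)"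
      proof (rule order_trans[OF integral_abs_bound integral_mono'])
        show "integrable lborel (\<lambda>w. e' * norm h * \<bar>indicator (cball x (R + 2)) w * u w\<bar>)" using Ci by simp
      qed (use pt e' in auto)
      also have "\<dots> = e' * C * norm h" by (simp add: C_def)
      also have "\<dots> \<le> e * norm h" using e' by (intro mult_right_mono) auto
      finally show "norm (conv u \<rho> y - conv u \<rho> x - (\<Sum>i\<in>UNIV. (y - x) $ i * conv u (partial_deriv i \<rho>) x)) \<le> e * norm (y - x)"
        using eq by (simp add: h_def)
    qed
  qed
qed

lemma partial_deriv_conv:
  assumes "loc_int u" "test_fun \<rho>"
  shows "partial_deriv i (conv u \<rho>) = conv u (partial_deriv i \<rho>)"
proof
  fix x
  have "(\<Sum>j\<in>UNIV. axis i 1 $ j * conv u (partial_deriv j \<rho>) x) = (\<Sum>j\<in>UNIV. if j = i then conv u (partial_deriv i \<rho>) x else 0)"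
    by (intro sum.cong) (auto simp: axis_def)
  then show "partial_deriv i (conv u \<rho>) x = conv u (partial_deriv i \<rho>) x"
    using partial_deriv_eq[OF has_derivative_conv[OF assms]] by simp
qed

lemma smooth_conv:
  assumes u: "loc_int u" and \<rho>: "test_fun \<rho>"
  shows "smooth (conv u \<rho>)"
proof -
  have "Ck k (conv u \<rho>)" if "test_fun \<rho>" for k \<rho> using that
  proof (induction k arbitrary: \<rho>)
    case 0
    have "conv u \<rho> differentiable (at x)" for x
      using has_derivative_conv[OF u 0] by (auto simp: differentiable_def)
    then show ?case by (auto intro!: continuous_at_imp_continuous_on differentiable_imp_continuous_within)
  next
    case (Suc k)
    then show ?case using has_derivative_conv[OF u Suc.prems] test_fun_partial
      by (auto simp: partial_deriv_conv[OF u Suc.prems] differentiable_def)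
  qed
  then show ?thesis using \<rho> by (simp add: smooth_def)
qed

section \<open>Translations and reflections\<close>

lemma integral_lborel_shift:
  fixes f :: "'a::euclidean_space \<Rightarrow> 'b::{banach, second_countable_topology}"
  assumes "f \<in> borel_measurable borel"
  shows "(LINT x|lborel. f (x + a)) = (LINT x|lborel. f x)"
proof -
  have "(LINT x|lborel. f x) = (LINT x|distr lborel borel ((+) a). f x)" by (simp add: lborel_distr_plus)
  also have "\<dots> = (LINT x|lborel. f (a + x))" using assms by (intro integral_distr) auto
  finally show ?thesis by (simp add: add.commute)
qed

lemma integrable_lborel_shift:
  fixes f :: "'a::euclidean_space \<Rightarrow> 'b::{banach, second_countable_topology}"
  assumes "f \<in> borel_measurable borel"
  shows "integrable lborel (\<lambda>x. f (x + a)) \<longleftrightarrow> integrable lborel f"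
proof -
  have "integrable lborel f \<longleftrightarrow> integrable (distr lborel borel ((+) a)) f" by (simp add: lborel_distr_plus)
  also have "\<dots> \<longleftrightarrow> integrable lborel (\<lambda>x. f (a + x))" using assms by (intro integrable_distr_eq) auto
  finally show ?thesis by (simp add: add.commute)
qed

lemma lborel_distr_minus: "distr lborel borel ((-) c) = (lborel :: 'a::euclidean_space measure)"
proof -
  have "lborel = density (distr lborel borel (\<lambda>x::'a. c + (-1) *\<^sub>R x)) (\<lambda>_. ennreal (\<bar>-1\<bar> ^ DIM('a)))"
    using lborel_affine[of "-1" c] by simp
  then show ?thesis by (simp add: density_1)
qed

lemma integral_lborel_reflect:
  fixes f :: "'a::euclidean_space \<Rightarrow> 'b::{banach, second_countable_topology}"
  assumes "f \<in> borel_measurable borel"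
  shows "(LINT x|lborel. f (c - x)) = (LINT x|lborel. f x)"
proof -
  have "(LINT x|lborel. f x) = (LINT x|distr lborel borel ((-) c). f x)" by (simp add: lborel_distr_minus)
  also have "\<dots> = (LINT x|lborel. f (c - x))" using assms by (intro integral_distr) auto
  finally show ?thesis by simp
qed

lemma smooth_affine:
  fixes f :: "real^'n \<Rightarrow> real"
  assumes "smooth f"
  shows "smooth (\<lambda>x. f (a + s *\<^sub>R x))" "partial_deriv i (\<lambda>x. f (a + s *\<^sub>R x)) = (\<lambda>x. s * partial_deriv i f (a + s *\<^sub>R x))"
proof -
  have der: "((\<lambda>x. f (a + s *\<^sub>R x)) has_derivative (\<lambda>h. frechet_derivative f (at (a + s *\<^sub>R x)) (s *\<^sub>R h))) (at x)"
    if "smooth f" for f :: "real^'n \<Rightarrow> real" and x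
  proof -
    have "((\<lambda>x. a + s *\<^sub>R x) has_derivative (\<lambda>h. s *\<^sub>R h)) (at x)"
      by (auto intro!: derivative_eq_intros)
    from has_derivative_compose[OF this has_derivative_frechet[OF smooth_differentiable[OF that]]]
    show ?thesis .
  qed
  have pd: "partial_deriv i (\<lambda>x. f (a + s *\<^sub>R x)) = (\<lambda>x. s * partial_deriv i f (a + s *\<^sub>R x))"
    if "smooth f" for f :: "real^'n \<Rightarrow> real" and i
    using has_derivative_linear[OF has_derivative_frechet[OF smooth_differentiable[OF that]]]
    by (simp add: fun_eq_iff partial_deriv_eq[OF der[OF that]] linear_cmul partial_deriv_def)
  show "partial_deriv i (\<lambda>x. f (a + s *\<^sub>R x)) = (\<lambda>x. s * partial_deriv i f (a + s *\<^sub>R x))"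
    by (rule pd[OF assms])
  have "Ck k (\<lambda>x. f (a + s *\<^sub>R x))" if "smooth f" for k and f :: "real^'n \<Rightarrow> real"
    using that
  proof (induction k arbitrary: f)
    case 0
    have "(\<lambda>x. f (a + s *\<^sub>R x)) differentiable (at x)" for x
      using der[OF 0] by (auto simp: differentiable_def)
    then show ?case by (auto intro!: continuous_at_imp_continuous_on differentiable_imp_continuous_within)
  next
    case (Suc k)
    then show ?case using der[OF Suc.prems]
      by (auto simp: pd differentiable_def smooth_partial intro!: Ck_mult)
  qed
  then show "smooth (\<lambda>x. f (a + s *\<^sub>R x))" using assms by (simp add: smooth_def)
qed

lemma test_fun_affine:
  fixes g :: "real^'n \<Rightarrow> real"
  assumes g: "test_fun g" and s: "\<bar>s\<bar> = 1"
  shows "test_fun (\<lambda>x. g (a + s *\<^sub>R x))"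
proof -
  have "Cc (\<lambda>x. g (a + s *\<^sub>R x))" by (intro Cc_affine test_fun_Cc g s)
  then show ?thesis using smooth_affine(1) g unfolding test_fun_def Cc_def by blast
qed

lemma test_fun_shift: "test_fun g \<Longrightarrow> test_fun (\<lambda>x. g (x + z))"
  using test_fun_affine[of g 1 z] by (simp add: add.commute)

lemma test_fun_reflect: "test_fun g \<Longrightarrow> test_fun (\<lambda>y. g (x - y))"
  using test_fun_affine[of g "-1" x] by simp

lemma partial_deriv_shift: "test_fun g \<Longrightarrow> partial_deriv i (\<lambda>x. g (x + z)) = (\<lambda>x. partial_deriv i g (x + z))"
  using smooth_affine(2)[of g i z 1] by (simp add: add.commute test_fun_def)

lemma partial_deriv_reflect: "test_fun g \<Longrightarrow> partial_deriv i (\<lambda>y. g (x - y)) = (\<lambda>y. - partial_deriv i g (x - y))"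
  using smooth_affine(2)[of g i x "-1"] by (simp add: test_fun_def)

lemma partial_deriv_cmult: "test_fun g \<Longrightarrow> partial_deriv i (\<lambda>x. c * g x) = (\<lambda>x. c * partial_deriv i g x)"
  using partial_deriv_mult[of "\<lambda>_. c" _ g] by (auto simp: fun_eq_iff test_fun_def smooth_differentiable)

section \<open>Mollifiers and averaged pairings\<close>

definition mollifier :: "real \<Rightarrow> (real^'n \<Rightarrow> real) \<Rightarrow> bool" where
  "mollifier d \<rho> \<longleftrightarrow> test_fun \<rho> \<and> (\<forall>x. 0 \<le> \<rho> x) \<and> (LINT x|lborel. \<rho> x) = 1 \<and> (\<forall>x. norm x \<ge> d \<longrightarrow> \<rho> x = 0)"

lemma mollifierD:
  assumes "mollifier d \<rho>"
  shows "test_fun \<rho>" "0 \<le> \<rho> x" "(LINT x|lborel. \<rho> x) = 1" "norm x \<ge> d \<Longrightarrow> \<rho> x = 0"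
  using assms by (auto simp: mollifier_def)

text \<open>A product of one-variable bumps supported in a small cube, divided by its integral. With
  \<open>r = d / (2 * real CARD('n))\<close> the l1-norm is at most \<open>d / 2\<close> on the
  cube.\<close>

lemma mollifier_exists:
  assumes d: "d > 0"
  shows "\<exists>\<rho>::real^'n \<Rightarrow> real. mollifier d \<rho>"
proof -
  define r where "r = d / (2 * real CARD('n))"
  have r: "r > 0" using d by (simp add: r_def)
  define \<phi> where "\<phi> x = (\<Prod>i\<in>UNIV. bump 1 (-r) r (x $ i))" for x :: "real^'n"
  have sm: "smooth \<phi>" unfolding \<phi>_def by (intro smooth_prod smooth_bump) auto
  have 0: "\<phi> x = 0" if "norm x \<ge> d" for x
  proof (rule ccontr)
    assume "\<phi> x \<noteq> 0"
    then have "bump 1 (-r) r (x $ i) \<noteq> 0" for i by (auto simp: \<phi>_def)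
    then have "\<bar>x $ i\<bar> \<le> r" for i using bump_outside[of 1 "x $ i" "-r" r] by force
    then have "norm x \<le> (\<Sum>i\<in>(UNIV::'n set). r)" by (intro order_trans[OF norm_le_l1_cart] sum_mono)
    also have "\<dots> = d / 2" by (simp add: r_def)
    finally show False using that d by simp
  qed
  have tf: "test_fun \<phi>" by (rule test_funI[OF sm 0])
  have nn: "0 \<le> \<phi> x" for x unfolding \<phi>_def by (intro prod_nonneg) (simp add: bump_bounds)
  have int: "integrable lborel \<phi>" using tf test_fun_Cc Cc_integrable by blast
  have pos: "(LINT x|lborel. \<phi> x) > 0"
  proof -
    \<comment> \<open>A vanishing integral would make the set where \<open>\<phi>\<close> is nonzero
      negligible, but that set is open and contains 0.\<close>
    have "(LINT x|lborel. \<phi> x) \<noteq> 0"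
    proof
      assume "(LINT x|lborel. \<phi> x) = 0"
      then have "AE x in lborel. \<phi> x = 0" using integral_nonneg_eq_0_iff_AE[OF int] nn by simp
      then have "AE x in lebesgue. x \<notin> {x. \<phi> x \<noteq> 0}" by (auto simp: AE_completion)
      moreover have op: "open {x. \<phi> x \<noteq> 0}"
        using open_Collect_neq[OF smooth_continuous[OF sm] continuous_on_const[of _ 0]] by simp
      ultimately have "negligible {x. \<phi> x \<noteq> 0}"
        by (simp add: negligible_iff_null_sets AE_iff_null_sets borel_open)
      moreover have "\<phi> 0 \<noteq> 0" using r by (simp add: \<phi>_def bump_def flat_def)
      ultimately show False using open_not_negligible[OF op] by blast
    qed
    moreover have "(LINT x|lborel. \<phi> x) \<ge> 0" using nn by simp
    ultimately show ?thesis by linarith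
  qed
  define c where "c = inverse (LINT x|lborel. \<phi> x)"
  have "mollifier d (\<lambda>x. c * \<phi> x)"
    using pos nn 0 test_fun_cmult[OF tf] by (auto simp: mollifier_def c_def)
  then show ?thesis by blast
qed

lemma integrable_lborel_product:
  fixes f g :: "'a::euclidean_space \<Rightarrow> real"
  assumes f: "integrable lborel f" and g: "integrable lborel g"
  shows "integrable (lborel \<Otimes>\<^sub>M lborel) (\<lambda>(x, y). f x * g y)"
proof (rule lborel_pair.Fubini_integrable)
  have [measurable]: "f \<in> borel_measurable borel" "g \<in> borel_measurable borel" using f g by simp_all
  show "(\<lambda>(x, y). f x * g y) \<in> borel_measurable (lborel \<Otimes>\<^sub>M lborel)" by measurable
  show "integrable lborel (\<lambda>x. LINT y|lborel. norm (case (x, y) of (x, y) \<Rightarrow> f x * g y))"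
    using f g by (simp add: abs_mult)
  show "AE x in lborel. integrable lborel (\<lambda>y. case (x, y) of (x, y) \<Rightarrow> f x * g y)"
    using g by simp
qed

text \<open>Fubini and the substitution \<open>x = y + z\<close> present the pairing of a mollified
  function with \<open>g\<close> as a weighted average of the pairings of \<open>u\<close> with the
  translates of \<open>g\<close>. Bounds on the latter thereby pass to the former.\<close>

lemma conv_pairing:
  fixes u \<rho> g :: "real^'n \<Rightarrow> real"
  assumes u: "loc_int u" and \<rho>: "Cc \<rho>" and g: "Cc g"
  shows "(LINT x|lborel. conv u \<rho> x * g x) = (LINT z|lborel. \<rho> z * (LINT y|lborel. u y * g (y + z)))"
    and "integrable lborel (\<lambda>z. \<rho> z * (LINT y|lborel. u y * g (y + z)))"
proof -
  note [measurable] = loc_int_borel[OF u] Cc_borel[OF \<rho>] Cc_borel[OF g]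
  obtain R B where R: "R > 0" "B > 0" "\<And>x. norm x \<ge> R \<Longrightarrow> \<rho> x = 0" "\<And>x. \<bar>\<rho> x\<bar> \<le> B" using Cc_obtain[OF \<rho>] by metis
  obtain S C where S: "S > 0" "C > 0" "\<And>x. norm x \<ge> S \<Longrightarrow> g x = 0" "\<And>x. \<bar>g x\<bar> \<le> C" using Cc_obtain[OF g] by metis
  \<comment> \<open>If the kernel and \<open>g\<close> are both nonzero, then
    \<open>norm y < R + S\<close>. Cutting \<open>u\<close> off there leaves an integrable product
    as majorant on the product space.\<close>
  let ?U = "\<lambda>y. indicator (cball 0 (R + S)) y * u y"
  have U: "integrable lborel ?U" by (rule loc_int_cball[OF u])
  have i1: "integrable (lborel \<Otimes>\<^sub>M lborel) (\<lambda>(x, y). u y * \<rho> (x - y) * g x)"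
  proof (rule Bochner_Integration.integrable_bound)
    show "integrable (lborel \<Otimes>\<^sub>M lborel) (\<lambda>(x, y). (B * \<bar>g x\<bar>) * ?U y)"
      by (intro integrable_lborel_product U) (simp add: Cc_integrable g)
    show "(\<lambda>(x, y). u y * \<rho> (x - y) * g x) \<in> borel_measurable (lborel \<Otimes>\<^sub>M lborel)" by measurable
    have "\<bar>u y * \<rho> (x - y) * g x\<bar> \<le> \<bar>B * \<bar>g x\<bar> * ?U y\<bar>" for x y
    proof (cases "g x = 0 \<or> \<rho> (x - y) = 0")
      case False
      then have "norm x < S" "norm (x - y) < R" using R(3) S(3) by (meson not_less)+
      then have "norm y < R + S"
        using norm_triangle_ineq4[of x "x - y"] by simp
      then have "y \<in> cball 0 (R + S)" by simp
      then have "\<bar>B * \<bar>g x\<bar> * ?U y\<bar> = \<bar>u y\<bar> * B * \<bar>g x\<bar>" using R by (simp add: abs_mult del: mem_cball)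
      moreover have "\<bar>u y * \<rho> (x - y) * g x\<bar> \<le> \<bar>u y\<bar> * B * \<bar>g x\<bar>"
        unfolding abs_mult using R(4) by (intro mult_right_mono mult_left_mono) auto
      ultimately show ?thesis by argo
    qed auto
    then show "AE x in lborel \<Otimes>\<^sub>M lborel. norm (case x of (x, y) \<Rightarrow> u y * \<rho> (x - y) * g x)
         \<le> norm (case x of (x, y) \<Rightarrow> B * \<bar>g x\<bar> * ?U y)" by auto
  qed
  have i2: "integrable (lborel \<Otimes>\<^sub>M lborel) (\<lambda>(z, y). \<rho> z * (u y * g (y + z)))"
  proof (rule Bochner_Integration.integrable_bound)
    show "integrable (lborel \<Otimes>\<^sub>M lborel) (\<lambda>(z, y). (C * \<bar>\<rho> z\<bar>) * ?U y)"
      by (intro integrable_lborel_product U) (simp add: Cc_integrable \<rho>)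
    show "(\<lambda>(z, y). \<rho> z * (u y * g (y + z))) \<in> borel_measurable (lborel \<Otimes>\<^sub>M lborel)" by measurable
    have "\<bar>\<rho> z * (u y * g (y + z))\<bar> \<le> \<bar>C * \<bar>\<rho> z\<bar> * ?U y\<bar>" for z y
    proof (cases "\<rho> z = 0 \<or> g (y + z) = 0")
      case False
      then have "norm z < R" "norm (y + z) < S" using R(3) S(3) by (meson not_less)+
      then have "norm y < R + S"
        using norm_triangle_ineq4[of "y + z" z] by simp
      then have "y \<in> cball 0 (R + S)" by simp
      then have "\<bar>C * \<bar>\<rho> z\<bar> * ?U y\<bar> = \<bar>\<rho> z\<bar> * (\<bar>u y\<bar> * C)" using S by (simp add: abs_mult del: mem_cball)
      moreover have "\<bar>\<rho> z * (u y * g (y + z))\<bar> \<le> \<bar>\<rho> z\<bar> * (\<bar>u y\<bar> * C)"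
        unfolding abs_mult using S(4) by (intro mult_left_mono) auto
      ultimately show ?thesis by argo
    qed auto
    then show "AE x in lborel \<Otimes>\<^sub>M lborel. norm (case x of (z, y) \<Rightarrow> \<rho> z * (u y * g (y + z)))
         \<le> norm (case x of (z, y) \<Rightarrow> C * \<bar>\<rho> z\<bar> * ?U y)" by auto
  qed
  show "integrable lborel (\<lambda>z. \<rho> z * (LINT y|lborel. u y * g (y + z)))"
    using lborel_pair.integrable_fst'[OF i2] by simp
  have "(LINT x|lborel. conv u \<rho> x * g x) = (LINT x|lborel. LINT y|lborel. u y * \<rho> (x - y) * g x)"
    by (simp add: conv_def)
  also have "\<dots> = (LINT y|lborel. LINT x|lborel. u y * \<rho> (x - y) * g x)"
    using lborel_pair.Fubini_integral[OF i1] by simp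
  also have "\<dots> = (LINT y|lborel. LINT z|lborel. \<rho> z * (u y * g (y + z)))"
  proof (rule Bochner_Integration.integral_cong[OF refl])
    fix y
    have "(LINT x|lborel. u y * \<rho> (x - y) * g x) = (LINT z|lborel. u y * \<rho> (z + y - y) * g (z + y))"
      by (rule integral_lborel_shift[symmetric]) measurable
    then show "(LINT x|lborel. u y * \<rho> (x - y) * g x) = (LINT z|lborel. \<rho> z * (u y * g (y + z)))"
      by (simp add: ac_simps)
  qed
  also have "\<dots> = (LINT z|lborel. LINT y|lborel. \<rho> z * (u y * g (y + z)))"
    using lborel_pair.Fubini_integral[OF i2] by simp
  finally show "(LINT x|lborel. conv u \<rho> x * g x) = (LINT z|lborel. \<rho> z * (LINT y|lborel. u y * g (y + z)))"
    by simp
qed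

text \<open>An average of numbers within \<open>c\<close> of \<open>a\<close> is within
  \<open>c\<close> of \<open>a\<close>. It is applied with \<open>a = 0\<close> to transfer bounds,
  and with \<open>a\<close> the pairing of \<open>u\<close> itself to prove convergence.\<close>

lemma conv_pairing_bound:
  fixes u \<rho> g :: "real^'n \<Rightarrow> real"
  assumes u: "loc_int u" and \<rho>: "mollifier d \<rho>" and g: "Cc g"
    and b: "\<And>z. norm z < d \<Longrightarrow> \<bar>(LINT y|lborel. u y * g (y + z)) - a\<bar> \<le> c"
  shows "\<bar>(LINT x|lborel. conv u \<rho> x * g x) - a\<bar> \<le> c"
proof -
  note C = test_fun_Cc[OF mollifierD(1)[OF \<rho>]]
  let ?G = "\<lambda>z. LINT y|lborel. u y * g (y + z)"
  have i: "integrable lborel \<rho>" by (rule Cc_integrable[OF C])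
  have "(LINT x|lborel. conv u \<rho> x * g x) - a = (LINT z|lborel. \<rho> z * ?G z) - (LINT z|lborel. \<rho> z * a)"
    by (simp add: conv_pairing(1)[OF u C g] mollifierD(3)[OF \<rho>])
  also have "\<dots> = (LINT z|lborel. \<rho> z * (?G z - a))"
    using conv_pairing(2)[OF u C g] i by (simp add: right_diff_distrib)
  finally have "\<bar>(LINT x|lborel. conv u \<rho> x * g x) - a\<bar> \<le> (LINT z|lborel. \<bar>\<rho> z * (?G z - a)\<bar>)"
    by (simp add: integral_abs_bound)
  also have "\<dots> \<le> (LINT z|lborel. \<rho> z * c)"
  proof (rule integral_mono)
    show "integrable lborel (\<lambda>z. \<bar>\<rho> z * (?G z - a)\<bar>)"
      using conv_pairing(2)[OF u C g] i by (simp add: right_diff_distrib)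
    show "integrable lborel (\<lambda>z. \<rho> z * c)" using i by simp
    fix z show "\<bar>\<rho> z * (?G z - a)\<bar> \<le> \<rho> z * c"
      using mollifierD(2,4)[OF \<rho>, of z] b[of z] by (cases "norm z < d") (auto simp: abs_mult intro!: mult_left_mono)
  qed
  also have "\<dots> = c" using mollifierD(3)[OF \<rho>] by simp
  finally show ?thesis .
qed

text \<open>Small translates of \<open>g\<close> are uniformly close to \<open>g\<close> and live in
  one ball, on which \<open>u\<close> is integrable. The threshold \<open>d\<close> serves all
  mollifiers of that radius at once.\<close>

lemma conv_pairing_tendsto:
  fixes u g :: "real^'n \<Rightarrow> real"
  assumes u: "loc_int u" and g: "Cc g" and e: "e > 0"
  obtains d where "d > 0" "\<And>\<rho>. mollifier d \<rho> \<Longrightarrow> \<bar>(LINT x|lborel. conv u \<rho> x * g x) - (LINT x|lborel. u x * g x)\<bar> \<le> e"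
proof -
  obtain R B where R: "R > 0" "B > 0" "\<And>x. norm x \<ge> R \<Longrightarrow> g x = 0" "\<And>x. \<bar>g x\<bar> \<le> B" using Cc_obtain[OF g] by metis
  define C where "C = (LINT y|lborel. \<bar>indicator (cball 0 (R + 1)) y * u y\<bar>)"
  have Ci: "integrable lborel (\<lambda>y. \<bar>indicator (cball 0 (R + 1)) y * u y\<bar>)"
    using loc_int_cball[OF u] by simp
  have C: "C \<ge> 0" by (simp add: C_def)
  have e': "e / (C + 1) > 0" using e C by simp
  obtain d where d: "d > 0" "\<And>x y. dist x y < d \<Longrightarrow> \<bar>g x - g y\<bar> < e / (C + 1)"
    using Cc_uniform[OF g e'] by metis
  show ?thesis
  proof (rule that)
    show "min d 1 > 0" using d by simp
    fix \<rho> :: "real^'n \<Rightarrow> real" assume \<rho>: "mollifier (min d 1) \<rho>"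
    show "\<bar>(LINT x|lborel. conv u \<rho> x * g x) - (LINT x|lborel. u x * g x)\<bar> \<le> e"
    proof (rule conv_pairing_bound[OF u \<rho> g])
      fix z :: "real^'n" assume z: "norm z < min d 1"
      have "(LINT y|lborel. u y * g (y + z)) - (LINT x|lborel. u x * g x) = (LINT y|lborel. u y * (g (y + z) - g y))"
        using loc_int_mult[OF u Cc_shift[OF g]] loc_int_mult[OF u g] by (simp add: right_diff_distrib)
      also have "\<bar>\<dots>\<bar> \<le> (LINT y|lborel. e / (C + 1) * \<bar>indicator (cball 0 (R + 1)) y * u y\<bar>)"
      proof (rule order_trans[OF integral_abs_bound integral_mono'])
        show "integrable lborel (\<lambda>y. e / (C + 1) * \<bar>indicator (cball 0 (R + 1)) y * u y\<bar>)" using Ci by simp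
        fix y
        show "\<bar>u y * (g (y + z) - g y)\<bar> \<le> e / (C + 1) * \<bar>indicator (cball 0 (R + 1)) y * u y\<bar>"
        proof (cases "norm y \<le> R + 1")
          case True
          have "\<bar>g (y + z) - g y\<bar> \<le> e / (C + 1)" using d(2)[of "y + z" y] z by (simp add: dist_norm)
          from mult_left_mono[OF this, of "\<bar>u y\<bar>"] show ?thesis using True by (simp add: abs_mult mult.commute)
        next
          case False
          then have "norm (y + z) \<ge> R" using z norm_triangle_ineq4[of "y + z" z] by simp
          then show ?thesis using R(3)[of "y+z"] R(3)[of y] False e' by simp
        qed
      qed (use e e' C in auto)
      also have "\<dots> = e * (C / (C + 1))" by (simp add: C_def)
      also have "\<dots> \<le> e * 1" using C e by (intro mult_left_mono) auto
      finally show "\<bar>(LINT y|lborel. u y * g (y + z)) - (LINT x|lborel. u x * g x)\<bar> \<le> e" by simp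
    qed
  qed
qed

text \<open>A value of a mollified function averages the values of \<open>g\<close> within distance
  \<open>d\<close>. Suitable \<open>a\<close> and \<open>c\<close> yield closeness to
  \<open>g\<close>, the size of the support, and the sup bound.\<close>

lemma conv_Cc_bound:
  fixes g :: "real^'n \<Rightarrow> real"
  assumes g: "Cc g" and \<rho>: "mollifier d \<rho>" and b: "\<And>y. norm (x - y) < d \<Longrightarrow> \<bar>g y - a\<bar> \<le> c"
  shows "\<bar>conv g \<rho> x - a\<bar> \<le> c"
proof -
  have \<rho>c: "Cc \<rho>" using mollifierD(1)[OF \<rho>] by (rule test_fun_Cc)
  note [measurable] = Cc_borel[OF \<rho>c]
  have i: "integrable lborel (\<lambda>y. \<rho> (x - y))" by (rule Cc_integrable[OF Cc_reflect[OF \<rho>c]])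
  have one: "(LINT y|lborel. \<rho> (x - y)) = 1"
    using integral_lborel_reflect[of \<rho> x] mollifierD(3)[OF \<rho>] by simp
  have gi: "integrable lborel (\<lambda>y. g y * \<rho> (x - y))"
    by (rule conv_integrable[OF continuous_loc_int[OF Cc_cont[OF g]] \<rho>c])
  have "conv g \<rho> x - a = (LINT y|lborel. g y * \<rho> (x - y)) - (LINT y|lborel. a * \<rho> (x - y))"
    by (simp add: conv_def one)
  also have "\<dots> = (LINT y|lborel. (g y - a) * \<rho> (x - y))"
    using gi i by (simp add: left_diff_distrib)
  finally have "\<bar>conv g \<rho> x - a\<bar> \<le> (LINT y|lborel. \<bar>(g y - a) * \<rho> (x - y)\<bar>)"
    by (simp add: integral_abs_bound)
  also have "\<dots> \<le> (LINT y|lborel. c * \<rho> (x - y))"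
  proof (rule integral_mono)
    show "integrable lborel (\<lambda>y. \<bar>(g y - a) * \<rho> (x - y)\<bar>)"
      using gi i by (simp add: left_diff_distrib)
    show "integrable lborel (\<lambda>y. c * \<rho> (x - y))" using i by simp
    fix y show "\<bar>(g y - a) * \<rho> (x - y)\<bar> \<le> c * \<rho> (x - y)"
      using mollifierD(2,4)[OF \<rho>, of "x - y"] b[of y]
      by (cases "norm (x - y) < d") (auto simp: abs_mult intro!: mult_right_mono)
  qed
  also have "\<dots> = c" using one by simp
  finally show ?thesis .
qed

section \<open>Approximation by test functions\<close>

lemma Cc_test_approx:
  fixes g :: "real^'n \<Rightarrow> real"
  assumes g: "Cc g" and B: "\<And>x. \<bar>g x\<bar> \<le> B" and R: "\<And>x. norm x \<ge> R \<Longrightarrow> g x = 0" and e: "e > 0"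
  shows "\<exists>\<phi>. test_fun \<phi> \<and> (\<forall>x. \<bar>\<phi> x - g x\<bar> \<le> e \<and> \<bar>\<phi> x\<bar> \<le> B) \<and> (\<forall>x. norm x \<ge> R + 1 \<longrightarrow> \<phi> x = 0)"
proof -
  obtain d where d: "d > 0" "\<And>x y. dist x y < d \<Longrightarrow> \<bar>g x - g y\<bar> < e"
    using Cc_uniform[OF g e] by metis
  obtain \<rho> :: "real^'n \<Rightarrow> real" where \<rho>: "mollifier (min d 1) \<rho>"
    using mollifier_exists[of "min d 1"] d by auto
  have 0: "conv g \<rho> x = 0" if "norm x \<ge> R + 1" for x
  proof -
    have "\<bar>conv g \<rho> x - 0\<bar> \<le> 0"
    proof (rule conv_Cc_bound[OF g \<rho>])
      fix y assume "norm (x - y) < min d 1"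
      then have "norm y \<ge> R" using that norm_triangle_ineq2[of x y] by simp
      then show "\<bar>g y - 0\<bar> \<le> 0" using R by simp
    qed
    then show ?thesis by simp
  qed
  show ?thesis
  proof (intro exI[of _ "conv g \<rho>"] conjI allI impI 0)
    show "test_fun (conv g \<rho>)"
      by (rule test_funI[OF smooth_conv[OF continuous_loc_int[OF Cc_cont[OF g]] mollifierD(1)[OF \<rho>]] 0])
    fix x
    show "\<bar>conv g \<rho> x - g x\<bar> \<le> e"
    proof (rule conv_Cc_bound[OF g \<rho>])
      fix y assume "norm (x - y) < min d 1"
      then show "\<bar>g y - g x\<bar> \<le> e" using d(2)[of y x] by (simp add: dist_norm norm_minus_commute)
    qed
    show "\<bar>conv g \<rho> x\<bar> \<le> B" using conv_Cc_bound[OF g \<rho>, of x 0 B] B by simp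
  qed
qed

text \<open>Measurability provides continuous functions converging almost everywhere; these are
  clamped, cut off, and mollified up to an error \<open>1 / real (Suc n)\<close>. The common bound
  and support are what dominated convergence will ask for.\<close>

lemma bounded_test_approx_AE:
  fixes s :: "real^'n \<Rightarrow> real"
  assumes s: "s \<in> borel_measurable lebesgue" and B: "\<And>x. \<bar>s x\<bar> \<le> B" and R: "\<And>x. norm x \<ge> R \<Longrightarrow> s x = 0"
  shows "\<exists>\<phi>. (\<forall>n. test_fun (\<phi> n)) \<and> (\<forall>n x. \<bar>\<phi> n x\<bar> \<le> B) \<and> (\<forall>n x. norm x \<ge> R + 2 \<longrightarrow> \<phi> n x = 0) \<and>
    (AE x in lebesgue. (\<lambda>n. \<phi> n x) \<longlonglongrightarrow> s x)"
proof -
  have "B \<ge> 0" using B[of 0] by simp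
  have "s measurable_on UNIV" using lebesgue_measurable_imp_measurable_on[OF s] by simp
  then obtain N and g :: "nat \<Rightarrow> real^'n \<Rightarrow> real" where N: "negligible N" "\<And>n. continuous_on UNIV (g n)"
    "\<And>x. x \<notin> N \<Longrightarrow> (\<lambda>n. g n x) \<longlonglongrightarrow> s x"
    unfolding measurable_on_def by auto
  define cut where "cut x = max 0 (min 1 (R + 1 - norm x))" for x :: "real^'n"
  \<comment> \<open>Clamping to \<open>[-B, B]\<close> and multiplying by \<open>cut\<close>, which
    is 1 up to radius \<open>R\<close>, do not disturb the limit, since \<open>s\<close> obeys that
    bound and vanishes from radius \<open>R\<close> on.\<close>
  define G where "G n x = max (-B) (min B (g n x)) * cut x" for n x
  have cut: "0 \<le> cut x" "cut x \<le> 1" for x by (auto simp: cut_def)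
  have GB: "\<bar>G n x\<bar> \<le> B" for n x
  proof -
    have "\<bar>max (-B) (min B (g n x))\<bar> * \<bar>cut x\<bar> \<le> B * 1"
      using cut[of x] \<open>B \<ge> 0\<close> by (intro mult_mono) auto
    then show ?thesis by (simp add: G_def abs_mult)
  qed
  have G0: "G n x = 0" if "norm x \<ge> R + 1" for n x using that by (simp add: G_def cut_def)
  have Gc: "Cc (G n)" for n
    by (rule CcI[OF _ G0]) (auto simp: G_def cut_def intro!: continuous_intros N)
  have Glim: "(\<lambda>n. G n x) \<longlonglongrightarrow> s x" if "x \<notin> N" for x
  proof -
    have "(\<lambda>n. G n x) \<longlonglongrightarrow> max (-B) (min B (s x)) * cut x"
      unfolding G_def by (intro tendsto_intros N that)
    moreover have "max (-B) (min B (s x)) * cut x = s x"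
      using B[of x] R[of x] by (cases "norm x \<ge> R") (auto simp: cut_def)
    ultimately show ?thesis by simp
  qed
  have "\<forall>n. \<exists>\<phi>. test_fun \<phi> \<and> (\<forall>x. \<bar>\<phi> x - G n x\<bar> \<le> 1 / real (Suc n) \<and> \<bar>\<phi> x\<bar> \<le> B) \<and> (\<forall>x. norm x \<ge> R + 1 + 1 \<longrightarrow> \<phi> x = 0)"
  proof
    fix n
    have "1 / real (Suc n) > 0" by simp
    then show "\<exists>\<phi>. test_fun \<phi> \<and> (\<forall>x. \<bar>\<phi> x - G n x\<bar> \<le> 1 / real (Suc n) \<and> \<bar>\<phi> x\<bar> \<le> B) \<and> (\<forall>x. norm x \<ge> R + 1 + 1 \<longrightarrow> \<phi> x = 0)"
      by (intro Cc_test_approx[OF Gc GB]) (auto intro: G0)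
  qed
  then obtain \<phi> where \<phi>: "\<And>n. test_fun (\<phi> n)" "\<And>n x. \<bar>\<phi> n x - G n x\<bar> \<le> 1 / real (Suc n)"
    "\<And>n x. \<bar>\<phi> n x\<bar> \<le> B" "\<And>n x. norm x \<ge> R + 1 + 1 \<Longrightarrow> \<phi> n x = 0"
    by metis
  show ?thesis
  proof (intro exI[of _ \<phi>] conjI allI impI \<phi>(1,3))
    show "\<phi> n x = 0" if "norm x \<ge> R + 2" for n x using \<phi>(4)[of x n] that by simp
    have "AE x in lebesgue. x \<notin> N"
      using N(1) unfolding negligible_iff_null_sets by (rule AE_not_in)
    then show "AE x in lebesgue. (\<lambda>n. \<phi> n x) \<longlonglongrightarrow> s x"
    proof eventually_elim
      case (elim x)
      have "(\<lambda>n. \<phi> n x - G n x) \<longlonglongrightarrow> 0"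
      proof (rule Lim_null_comparison)
        show "\<forall>\<^sub>F n in sequentially. norm (\<phi> n x - G n x) \<le> 1 / real (Suc n)" using \<phi>(2) by simp
        show "(\<lambda>n. 1 / real (Suc n)) \<longlonglongrightarrow> 0" by (rule LIMSEQ_Suc) (rule lim_1_over_n)
      qed
      from tendsto_add[OF this Glim[OF elim]] show ?case by simp
    qed
  qed
qed

lemma powr_add_le:
  fixes a b p :: real
  assumes "0 \<le> p"
  shows "\<bar>a + b\<bar> powr p \<le> 2 powr p * (\<bar>a\<bar> powr p + \<bar>b\<bar> powr p)"
proof -
  have "\<bar>a + b\<bar> powr p \<le> (2 * max \<bar>a\<bar> \<bar>b\<bar>) powr p"
    using assms by (intro powr_mono2) auto
  also have "\<dots> = 2 powr p * max \<bar>a\<bar> \<bar>b\<bar> powr p"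
    by (simp add: powr_mult)
  also have "\<dots> \<le> 2 powr p * (\<bar>a\<bar> powr p + \<bar>b\<bar> powr p)"
    by (intro mult_left_mono) (auto simp: max_def)
  finally show ?thesis .
qed

lemma integrable_cball: "integrable lebesgue (indicator (cball a r) :: 'a::euclidean_space \<Rightarrow> real)"
  using lmeasurable_cball lmeasurable_iff_integrable by blast

text \<open>Truncation in domain and range, then approximation of the bounded truncation; both steps
  converge by domination. The errors are combined by the quasi-triangle inequality
  \<open>powr_add_le\<close>, which holds for every positive \<open>p\<close>.\<close>

lemma Lp_test_dense:
  fixes f :: "real^'n \<Rightarrow> real"
  assumes p: "p > 0" and f: "f \<in> Lp p" and e: "e > 0"
  obtains \<phi> where "test_fun \<phi>" "(LINT x|lebesgue. \<bar>f x - \<phi> x\<bar> powr p) < e"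
proof -
  note [measurable] = Lp_measurable[OF f]
  have fi: "integrable lebesgue (\<lambda>x. \<bar>f x\<bar> powr p)" using f by (simp add: Lp_def)
  define F where "F n x = (if norm x < real n \<and> \<bar>f x\<bar> \<le> real n then f x else 0)" for n x
  have Fm[measurable]: "F n \<in> borel_measurable lebesgue" for n
  proof -
    have "(\<lambda>x::real^'n. norm x) \<in> borel_measurable lebesgue" by (intro measurable_completion) simp
    then show ?thesis unfolding F_def by measurable
  qed
  \<comment> \<open>Two errors below \<open>\<eta>\<close> enter with the factor
    \<open>2 powr p\<close> of \<open>powr_add_le\<close>.\<close>
  define \<eta> where "\<eta> = e / (2 * 2 powr p)"
  have \<eta>: "\<eta> > 0" using e by (simp add: \<eta>_def)
  have "(\<lambda>n. LINT x|lebesgue. \<bar>f x - F n x\<bar> powr p) \<longlonglongrightarrow> (LINT x|lebesgue. (\<lambda>x::real^'n. 0) x)"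
  proof (rule integral_dominated_convergence[where w="\<lambda>x. \<bar>f x\<bar> powr p"])
    show "AE x in lebesgue. (\<lambda>n. \<bar>f x - F n x\<bar> powr p) \<longlonglongrightarrow> 0"
    proof (rule AE_I2)
      fix x
      obtain n0 :: nat where n0: "real n0 > max (norm x) \<bar>f x\<bar>" using reals_Archimedean2 by blast
      have "eventually (\<lambda>n. 0 = \<bar>f x - F n x\<bar> powr p) sequentially"
        unfolding eventually_sequentially
      proof (intro exI allI impI)
        fix n assume "n0 \<le> n"
        then have "real n > max (norm x) \<bar>f x\<bar>" using n0 by linarith
        then show "0 = \<bar>f x - F n x\<bar> powr p" by (simp add: F_def)
      qed
      then show "(\<lambda>n. \<bar>f x - F n x\<bar> powr p) \<longlonglongrightarrow> 0" by (rule Lim_transform_eventually[OF tendsto_const])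
    qed
    show "AE x in lebesgue. norm (\<bar>f x - F n x\<bar> powr p) \<le> \<bar>f x\<bar> powr p" for n
      by (intro AE_I2) (simp add: F_def)
  qed (use fi in measurable)
  then have "\<forall>\<^sub>F n in sequentially. (LINT x|lebesgue. \<bar>f x - F n x\<bar> powr p) < \<eta>"
    using \<eta> by (auto dest: order_tendstoD(2))
  then obtain n where n: "(LINT x|lebesgue. \<bar>f x - F n x\<bar> powr p) < \<eta>"
    by (meson eventually_happens sequentially_bot)
  have FB: "\<bar>F n x\<bar> \<le> real n" "norm x \<ge> real n \<Longrightarrow> F n x = 0" for x by (auto simp: F_def)
  obtain \<phi> where \<phi>': "\<forall>k. test_fun (\<phi> k)" "\<forall>k x. \<bar>\<phi> k x\<bar> \<le> real n"
      "\<forall>k x. norm x \<ge> real n + 2 \<longrightarrow> \<phi> k x = 0" and \<phi>4: "AE x in lebesgue. (\<lambda>k. \<phi> k x) \<longlonglongrightarrow> F n x"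
    by (rule exE[OF bounded_test_approx_AE[OF Fm FB(1), of "real n"]]) (use FB(2) in blast)+
  note \<phi> = \<phi>'[rule_format] \<phi>4
  note [measurable] = test_fun_measurable[OF \<phi>(1)]
  have dom: "\<bar>F n x - \<phi> k x\<bar> powr p \<le> (2 * real n) powr p * indicator (cball 0 (real n + 2)) x" for x k
  proof (cases "norm x \<le> real n + 2")
    case True
    have "\<bar>F n x - \<phi> k x\<bar> \<le> 2 * real n" using FB(1)[of x] \<phi>(2)[of k x] by linarith
    then show ?thesis using True p by (auto intro: powr_mono2)
  next
    case False
    then show ?thesis using FB(2)[of x] \<phi>(3)[of x k] by simp
  qed
  have Di: "integrable lebesgue (\<lambda>x::real^'n. (2 * real n) powr p * indicator (cball 0 (real n + 2)) x)"
    using integrable_cball by (rule integrable_mult_right)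
  have "(\<lambda>k. LINT x|lebesgue. \<bar>F n x - \<phi> k x\<bar> powr p) \<longlonglongrightarrow> (LINT x|lebesgue. (\<lambda>x::real^'n. 0) x)"
  proof (rule integral_dominated_convergence[OF _ _ Di])
    show "AE x in lebesgue. (\<lambda>k. \<bar>F n x - \<phi> k x\<bar> powr p) \<longlonglongrightarrow> 0"
      using \<phi>(4)
    proof eventually_elim
      case (elim x)
      have "(\<lambda>k. \<bar>F n x - \<phi> k x\<bar>) \<longlonglongrightarrow> \<bar>F n x - F n x\<bar>" by (intro tendsto_intros elim)
      then have "(\<lambda>k. \<bar>F n x - \<phi> k x\<bar> powr p) \<longlonglongrightarrow> 0 powr p"
        using p by (intro tendsto_powr2) auto
      then show ?case by simp
    qed
  qed (use dom in auto)
  then have "\<forall>\<^sub>F k in sequentially. (LINT x|lebesgue. \<bar>F n x - \<phi> k x\<bar> powr p) < \<eta>"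
    using \<eta> by (auto dest: order_tendstoD(2))
  then obtain k where k: "(LINT x|lebesgue. \<bar>F n x - \<phi> k x\<bar> powr p) < \<eta>"
    by (meson eventually_happens sequentially_bot)
  have i1: "integrable lebesgue (\<lambda>x. \<bar>f x - F n x\<bar> powr p)"
  proof (rule Bochner_Integration.integrable_bound[OF fi])
    show "AE x in lebesgue. norm (\<bar>f x - F n x\<bar> powr p) \<le> norm (\<bar>f x\<bar> powr p)"
      by (intro AE_I2) (simp add: F_def)
  qed measurable
  have i2: "integrable lebesgue (\<lambda>x. \<bar>F n x - \<phi> k x\<bar> powr p)"
  proof (rule Bochner_Integration.integrable_bound[OF Di])
    show "AE x in lebesgue. norm (\<bar>F n x - \<phi> k x\<bar> powr p) \<le> norm ((2 * real n) powr p * indicator (cball 0 (real n + 2)) x)"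
      using dom by (intro AE_I2) simp
  qed measurable
  have "(LINT x|lebesgue. \<bar>f x - \<phi> k x\<bar> powr p)
    \<le> (LINT x|lebesgue. 2 powr p * (\<bar>f x - F n x\<bar> powr p + \<bar>F n x - \<phi> k x\<bar> powr p))"
    using i1 i2 powr_add_le[of p "f x - F n x" "F n x - \<phi> k x" for x] p by (intro integral_mono') auto
  also have "\<dots> = 2 powr p * ((LINT x|lebesgue. \<bar>f x - F n x\<bar> powr p) + (LINT x|lebesgue. \<bar>F n x - \<phi> k x\<bar> powr p))"
    using i1 i2 by simp
  also have "\<dots> < 2 powr p * (\<eta> + \<eta>)" using n k by (intro mult_strict_left_mono) auto
  also have "\<dots> = e" by (simp add: \<eta>_def)
  finally show ?thesis using that \<phi>(1) by blast
qed

text \<open>The L_1 norm by duality: tests approximating the sign of \<open>w\<close> on a ball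
  bound the integral of \<open>\<bar>w\<bar>\<close> there, and monotone convergence removes the
  ball. This turns distributional bounds on a gradient into integrability; with \<open>c = 0\<close>
  it shows that a function annihilated by all tests vanishes almost everywhere.\<close>

lemma integrable_from_tests:
  fixes w :: "real^'n \<Rightarrow> real"
  assumes w: "loc_int w" and c: "\<And>\<phi>. test_fun \<phi> \<Longrightarrow> (\<And>x. \<bar>\<phi> x\<bar> \<le> 1) \<Longrightarrow> (LINT x|lborel. w x * \<phi> x) \<le> c"
  shows "integrable lborel w" "(LINT x|lborel. \<bar>w x\<bar>) \<le> c"
proof -
  note [measurable] = loc_int_borel[OF w]
  have [measurable]: "ball (0::real^'n) r \<in> sets borel" for r by simp
  have c0: "c \<ge> 0" using c[OF test_funI[of "\<lambda>_. 0" 0]] by simp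
  have le: "(LINT x|lborel. \<bar>w x\<bar> * indicator (ball 0 r) x) \<le> c" for r
  proof -
    define s where "s x = sgn (w x) * indicator (ball 0 r) x" for x
    have sb: "s \<in> borel_measurable borel" unfolding s_def by (intro borel_measurable_times borel_measurable_indicator) auto
    then have "s \<in> borel_measurable lebesgue" by (simp add: measurable_completion)
    moreover have "\<bar>s x\<bar> \<le> 1" "norm x \<ge> r \<Longrightarrow> s x = 0" for x by (auto simp: s_def sgn_if indicator_def)
    ultimately have "\<exists>\<phi>. (\<forall>n. test_fun (\<phi> n)) \<and> (\<forall>n x. \<bar>\<phi> n x\<bar> \<le> 1) \<and> (\<forall>n x. norm x \<ge> r + 2 \<longrightarrow> \<phi> n x = 0) \<and>
      (AE x in lebesgue. (\<lambda>n. \<phi> n x) \<longlonglongrightarrow> s x)"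
      by (rule bounded_test_approx_AE)
    then obtain \<phi> where \<phi>': "\<forall>k. test_fun (\<phi> k)" "\<forall>k x. \<bar>\<phi> k x\<bar> \<le> 1"
      "\<forall>k x. norm x \<ge> r + 2 \<longrightarrow> \<phi> k x = 0" and \<phi>4: "AE x in lebesgue. (\<lambda>k. \<phi> k x) \<longlonglongrightarrow> s x"
      by (elim exE conjE) (rule that; assumption)
    note \<phi> = \<phi>'[rule_format] \<phi>4
    note [measurable] = test_fun_borel[OF \<phi>(1)] sb
    have "(\<lambda>k. LINT x|lborel. w x * \<phi> k x) \<longlonglongrightarrow> (LINT x|lborel. w x * s x)"
    proof (rule integral_dominated_convergence[where w="\<lambda>x. \<bar>indicator (cball 0 (r + 2)) x * w x\<bar>"])
      show "integrable lborel (\<lambda>x. \<bar>indicator (cball 0 (r + 2)) x * w x\<bar>)"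
        using loc_int_cball[OF w] by simp
      have "AE x in lborel. (\<lambda>k. \<phi> k x) \<longlonglongrightarrow> s x" using \<phi>(4) by (simp add: AE_completion_iff)
      then show "AE x in lborel. (\<lambda>k. w x * \<phi> k x) \<longlonglongrightarrow> w x * s x"
        by eventually_elim (intro tendsto_intros)
      show "AE x in lborel. norm (w x * \<phi> k x) \<le> \<bar>indicator (cball 0 (r + 2)) x * w x\<bar>" for k
      proof (rule AE_I2)
        fix x show "norm (w x * \<phi> k x) \<le> \<bar>indicator (cball 0 (r + 2)) x * w x\<bar>"
          using \<phi>(2)[of k x] \<phi>(3)[of x k] by (cases "norm x \<le> r + 2") (auto simp: abs_mult mult_left_le)
      qed
    qed measurable
    then have "(LINT x|lborel. w x * s x) \<le> c"
      by (rule LIMSEQ_le_const2) (use c \<phi> in auto)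
    moreover have "w x * s x = \<bar>w x\<bar> * indicator (ball 0 r) x" for x by (simp add: s_def abs_sgn)
    ultimately show ?thesis by simp
  qed
  have int: "integrable lborel (\<lambda>x. \<bar>w x\<bar> * indicator (ball 0 r) x)" for r
    by (rule Bochner_Integration.integrable_bound[OF loc_int_cball[OF w, of 0 r]]) (auto simp: indicator_def)
  have nn: "(\<integral>\<^sup>+x. ennreal \<bar>w x\<bar> \<partial>lborel) \<le> ennreal c"
  proof -
    have "(\<integral>\<^sup>+x. ennreal \<bar>w x\<bar> \<partial>lborel) = (\<integral>\<^sup>+x. (SUP n. ennreal (\<bar>w x\<bar> * indicator (ball 0 (real n)) x)) \<partial>lborel)"
    proof (intro nn_integral_cong antisym)
      fix x :: "real^'n"
      obtain n :: nat where "real n > norm x" using reals_Archimedean2 by blast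
      then have "ennreal \<bar>w x\<bar> = ennreal (\<bar>w x\<bar> * indicator (ball 0 (real n)) x)" by simp
      then show "ennreal \<bar>w x\<bar> \<le> (SUP n. ennreal (\<bar>w x\<bar> * indicator (ball 0 (real n)) x))"
        by (metis (mono_tags, lifting) SUP_upper UNIV_I)
      show "(SUP n. ennreal (\<bar>w x\<bar> * indicator (ball 0 (real n)) x)) \<le> ennreal \<bar>w x\<bar>"
        by (intro SUP_least ennreal_leI) (auto simp: indicator_def)
    qed
    also have "\<dots> = (SUP n. \<integral>\<^sup>+x. ennreal (\<bar>w x\<bar> * indicator (ball 0 (real n)) x) \<partial>lborel)"
      by (rule nn_integral_monotone_convergence_SUP)
         (auto simp: incseq_def le_fun_def indicator_def intro!: ennreal_leI)
    also have "\<dots> \<le> ennreal c"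
    proof (rule SUP_least)
      fix n
      have "(\<integral>\<^sup>+x. ennreal (\<bar>w x\<bar> * indicator (ball 0 (real n)) x) \<partial>lborel) = ennreal (LINT x|lborel. \<bar>w x\<bar> * indicator (ball 0 (real n)) x)"
        using int by (intro nn_integral_eq_integral) auto
      also have "\<dots> \<le> ennreal c" using le by (rule ennreal_leI)
      finally show "(\<integral>\<^sup>+x. ennreal (\<bar>w x\<bar> * indicator (ball 0 (real n)) x) \<partial>lborel) \<le> ennreal c" .
    qed
    finally show ?thesis .
  qed
  show 1: "integrable lborel w"
    by (rule integrableI_bounded) (use nn le_less_trans[OF nn ennreal_less_top] in auto)
  show "(LINT x|lborel. \<bar>w x\<bar>) \<le> c"
    using nn nn_integral_eq_integral[of lborel "\<lambda>x. \<bar>w x\<bar>"] 1 c0 by simp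
qed

section \<open>Best approximation in \<open>L\<^sub>p\<close>\<close>

text \<open>The derivative of \<open>\<bar>s\<bar> ^ p / p\<close>, that is, the duality map of L_p;
  for \<open>p = 2\<close> it is the identity.\<close>

definition psi :: "nat \<Rightarrow> real \<Rightarrow> real" where
  "psi p s = \<bar>s\<bar> ^ (p - 2) * s"

lemma psi_mult_self: "p \<ge> 2 \<Longrightarrow> psi p s * s = \<bar>s\<bar> ^ p"
proof -
  assume "p \<ge> 2"
  then obtain k where p: "p = k + 2" by (metis le_Suc_ex add.commute)
  have "psi p s * s = \<bar>s\<bar> ^ k * (s * s)" by (simp add: psi_def p)
  also have "s * s = \<bar>s\<bar> ^ 2" by (simp add: power2_eq_square)
  finally show ?thesis by (simp only: p power_add)
qed

lemma abs_psi: "p \<ge> 2 \<Longrightarrow> \<bar>psi p s\<bar> = \<bar>s\<bar> ^ (p - 1)"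
proof -
  assume "p \<ge> 2"
  then obtain k where p: "p = k + 2" by (metis le_Suc_ex add.commute)
  show ?thesis by (simp add: psi_def p abs_mult mult.commute)
qed

text \<open>The tangent line at \<open>x\<close> lies below a convex function. Bernoulli's
  inequality for \<open>b / a - 1\<close> proves this for absolute values, and signs can only help
  because a product is at most its absolute value.\<close>

lemma power_convex_lower:
  assumes p: "p \<ge> 2"
  shows "\<bar>y\<bar> ^ p \<ge> \<bar>x\<bar> ^ p + real p * psi p x * (y - x)"
proof (cases "x = 0")
  case True
  then show ?thesis using p by (simp add: psi_def)
next
  case False
  define a b where "a = \<bar>x\<bar>" and "b = \<bar>y\<bar>"
  have a: "a > 0" "b \<ge> 0" using False by (auto simp: a_def b_def)
  obtain k where k: "p = Suc k" using p by (cases p) auto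
  have "1 + real p * (b / a - 1) \<le> (1 + (b / a - 1)) ^ p"
    by (rule Bernoulli_inequality) (use a in auto)
  then have "a ^ p * (1 + real p * (b / a - 1)) \<le> a ^ p * (b / a) ^ p"
    using a by (intro mult_left_mono) auto
  also have "\<dots> = b ^ p" using a by (simp add: power_divide)
  also have "a ^ p * (1 + real p * (b / a - 1)) = a ^ p + real p * (a ^ k * b - a ^ p)"
    using a by (simp add: k field_simps)
  finally have 1: "a ^ p + real p * (a ^ k * b - a ^ p) \<le> b ^ p" .
  have "psi p x * y \<le> \<bar>psi p x * y\<bar>" by simp
  also have "\<dots> = a ^ k * b" using abs_psi[OF p, of x] by (simp add: abs_mult a_def b_def k)
  finally have "real p * (psi p x * y) \<le> real p * (a ^ k * b)" by (intro mult_left_mono) auto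
  moreover have "psi p x * x = a ^ p" using psi_mult_self[OF p] by (simp add: a_def)
  moreover have eq: "real p * psi p x * (y - x) = real p * (psi p x * y) - real p * (psi p x * x)"
    by (simp add: algebra_simps)
  ultimately have "a ^ p + real p * psi p x * (y - x) \<le> b ^ p"
    using 1 unfolding eq by (simp add: right_diff_distrib)
  then show ?thesis by (simp add: a_def b_def)
qed

text \<open>After division by \<open>s + t\<close> both terms lie in the unit interval, where
  raising to a power \<open>q \<ge> 1\<close> does not increase them.\<close>

lemma powr_superadd:
  fixes s t q :: real
  assumes "s \<ge> 0" "t \<ge> 0" "q \<ge> 1"
  shows "s powr q + t powr q \<le> (s + t) powr q"
proof (cases "s + t = 0")
  case False
  then have st: "s + t > 0" using assms by auto
  have *: "a powr q \<le> (s + t) powr q * (a / (s + t))" if "0 \<le> a" "a \<le> s + t" for a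
  proof (cases "a = 0")
    case False
    have "a powr q = ((s + t) * (a / (s + t))) powr q" using st by simp
    also have "\<dots> = (s + t) powr q * (a / (s + t)) powr q"
      by (rule powr_mult)
    also have "(a / (s + t)) powr q \<le> (a / (s + t)) powr 1"
      using that st assms(3) False by (intro powr_mono') auto
    finally show ?thesis using that st False by (simp add: mult_left_mono)
  qed (use assms in auto)
  have "s powr q + t powr q \<le> (s + t) powr q * (s / (s + t)) + (s + t) powr q * (t / (s + t))"
    using assms by (intro add_mono *) auto
  also have "\<dots> = (s + t) powr q" using st by (simp add: add_divide_distrib[symmetric] distrib_left[symmetric])
  finally show ?thesis .
next
  case True
  then have "s = 0" "t = 0" using assms by auto
  then show ?thesis by simp
qed

lemma powr_mean_le:
  fixes s t q :: real
  assumes "s \<ge> 0" "t \<ge> 0" "q \<ge> 1"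
  shows "((s + t) / 2) powr q \<le> (s powr q + t powr q) / 2"
proof (cases "s = 0 \<or> t = 0")
  case False
  then have "s > 0" "t > 0" using assms by auto
  then show ?thesis
    using convex_onD[OF powr_convex[OF assms(3)], of "1/2" s t] by (simp add: field_simps)
next
  case True
  have "(a / 2) powr q \<le> a powr q / 2" for a
  proof -
    have "(1/2::real) powr q \<le> (1/2) powr 1" using assms(3) by (intro powr_mono') auto
    then have "a powr q * (1/2) powr q \<le> a powr q * (1/2)" by (intro mult_left_mono) auto
    then show ?thesis using powr_mult[of a "1/2" q] by simp
  qed
  then show ?thesis using True assms by auto
qed

text \<open>Clarkson's inequality; it makes minimising sequences in \<open>L\<^sub>p\<close> Cauchy.\<close>

lemma clarkson:
  fixes a b :: real
  assumes p: "p \<ge> 2"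
  shows "\<bar>a + b\<bar> ^ p + \<bar>a - b\<bar> ^ p \<le> 2 ^ (p - 1) * (\<bar>a\<bar> ^ p + \<bar>b\<bar> ^ p)"
proof -
  \<comment> \<open>With exponent \<open>p / 2\<close> acting on squares, superadditivity merges the
    two terms into \<open>(a + b)\<^sup>2 + (a - b)\<^sup>2\<close>, the parallelogram identity
    evaluates this sum, and convexity separates \<open>a\<close> from \<open>b\<close>
    again.\<close>
  define q where "q = real p / 2"
  have q: "q \<ge> 1" using p by (simp add: q_def)
  have pw: "\<bar>s\<bar> ^ p = (s\<^sup>2) powr q" for s :: real
  proof (cases "s = 0")
    case False
    have "s\<^sup>2 = \<bar>s\<bar> powr 2" using False by simp
    then have "(s\<^sup>2) powr q = (\<bar>s\<bar> powr 2) powr q" by (simp only:)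
    also have "\<dots> = \<bar>s\<bar> powr real p" unfolding powr_powr q_def by simp
    also have "\<dots> = \<bar>s\<bar> ^ p" using False by (simp add: powr_realpow)
    finally show ?thesis by simp
  qed (use p in auto)
  have "\<bar>a + b\<bar> ^ p + \<bar>a - b\<bar> ^ p \<le> ((a + b)\<^sup>2 + (a - b)\<^sup>2) powr q"
    unfolding pw by (intro powr_superadd) (use q in auto)
  also have "(a + b)\<^sup>2 + (a - b)\<^sup>2 = 4 * ((a\<^sup>2 + b\<^sup>2) / 2)" by (simp add: power2_eq_square algebra_simps)
  also have "\<dots> powr q = 4 powr q * ((a\<^sup>2 + b\<^sup>2) / 2) powr q" by (rule powr_mult)
  also have "4 powr q = (2::real) ^ p"
  proof -
    have "(4::real) powr q = (2 powr 2) powr q" by simp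
    also have "\<dots> = 2 powr real p" by (subst powr_powr) (simp add: q_def)
    finally show ?thesis by (simp add: powr_realpow)
  qed
  also have "2 ^ p * ((a\<^sup>2 + b\<^sup>2) / 2) powr q \<le> 2 ^ p * (((a\<^sup>2) powr q + (b\<^sup>2) powr q) / 2)"
    by (intro mult_left_mono powr_mean_le) (use q in auto)
  also have "\<dots> = 2 ^ (p - 1) * (\<bar>a\<bar> ^ p + \<bar>b\<bar> ^ p)"
    using p by (cases p) (auto simp: pw[symmetric])
  finally show ?thesis .
qed

lemma power_add_le:
  fixes a b :: real
  shows "\<bar>a + b\<bar> ^ p \<le> 2 ^ p * (\<bar>a\<bar> ^ p + \<bar>b\<bar> ^ p)"
proof -
  have "\<bar>a + b\<bar> ^ p \<le> (2 * max \<bar>a\<bar> \<bar>b\<bar>) ^ p" by (intro power_mono) auto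
  also have "\<dots> = 2 ^ p * max \<bar>a\<bar> \<bar>b\<bar> ^ p" by (simp add: power_mult_distrib)
  also have "\<dots> \<le> 2 ^ p * (\<bar>a\<bar> ^ p + \<bar>b\<bar> ^ p)" by (intro mult_left_mono) (auto simp: max_def)
  finally show ?thesis .
qed

section \<open>Minimisation over a convex set\<close>

lemma integrable_power_add:
  fixes f g :: "'a \<Rightarrow> real"
  assumes [measurable]: "f \<in> borel_measurable M" "g \<in> borel_measurable M"
    and f: "integrable M (\<lambda>x. \<bar>f x\<bar> ^ p)" and g: "integrable M (\<lambda>x. \<bar>g x\<bar> ^ p)"
  shows "integrable M (\<lambda>x. \<bar>a * f x + b * g x\<bar> ^ p)"
proof (rule Bochner_Integration.integrable_bound)
  show "integrable M (\<lambda>x. 2 ^ p * (\<bar>a\<bar> ^ p * \<bar>f x\<bar> ^ p + \<bar>b\<bar> ^ p * \<bar>g x\<bar> ^ p))" using f g by simp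
  have "\<bar>a * f x + b * g x\<bar> ^ p \<le> 2 ^ p * (\<bar>a\<bar> ^ p * \<bar>f x\<bar> ^ p + \<bar>b\<bar> ^ p * \<bar>g x\<bar> ^ p)" for x
    using power_add_le[of "a * f x" "b * g x" p] by (simp add: abs_mult power_mult_distrib)
  then show "AE x in M. norm (\<bar>a * f x + b * g x\<bar> ^ p) \<le> norm (2 ^ p * (\<bar>a\<bar> ^ p * \<bar>f x\<bar> ^ p + \<bar>b\<bar> ^ p * \<bar>g x\<bar> ^ p))"
    by (intro AE_I2) (smt (verit) real_norm_def zero_le_power abs_ge_zero)
qed measurable

lemma AE_summable:
  fixes f :: "nat \<Rightarrow> 'a \<Rightarrow> real"
  assumes f: "\<And>i. integrable M (f i)" "\<And>i x. 0 \<le> f i x" and s: "summable (\<lambda>i. LINT x|M. f i x)"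
  shows "AE x in M. summable (\<lambda>i. f i x)"
proof -
  have [measurable]: "f i \<in> borel_measurable M" for i using f(1) by simp
  have "(\<integral>\<^sup>+x. (\<Sum>i. ennreal (f i x)) \<partial>M) = (\<Sum>i. \<integral>\<^sup>+x. ennreal (f i x) \<partial>M)"
    by (rule nn_integral_suminf) measurable
  also have "\<dots> = (\<Sum>i. ennreal (LINT x|M. f i x))"
    using f by (intro suminf_cong nn_integral_eq_integral) auto
  also have "\<dots> = ennreal (\<Sum>i. LINT x|M. f i x)"
    using f s by (intro suminf_ennreal2) auto
  finally have "(\<integral>\<^sup>+x. (\<Sum>i. ennreal (f i x)) \<partial>M) \<noteq> \<infinity>" by simp
  then have "AE x in M. (\<Sum>i. ennreal (f i x)) \<noteq> \<infinity>"
    by (intro nn_integral_PInf_AE) measurable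
  then show ?thesis
    by eventually_elim (rule summable_suminf_not_top, use f in auto)
qed

text \<open>\<open>h\<close> is the limit of the residuals of a minimising sequence. The sets
  \<open>K\<close> of divergences are convex but come without closedness, so \<open>f - h\<close> is
  only approximated from \<open>K\<close>. The last clause is the first-order condition: moving the
  approximant \<open>f - h\<close> towards \<open>g\<close> does not lower the distance to
  \<open>f\<close>.\<close>

lemma Lp_minimiser:
  fixes f :: "'a \<Rightarrow> real" and K :: "('a \<Rightarrow> real) set"
  assumes p: "p \<ge> 2" and f: "f \<in> borel_measurable M" "integrable M (\<lambda>x. \<bar>f x\<bar> ^ p)"
    and K: "\<And>g. g \<in> K \<Longrightarrow> g \<in> borel_measurable M" "\<And>g. g \<in> K \<Longrightarrow> integrable M (\<lambda>x. \<bar>g x\<bar> ^ p)"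
    and ne: "K \<noteq> {}"
    and conv: "\<And>g g' t. g \<in> K \<Longrightarrow> g' \<in> K \<Longrightarrow> 0 \<le> t \<Longrightarrow> t \<le> 1 \<Longrightarrow> (\<lambda>x. (1 - t) * g x + t * g' x) \<in> K"
  obtains h where "h \<in> borel_measurable M" "integrable M (\<lambda>x. \<bar>h x\<bar> ^ p)"
    "\<And>e. e > 0 \<Longrightarrow> \<exists>g\<in>K. (LINT x|M. \<bar>f x - h x - g x\<bar> ^ p) < e"
    "\<And>g. g \<in> K \<Longrightarrow> (LINT x|M. psi p (h x) * (g x - (f x - h x))) \<le> 0"
proof -
  note [measurable] = f(1)
  define J where "J g = (LINT x|M. \<bar>f x - g x\<bar> ^ p)" for g
  define d where "d = Inf (J ` K)"
  have bdd: "bdd_below (J ` K)" by (rule bdd_belowI2[of _ 0]) (simp add: J_def)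
  have dle: "d \<le> J g" if "g \<in> K" for g
    unfolding d_def using that bdd by (intro cInf_lower) auto
  \<comment> \<open>The factor \<open>((1/2) ^ k) ^ p\<close> will cancel the weight
    \<open>2 ^ k\<close> inside \<open>b\<close>; the factor \<open>(1/2) ^ k\<close> is left to
    make the integrals of \<open>b\<close> summable.\<close>
  define \<delta> :: "nat \<Rightarrow> real" where "\<delta> k = (1/2) ^ k * ((1/2) ^ k) ^ p" for k
  have \<delta>: "\<delta> k > 0" for k by (simp add: \<delta>_def)
  have \<delta>_le: "\<delta> (Suc k) \<le> \<delta> k" for k
    unfolding \<delta>_def by (intro mult_mono power_mono) auto
  have "\<exists>g\<in>K. J g < d + \<delta> k" for k
  proof -
    have "Inf (J ` K) < d + \<delta> k" using \<delta>[of k] by (simp add: d_def)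
    then show ?thesis using cInf_lessD[of "J ` K" "d + \<delta> k"] ne by auto
  qed
  then obtain G where G: "\<And>k. G k \<in> K" "\<And>k. J (G k) < d + \<delta> k" by metis
  define H where "H k x = f x - G k x" for k x
  have Hm[measurable]: "H k \<in> borel_measurable M" for k
    unfolding H_def using K(1)[OF G(1)[of k]] by measurable
  have Hi: "integrable M (\<lambda>x. \<bar>H k x\<bar> ^ p)" for k
    using integrable_power_add[OF f(1) K(1)[OF G(1)[of k]] f(2) K(2)[OF G(1)[of k]], of 1 "-1"]
    by (simp add: H_def)
  have JH: "J (G k) = (LINT x|M. \<bar>H k x\<bar> ^ p)" for k by (simp add: J_def H_def)
  have diff: "(LINT x|M. \<bar>H (Suc k) x - H k x\<bar> ^ p) \<le> 2 ^ p * \<delta> k" for k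
  proof -
    have i1: "integrable M (\<lambda>x. \<bar>H (Suc k) x + H k x\<bar> ^ p)" and i2: "integrable M (\<lambda>x. \<bar>H (Suc k) x - H k x\<bar> ^ p)"
      using integrable_power_add[OF Hm Hm Hi Hi, of 1 "Suc k" 1 k] integrable_power_add[OF Hm Hm Hi Hi, of 1 "Suc k" "-1" k]
      by simp_all
    \<comment> \<open>The midpoint belongs to \<open>K\<close>, so the sum of two residuals cannot
      be small; Clarkson's inequality then forces their difference to be small.\<close>
    have "(\<lambda>x. (1 - 1/2) * G (Suc k) x + 1/2 * G k x) \<in> K" by (intro conv G) auto
    from dle[OF this] have "d \<le> (LINT x|M. \<bar>(1/2) * (H (Suc k) x + H k x)\<bar> ^ p)"
      by (simp add: J_def H_def algebra_simps)
    also have "\<dots> = (1/2) ^ p * (LINT x|M. \<bar>H (Suc k) x + H k x\<bar> ^ p)"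
      unfolding abs_mult power_mult_distrib by simp
    finally have "2 ^ p * d \<le> (LINT x|M. \<bar>H (Suc k) x + H k x\<bar> ^ p)"
      by (simp add: field_simps)
    moreover have "(LINT x|M. \<bar>H (Suc k) x + H k x\<bar> ^ p + \<bar>H (Suc k) x - H k x\<bar> ^ p)
       \<le> (LINT x|M. 2 ^ (p - 1) * (\<bar>H (Suc k) x\<bar> ^ p + \<bar>H k x\<bar> ^ p))"
      using i1 i2 Hi clarkson[OF p] by (intro integral_mono) auto
    then have "(LINT x|M. \<bar>H (Suc k) x + H k x\<bar> ^ p) + (LINT x|M. \<bar>H (Suc k) x - H k x\<bar> ^ p)
       \<le> 2 ^ (p - 1) * (J (G (Suc k)) + J (G k))"
      using i1 i2 Hi by (simp add: JH)
    moreover have "2 ^ (p - 1) * (J (G (Suc k)) + J (G k)) \<le> 2 ^ (p - 1) * ((d + \<delta> k) + (d + \<delta> k))"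
      using G(2)[of k] G(2)[of "Suc k"] \<delta>_le[of k] by (intro mult_left_mono) auto
    moreover have "2 ^ (p - 1) * ((d + \<delta> k) + (d + \<delta> k)) = 2 ^ p * d + 2 ^ p * \<delta> k"
      using p by (cases p) (auto simp: algebra_simps)
    ultimately show ?thesis by linarith
  qed
  \<comment> \<open>Where the series converges, \<open>b k x \<le> Q x\<close>, so consecutive
    residuals differ by at most \<open>root p \<bar>Q x\<bar> * (1/2) ^ k\<close>. This gives both
    convergence and a majorant almost everywhere.\<close>
  define b where "b k x = (2 ^ k * \<bar>H (Suc k) x - H k x\<bar>) ^ p" for k x
  have [measurable]: "b k \<in> borel_measurable M" for k unfolding b_def by measurable
  have b0: "b k x \<ge> 0" for k x by (simp add: b_def)
  have bi: "integrable M (b k)" for k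
    using integrable_power_add[OF Hm Hm Hi Hi, of 1 "Suc k" "-1" k]
    by (simp add: b_def[abs_def] power_mult_distrib)
  have b_le: "(LINT x|M. b k x) \<le> 2 ^ p * (1/2) ^ k" for k
  proof -
    have "(LINT x|M. b k x) = (2 ^ k) ^ p * (LINT x|M. \<bar>H (Suc k) x - H k x\<bar> ^ p)"
      by (simp add: b_def power_mult_distrib)
    also have "\<dots> \<le> (2 ^ k) ^ p * (2 ^ p * \<delta> k)" by (intro mult_left_mono diff) auto
    also have "\<dots> = 2 ^ p * (1/2) ^ k * ((2 ^ k) ^ p * ((1/2) ^ k) ^ p)" by (simp add: \<delta>_def)
    also have "(2 ^ k) ^ p * ((1/2::real) ^ k) ^ p = 1" by (simp flip: power_mult_distrib)
    finally show ?thesis by simp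
  qed
  have bs: "summable (\<lambda>k. LINT x|M. b k x)"
  proof (rule summable_comparison_test')
    show "summable (\<lambda>k. 2 ^ p * (1/2::real) ^ k)" by (intro summable_mult summable_geometric) simp
    show "norm (LINT x|M. b k x) \<le> 2 ^ p * (1/2) ^ k" for k using b_le b0 by simp
  qed
  have bAE: "AE x in M. summable (\<lambda>k. b k x)" by (rule AE_summable[OF bi b0 bs])
  define Q where "Q x = (\<Sum>k. b k x)" for x
  have Qi: "integrable M Q"
    unfolding Q_def by (rule integrable_suminf[OF bi]) (use bAE bs b0 in auto)
  note [measurable] = borel_measurable_integrable[OF Qi]
  \<comment> \<open>A majorant of the whole sequence; the factor 2 is the sum of the geometric
    series.\<close>
  define D where "D x = \<bar>H 0 x\<bar> + 2 * root p \<bar>Q x\<bar>" for x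
  have [measurable]: "D \<in> borel_measurable M" unfolding D_def by measurable
  have p0: "p > 0" using p by simp
  have Di: "integrable M (\<lambda>x. \<bar>D x\<bar> ^ p)"
  proof -
    have "integrable M (\<lambda>x. \<bar>1 * \<bar>H 0 x\<bar> + 2 * root p \<bar>Q x\<bar>\<bar> ^ p)"
    proof (rule integrable_power_add)
      show "integrable M (\<lambda>x. \<bar>\<bar>H 0 x\<bar>\<bar> ^ p)" using Hi by simp
      have "\<bar>root p \<bar>Q x\<bar>\<bar> ^ p = \<bar>Q x\<bar>" for x using p0 by simp
      then show "integrable M (\<lambda>x. \<bar>root p \<bar>Q x\<bar>\<bar> ^ p)" using Qi by simp
    qed measurable
    then show ?thesis by (simp add: D_def)
  qed
  \<comment> \<open>\<open>lim\<close> is measurable as a total function, although the convergence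
    holds only almost everywhere.\<close>
  define h where "h x = lim (\<lambda>k. H k x)" for x
  have hm[measurable]: "h \<in> borel_measurable M" unfolding h_def by measurable
  have main: "AE x in M. (\<lambda>k. H k x) \<longlonglongrightarrow> h x \<and> (\<forall>k. \<bar>H k x\<bar> \<le> D x)"
    using bAE
  proof eventually_elim
    case (elim x)
    let ?S = "root p \<bar>Q x\<bar>"
    have Q0: "Q x \<ge> 0" unfolding Q_def using elim b0 by (intro suminf_nonneg) auto
    have step: "\<bar>H (Suc k) x - H k x\<bar> \<le> ?S * (1/2) ^ k" for k
    proof -
      have "b k x = (\<Sum>i\<in>{k}. b i x)" by simp
      also have "\<dots> \<le> Q x" unfolding Q_def using elim b0 by (intro sum_le_suminf) auto
      finally have "root p (b k x) \<le> ?S" using p0 Q0 by (simp add: real_root_le_iff)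
      moreover have "root p (b k x) = 2 ^ k * \<bar>H (Suc k) x - H k x\<bar>"
        unfolding b_def using p0 by (intro real_root_power_cancel) auto
      ultimately show ?thesis by (simp add: field_simps)
    qed
    have sm: "summable (\<lambda>k. H (Suc k) x - H k x)"
      by (rule summable_comparison_test'[where g="\<lambda>k. ?S * (1/2) ^ k"])
         (use step in \<open>auto intro!: summable_mult summable_geometric\<close>)
    have tel: "(\<Sum>k<n. H (Suc k) x - H k x) = H n x - H 0 x" for n
      by (rule sum_lessThan_telescope)
    have "(\<lambda>n. (\<Sum>k<n. H (Suc k) x - H k x) + H 0 x) \<longlonglongrightarrow> (\<Sum>k. H (Suc k) x - H k x) + H 0 x"
      by (intro tendsto_intros summable_LIMSEQ sm)
    then have "convergent (\<lambda>n. H n x)" unfolding tel by (auto simp: convergent_def)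
    then have "(\<lambda>k. H k x) \<longlonglongrightarrow> h x" unfolding h_def convergent_LIMSEQ_iff .
    moreover have "\<bar>H n x\<bar> \<le> D x" for n
    proof -
      have "\<bar>H n x - H 0 x\<bar> \<le> (\<Sum>k<n. \<bar>H (Suc k) x - H k x\<bar>)"
        unfolding tel[symmetric] by (rule sum_abs)
      also have "\<dots> \<le> (\<Sum>k<n. ?S * (1/2) ^ k)" by (intro sum_mono step)
      also have "\<dots> \<le> (\<Sum>k. ?S * (1/2) ^ k)"
        using Q0 p0 by (intro sum_le_suminf summable_mult summable_geometric) (auto simp: real_root_ge_zero)
      also have "\<dots> = ?S * 2" by (subst suminf_mult) (auto simp: suminf_geometric summable_geometric)
      finally show ?thesis unfolding D_def by linarith
    qed
    ultimately show ?case by blast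
  qed
  have hD: "AE x in M. \<bar>h x\<bar> \<le> D x"
    using main
  proof eventually_elim
    case (elim x)
    then have "(\<lambda>k. \<bar>H k x\<bar>) \<longlonglongrightarrow> \<bar>h x\<bar>" by (intro tendsto_intros) auto
    then show ?case by (rule LIMSEQ_le_const2) (use elim in auto)
  qed
  have hi: "integrable M (\<lambda>x. \<bar>h x\<bar> ^ p)"
  proof (rule Bochner_Integration.integrable_bound[OF Di])
    show "AE x in M. norm (\<bar>h x\<bar> ^ p) \<le> norm (\<bar>D x\<bar> ^ p)"
      using hD by eventually_elim (simp add: power_abs, rule power_mono, auto)
  qed measurable
  \<comment> \<open>One limit theorem for three uses: the value of the infimum
    (\<open>c = 1\<close>), the approximation clause (\<open>c = -1\<close>), and convex
    combinations with a competitor (\<open>c = 1 - t\<close>).\<close>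
  have lim: "(\<lambda>k. LINT x|M. \<bar>c * H k x + w x\<bar> ^ p) \<longlonglongrightarrow> (LINT x|M. \<bar>c * h x + w x\<bar> ^ p)"
    if [measurable]: "w \<in> borel_measurable M" and w: "integrable M (\<lambda>x. \<bar>w x\<bar> ^ p)" for c w
  proof (rule integral_dominated_convergence[where w="\<lambda>x. 2 ^ p * (\<bar>c\<bar> ^ p * \<bar>D x\<bar> ^ p + \<bar>w x\<bar> ^ p)"])
    show "integrable M (\<lambda>x. 2 ^ p * (\<bar>c\<bar> ^ p * \<bar>D x\<bar> ^ p + \<bar>w x\<bar> ^ p))" using Di w by simp
    show "AE x in M. (\<lambda>k. \<bar>c * H k x + w x\<bar> ^ p) \<longlonglongrightarrow> \<bar>c * h x + w x\<bar> ^ p"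
      using main by eventually_elim (intro tendsto_intros, auto)
    show "AE x in M. norm (\<bar>c * H k x + w x\<bar> ^ p) \<le> 2 ^ p * (\<bar>c\<bar> ^ p * \<bar>D x\<bar> ^ p + \<bar>w x\<bar> ^ p)" for k
      using main
    proof eventually_elim
      case (elim x)
      have "\<bar>c * H k x + w x\<bar> ^ p \<le> 2 ^ p * (\<bar>c\<bar> ^ p * \<bar>H k x\<bar> ^ p + \<bar>w x\<bar> ^ p)"
        using power_add_le[of "c * H k x" "w x" p] by (simp add: abs_mult power_mult_distrib)
      also have "\<dots> \<le> 2 ^ p * (\<bar>c\<bar> ^ p * \<bar>D x\<bar> ^ p + \<bar>w x\<bar> ^ p)"
        using elim by (intro mult_left_mono add_mono power_mono order_refl) (auto intro: order_trans)
      finally show ?case by simp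
    qed
  qed measurable
  have hd: "(LINT x|M. \<bar>h x\<bar> ^ p) = d"
  proof -
    have 1: "(\<lambda>k. J (G k)) \<longlonglongrightarrow> (LINT x|M. \<bar>h x\<bar> ^ p)"
      using lim[of "\<lambda>_. 0" 1] p0 by (simp add: JH power_0_left)
    have "\<delta> \<longlonglongrightarrow> 0"
    proof (rule Lim_null_comparison)
      show "(\<lambda>k. (1/2::real) ^ k) \<longlonglongrightarrow> 0" by (intro LIMSEQ_realpow_zero) auto
      have "\<delta> k \<le> (1/2) ^ k * 1" for k unfolding \<delta>_def by (intro mult_left_mono) (auto simp: power_le_one)
      then show "\<forall>\<^sub>F k in sequentially. norm (\<delta> k) \<le> (1/2) ^ k" using \<delta> by (simp add: less_imp_le)
    qed
    then have "(\<lambda>k. d + \<delta> k) \<longlonglongrightarrow> d" using tendsto_add[OF tendsto_const] by fastforce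
    then have "(\<lambda>k. J (G k)) \<longlonglongrightarrow> d"
      by (rule tendsto_sandwich[OF _ _ tendsto_const, rotated 2])
         (use dle G in \<open>auto intro!: always_eventually less_imp_le\<close>)
    then show ?thesis using 1 LIMSEQ_unique by blast
  qed
  show ?thesis
  proof (rule that[OF hm hi])
    fix e :: real assume e: "e > 0"
    have "(\<lambda>k. LINT x|M. \<bar>(-1) * H k x + h x\<bar> ^ p) \<longlonglongrightarrow> (LINT x|M. \<bar>(-1) * h x + h x\<bar> ^ p)"
      by (rule lim[OF hm hi])
    then have "(\<lambda>k. LINT x|M. \<bar>(-1) * H k x + h x\<bar> ^ p) \<longlonglongrightarrow> 0" using p0 by (simp add: power_0_left)
    from order_tendstoD(2)[OF this e] obtain k where k: "(LINT x|M. \<bar>(-1) * H k x + h x\<bar> ^ p) < e"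
      by (meson eventually_happens sequentially_bot)
    have "\<bar>(-1) * H k x + h x\<bar> = \<bar>f x - h x - G k x\<bar>" for x
      using abs_minus_cancel[of "f x - h x - G k x"] by (simp add: H_def algebra_simps)
    with k show "\<exists>g\<in>K. (LINT x|M. \<bar>f x - h x - g x\<bar> ^ p) < e" using G(1) by auto
  next
    fix g assume g: "g \<in> K"
    define w where "w x = g x - (f x - h x)" for x
    have gm[measurable]: "g \<in> borel_measurable M" by (rule K(1)[OF g])
    have wm[measurable]: "w \<in> borel_measurable M" unfolding w_def by measurable
    have fgi: "integrable M (\<lambda>x. \<bar>f x - g x\<bar> ^ p)"
      using integrable_power_add[OF f(1) gm f(2) K(2)[OF g], of 1 "-1"] by simp
    have wi: "integrable M (\<lambda>x. \<bar>w x\<bar> ^ p)"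
    proof -
      have "integrable M (\<lambda>x. \<bar>(-1) * (f x - g x) + 1 * h x\<bar> ^ p)"
        by (rule integrable_power_add[OF _ hm fgi hi]) measurable
      then show ?thesis by (simp add: w_def algebra_simps)
    qed
    have hwi: "integrable M (\<lambda>x. \<bar>h x - t * w x\<bar> ^ p)" for t
      using integrable_power_add[OF hm wm hi wi, of 1 "-t"] by simp
    define E where "E x = (\<bar>h x\<bar> + \<bar>w x\<bar>) ^ p" for x
    have Ei: "integrable M E"
      using integrable_power_add[of "\<lambda>x. \<bar>h x\<bar>" M "\<lambda>x. \<bar>w x\<bar>" p 1 1] hi wi by (simp add: E_def[abs_def])
    have [measurable]: "psi p \<in> borel_measurable borel"
      unfolding psi_def[abs_def] by measurable
    have dom: "\<bar>psi p (h x - t * w x) * w x\<bar> \<le> E x" if "0 \<le> t" "t \<le> 1" for t x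
    proof -
      have "\<bar>t * w x\<bar> \<le> \<bar>w x\<bar>" using that by (simp add: abs_mult mult_left_le_one_le)
      then have "\<bar>h x - t * w x\<bar> \<le> \<bar>h x\<bar> + \<bar>w x\<bar>" by linarith
      then have "\<bar>h x - t * w x\<bar> ^ (p - 1) * \<bar>w x\<bar> \<le> (\<bar>h x\<bar> + \<bar>w x\<bar>) ^ (p - 1) * (\<bar>h x\<bar> + \<bar>w x\<bar>)"
        by (intro mult_mono power_mono) auto
      also have "\<dots> = E x" unfolding E_def using p0 by (metis power_minus_mult)
      finally show ?thesis using abs_psi[OF p] by (simp add: abs_mult)
    qed
    have psii: "integrable M (\<lambda>x. psi p (h x - t * w x) * w x)" if "0 \<le> t" "t \<le> 1" for t
      by (rule Bochner_Integration.integrable_bound[OF Ei]) (use dom[OF that] in \<open>auto intro: order_trans[OF _ abs_ge_self]\<close>)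
    \<comment> \<open>The competitor has residual
      \<open>h - t * w = (1 - t) * h + t * (f - g)\<close>. The tangent line is taken at this moved
      point and not at \<open>h\<close>, which gives a sign for each such \<open>t\<close>; letting
      \<open>t\<close> tend to 0 then requires dominated convergence but no differentiation under
      the integral.\<close>
    have le0: "(LINT x|M. psi p (h x - t * w x) * w x) \<le> 0" if t: "0 < t" "t \<le> 1" for t
    proof -
      have "d \<le> (LINT x|M. \<bar>h x - t * w x\<bar> ^ p)"
      proof (rule LIMSEQ_le_const)
        have "integrable M (\<lambda>x. \<bar>t * (f x - g x)\<bar> ^ p)"
          using fgi by (simp add: abs_mult power_mult_distrib)
        then have "(\<lambda>k. LINT x|M. \<bar>(1 - t) * H k x + t * (f x - g x)\<bar> ^ p) \<longlonglongrightarrow> (LINT x|M. \<bar>(1 - t) * h x + t * (f x - g x)\<bar> ^ p)"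
          by (intro lim) measurable
        also have "(\<lambda>x. (1 - t) * h x + t * (f x - g x)) = (\<lambda>x. h x - t * w x)"
          by (simp add: w_def algebra_simps)
        then have "(LINT x|M. \<bar>(1 - t) * h x + t * (f x - g x)\<bar> ^ p) = (LINT x|M. \<bar>h x - t * w x\<bar> ^ p)"
          by (simp add: fun_eq_iff)
        finally show "(\<lambda>k. LINT x|M. \<bar>(1 - t) * H k x + t * (f x - g x)\<bar> ^ p) \<longlonglongrightarrow> (LINT x|M. \<bar>h x - t * w x\<bar> ^ p)" .
        have "d \<le> (LINT x|M. \<bar>(1 - t) * H k x + t * (f x - g x)\<bar> ^ p)" for k
        proof -
          have "d \<le> J (\<lambda>x. (1 - t) * G k x + t * g x)" using t by (intro dle conv G g) auto
          also have "\<dots> = (LINT x|M. \<bar>(1 - t) * H k x + t * (f x - g x)\<bar> ^ p)"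
            unfolding J_def H_def by (simp add: algebra_simps)
          finally show ?thesis .
        qed
        then show "\<exists>N. \<forall>n\<ge>N. d \<le> (LINT x|M. \<bar>(1 - t) * H n x + t * (f x - g x)\<bar> ^ p)" by blast
      qed
      then have "(LINT x|M. \<bar>h x\<bar> ^ p) \<le> (LINT x|M. \<bar>h x - t * w x\<bar> ^ p)" by (simp add: hd)
      moreover have "(LINT x|M. \<bar>h x - t * w x\<bar> ^ p + real p * t * (psi p (h x - t * w x) * w x)) \<le> (LINT x|M. \<bar>h x\<bar> ^ p)"
      proof (rule integral_mono)
        show "integrable M (\<lambda>x. \<bar>h x - t * w x\<bar> ^ p + real p * t * (psi p (h x - t * w x) * w x))"
          using hwi psii[of t] t by auto
        show "\<bar>h x - t * w x\<bar> ^ p + real p * t * (psi p (h x - t * w x) * w x) \<le> \<bar>h x\<bar> ^ p" for x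
          using power_convex_lower[OF p, of "h x - t * w x" "h x"] by (simp add: algebra_simps)
      qed (rule hi)
      then have "(LINT x|M. \<bar>h x - t * w x\<bar> ^ p) + real p * t * (LINT x|M. psi p (h x - t * w x) * w x) \<le> (LINT x|M. \<bar>h x\<bar> ^ p)"
        using hwi[of t] psii[of t] t by simp
      ultimately have "real p * t * (LINT x|M. psi p (h x - t * w x) * w x) \<le> 0" by linarith
      moreover have "real p * t > 0" using p0 t by simp
      ultimately show ?thesis by (metis linorder_not_le mult_pos_pos)
    qed
    have "(\<lambda>n. LINT x|M. psi p (h x - 1 / real (Suc n) * w x) * w x) \<longlonglongrightarrow> (LINT x|M. psi p (h x - 0 * w x) * w x)"
    proof (rule integral_dominated_convergence[OF _ _ Ei])
      have z: "(\<lambda>n. 1 / real (Suc n)) \<longlonglongrightarrow> 0" by (rule LIMSEQ_Suc) (rule lim_1_over_n)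
      show "AE x in M. (\<lambda>n. psi p (h x - 1 / real (Suc n) * w x) * w x) \<longlonglongrightarrow> psi p (h x - 0 * w x) * w x"
        unfolding psi_def by (intro AE_I2 tendsto_intros z)
      show "AE x in M. norm (psi p (h x - 1 / real (Suc n) * w x) * w x) \<le> E x" for n
        using dom[of "1 / real (Suc n)"] by (intro AE_I2) simp
    qed measurable
    moreover have "(LINT x|M. psi p (h x - 1 / real (Suc n) * w x) * w x) \<le> 0" for n
      by (rule le0) auto
    ultimately have "(LINT x|M. psi p (h x - 0 * w x) * w x) \<le> 0"
      by (intro LIMSEQ_le_const2[where a=0]) blast+
    then show "(LINT x|M. psi p (h x) * (g x - (f x - h x))) \<le> 0" by (simp add: w_def)
  qed
qed

section \<open>The Gagliardo--Nirenberg inequality\<close>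

text \<open>The \<open>k\<close>-th root, with \<open>top\<close> as the root of \<open>top\<close>.
  Values in \<open>ennreal\<close> let the iterated integration run without integrability
  conditions.\<close>

definition epow :: "real \<Rightarrow> ennreal \<Rightarrow> ennreal" where
  "epow k x = (if x = top then top else ennreal (enn2real x powr (1 / k)))"

lemma epow_ennreal: "0 \<le> r \<Longrightarrow> epow k (ennreal r) = ennreal (r powr (1 / k))"
  by (simp add: epow_def)

lemma epow_mono:
  assumes "0 < k" "x \<le> y" shows "epow k x \<le> epow k y"
proof (cases "y = top")
  case False
  then have "x \<noteq> top" using assms(2) by (auto simp: top_unique)
  moreover have "enn2real x \<le> enn2real y" using assms(2) False by (intro enn2real_mono) (auto simp: less_top)
  ultimately show ?thesis using False assms(1) by (auto simp: epow_def intro!: ennreal_leI powr_mono2)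
qed (simp add: epow_def)

lemma epow_measurable [measurable]: "epow k \<in> borel_measurable borel"
  unfolding epow_def[abs_def] by measurable

text \<open>The inequality of arithmetic and geometric means, from \<open>ln x \<le> x - 1\<close>
  applied to \<open>a i / s\<close> with \<open>s\<close> the arithmetic mean.\<close>

lemma prod_powr_le_mean:
  fixes a :: "'i \<Rightarrow> real"
  assumes J: "finite J" "J \<noteq> {}" and a: "\<And>i. i \<in> J \<Longrightarrow> 0 \<le> a i"
  shows "(\<Prod>i\<in>J. a i powr (1 / real (card J))) \<le> (\<Sum>i\<in>J. a i) / real (card J)"
proof (cases "\<exists>i\<in>J. a i = 0")
  case True
  then have "(\<Prod>i\<in>J. a i powr (1 / real (card J))) = 0" using J by (intro prod_zero) auto
  then show ?thesis using a by (simp add: sum_nonneg)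
next
  case False
  let ?k = "real (card J)"
  have k: "?k > 0" using J by (simp add: card_gt_0_iff)
  have a': "a i > 0" if "i \<in> J" for i using a[OF that] False that by force
  define s where "s = (\<Sum>i\<in>J. a i) / ?k"
  have s: "s > 0" unfolding s_def using J a' k by (intro divide_pos_pos sum_pos) auto
  have "(\<Sum>i\<in>J. ln (a i)) \<le> (\<Sum>i\<in>J. ln s + (a i / s - 1))"
  proof (rule sum_mono)
    fix i assume i: "i \<in> J"
    have "ln (a i / s) \<le> a i / s - 1" using a'[OF i] s by (intro ln_le_minus_one) auto
    then show "ln (a i) \<le> ln s + (a i / s - 1)" using a'[OF i] s by (simp add: ln_div)
  qed
  also have "\<dots> = ?k * ln s + ((\<Sum>i\<in>J. a i) / s - ?k)"
    by (simp add: sum.distrib sum_subtractf sum_divide_distrib)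
  also have "(\<Sum>i\<in>J. a i) / s = ?k" using s k by (simp add: s_def field_simps)
  finally have le: "(\<Sum>i\<in>J. ln (a i)) / ?k \<le> ln s" using k by (simp add: field_simps)
  have "(\<Prod>i\<in>J. a i powr (1 / ?k)) = (\<Prod>i\<in>J. exp (1 / ?k * ln (a i)))"
    using a' by (intro prod.cong) (auto simp: powr_def dest: a')
  also have "\<dots> = exp ((\<Sum>i\<in>J. ln (a i)) / ?k)"
    using J by (simp add: exp_sum sum_divide_distrib)
  also have "\<dots> \<le> exp (ln s)" using le by simp
  finally show ?thesis using s by (simp add: s_def)
qed

text \<open>Hoelder's inequality for \<open>card J\<close> functions with equal exponents: each is
  divided by its integral and the inequality of means is used pointwise. A vanishing or infinite
  integral, where this division fails, is treated beforehand.\<close>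

lemma Holder_epow:
  fixes g :: "'i \<Rightarrow> 'a \<Rightarrow> ennreal"
  assumes J: "finite J" "J \<noteq> {}" and g[measurable]: "\<And>i. i \<in> J \<Longrightarrow> g i \<in> borel_measurable M"
  shows "(\<integral>\<^sup>+x. (\<Prod>i\<in>J. epow (real (card J)) (g i x)) \<partial>M) \<le> (\<Prod>i\<in>J. epow (real (card J)) (\<integral>\<^sup>+x. g i x \<partial>M))"
proof -
  let ?k = "real (card J)"
  have k: "?k > 0" using J by (simp add: card_gt_0_iff)
  consider i where "i \<in> J" "(\<integral>\<^sup>+x. g i x \<partial>M) = 0"
    | i where "i \<in> J" "(\<integral>\<^sup>+x. g i x \<partial>M) = top" "\<And>i. i \<in> J \<Longrightarrow> (\<integral>\<^sup>+x. g i x \<partial>M) \<noteq> 0"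
    | "\<And>i. i \<in> J \<Longrightarrow> (\<integral>\<^sup>+x. g i x \<partial>M) \<noteq> 0 \<and> (\<integral>\<^sup>+x. g i x \<partial>M) \<noteq> top" by metis
  then show ?thesis
  proof cases
    case 1
    then have "AE x in M. g i x = 0" using g by (simp add: nn_integral_0_iff_AE)
    then have "AE x in M. (\<Prod>i\<in>J. epow ?k (g i x)) = 0"
    proof eventually_elim
      case (elim x)
      then have "epow ?k (g i x) = 0" by (simp add: epow_def)
      then show ?case using J 1 by (intro prod_zero) auto
    qed
    then have "(\<integral>\<^sup>+x. (\<Prod>i\<in>J. epow ?k (g i x)) \<partial>M) = 0"
      by (subst nn_integral_0_iff_AE) measurable
    then show ?thesis by simp
  next
    case 2
    have "(\<Prod>i\<in>J. epow ?k (\<integral>\<^sup>+x. g i x \<partial>M)) = epow ?k (\<integral>\<^sup>+x. g i x \<partial>M) * (\<Prod>i\<in>J - {i}. epow ?k (\<integral>\<^sup>+x. g i x \<partial>M))"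
      using J 2 by (intro prod.remove) auto
    also have "epow ?k (\<integral>\<^sup>+x. g i x \<partial>M) = top" using 2 by (simp add: epow_def)
    \<comment> \<open>In \<open>ennreal\<close> a factor 0 would swallow \<open>top\<close>; this is
      why vanishing integrals were split off before.\<close>
    also have "top * (\<Prod>i\<in>J - {i}. epow ?k (\<integral>\<^sup>+x. g i x \<partial>M)) = top"
    proof -
      have "epow ?k (\<integral>\<^sup>+x. g i x \<partial>M) \<noteq> 0" if "i \<in> J" for i
        using 2(3)[OF that] by (auto simp: epow_def enn2real_eq_0_iff)
      then have "(\<Prod>i\<in>J - {i}. epow ?k (\<integral>\<^sup>+x. g i x \<partial>M)) \<noteq> 0"
        using J by auto
      then show ?thesis by (simp add: ennreal_top_mult)
    qed
    finally show ?thesis by simp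
  next
    case 3
    define a where "a i = enn2real (\<integral>\<^sup>+x. g i x \<partial>M)" for i
    have A: "(\<integral>\<^sup>+x. g i x \<partial>M) = ennreal (a i)" if "i \<in> J" for i
      using 3[OF that] by (simp add: a_def less_top)
    have a: "a i > 0" if "i \<in> J" for i
      using 3[OF that] by (simp add: a_def enn2real_positive_iff less_top zero_less_iff_neq_zero)
    \<comment> \<open>\<open>C\<close> is the right-hand side of the claim. Each normalised function
      has integral 1, and \<open>?k\<close> of them are averaged with the factor
      \<open>C / ?k\<close>.\<close>
    define C where "C = (\<Prod>i\<in>J. a i powr (1 / ?k))"
    have C: "C \<ge> 0" unfolding C_def by (intro prod_nonneg) auto
    have "AE x in M. \<forall>i\<in>J. g i x \<noteq> \<infinity>"
      using 3 g J by (intro AE_finite_allI nn_integral_PInf_AE) auto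
    then have "AE x in M. (\<Prod>i\<in>J. epow ?k (g i x)) \<le> (\<Sum>i\<in>J. ennreal (C / (?k * a i)) * g i x)"
    proof eventually_elim
      case (elim x)
      define c where "c i = enn2real (g i x)" for i
      have gc: "g i x = ennreal (c i)" if "i \<in> J" for i using elim that by (simp add: c_def less_top)
      have c0: "c i \<ge> 0" for i by (simp add: c_def)
      have "(\<Prod>i\<in>J. epow ?k (g i x)) = ennreal (\<Prod>i\<in>J. c i powr (1 / ?k))"
        by (subst prod_ennreal[symmetric]) (auto simp: gc epow_ennreal c0)
      also have "(\<Prod>i\<in>J. c i powr (1 / ?k)) = C * (\<Prod>i\<in>J. (c i / a i) powr (1 / ?k))"
        unfolding C_def prod.distrib[symmetric]
        using c0 by (intro prod.cong) (auto simp: less_imp_le simp flip: powr_mult dest: a)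
      also have "\<dots> \<le> C * ((\<Sum>i\<in>J. c i / a i) / ?k)"
        using a c0 C J by (intro mult_left_mono prod_powr_le_mean) (auto simp: less_imp_le)
      also have "\<dots> = (\<Sum>i\<in>J. C / (?k * a i) * c i)"
        by (simp add: sum_distrib_left sum_divide_distrib mult_ac)
      finally have "(\<Prod>i\<in>J. epow ?k (g i x)) \<le> ennreal (\<Sum>i\<in>J. C / (?k * a i) * c i)"
        by (simp add: ennreal_leI)
      also have "\<dots> = (\<Sum>i\<in>J. ennreal (C / (?k * a i)) * g i x)"
      proof -
        have "ennreal (C / (?k * a i)) * g i x = ennreal (C / (?k * a i) * c i)" if "i \<in> J" for i
          using a[OF that] c0 C k gc[OF that] by (simp add: ennreal_mult[symmetric])
        moreover have "C / (?k * a i) * c i \<ge> 0" if "i \<in> J" for i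
          using a[OF that] c0 C k by simp
        ultimately show ?thesis by (simp add: sum_ennreal)
      qed
      finally show ?case .
    qed
    then have "(\<integral>\<^sup>+x. (\<Prod>i\<in>J. epow ?k (g i x)) \<partial>M) \<le> (\<integral>\<^sup>+x. (\<Sum>i\<in>J. ennreal (C / (?k * a i)) * g i x) \<partial>M)"
      by (rule nn_integral_mono_AE)
    also have "\<dots> = (\<Sum>i\<in>J. ennreal (C / (?k * a i)) * ennreal (a i))"
      by (subst nn_integral_sum) (auto simp: nn_integral_cmult A)
    also have "\<dots> = (\<Sum>i\<in>J. ennreal (C / ?k))"
      using a C k by (intro sum.cong) (auto simp: ennreal_mult[symmetric] less_imp_le, use a in force)
    also have "\<dots> = ennreal (\<Sum>i\<in>J. C / ?k)" using C k by (intro sum_ennreal) auto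
    also have "\<dots> = ennreal C" using k by simp
    also have "\<dots> = (\<Prod>i\<in>J. epow ?k (\<integral>\<^sup>+x. g i x \<partial>M))"
      unfolding C_def by (subst prod_ennreal[symmetric]) (use a in \<open>auto simp: A epow_ennreal less_imp_le intro!: prod.cong\<close>)
    finally show ?thesis .
  qed
qed

section \<open>Partial integrals and Gagliardo's inequality\<close>

definition pt :: "('a::euclidean_space \<Rightarrow> real) \<Rightarrow> 'a" where
  "pt y = (\<Sum>b\<in>Basis. y b *\<^sub>R b)"

text \<open>The coordinates in \<open>S\<close> are integrated out and the others frozen at
  \<open>y\<close>, so the value does not depend on \<open>y\<close> within \<open>S\<close>. Total
  functions \<open>y\<close> keep one type for all \<open>S\<close>.\<close>

definition part_int :: "'a::euclidean_space set \<Rightarrow> ('a \<Rightarrow> ennreal) \<Rightarrow> ('a \<Rightarrow> real) \<Rightarrow> ennreal" where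
  "part_int S G y = (\<integral>\<^sup>+z. G (pt (\<lambda>b. if b \<in> S then z b else y b)) \<partial>PiM S (\<lambda>_. lborel))"

interpretation lborel_prod: product_sigma_finite "\<lambda>_::'a. lborel :: real measure"
  by standard

lemma pt_upd_measurable:
  fixes j :: "'a::euclidean_space"
  shows "(\<lambda>(t, z). pt (\<lambda>b. if b \<in> S then z b else (y(j := t)) b)) \<in> borel_measurable (lborel \<Otimes>\<^sub>M PiM S (\<lambda>_. lborel :: real measure))"
proof -
  have "(\<lambda>p. (if b \<in> S then snd p b else (y(j := fst p)) b) *\<^sub>R b) \<in> borel_measurable (lborel \<Otimes>\<^sub>M PiM S (\<lambda>_. lborel :: real measure))" for b :: 'a
  proof (cases "b \<in> S")
    case True
    then show ?thesis by simp
  qed (cases "b = j"; simp)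
  then show ?thesis unfolding pt_def split_beta by (intro borel_measurable_sum)
qed

lemma part_int_measurable:
  assumes S: "finite S" and G[measurable]: "G \<in> borel_measurable borel"
  shows "(\<lambda>t. part_int S G (y(j := t))) \<in> borel_measurable lborel"
proof -
  interpret S: sigma_finite_measure "PiM S (\<lambda>_. lborel :: real measure)"
    using lborel_prod.sigma_finite[OF S] .
  have "(\<lambda>(t, z). G (pt (\<lambda>b. if b \<in> S then z b else (y(j := t)) b))) \<in> borel_measurable (lborel \<Otimes>\<^sub>M PiM S (\<lambda>_. lborel :: real measure))"
    using measurable_compose[OF pt_upd_measurable G] by (simp add: split_beta)
  then show ?thesis unfolding part_int_def by (rule S.borel_measurable_nn_integral)
qed

lemma part_int_insert:
  assumes S: "finite S" "j \<notin> S" and G[measurable]: "G \<in> borel_measurable borel"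
  shows "part_int (insert j S) G y = (\<integral>\<^sup>+t. part_int S G (y(j := t)) \<partial>lborel)"
proof -
  have [measurable]: "(\<lambda>z. pt (\<lambda>b. if b \<in> insert j S then z b else y b)) \<in> borel_measurable (PiM (insert j S) (\<lambda>_. lborel :: real measure))"
  proof -
    have "(\<lambda>z. (if b \<in> insert j S then z b else y b) *\<^sub>R b) \<in> borel_measurable (PiM (insert j S) (\<lambda>_. lborel :: real measure))" for b
      by (cases "b \<in> insert j S") auto
    then show ?thesis unfolding pt_def by (intro borel_measurable_sum)
  qed
  have eq: "(\<lambda>b. if b \<in> insert j S then (z(j := t)) b else y b) = (\<lambda>b. if b \<in> S then z b else (y(j := t)) b)" for z t
    using S(2) by auto
  have "part_int (insert j S) G y = (\<integral>\<^sup>+t. \<integral>\<^sup>+z. G (pt (\<lambda>b. if b \<in> insert j S then (z(j := t)) b else y b)) \<partial>PiM S (\<lambda>_. lborel) \<partial>lborel)"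
    unfolding part_int_def by (rule lborel_prod.product_nn_integral_insert_rev[OF S]) measurable
  then show ?thesis unfolding part_int_def eq .
qed

lemma part_int_absorb: "j \<in> S \<Longrightarrow> part_int S G (y(j := t)) = part_int S G y"
proof -
  assume j: "j \<in> S"
  have "(\<lambda>b. if b \<in> S then z b else (y(j := t)) b) = (\<lambda>b. if b \<in> S then z b else y b)" for z
    using j by auto
  then show ?thesis unfolding part_int_def by simp
qed

lemma part_int_empty: "part_int {} G y = G (pt y)"
  unfolding part_int_def by (simp add: PiM_empty nn_integral_count_space_finite)

lemma part_int_Basis:
  assumes [measurable]: "G \<in> borel_measurable borel"
  shows "part_int Basis G y = (\<integral>\<^sup>+x. G x \<partial>lborel)"
proof -
  have "pt (\<lambda>b. if b \<in> Basis then z b else y b) = (\<Sum>b\<in>Basis. z b *\<^sub>R b)" for z :: "'a \<Rightarrow> real"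
    unfolding pt_def by (intro sum.cong) auto
  moreover have "(\<integral>\<^sup>+x. G x \<partial>lborel) = (\<integral>\<^sup>+x. G x \<partial>distr (\<Pi>\<^sub>M b\<in>Basis. lborel) borel (\<lambda>f. \<Sum>b\<in>Basis. f b *\<^sub>R b))"
    by (simp only: lborel_eq[where 'a='a, symmetric])
  ultimately show ?thesis unfolding part_int_def by (simp add: nn_integral_distr)
qed

lemma prod_mono_ennreal:
  fixes f g :: "'i \<Rightarrow> ennreal"
  shows "(\<And>i. i \<in> A \<Longrightarrow> f i \<le> g i) \<Longrightarrow> prod f A \<le> prod g A"
  by (induction A rule: infinite_finite_induct) (auto intro: mult_mono)

text \<open>Integrating out one more coordinate \<open>j\<close>, the factor with index
  \<open>j\<close> no longer depends on it and comes out of the integral. The remaining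
  \<open>DIM('a) - 1\<close> factors carry the exponent \<open>1 / k\<close> with \<open>k\<close>
  equal to their number, which is exactly Hoelder's inequality.\<close>

lemma Gagliardo_induct:
  fixes u :: "'a::euclidean_space \<Rightarrow> ennreal"
  assumes dim: "DIM('a) \<ge> 2" and [measurable]: "u \<in> borel_measurable borel" "\<And>i. F i \<in> borel_measurable borel"
    and u: "\<And>i y. i \<in> Basis \<Longrightarrow> u (pt y) \<le> part_int {i} (F i) y"
    and S: "finite S" "S \<subseteq> Basis"
  defines "k \<equiv> real (DIM('a) - 1)"
  shows "part_int S (\<lambda>x. epow k (u x) ^ DIM('a)) y \<le> (\<Prod>i\<in>Basis. epow k (part_int (insert i S) (F i) y))"
  using S
proof (induction S arbitrary: y rule: finite_induct)
  case empty
  \<comment> \<open>One copy of the pointwise bound for each of the \<open>DIM('a)\<close>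
    directions.\<close>
  have "epow k (u (pt y)) ^ DIM('a) = (\<Prod>i\<in>(Basis::'a set). epow k (u (pt y)))" by simp
  also have "\<dots> \<le> (\<Prod>i\<in>Basis. epow k (part_int {i} (F i) y))"
    using dim u by (intro prod_mono_ennreal epow_mono) (auto simp: k_def)
  finally show ?case by (simp add: part_int_empty)
next
  case (insert j S)
  have j: "j \<in> Basis" and SB: "S \<subseteq> Basis" using insert.prems by auto
  have card: "k = real (card (Basis - {j} :: 'a set))" using j by (simp add: k_def)
  have ne: "Basis - {j} \<noteq> ({} :: 'a set)"
  proof
    assume "Basis - {j} = ({} :: 'a set)"
    then have "card (Basis - {j} :: 'a set) = 0" by simp
    then show False using j dim by simp
  qed
  let ?P = "\<lambda>i. part_int (insert i S) (F i)"
  have eG: "(\<lambda>x. epow k (u x) ^ DIM('a)) \<in> borel_measurable borel" by measurable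
  have meas: "(\<lambda>t. ?P i (y(j := t))) \<in> borel_measurable lborel" for i
    using insert.hyps by (intro part_int_measurable) auto
  have "part_int (insert j S) (\<lambda>x. epow k (u x) ^ DIM('a)) y
      = (\<integral>\<^sup>+t. part_int S (\<lambda>x. epow k (u x) ^ DIM('a)) (y(j := t)) \<partial>lborel)"
    by (rule part_int_insert[OF insert.hyps eG])
  also have "\<dots> \<le> (\<integral>\<^sup>+t. (\<Prod>i\<in>Basis. epow k (?P i (y(j := t)))) \<partial>lborel)"
    by (intro nn_integral_mono insert.IH SB)
  also have "\<dots> = (\<integral>\<^sup>+t. epow k (?P j y) * (\<Prod>i\<in>Basis - {j}. epow k (?P i (y(j := t)))) \<partial>lborel)"
    using j by (intro nn_integral_cong) (simp add: prod.remove[of Basis j] part_int_absorb)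
  also have "\<dots> = epow k (?P j y) * (\<integral>\<^sup>+t. (\<Prod>i\<in>Basis - {j}. epow k (?P i (y(j := t)))) \<partial>lborel)"
    using meas by (intro nn_integral_cmult borel_measurable_prod measurable_compose[OF _ epow_measurable]) auto
  also have "\<dots> \<le> epow k (?P j y) * (\<Prod>i\<in>Basis - {j}. epow k (\<integral>\<^sup>+t. ?P i (y(j := t)) \<partial>lborel))"
    unfolding card using meas ne by (intro mult_left_mono Holder_epow) auto
  also have "\<dots> = epow k (?P j y) * (\<Prod>i\<in>Basis - {j}. epow k (part_int (insert i (insert j S)) (F i) y))"
  proof -
    have "(\<integral>\<^sup>+t. ?P i (y(j := t)) \<partial>lborel) = part_int (insert i (insert j S)) (F i) y" if "i \<in> Basis - {j}" for i
      using part_int_insert[of "insert i S" j "F i" y] that insert.hyps by (auto simp: insert_commute)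
    then show ?thesis by simp
  qed
  also have "\<dots> = (\<Prod>i\<in>Basis. epow k (part_int (insert i (insert j S)) (F i) y))"
    using j by (simp add: prod.remove[of Basis j])
  finally show ?case .
qed

text \<open>\<open>x + (t - x \<bullet> i) *\<^sub>R i\<close> is \<open>x\<close> with its
  \<open>i\<close>-th coordinate replaced by \<open>t\<close>, so \<open>le\<close> bounds
  \<open>u\<close> by an integral along each coordinate line. The conclusion is the induction with
  all coordinates integrated out.\<close>

lemma Gagliardo:
  fixes u :: "'a::euclidean_space \<Rightarrow> ennreal"
  assumes dim: "DIM('a) \<ge> 2" and u[measurable]: "u \<in> borel_measurable borel" "\<And>i. F i \<in> borel_measurable borel"
    and le: "\<And>i x. i \<in> Basis \<Longrightarrow> u x \<le> (\<integral>\<^sup>+t. F i (x + (t - x \<bullet> i) *\<^sub>R i) \<partial>lborel)"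
  shows "(\<integral>\<^sup>+x. epow (real (DIM('a) - 1)) (u x) ^ DIM('a) \<partial>lborel)
     \<le> (\<Prod>i\<in>Basis. epow (real (DIM('a) - 1)) (\<integral>\<^sup>+x. F i x \<partial>lborel))"
proof -
  have line: "u (pt y) \<le> part_int {i} (F i) y" if i: "i \<in> Basis" for i y
  proof -
    have "pt y + (t - pt y \<bullet> i) *\<^sub>R i = pt (y(i := t))" for t
    proof (rule euclidean_eqI)
      fix b :: 'a assume b: "b \<in> Basis"
      have pti: "pt z \<bullet> c = z c" if "c \<in> Basis" for z c using that by (simp add: pt_def)
      show "(pt y + (t - pt y \<bullet> i) *\<^sub>R i) \<bullet> b = pt (y(i := t)) \<bullet> b"
        using i b by (simp add: inner_add_left pti inner_Basis)
    qed
    then have "u (pt y) \<le> (\<integral>\<^sup>+t. F i (pt (y(i := t))) \<partial>lborel)" using le[OF i, of "pt y"] by simp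
    also have "\<dots> = part_int {i} (F i) y"
      using part_int_insert[of "{}" i "F i" y] by (simp add: part_int_empty)
    finally show ?thesis .
  qed
  have eG: "(\<lambda>x. epow (real (DIM('a) - 1)) (u x) ^ DIM('a)) \<in> borel_measurable borel" by measurable
  have "part_int Basis (\<lambda>x. epow (real (DIM('a) - 1)) (u x) ^ DIM('a)) (\<lambda>_. 0)
    \<le> (\<Prod>i\<in>Basis. epow (real (DIM('a) - 1)) (part_int (insert i Basis) (F i) (\<lambda>_. 0)))"
    by (rule Gagliardo_induct[OF dim u line]) auto
  then show ?thesis unfolding part_int_Basis[OF eG]
    by (simp add: part_int_Basis[OF u(2)] insert_absorb del: of_nat_diff cong: prod.cong)
qed

section \<open>Integration by parts and regularisation of functions of bounded variation\<close>

lemma borel_lborel_lebesgue: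
  fixes f :: "'a::euclidean_space \<Rightarrow> 'b::{banach, second_countable_topology}"
  assumes "f \<in> borel_measurable borel"
  shows "(LINT x|lebesgue. f x) = (LINT x|lborel. f x)" "integrable lebesgue f \<longleftrightarrow> integrable lborel f"
  using assms by (simp_all add: integral_completion integrable_completion)

text \<open>The translation is moved from \<open>U\<close> to the test function, whose expansion is
  uniform. Constant \<open>U\<close> then shows that derivatives of tests have integral 0, and
  Lipschitz \<open>U\<close> gives the weak derivative.\<close>

lemma difference_quotient_tendsto:
  fixes U :: "real^'n \<Rightarrow> real" and e :: "real^'n"
  assumes U: "loc_int U" and \<phi>: "test_fun \<phi>"
  shows "(\<lambda>n. LINT x|lborel. (U (x + (1 / real (Suc n)) *\<^sub>R e) - U x) * real (Suc n) * \<phi> x)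
    \<longlonglongrightarrow> - (LINT x|lborel. U x * (\<Sum>i\<in>UNIV. e $ i * partial_deriv i \<phi> x))"
proof (rule LIMSEQ_I)
  fix \<epsilon> :: real assume \<epsilon>: "\<epsilon> > 0"
  note [measurable] = loc_int_borel[OF U] test_fun_borel[OF \<phi>] test_fun_borel[OF test_fun_partial[OF \<phi>]]
  obtain R B where R: "R > 0" "B > 0" "\<And>x. norm x \<ge> R \<Longrightarrow> \<phi> x = 0" "\<And>x. \<bar>\<phi> x\<bar> \<le> B"
    using Cc_obtain[OF test_fun_Cc[OF \<phi>]] by metis
  have R': "partial_deriv i \<phi> z = 0" if "norm z \<ge> R + 1" for i z
  proof -
    have "(\<phi> has_derivative (\<lambda>_. 0)) (at z)"
      by (rule has_derivative_transform_within_open[OF has_derivative_const[of 0], where s="- cball 0 R"])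
         (use that R in auto)
    then show ?thesis by (simp add: partial_deriv_eq)
  qed
  \<comment> \<open>The steps \<open>1 / real (Suc n)\<close> are at most 1, so the support of
    \<open>\<phi>\<close> is moved by at most \<open>norm e\<close>.\<close>
  let ?S = "R + 1 + norm e"
  define C where "C = (LINT y|lborel. \<bar>indicator (cball 0 ?S) y * U y\<bar>)"
  have Ci: "integrable lborel (\<lambda>y. \<bar>indicator (cball 0 ?S) y * U y\<bar>)"
    using loc_int_cball[OF U] by simp
  have C: "C \<ge> 0" by (simp add: C_def)
  define P where "P = (norm e + 1) * (C + 1)"
  have P: "P > 0" unfolding P_def using C norm_ge_zero[of e] by (intro mult_pos_pos) linarith+
  define \<eta> where "\<eta> = \<epsilon> / 2 / P"
  have \<eta>: "\<eta> > 0" unfolding \<eta>_def using \<epsilon> P by simp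
  obtain d where d: "d > 0"
    "\<And>z h. norm h < d \<Longrightarrow> \<bar>\<phi> (z + h) - \<phi> z - (\<Sum>i\<in>UNIV. h $ i * partial_deriv i \<phi> z)\<bar> \<le> \<eta> * norm h"
    using gradient_bound_linearization[OF \<phi> \<eta>] by metis
  obtain N :: nat where N: "real N > norm e / d" using reals_Archimedean2 by blast
  let ?D = "\<lambda>x. \<Sum>i\<in>UNIV. e $ i * partial_deriv i \<phi> x"
  have "\<bar>(LINT x|lborel. (U (x + (1 / real (Suc n)) *\<^sub>R e) - U x) * real (Suc n) * \<phi> x) + (LINT x|lborel. U x * ?D x)\<bar> < \<epsilon>"
    if n: "n \<ge> N" for n
  proof -
    define t where "t = 1 / real (Suc n)"
    have t: "t > 0" "t \<le> 1" "real (Suc n) = 1 / t" by (auto simp: t_def)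
    have te: "norm (t *\<^sub>R e) < d"
    proof -
      have "norm e / d < real (Suc n)" using N n by linarith
      then show ?thesis using d t by (simp add: t_def field_simps)
    qed
    have tle: "norm (t *\<^sub>R e) \<le> norm e" using t by (simp add: mult_left_le_one_le)
    have i1: "integrable lborel (\<lambda>x. U (x + t *\<^sub>R e) * \<phi> x)"
    proof -
      have "integrable lborel (\<lambda>x. (\<lambda>y. U y * \<phi> (y - t *\<^sub>R e)) (x + t *\<^sub>R e))"
        using loc_int_mult[OF U Cc_shift[OF test_fun_Cc[OF \<phi>], of "- t *\<^sub>R e"]]
        by (subst integrable_lborel_shift) auto
      then show ?thesis by simp
    qed
    have i2: "integrable lborel (\<lambda>x. U x * \<phi> x)" by (rule loc_int_mult[OF U test_fun_Cc[OF \<phi>]])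
    have i3: "integrable lborel (\<lambda>x. U x * \<phi> (x + - t *\<^sub>R e))" by (rule loc_int_mult[OF U Cc_shift[OF test_fun_Cc[OF \<phi>]]])
    have i4: "integrable lborel (\<lambda>x. U x * ?D x)"
    proof -
      have "integrable lborel (\<lambda>x. \<Sum>i\<in>UNIV. e $ i * (U x * partial_deriv i \<phi> x))"
        by (intro Bochner_Integration.integrable_sum integrable_mult_right loc_int_mult[OF U] test_fun_Cc test_fun_partial \<phi>)
      then show ?thesis by (simp add: sum_distrib_left mult_ac)
    qed
    have "(LINT x|lborel. (U (x + t *\<^sub>R e) - U x) * (1 / t) * \<phi> x)
      = (1 / t) * ((LINT x|lborel. U (x + t *\<^sub>R e) * \<phi> x) - (LINT x|lborel. U x * \<phi> x))"
      using i1 i2 by (simp add: algebra_simps diff_divide_distrib)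
    also have "(LINT x|lborel. U (x + t *\<^sub>R e) * \<phi> x) = (LINT x|lborel. U x * \<phi> (x + - t *\<^sub>R e))"
      using integral_lborel_shift[of "\<lambda>x. U x * \<phi> (x + - t *\<^sub>R e)" "t *\<^sub>R e"] by simp
    finally have "(LINT x|lborel. (U (x + t *\<^sub>R e) - U x) * (1 / t) * \<phi> x) + (LINT x|lborel. U x * ?D x)
      = (LINT x|lborel. (1 / t) * (U x * (\<phi> (x + - t *\<^sub>R e) - \<phi> x + t * ?D x)))"
      using i2 i3 i4 t by (simp add: algebra_simps diff_divide_distrib add_divide_distrib)
    also have "\<bar>\<dots>\<bar> \<le> (LINT x|lborel. \<eta> * norm e * \<bar>indicator (cball 0 ?S) x * U x\<bar>)"
    proof (rule order_trans[OF integral_abs_bound integral_mono'])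
      show "integrable lborel (\<lambda>x. \<eta> * norm e * \<bar>indicator (cball 0 ?S) x * U x\<bar>)" using Ci by simp
      fix x
      show "\<bar>(1 / t) * (U x * (\<phi> (x + - t *\<^sub>R e) - \<phi> x + t * ?D x))\<bar> \<le> \<eta> * norm e * \<bar>indicator (cball 0 ?S) x * U x\<bar>"
      proof (cases "norm x \<le> ?S")
        case True
        have "(\<Sum>i\<in>UNIV. (- t *\<^sub>R e) $ i * partial_deriv i \<phi> x) = - (t * ?D x)"
          by (simp add: sum_distrib_left sum_negf mult.assoc)
        then have "\<bar>\<phi> (x + - t *\<^sub>R e) - \<phi> x + t * ?D x\<bar> \<le> \<eta> * (t * norm e)"
          using d(2)[of "- t *\<^sub>R e" x] te t by simp
        then have "(1 / t) * (\<bar>U x\<bar> * \<bar>\<phi> (x + - t *\<^sub>R e) - \<phi> x + t * ?D x\<bar>) \<le> (1 / t) * (\<bar>U x\<bar> * (\<eta> * (t * norm e)))"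
          using t by (intro mult_left_mono) auto
        also have "\<dots> = \<eta> * norm e * \<bar>U x\<bar>" using t by simp
        finally show ?thesis using True t by (simp add: abs_mult)
      next
        case False
        have "norm (x + - t *\<^sub>R e) \<ge> norm x - norm (t *\<^sub>R e)"
          using norm_triangle_ineq2[of x "t *\<^sub>R e"] by simp
        then have "norm (x + - t *\<^sub>R e) \<ge> R" using False tle by linarith
        moreover have "norm x \<ge> R + 1" using False norm_ge_zero[of e] by linarith
        ultimately show ?thesis using R(3)[of "x + - t *\<^sub>R e"] R(3)[of x] R'[of x] \<eta> by simp
      qed
    qed (use \<eta> in auto)
    also have "\<dots> = \<eta> * norm e * C" by (simp add: C_def)
    also have "\<dots> \<le> \<eta> * ((norm e + 1) * (C + 1))" using \<eta> C by (simp only: mult.assoc) (intro mult_left_mono mult_mono, auto)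
    also have "\<dots> = \<epsilon> / 2"
      unfolding P_def[symmetric] using P by (simp add: \<eta>_def)
    finally show ?thesis using \<epsilon> t(3) unfolding t_def by simp
  qed
  then show "\<exists>no. \<forall>n\<ge>no. norm ((LINT x|lborel. (U (x + (1 / real (Suc n)) *\<^sub>R e) - U x) * real (Suc n) * \<phi> x)
      - - (LINT x|lborel. U x * ?D x)) < \<epsilon>" by auto
qed

lemma sum_axis: "(\<Sum>j\<in>UNIV. axis i (1::real) $ j * f j) = f i"
proof -
  have "(\<Sum>j\<in>UNIV. axis i (1::real) $ j * f j) = (\<Sum>j\<in>UNIV. if j = i then f i else 0)"
    by (intro sum.cong) (auto simp: axis_def)
  then show ?thesis by simp
qed

lemma integral_partial_test:
  fixes \<phi> :: "real^'n \<Rightarrow> real"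
  assumes "test_fun \<phi>"
  shows "(LINT x|lborel. partial_deriv i \<phi> x) = 0"
  using difference_quotient_tendsto[OF loc_int_const[of 1] assms, of "axis i 1"]
  by (simp add: sum_axis LIMSEQ_const_iff)

lemma test_fun_smooth_mult: "test_fun \<phi> \<Longrightarrow> smooth w \<Longrightarrow> test_fun (\<lambda>x. w x * \<phi> x)"
  unfolding test_fun_def by (auto intro!: smooth_mult)

lemma smooth_ibp:
  fixes w \<phi> :: "real^'n \<Rightarrow> real"
  assumes w: "smooth w" and \<phi>: "test_fun \<phi>"
  shows "(LINT x|lborel. w x * partial_deriv i \<phi> x) = - (LINT x|lborel. partial_deriv i w x * \<phi> x)"
proof -
  have "(LINT x|lborel. partial_deriv i (\<lambda>x. w x * \<phi> x) x) = 0"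
    by (rule integral_partial_test[OF test_fun_smooth_mult[OF \<phi> w]])
  moreover have "partial_deriv i (\<lambda>x. w x * \<phi> x) x = w x * partial_deriv i \<phi> x + partial_deriv i w x * \<phi> x" for x
    using w \<phi> by (intro partial_deriv_mult) (auto simp: test_fun_def smooth_differentiable)
  moreover have "integrable lborel (\<lambda>x. w x * partial_deriv i \<phi> x)" "integrable lborel (\<lambda>x. partial_deriv i w x * \<phi> x)"
    using w \<phi> by (auto intro!: loc_int_mult continuous_loc_int smooth_continuous test_fun_Cc test_fun_partial smooth_partial)
  ultimately show ?thesis by simp
qed

lemma abs_powr_nat: "n > 0 \<Longrightarrow> \<bar>x::real\<bar> powr real n = \<bar>x\<bar> ^ n"
  by (cases "x = 0") (auto simp: powr_realpow)

section \<open>The Sobolev inequality for smooth functions\<close>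

text \<open>The fundamental theorem of calculus along the line in direction \<open>i\<close>,
  starting so far out that \<open>w\<close> is below \<open>e\<close> there. Decay at infinity
  stands in for compact support, which a mollified function may lack.\<close>

lemma line_bound_vanishing:
  fixes w :: "real^'n \<Rightarrow> real"
  assumes w: "smooth w" and lim: "(w \<longlongrightarrow> 0) at_infinity"
  shows "ennreal \<bar>w x\<bar> \<le> (\<integral>\<^sup>+t. ennreal \<bar>partial_deriv i w (x + (t - x $ i) *\<^sub>R axis i 1)\<bar> \<partial>lborel)"
proof (rule ennreal_le_epsilon)
  fix e :: real assume e: "e > 0"
  let ?p = "\<lambda>t. x + (t - x $ i) *\<^sub>R axis i 1"
  obtain b where b: "\<And>y. norm y \<ge> b \<Longrightarrow> \<bar>w y\<bar> < e"
    using lim e unfolding Lim_at_infinity by (auto simp: dist_real_def)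
  \<comment> \<open>Far enough for the starting point to have norm at least
    \<open>\<bar>b\<bar>\<close>, whatever the other coordinates of \<open>x\<close> are.\<close>
  define a where "a = x $ i - (\<bar>b\<bar> + norm x)"
  have ab: "a \<le> x $ i" unfolding a_def using norm_ge_zero[of x] by linarith
  have na: "\<bar>w (?p a)\<bar> < e"
  proof (rule b)
    have "norm ((a - x $ i) *\<^sub>R axis i (1::real)) = \<bar>a - x $ i\<bar>" by simp
    also have "\<dots> = \<bar>b\<bar> + norm x" unfolding a_def using norm_ge_zero[of x] by linarith
    finally have "norm ((a - x $ i) *\<^sub>R axis i (1::real)) = \<bar>b\<bar> + norm x" .
    then show "b \<le> norm (?p a)" using norm_diff_ineq[of "(a - x $ i) *\<^sub>R axis i 1" x]
      by (simp add: add.commute)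
  qed
  have der: "((\<lambda>t. w (?p t)) has_real_derivative partial_deriv i w (?p t)) (at t)" for t
  proof -
    have D: "(w has_derivative frechet_derivative w (at (?p t))) (at (?p t))"
      using w by (intro has_derivative_frechet smooth_differentiable)
    have "((\<lambda>t. ?p t) has_derivative (\<lambda>h. h *\<^sub>R axis i 1)) (at t)"
      by (auto intro!: derivative_eq_intros)
    from has_derivative_compose[OF this D]
    have "((\<lambda>t. w (?p t)) has_derivative (\<lambda>h. frechet_derivative w (at (?p t)) (h *\<^sub>R axis i 1))) (at t)" .
    moreover have "frechet_derivative w (at (?p t)) (h *\<^sub>R axis i 1) = partial_deriv i w (?p t) * h" for h
      using has_derivative_linear[OF D] by (simp add: linear_cmul partial_deriv_def mult.commute)
    ultimately show ?thesis by (simp add: has_field_derivative_def)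
  qed
  have cont: "isCont (\<lambda>t. partial_deriv i w (?p t)) t" for t
  proof -
    have "continuous_on UNIV (\<lambda>t. partial_deriv i w (?p t))"
      by (rule continuous_on_compose2[OF smooth_continuous[OF smooth_partial[OF w]]]) (auto intro!: continuous_intros)
    then show ?thesis by (simp add: continuous_on_eq_continuous_at)
  qed
  then have [measurable]: "(\<lambda>t. partial_deriv i w (?p t)) \<in> borel_measurable borel"
    by (intro borel_measurable_continuous_onI) (simp add: continuous_at_imp_continuous_on)
  have hb: "has_bochner_integral lborel (\<lambda>t. partial_deriv i w (?p t) * indicator {a..x $ i} t) (w (?p (x $ i)) - w (?p a))"
    by (rule has_bochner_integral_FTC_Icc_real[OF ab der]) (use cont in auto)
  have "\<bar>w x - w (?p a)\<bar> = \<bar>LINT t|lborel. partial_deriv i w (?p t) * indicator {a..x $ i} t\<bar>"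
    using has_bochner_integral_integral_eq[OF hb] by simp
  also have "\<dots> \<le> (LINT t|lborel. \<bar>partial_deriv i w (?p t) * indicator {a..x $ i} t\<bar>)"
    by (rule integral_abs_bound)
  finally have "ennreal \<bar>w x - w (?p a)\<bar> \<le> ennreal (LINT t|lborel. \<bar>partial_deriv i w (?p t) * indicator {a..x $ i} t\<bar>)"
    by (rule ennreal_leI)
  also have "\<dots> = (\<integral>\<^sup>+t. ennreal \<bar>partial_deriv i w (?p t) * indicator {a..x $ i} t\<bar> \<partial>lborel)"
    using has_bochner_integral_iff[THEN iffD1, OF hb] by (intro nn_integral_eq_integral[symmetric]) auto
  also have "\<dots> \<le> (\<integral>\<^sup>+t. ennreal \<bar>partial_deriv i w (?p t)\<bar> \<partial>lborel)"
    by (intro nn_integral_mono ennreal_leI) (auto simp: indicator_def)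
  finally have 1: "ennreal \<bar>w x - w (?p a)\<bar> \<le> (\<integral>\<^sup>+t. ennreal \<bar>partial_deriv i w (?p t)\<bar> \<partial>lborel)" .
  have "ennreal \<bar>w x\<bar> \<le> ennreal (\<bar>w x - w (?p a)\<bar> + e)" using na by (intro ennreal_leI) linarith
  also have "\<dots> = ennreal \<bar>w x - w (?p a)\<bar> + ennreal e" using e by (simp add: ennreal_plus)
  also have "\<dots> \<le> (\<integral>\<^sup>+t. ennreal \<bar>partial_deriv i w (?p t)\<bar> \<partial>lborel) + ennreal e" using 1 by (intro add_mono) auto
  finally show "ennreal \<bar>w x\<bar> \<le> (\<integral>\<^sup>+t. ennreal \<bar>partial_deriv i w (?p t)\<bar> \<partial>lborel) + ennreal e" .
qed

text \<open>In \<open>Gagliardo\<close> each of the \<open>?m\<close> factors is at most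
  \<open>c powr (1 / (m - 1))\<close>; their product has the exponent \<open>m / (m - 1)\<close>,
  which is \<open>conj_exp\<close>.\<close>

lemma GNS_smooth:
  fixes w :: "(real, 'n::card2) vec \<Rightarrow> real"
  assumes w: "smooth w" and lim: "(w \<longlongrightarrow> 0) at_infinity" and c: "c \<ge> 0"
    and i: "\<And>i. integrable lborel (partial_deriv i w)" and le: "\<And>i. (LINT x|lborel. \<bar>partial_deriv i w x\<bar>) \<le> c"
  shows "integrable lborel (\<lambda>x. \<bar>w x\<bar> powr conj_exp TYPE('n))"
    "(LINT x|lborel. \<bar>w x\<bar> powr conj_exp TYPE('n)) \<le> c powr conj_exp TYPE('n)"
proof -
  let ?m = "CARD('n)" and ?q = "conj_exp TYPE('n)"
  have m: "?m \<ge> 2" by (rule two_le_card)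
  define F where "F b x = ennreal \<bar>\<Sum>k\<in>UNIV. b $ k * partial_deriv k w x\<bar>" for b x :: "(real, 'n) vec"
  have [measurable]: "w \<in> borel_measurable borel" "partial_deriv k w \<in> borel_measurable borel" for k
    using w by (auto intro!: borel_measurable_continuous_onI smooth_continuous smooth_partial)
  have Fax: "F (axis k 1) x = ennreal \<bar>partial_deriv k w x\<bar>" for k x by (simp add: F_def sum_axis)
  have ep: "epow (real (?m - 1)) (ennreal s) ^ ?m = ennreal (s powr ?q)" if "s \<ge> 0" for s
  proof -
    have "epow (real (?m - 1)) (ennreal s) ^ ?m = ennreal ((s powr (1 / real (?m - 1))) ^ ?m)"
      using that by (simp add: epow_ennreal ennreal_power)
    also have "(s powr (1 / real (?m - 1))) ^ ?m = (s powr (1 / real (?m - 1))) powr real ?m"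
      using abs_powr_nat[of ?m "s powr (1 / real (?m - 1))"] by simp
    also have "\<dots> = s powr ?q" using m by (simp add: powr_powr conj_exp_def of_nat_diff)
    finally show ?thesis .
  qed
  have "(\<integral>\<^sup>+x. epow (real (DIM((real, 'n) vec) - 1)) (ennreal \<bar>w x\<bar>) ^ DIM((real, 'n) vec) \<partial>lborel)
     \<le> (\<Prod>b\<in>Basis. epow (real (DIM((real, 'n) vec) - 1)) (\<integral>\<^sup>+x. F b x \<partial>lborel))"
  proof (rule Gagliardo)
    show "F b \<in> borel_measurable borel" for b unfolding F_def[abs_def] by measurable
    fix b x :: "(real, 'n) vec" assume "b \<in> Basis"
    then obtain k where k: "b = axis k 1" by (auto simp: Basis_vec_def)
    show "ennreal \<bar>w x\<bar> \<le> (\<integral>\<^sup>+t. F b (x + (t - x \<bullet> b) *\<^sub>R b) \<partial>lborel)"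
      using line_bound_vanishing[OF w lim, of x k] unfolding k Fax by (simp add: inner_axis)
  qed (use m in auto)
  also have "\<dots> \<le> (\<Prod>b\<in>(Basis :: (real, 'n) vec set). epow (real (?m - 1)) (ennreal c))"
  proof (rule prod_mono_ennreal)
    fix b :: "(real, 'n) vec" assume "b \<in> Basis"
    then obtain k where k: "b = axis k 1" by (auto simp: Basis_vec_def)
    have "(\<integral>\<^sup>+x. F b x \<partial>lborel) = ennreal (LINT x|lborel. \<bar>partial_deriv k w x\<bar>)"
      unfolding k Fax using i by (intro nn_integral_eq_integral) auto
    also have "\<dots> \<le> ennreal c" by (rule ennreal_leI[OF le])
    finally show "epow (real (DIM((real, 'n) vec) - 1)) (\<integral>\<^sup>+x. F b x \<partial>lborel) \<le> epow (real (?m - 1)) (ennreal c)"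
      using m by (auto intro!: epow_mono)
  qed
  also have "\<dots> = ennreal (c powr ?q)" using ep[OF c] by simp
  finally have nn: "(\<integral>\<^sup>+x. ennreal (\<bar>w x\<bar> powr ?q) \<partial>lborel) \<le> ennreal (c powr ?q)"
    using ep by simp
  show int: "integrable lborel (\<lambda>x. \<bar>w x\<bar> powr ?q)"
    by (rule integrableI_nonneg) (use le_less_trans[OF nn ennreal_less_top] in auto)
  show "(LINT x|lborel. \<bar>w x\<bar> powr ?q) \<le> c powr ?q"
    using nn nn_integral_eq_integral[OF int] by simp
qed

lemma Lp_loc_int:
  fixes u :: "real^'n \<Rightarrow> real"
  assumes [measurable]: "u \<in> borel_measurable borel" and q: "q > 1" and u: "integrable lborel (\<lambda>x. \<bar>u x\<bar> powr q)"
  shows "loc_int u"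
  unfolding loc_int_def
proof (intro conjI allI impI)
  fix K :: "(real^'n) set" assume K: "compact K"
  have [measurable]: "K \<in> sets borel" using K by (simp add: compact_imp_closed borel_closed)
  have "integrable lborel (\<lambda>x. indicator K x * 1 :: real)" using loc_int_const[of 1] K unfolding loc_int_def by blast
  then have i: "integrable lborel (\<lambda>x. indicator K x + \<bar>u x\<bar> powr q)" using u by simp
  have "\<bar>t\<bar> \<le> 1 + \<bar>t\<bar> powr q" for t :: real using Lp_local_le[OF q, of 1 t] by simp
  then show "integrable lborel (\<lambda>x. indicator K x * u x)"
    by (intro Bochner_Integration.integrable_bound[OF i]) (auto intro!: AE_I2 simp: indicator_def)
qed simp

text \<open>By \<open>Lp_local_le\<close>, \<open>\<bar>u\<bar> \<le> \<eta> + \<eta> powr (1 - q) *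
  \<bar>u\<bar> powr q\<close>. Over the ball of radius \<open>R\<close> about \<open>x\<close> the
  first summand contributes a multiple of \<open>\<eta>\<close> uniformly in \<open>x\<close>, the
  second a tail of a convergent integral.\<close>

lemma conv_vanishes:
  fixes u \<rho> :: "real^'n \<Rightarrow> real"
  assumes [measurable]: "u \<in> borel_measurable borel" and q: "q > 1" and u: "integrable lborel (\<lambda>x. \<bar>u x\<bar> powr q)"
    and \<rho>: "Cc \<rho>"
  shows "(conv u \<rho> \<longlongrightarrow> 0) at_infinity"
  unfolding Lim_at_infinity
proof (intro allI impI)
  fix e :: real assume e: "e > 0"
  note [measurable] = Cc_borel[OF \<rho>]
  obtain R B where R: "R > 0" "B > 0" "\<And>x. norm x \<ge> R \<Longrightarrow> \<rho> x = 0" "\<And>x. \<bar>\<rho> x\<bar> \<le> B" using Cc_obtain[OF \<rho>] by metis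
  define V where "V = measure lborel (cball (0::real^'n) R)"
  have Vx: "(LINT y|lborel. indicator (cball x R) y) = V" for x :: "real^'n"
  proof -
    have [measurable]: "cball x R \<in> sets borel" by simp
    have "(LINT y|lborel. indicator (cball x R) y :: real) = (LINT y|lborel. indicator (cball x R) (y + x))"
      by (rule integral_lborel_shift[symmetric]) measurable
    also have "(\<lambda>y. indicator (cball x R) (y + x) :: real) = indicator (cball 0 R)"
      by (auto simp: indicator_def dist_norm fun_eq_iff)
    finally show ?thesis by (simp add: V_def)
  qed
  have Vi: "integrable lborel (indicator (cball x R) :: real^'n \<Rightarrow> real)" for x
    using integrable_cball[of x R] by (subst borel_lborel_lebesgue(2)[symmetric]) (intro borel_measurable_indicator, simp)
  define \<eta> where "\<eta> = e / (4 * B * (V + 1))"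
  have V0: "V \<ge> 0" by (simp add: V_def)
  have \<eta>: "\<eta> > 0" "B * (\<eta> * V) < e / 2"
  proof -
    show "\<eta> > 0" using e R V0 by (simp add: \<eta>_def)
    have "B * (\<eta> * V) = (e / 4) * (V / (V + 1))" using R V0 by (simp add: \<eta>_def)
    also have "\<dots> \<le> e / 4 * 1" using e V0 by (intro mult_left_mono) auto
    finally show "B * (\<eta> * V) < e / 2" using e by simp
  qed
  have "(\<lambda>n. LINT y|lborel. indicator {y. norm y \<ge> real n} y * \<bar>u y\<bar> powr q) \<longlonglongrightarrow> (LINT y|lborel. (\<lambda>x::real^'n. 0) y)"
  proof (rule integral_dominated_convergence[OF _ _ u])
    show "AE y in lborel. (\<lambda>n. indicator {y. norm y \<ge> real n} y * \<bar>u y\<bar> powr q) \<longlonglongrightarrow> 0"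
    proof (rule AE_I2)
      fix y :: "real^'n"
      obtain n0 :: nat where n0: "real n0 > norm y" using reals_Archimedean2 by blast
      have "eventually (\<lambda>n. 0 = indicator {y. norm y \<ge> real n} y * \<bar>u y\<bar> powr q) sequentially"
        unfolding eventually_sequentially
      proof (intro exI allI impI)
        fix n assume "n0 \<le> n"
        then have "\<not> norm y \<ge> real n" using n0 by linarith
        then show "0 = indicator {y. norm y \<ge> real n} y * \<bar>u y\<bar> powr q" by simp
      qed
      then show "(\<lambda>n. indicator {y. norm y \<ge> real n} y * \<bar>u y\<bar> powr q) \<longlonglongrightarrow> 0" by (rule Lim_transform_eventually[OF tendsto_const])
    qed
    show "AE y in lborel. norm (indicator {y. norm y \<ge> real n} y * \<bar>u y\<bar> powr q) \<le> \<bar>u y\<bar> powr q" for n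
      by (auto simp: indicator_def)
  qed measurable
  moreover have "e / 2 / (B * \<eta> powr (1 - q)) > 0" using e R \<eta> by simp
  ultimately have "\<forall>\<^sub>F n in sequentially. (LINT y|lborel. indicator {y. norm y \<ge> real n} y * \<bar>u y\<bar> powr q) < e / 2 / (B * \<eta> powr (1 - q))"
    by (auto dest: order_tendstoD(2))
  then obtain n where n: "(LINT y|lborel. indicator {y. norm y \<ge> real n} y * \<bar>u y\<bar> powr q) < e / 2 / (B * \<eta> powr (1 - q))"
    by (meson eventually_happens sequentially_bot)
  let ?T = "\<lambda>y. indicator {y. norm y \<ge> real n} y * \<bar>u y\<bar> powr q"
  have Ti: "integrable lborel ?T"
    by (rule Bochner_Integration.integrable_bound[OF u]) (auto simp: indicator_def)
  have "\<bar>conv u \<rho> x\<bar> < e" if x: "norm x \<ge> R + real n" for x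
  proof -
    have "\<bar>conv u \<rho> x\<bar> \<le> (LINT y|lborel. \<bar>u y * \<rho> (x - y)\<bar>)"
      unfolding conv_def by (rule integral_abs_bound)
    also have "\<dots> \<le> (LINT y|lborel. B * (\<eta> * indicator (cball x R) y + \<eta> powr (1 - q) * ?T y))"
    proof (rule integral_mono')
      show "integrable lborel (\<lambda>y. B * (\<eta> * indicator (cball x R) y + \<eta> powr (1 - q) * ?T y))"
        using Vi Ti by simp
      fix y
      show "\<bar>u y * \<rho> (x - y)\<bar> \<le> B * (\<eta> * indicator (cball x R) y + \<eta> powr (1 - q) * ?T y)"
      proof (cases "norm (x - y) < R")
        case True
        then have y: "y \<in> cball x R" "norm y \<ge> real n"
          using x norm_triangle_ineq2[of x "x - y"] norm_triangle_ineq2[of x y] by (auto simp: dist_norm)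
        have "\<bar>u y\<bar> \<le> \<eta> + \<eta> powr (1 - q) * \<bar>u y\<bar> powr q" by (rule Lp_local_le[OF q \<eta>(1)])
        then have "\<bar>\<rho> (x - y)\<bar> * \<bar>u y\<bar> \<le> B * (\<eta> + \<eta> powr (1 - q) * \<bar>u y\<bar> powr q)"
          using R by (intro mult_mono) auto
        then show ?thesis using y by (simp add: abs_mult mult.commute)
      next
        case False
        then show ?thesis using R \<eta> by simp
      qed
      show "0 \<le> B * (\<eta> * indicator (cball x R) y + \<eta> powr (1 - q) * ?T y)" using R \<eta> by simp
    qed
    also have "\<dots> = B * (\<eta> * V + \<eta> powr (1 - q) * (LINT y|lborel. ?T y))"
      using Vi Ti Vx[of x] by simp
    also have "\<dots> = B * (\<eta> * V) + (B * \<eta> powr (1 - q)) * (LINT y|lborel. ?T y)" by (simp add: algebra_simps)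
    also have "\<dots> < e / 2 + e / 2"
      using \<eta> R n by (intro add_strict_mono) (simp_all add: pos_less_divide_eq mult.commute)
    finally show ?thesis by simp
  qed
  then show "\<exists>b. \<forall>x. norm x \<ge> b \<longrightarrow> dist (conv u \<rho> x) 0 < e" by (auto simp: dist_real_def)
qed

section \<open>From bounds on tests to bounded variation\<close>

lemma test_field_axis:
  assumes \<phi>: "test_fun \<phi>"
  shows "test_field (\<lambda>x. \<phi> x *\<^sub>R axis i 1)" "divergence (\<lambda>x. \<phi> x *\<^sub>R axis i 1) x = partial_deriv i \<phi> x"
proof -
  have comp: "(\<lambda>x. (\<phi> x *\<^sub>R axis i 1) $ j) = (\<lambda>x. (if j = i then 1 else 0) * \<phi> x)" for j
    by (auto simp: axis_def)
  show "test_field (\<lambda>x. \<phi> x *\<^sub>R axis i 1)"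
    unfolding test_field_def comp using test_fun_cmult[OF \<phi>] by auto
  have "divergence (\<lambda>x. \<phi> x *\<^sub>R axis i 1) x = (\<Sum>j\<in>UNIV. if j = i then partial_deriv i \<phi> x else 0)"
    unfolding divergence_def comp partial_deriv_cmult[OF \<phi>] by (intro sum.cong) auto
  then show "divergence (\<lambda>x. \<phi> x *\<^sub>R axis i 1) x = partial_deriv i \<phi> x" by simp
qed

text \<open>The L_1 norm of a field for the l1-norm on its values: being additive over coordinates,
  it suits testing with coordinate fields.\<close>

definition mass :: "(real^'n \<Rightarrow> real^'n) \<Rightarrow> real" where
  "mass v = (\<Sum>i\<in>UNIV. LINT x|lebesgue. \<bar>v x $ i\<bar>)"

lemma unit_field_axis:
  assumes "test_fun \<phi>" "\<And>x. \<bar>\<phi> x\<bar> \<le> 1"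
  shows "(\<lambda>x. \<phi> x *\<^sub>R axis i 1) \<in> unit_fields"
  using assms test_field_axis(1)[OF assms(1)] by (simp add: unit_fields_def)

text \<open>The positive and the negative part of the derivative serve as densities of the two
  measures that encode a signed measure.\<close>

lemma is_distr_deriv_smooth:
  fixes w :: "real^'n \<Rightarrow> real"
  assumes w: "smooth w" and i: "integrable lborel (partial_deriv i w)"
  shows "\<exists>\<sigma>. is_distr_deriv i w \<sigma>"
proof -
  let ?D = "partial_deriv i w"
  have [measurable]: "w \<in> borel_measurable borel" "?D \<in> borel_measurable borel"
    using w by (auto intro!: borel_measurable_continuous_onI smooth_continuous smooth_partial)
  define \<mu> where "\<mu> g = density lborel (\<lambda>x. ennreal (max 0 (g x)))" for g :: "real^'n \<Rightarrow> real"
  have fin: "finite_measure (\<mu> g)" if "integrable lborel g" for g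
  proof (rule finite_measureI)
    have [measurable]: "g \<in> borel_measurable borel" using that by simp
    have "(\<integral>\<^sup>+x. ennreal (max 0 (g x)) \<partial>lborel) = ennreal (LINT x|lborel. max 0 (g x))"
      using that by (intro nn_integral_eq_integral) auto
    then show "emeasure (\<mu> g) (space (\<mu> g)) \<noteq> \<infinity>" by (simp add: \<mu>_def emeasure_density)
  qed
  have int: "(LINT x|\<mu> g. \<phi> x) = (LINT x|lborel. max 0 (g x) * \<phi> x)"
    if "integrable lborel g" "test_fun \<phi>" for g \<phi> :: "real^'n \<Rightarrow> real"
    unfolding \<mu>_def using that test_fun_borel[OF that(2)] by (subst integral_density) auto
  have bi: "integrable lborel (\<lambda>x. max 0 (g x) * \<phi> x)"
    if g: "integrable lborel g" and \<phi>: "test_fun \<phi>" for g \<phi> :: "real^'n \<Rightarrow> real"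
  proof -
    obtain B where B: "B > 0" "\<And>x. \<bar>\<phi> x\<bar> \<le> B" using test_fun_bounded[OF \<phi>] by blast
    have [measurable]: "g \<in> borel_measurable borel" "\<phi> \<in> borel_measurable borel"
      using g test_fun_borel[OF \<phi>] by auto
    show ?thesis
    proof (rule Bochner_Integration.integrable_bound)
      show "integrable lborel (\<lambda>x. B * g x)" using g by simp
      have "\<bar>max 0 (g x)\<bar> * \<bar>\<phi> x\<bar> \<le> \<bar>g x\<bar> * B" for x using B by (intro mult_mono) auto
      then show "AE x in lborel. norm (max 0 (g x) * \<phi> x) \<le> norm (B * g x)"
        using B by (intro AE_I2) (simp add: abs_mult mult.commute)
    qed measurable
  qed
  have i': "integrable lborel (\<lambda>x. - ?D x)" using i by simp
  have "is_distr_deriv i w (\<mu> ?D, \<mu> (\<lambda>x. - ?D x))"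
    unfolding is_distr_deriv_def
  proof (intro conjI allI impI)
    show "signed_borel_measure (\<mu> ?D, \<mu> (\<lambda>x. - ?D x))"
      unfolding signed_borel_measure_def using fin[OF i] fin[OF i'] by (simp add: \<mu>_def)
    fix \<phi> :: "real^'n \<Rightarrow> real" assume \<phi>: "test_fun \<phi>"
    have "signed_integral (\<mu> ?D, \<mu> (\<lambda>x. - ?D x)) \<phi> = (LINT x|lborel. max 0 (?D x) * \<phi> x - max 0 (- ?D x) * \<phi> x)"
      unfolding signed_integral_def using bi[OF i \<phi>] bi[OF i' \<phi>] by (simp add: int i i' \<phi>)
    also have "(\<lambda>x. max 0 (?D x) * \<phi> x - max 0 (- ?D x) * \<phi> x) = (\<lambda>x. ?D x * \<phi> x)"
      by (auto simp: fun_eq_iff max_def)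
    also have "(LINT x|lborel. ?D x * \<phi> x) = - (LINT x|lborel. w x * partial_deriv i \<phi> x)"
      using smooth_ibp[OF w \<phi>, of i] by simp
    finally show "(LINT x|lebesgue. w x * partial_deriv i \<phi> x) = - signed_integral (\<mu> ?D, \<mu> (\<lambda>x. - ?D x)) \<phi>"
      using test_fun_borel[OF test_fun_partial[OF \<phi>]] by (subst borel_lborel_lebesgue) auto
  qed
  then show ?thesis by blast
qed

text \<open>Regularisation turns a bound on the distributional gradient into membership in the space,
  so that no representation theorem for functionals on continuous functions is needed.\<close>

lemma conv_BV:
  fixes u :: "(real, 'n::card2) vec \<Rightarrow> real"
  assumes [measurable]: "u \<in> borel_measurable borel" and u: "integrable lborel (\<lambda>x. \<bar>u x\<bar> powr conj_exp TYPE('n))"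
    and c: "\<And>i \<phi>. test_fun \<phi> \<Longrightarrow> (\<And>x. \<bar>\<phi> x\<bar> \<le> 1) \<Longrightarrow> (LINT x|lborel. u x * partial_deriv i \<phi> x) \<le> c"
    and \<rho>: "mollifier d \<rho>"
  shows "conv u \<rho> \<in> BV_fun" "variation (conv u \<rho>) \<le> real CARD('n) * c"
    "(LINT x|lborel. \<bar>conv u \<rho> x\<bar> powr conj_exp TYPE('n)) \<le> c powr conj_exp TYPE('n)"
    "conv u \<rho> \<in> borel_measurable borel"
    "integrable lborel (\<lambda>x. \<bar>conv u \<rho> x\<bar> powr conj_exp TYPE('n))"
proof -
  let ?q = "conj_exp TYPE('n)" and ?w = "conv u \<rho>"
  have q: "?q > 1" by (rule conj_exp_gt_1)
  have li: "loc_int u" by (rule Lp_loc_int[OF _ q u]) simp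
  have c0: "c \<ge> 0" using c[OF test_funI[of "\<lambda>_. 0" 0]] by simp
  have w: "smooth ?w" by (rule smooth_conv[OF li mollifierD(1)[OF \<rho>]])
  have wb[measurable]: "?w \<in> borel_measurable borel" "partial_deriv i ?w \<in> borel_measurable borel" for i
    using w by (auto intro!: borel_measurable_continuous_onI smooth_continuous smooth_partial)
  have lim: "(?w \<longlongrightarrow> 0) at_infinity"
    by (rule conv_vanishes[OF _ q u test_fun_Cc[OF mollifierD(1)[OF \<rho>]]]) simp
  \<comment> \<open>Translates and negatives of a test bounded by 1 are again such tests, so the
    bound \<open>c\<close> survives the averaging; integration by parts then moves it to the
    derivative of the smooth function.\<close>
  have D: "(LINT x|lborel. partial_deriv i ?w x * \<phi> x) \<le> c" if \<phi>: "test_fun \<phi>" "\<And>x. \<bar>\<phi> x\<bar> \<le> 1" for i \<phi>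
  proof -
    have "\<bar>(LINT x|lborel. ?w x * partial_deriv i \<phi> x) - 0\<bar> \<le> c"
    proof (rule conv_pairing_bound[OF li \<rho> test_fun_Cc[OF test_fun_partial[OF \<phi>(1)]]])
      fix z
      have t: "test_fun (\<lambda>x. s * \<phi> (x + z))" for s by (intro test_fun_cmult test_fun_shift \<phi>)
      have "(LINT x|lborel. u x * partial_deriv i (\<lambda>x. s * \<phi> (x + z)) x) \<le> c" if "\<bar>s\<bar> = 1" for s
        by (rule c[OF t]) (use \<phi>(2) that in \<open>simp add: abs_mult\<close>)
      from this[of 1] this[of "-1"]
      show "\<bar>(LINT y|lborel. u y * partial_deriv i \<phi> (y + z)) - 0\<bar> \<le> c"
        by (simp add: partial_deriv_cmult[OF test_fun_shift[OF \<phi>(1)], of i "-1", simplified] partial_deriv_shift[OF \<phi>(1)] abs_le_iff)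
    qed
    then show ?thesis using smooth_ibp[OF w \<phi>(1), of i] by simp
  qed
  have li': "loc_int (partial_deriv i ?w)" for i by (intro continuous_loc_int smooth_continuous smooth_partial w)
  \<comment> \<open>Duality makes the partial derivatives integrable; the Sobolev inequality then
    bounds the function itself in terms of \<open>c\<close>.\<close>
  have i: "integrable lborel (partial_deriv i ?w)" and le: "(LINT x|lborel. \<bar>partial_deriv i ?w x\<bar>) \<le> c" for i
    by (rule integrable_from_tests[OF li' D]; assumption)+
  show G: "integrable lborel (\<lambda>x. \<bar>?w x\<bar> powr ?q)" "(LINT x|lborel. \<bar>?w x\<bar> powr ?q) \<le> c powr ?q"
    by (rule GNS_smooth[OF w lim c0 i le])+
  have "?w \<in> Lp ?q"
    unfolding Lp_def using G(1) by (simp add: borel_lborel_lebesgue(2) measurable_completion)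
  then show "?w \<in> BV_fun" using is_distr_deriv_smooth[OF w i] by (simp add: BV_fun_def)
  show "?w \<in> borel_measurable borel" by (rule wb(1))
  \<comment> \<open>The coordinates of a unit field are admissible tests, each contributing at most
    \<open>c\<close>.\<close>
  show "variation ?w \<le> real CARD('n) * c"
  proof (rule variation_least)
    fix v :: "(real, 'n) vec \<Rightarrow> (real, 'n) vec" assume v: "v \<in> unit_fields"
    have t: "test_fun (\<lambda>x. v x $ i)" for i using v by (auto simp: unit_fields_def test_field_def)
    have v1: "\<bar>v x $ i\<bar> \<le> 1" for x i
      using v order_trans[OF component_le_norm_cart[of "v x" i]] by (auto simp: unit_fields_def)
    have pi: "integrable lborel (\<lambda>x. ?w x * partial_deriv i (\<lambda>y. v y $ i) x)" for i
      by (intro loc_int_mult continuous_loc_int smooth_continuous w test_fun_Cc test_fun_partial t)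
    note [measurable] = test_fun_borel[OF test_fun_partial[OF t]]
    have "(LINT x|lebesgue. ?w x * divergence v x) = (LINT x|lborel. ?w x * divergence v x)"
      by (rule borel_lborel_lebesgue) (simp add: divergence_def)
    also have "\<dots> = (\<Sum>i\<in>UNIV. LINT x|lborel. ?w x * partial_deriv i (\<lambda>y. v y $ i) x)"
      unfolding divergence_def sum_distrib_left using pi by (rule Bochner_Integration.integral_sum)
    also have "\<dots> = (\<Sum>i\<in>UNIV. LINT x|lborel. partial_deriv i ?w x * - (v x $ i))"
      using smooth_ibp[OF w t] by simp
    also have "\<dots> \<le> (\<Sum>i\<in>(UNIV::'n set). c)"
    proof (rule sum_mono)
      fix i
      have "test_fun (\<lambda>x. - (v x $ i))" using test_fun_cmult[OF t, of "-1" i] by simp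
      then show "(LINT x|lborel. partial_deriv i ?w x * - (v x $ i)) \<le> c" by (rule D) (simp add: v1)
    qed
    finally show "(LINT x|lebesgue. ?w x * divergence v x) \<le> real CARD('n) * c" by simp
  qed
qed

section \<open>Duality between functions of bounded variation and \<open>L\<^sub>m\<close>\<close>

lemma ae_borel_version:
  fixes u :: "real^'n \<Rightarrow> real"
  assumes "u \<in> borel_measurable lebesgue"
  obtains u' where "u' \<in> borel_measurable borel" "AE x in lebesgue. u x = u' x"
proof -
  obtain u' where "u' \<in> borel_measurable lborel" "AE x in lborel. u x = u' x"
    using completion_ex_borel_measurable_real[OF assms] by auto
  then show ?thesis using that[of u'] AE_completion by auto
qed

lemma integral_ae_borel:
  fixes u u' g :: "real^'n \<Rightarrow> real"
  assumes u: "u \<in> borel_measurable lebesgue" and u': "u' \<in> borel_measurable borel" and ae: "AE x in lebesgue. u x = u' x"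
    and g: "g \<in> borel_measurable borel"
  shows "(LINT x|lebesgue. u x * g x) = (LINT x|lborel. u' x * g x)"
proof -
  note [measurable] = u' g
  have [measurable]: "u \<in> borel_measurable lebesgue" "u' \<in> borel_measurable lebesgue" "g \<in> borel_measurable lebesgue"
    using u u' g by (auto simp: measurable_completion)
  have "(LINT x|lebesgue. u x * g x) = (LINT x|lebesgue. u' x * g x)"
    using ae by (intro integral_cong_AE) auto
  also have "\<dots> = (LINT x|lborel. u' x * g x)" by (rule borel_lborel_lebesgue) measurable
  finally show ?thesis .
qed

text \<open>Young's inequality for the exponents \<open>conj_exp\<close> and \<open>CARD('n)\<close>
  with a free scale \<open>r\<close>, the divisors being dropped. Choosing \<open>r\<close> later
  takes the place of Hoelder's inequality.\<close>

lemma Young_scaled: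
  fixes s t r :: real
  assumes r: "r > 0"
  shows "\<bar>s * t\<bar> \<le> r powr conj_exp TYPE('n::card2) * \<bar>s\<bar> powr conj_exp TYPE('n) + r powr - real CARD('n) * \<bar>t\<bar> ^ CARD('n)"
proof -
  let ?q = "conj_exp TYPE('n)" and ?m = "real CARD('n)"
  have m: "CARD('n) \<ge> 2" by (rule two_le_card)
  have q: "?q > 1" by (rule conj_exp_gt_1)
  have "(r * \<bar>s\<bar>) * (\<bar>t\<bar> / r) \<le> (r * \<bar>s\<bar>) powr ?q / ?q + (\<bar>t\<bar> / r) powr ?m / ?m"
    using m q r by (intro Youngs_inequality) (auto simp: conj_exp_def field_simps)
  also have "\<dots> \<le> (r * \<bar>s\<bar>) powr ?q + (\<bar>t\<bar> / r) powr ?m"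
  proof -
    have dv: "a / k \<le> a" if "a \<ge> 0" "k \<ge> 1" for a k :: real
      using that mult_left_mono[of 1 k a] by (simp add: divide_le_eq)
    show ?thesis using m q by (intro add_mono dv) auto
  qed
  also have "(r * \<bar>s\<bar>) powr ?q = r powr ?q * \<bar>s\<bar> powr ?q" by (rule powr_mult)
  also have "(\<bar>t\<bar> / r) powr ?m = r powr - ?m * \<bar>t\<bar> ^ CARD('n)"
    using r abs_powr_nat[of "CARD('n)" t] by (simp add: powr_divide powr_minus_divide)
  finally show ?thesis using r by (simp add: abs_mult)
qed

lemma Lm_iff: "f \<in> Lp (real CARD('n)) \<longleftrightarrow> f \<in> borel_measurable lebesgue \<and> integrable lebesgue (\<lambda>x. \<bar>f x\<bar> ^ CARD('n))"
  for f :: "real^'n \<Rightarrow> real"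
  by (simp add: Lp_def abs_powr_nat)

lemma Lp_pairing:
  fixes u f :: "(real, 'n::card2) vec \<Rightarrow> real"
  assumes u: "u \<in> Lp (conj_exp TYPE('n))" and f: "f \<in> Lp (real CARD('n))"
  shows "integrable lebesgue (\<lambda>x. u x * f x)"
    "r > 0 \<Longrightarrow> \<bar>LINT x|lebesgue. u x * f x\<bar> \<le> r powr conj_exp TYPE('n) * (LINT x|lebesgue. \<bar>u x\<bar> powr conj_exp TYPE('n))
        + r powr - real CARD('n) * (LINT x|lebesgue. \<bar>f x\<bar> ^ CARD('n))"
proof -
  let ?q = "conj_exp TYPE('n)" and ?m = "real CARD('n)"
  note [measurable] = Lp_measurable[OF u] Lp_measurable[OF f]
  have ui: "integrable lebesgue (\<lambda>x. \<bar>u x\<bar> powr ?q)" using u by (simp add: Lp_def)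
  have fi: "integrable lebesgue (\<lambda>x. \<bar>f x\<bar> ^ CARD('n))" using f by (simp add: Lm_iff)
  have bi: "integrable lebesgue (\<lambda>x. r powr ?q * \<bar>u x\<bar> powr ?q + r powr - ?m * \<bar>f x\<bar> ^ CARD('n))" for r
    using ui fi by simp
  show i: "integrable lebesgue (\<lambda>x. u x * f x)"
  proof (rule Bochner_Integration.integrable_bound[OF bi[of 1]])
    show "AE x in lebesgue. norm (u x * f x) \<le> norm (1 powr ?q * \<bar>u x\<bar> powr ?q + 1 powr - ?m * \<bar>f x\<bar> ^ CARD('n))"
    proof (rule AE_I2)
      fix x show "norm (u x * f x) \<le> norm (1 powr ?q * \<bar>u x\<bar> powr ?q + 1 powr - ?m * \<bar>f x\<bar> ^ CARD('n))"
        using Young_scaled[of 1 "u x" "f x", where 'n='n] unfolding real_norm_def by linarith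
    qed
  qed measurable
  assume r: "r > 0"
  have "\<bar>LINT x|lebesgue. u x * f x\<bar> \<le> (LINT x|lebesgue. \<bar>u x * f x\<bar>)" by (rule integral_abs_bound)
  also have "\<dots> \<le> (LINT x|lebesgue. r powr ?q * \<bar>u x\<bar> powr ?q + r powr - ?m * \<bar>f x\<bar> ^ CARD('n))"
    using i bi Young_scaled[OF r] by (intro integral_mono) auto
  also have "\<dots> = r powr ?q * (LINT x|lebesgue. \<bar>u x\<bar> powr ?q) + r powr - ?m * (LINT x|lebesgue. \<bar>f x\<bar> ^ CARD('n))"
    using ui fi by simp
  finally show "\<bar>LINT x|lebesgue. u x * f x\<bar> \<le> r powr ?q * (LINT x|lebesgue. \<bar>u x\<bar> powr ?q) + r powr - ?m * (LINT x|lebesgue. \<bar>f x\<bar> ^ CARD('n))" .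
qed

lemma test_fun_Lm: "test_fun \<phi> \<Longrightarrow> \<phi> \<in> Lp (real CARD('n))" for \<phi> :: "real^'n \<Rightarrow> real"
proof -
  assume \<phi>: "test_fun \<phi>"
  note c = test_fun_Cc[OF \<phi>]
  obtain R where R: "\<And>x. norm x \<ge> R \<Longrightarrow> \<phi> x = 0" using Cc_obtain[OF c] by metis
  have "Cc (\<lambda>x. \<bar>\<phi> x\<bar> ^ CARD('n))"
    by (rule CcI[of _ R]) (auto intro!: continuous_intros Cc_cont[OF c] simp: R)
  then have "integrable lborel (\<lambda>x. \<bar>\<phi> x\<bar> ^ CARD('n))" by (rule Cc_integrable)
  then have "integrable lebesgue (\<lambda>x. \<bar>\<phi> x\<bar> ^ CARD('n))"
    using test_fun_borel[OF \<phi>] by (subst borel_lborel_lebesgue(2)) auto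
  then show ?thesis using test_fun_measurable[OF \<phi>] by (simp add: Lm_iff)
qed

lemma BV_fun_test_bound:
  fixes u :: "(real, 'n::card2) vec \<Rightarrow> real"
  assumes "u \<in> BV_fun" "test_fun \<phi>" "\<And>x. \<bar>\<phi> x\<bar> \<le> 1"
  shows "(LINT x|lebesgue. u x * partial_deriv i \<phi> x) \<le> variation u"
  using variation_upper[OF assms(1) unit_field_axis[OF assms(2,3)]]
  unfolding test_field_axis(2)[OF assms(2)] .

text \<open>The Sobolev inequality for functions of bounded variation in weak form. For the
  regularisations of \<open>u\<close> the variation controls the integral of the power
  \<open>conj_exp\<close>; after Young's inequality, the pairing with a fixed test passes to the
  limit.\<close>

lemma BV_test_pairing:
  fixes u :: "(real, 'n::card2) vec \<Rightarrow> real"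
  assumes u: "u \<in> BV_fun" and c: "c > 0" "variation u \<le> c" and \<phi>: "test_fun \<phi>" and r: "r > 0"
  shows "\<bar>LINT x|lebesgue. u x * \<phi> x\<bar> \<le> c * (r powr conj_exp TYPE('n) + r powr - real CARD('n) * (LINT x|lebesgue. \<bar>\<phi> x\<bar> ^ CARD('n)))"
proof -
  let ?q = "conj_exp TYPE('n)" and ?m = "real CARD('n)"
  let ?A = "LINT x|lebesgue. \<bar>\<phi> x\<bar> ^ CARD('n)"
  have m: "CARD('n) \<ge> 2" by (rule two_le_card)
  have uL: "u \<in> Lp ?q" by (rule BV_fun_Lp[OF u])
  obtain u' where u': "u' \<in> borel_measurable borel" "AE x in lebesgue. u x = u' x"
    using ae_borel_version[OF Lp_measurable[OF uL]] by metis
  note [measurable] = u'(1) test_fun_borel[OF \<phi>]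
  have ui: "integrable lborel (\<lambda>x. \<bar>u' x\<bar> powr ?q)"
  proof -
    have "u' \<in> Lp ?q" using u' by (intro Lp_cong_AE[OF uL]) (auto simp: measurable_completion)
    then show ?thesis by (simp add: Lp_def borel_lborel_lebesgue(2))
  qed
  have li: "loc_int u'" by (rule Lp_loc_int[OF u'(1) conj_exp_gt_1 ui])
  have tb: "(LINT x|lborel. u' x * partial_deriv i \<psi> x) \<le> c" if "test_fun \<psi>" "\<And>x. \<bar>\<psi> x\<bar> \<le> 1" for i \<psi>
    using BV_fun_test_bound[OF u that, of i] c
      integral_ae_borel[OF Lp_measurable[OF uL] u' test_fun_borel[OF test_fun_partial[OF that(1)]]] by simp
  \<comment> \<open>This scale makes the bound linear in \<open>c\<close>:
    \<open>k powr ?q * c powr ?q = c * r powr ?q\<close> because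
    \<open>?q * (1 - 1 / ?m) = 1\<close>, and \<open>k powr - ?m = c * r powr - ?m\<close>.\<close>
  define k where "k = r * c powr - (1 / ?m)"
  have k: "k > 0" using r c by (simp add: k_def)
  have k1: "k powr ?q * c powr ?q = c * r powr ?q"
  proof -
    have "k powr ?q * c powr ?q = r powr ?q * (c powr (- (1 / ?m) * ?q) * c powr ?q)"
      by (simp add: k_def powr_mult powr_powr mult.assoc)
    also have "c powr (- (1 / ?m) * ?q) * c powr ?q = c powr (- (1 / ?m) * ?q + ?q)" by (rule powr_add[symmetric])
    also have "- (1 / ?m) * ?q + ?q = 1"
    proof -
      have nz: "?m - 1 \<noteq> 0" "?m \<noteq> 0" using m by auto
      have "- (1 / ?m) * ?q + ?q = ?q * ((?m - 1) / ?m)" using nz by (simp add: diff_divide_distrib algebra_simps)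
      also have "\<dots> = 1" using nz by (simp add: conj_exp_def)
      finally show ?thesis .
    qed
    finally show ?thesis using c by simp
  qed
  have k2: "k powr - ?m = c * r powr - ?m"
  proof -
    have "(- (1 / ?m)) * (- ?m) = 1" using m by simp
    then have "(c powr - (1 / ?m)) powr - ?m = c" using c by (simp only: powr_powr) simp
    then show ?thesis by (simp add: k_def powr_mult)
  qed
  have wb: "\<bar>LINT x|lborel. conv u' \<rho> x * \<phi> x\<bar> \<le> c * (r powr ?q + r powr - ?m * ?A)" if \<rho>: "mollifier d \<rho>" for d \<rho>
  proof -
    note B = conv_BV[OF u'(1) ui tb \<rho>]
    have "(LINT x|lborel. conv u' \<rho> x * \<phi> x) = (LINT x|lebesgue. conv u' \<rho> x * \<phi> x)"
      using B(4) by (intro borel_lborel_lebesgue(1)[symmetric]) simp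
    also have "\<bar>\<dots>\<bar> \<le> k powr ?q * (LINT x|lebesgue. \<bar>conv u' \<rho> x\<bar> powr ?q) + k powr - ?m * ?A"
      by (rule Lp_pairing(2)[OF BV_fun_Lp[OF B(1)] test_fun_Lm[OF \<phi>] k])
    also have "(LINT x|lebesgue. \<bar>conv u' \<rho> x\<bar> powr ?q) = (LINT x|lborel. \<bar>conv u' \<rho> x\<bar> powr ?q)"
      using B(4) by (intro borel_lborel_lebesgue(1)) simp
    also have "k powr ?q * (LINT x|lborel. \<bar>conv u' \<rho> x\<bar> powr ?q) + k powr - ?m * ?A \<le> k powr ?q * c powr ?q + k powr - ?m * ?A"
      using B(3) by (intro add_right_mono mult_left_mono) auto
    also have "\<dots> = c * (r powr ?q + r powr - ?m * ?A)" unfolding k1 k2 by (simp add: algebra_simps)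
    finally show ?thesis .
  qed
  have "\<bar>LINT x|lborel. u' x * \<phi> x\<bar> \<le> c * (r powr ?q + r powr - ?m * ?A) + e" if e: "e > 0" for e
  proof -
    obtain d where d: "d > 0" "\<And>\<rho>. mollifier d \<rho> \<Longrightarrow> \<bar>(LINT x|lborel. conv u' \<rho> x * \<phi> x) - (LINT x|lborel. u' x * \<phi> x)\<bar> \<le> e"
      using conv_pairing_tendsto[OF li test_fun_Cc[OF \<phi>] e] by metis
    obtain \<rho> :: "(real, 'n) vec \<Rightarrow> real" where \<rho>: "mollifier d \<rho>" using mollifier_exists[OF d(1)] by blast
    show ?thesis using d(2)[OF \<rho>] wb[OF \<rho>] by linarith
  qed
  then have "\<bar>LINT x|lborel. u' x * \<phi> x\<bar> \<le> c * (r powr ?q + r powr - ?m * ?A)" by (rule field_le_epsilon)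
  then show ?thesis using integral_ae_borel[OF Lp_measurable[OF uL] u' test_fun_borel[OF \<phi>]] by simp
qed

text \<open>\<open>f\<close> is approximated by tests in L_m. The factor \<open>2 ^ CARD('n)\<close>
  arises when the norm of the approximating test is bounded by that of \<open>f\<close> through
  \<open>power_add_le\<close>.\<close>

lemma BV_Lm_pairing:
  fixes u f :: "(real, 'n::card2) vec \<Rightarrow> real"
  assumes u: "u \<in> BV_fun" and f: "f \<in> Lp (real CARD('n))" and r: "r > 0"
  shows "\<bar>LINT x|lebesgue. u x * f x\<bar> \<le> variation u * (r powr conj_exp TYPE('n) + r powr - real CARD('n) * (2 ^ CARD('n) * (LINT x|lebesgue. \<bar>f x\<bar> ^ CARD('n))))"
proof -
  let ?q = "conj_exp TYPE('n)" and ?m = "real CARD('n)"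
  let ?F = "LINT x|lebesgue. \<bar>f x\<bar> ^ CARD('n)"
  let ?U = "LINT x|lebesgue. \<bar>u x\<bar> powr ?q"
  let ?C = "r powr ?q + r powr - ?m * (2 ^ CARD('n) * ?F)"
  have U0: "?U \<ge> 0" by simp
  note fm = Lp_measurable[OF f]
  have fi: "integrable lebesgue (\<lambda>x. \<bar>f x\<bar> ^ CARD('n))" using f by (simp add: Lm_iff)
  \<comment> \<open>The variation may be 0, so a positive upper bound \<open>c\<close> stands for it
    and is lowered to it at the end.\<close>
  have key: "\<bar>LINT x|lebesgue. u x * f x\<bar> \<le> c * ?C" if c: "c > 0" "variation u \<le> c" for c
  proof (rule field_le_epsilon)
    fix e :: real assume e: "e > 0"
    \<comment> \<open>The error \<open>f - \<phi>\<close> is paired with \<open>u\<close> at a scale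
      \<open>s\<close> of its own, small enough for the integral \<open>?U\<close>, which is finite
      but not bounded by the variation at this point.\<close>
    define s where "s = (e / 2 / (?U + 1)) powr (1 / ?q)"
    have pos: "e / 2 / (?U + 1) > 0" using e U0 by (intro divide_pos_pos add_nonneg_pos) auto
    then have s: "s > 0" unfolding s_def using powr_gt_zero less_imp_neq by metis
    have sq: "s powr ?q * ?U \<le> e / 2"
    proof -
      have "s powr ?q = (e / 2 / (?U + 1)) powr 1"
        unfolding s_def powr_powr using conj_exp_gt_1[where 'n='n] by simp
      then have "s powr ?q = e / 2 / (?U + 1)" unfolding powr_one[OF less_imp_le[OF pos]] .
      then have "s powr ?q * ?U = e / 2 * (?U / (?U + 1))" by simp
      also have "\<dots> \<le> e / 2 * 1"
      proof -
        have fr: "t / (t + 1) \<le> 1" if "t \<ge> 0" for t :: real using that by simp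
        show ?thesis by (rule mult_left_mono[OF fr[OF U0]]) (use e in simp)
      qed
      finally show ?thesis by simp
    qed
    \<comment> \<open>The total coefficient of the error \<open>E\<close> in the final
      estimate.\<close>
    define K where "K = s powr - ?m + c * (r powr - ?m * 2 ^ CARD('n))"
    have K: "K > 0" using s r c by (simp add: K_def add_pos_pos)
    have m0: "?m > 0" and eK: "e / 2 / K > 0" using e K by simp_all
    obtain \<phi> where \<phi>: "test_fun \<phi>" "(LINT x|lebesgue. \<bar>f x - \<phi> x\<bar> powr ?m) < e / 2 / K"
      by (rule Lp_test_dense[OF m0 f eK])
    define E where "E = (LINT x|lebesgue. \<bar>f x - \<phi> x\<bar> ^ CARD('n))"
    have E: "E < e / 2 / K" using \<phi>(2) by (simp add: E_def abs_powr_nat)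
    note \<phi>L = test_fun_Lm[OF \<phi>(1)]
    have dL: "(\<lambda>x. f x - \<phi> x) \<in> Lp ?m"
      using Lp_add[OF _ f Lp_scale[OF \<phi>L, of "-1"]] by simp
    have di: "integrable lebesgue (\<lambda>x. \<bar>f x - \<phi> x\<bar> ^ CARD('n))" and \<phi>i: "integrable lebesgue (\<lambda>x. \<bar>\<phi> x\<bar> ^ CARD('n))"
      using dL \<phi>L by (auto simp: Lm_iff)
    have A: "(LINT x|lebesgue. \<bar>\<phi> x\<bar> ^ CARD('n)) \<le> 2 ^ CARD('n) * (?F + E)"
    proof -
      have "(LINT x|lebesgue. \<bar>\<phi> x\<bar> ^ CARD('n)) \<le> (LINT x|lebesgue. 2 ^ CARD('n) * (\<bar>f x\<bar> ^ CARD('n) + \<bar>f x - \<phi> x\<bar> ^ CARD('n)))"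
      proof (rule integral_mono[OF \<phi>i])
        show "integrable lebesgue (\<lambda>x. 2 ^ CARD('n) * (\<bar>f x\<bar> ^ CARD('n) + \<bar>f x - \<phi> x\<bar> ^ CARD('n)))" using fi di by simp
        show "\<bar>\<phi> x\<bar> ^ CARD('n) \<le> 2 ^ CARD('n) * (\<bar>f x\<bar> ^ CARD('n) + \<bar>f x - \<phi> x\<bar> ^ CARD('n))" for x
          using power_add_le[of "f x" "\<phi> x - f x" "CARD('n)"] by (simp add: abs_minus_commute)
      qed
      then show ?thesis using fi di by (simp add: E_def)
    qed
    have "(LINT x|lebesgue. u x * f x) = (LINT x|lebesgue. u x * (f x - \<phi> x)) + (LINT x|lebesgue. u x * \<phi> x)"
      using Lp_pairing(1)[OF BV_fun_Lp[OF u] f] Lp_pairing(1)[OF BV_fun_Lp[OF u] \<phi>L]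
      by (simp add: right_diff_distrib)
    then have "\<bar>LINT x|lebesgue. u x * f x\<bar> \<le> \<bar>LINT x|lebesgue. u x * (f x - \<phi> x)\<bar> + \<bar>LINT x|lebesgue. u x * \<phi> x\<bar>" by simp
    also have "\<dots> \<le> (s powr ?q * ?U + s powr - ?m * E) + c * (r powr ?q + r powr - ?m * (2 ^ CARD('n) * (?F + E)))"
    proof (rule add_mono)
      show "\<bar>LINT x|lebesgue. u x * (f x - \<phi> x)\<bar> \<le> s powr ?q * ?U + s powr - ?m * E"
        unfolding E_def by (rule Lp_pairing(2)[OF BV_fun_Lp[OF u] dL s])
      have "\<bar>LINT x|lebesgue. u x * \<phi> x\<bar> \<le> c * (r powr ?q + r powr - ?m * (LINT x|lebesgue. \<bar>\<phi> x\<bar> ^ CARD('n)))"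
        by (rule BV_test_pairing[OF u c \<phi>(1) r])
      also have "\<dots> \<le> c * (r powr ?q + r powr - ?m * (2 ^ CARD('n) * (?F + E)))"
        using A c by (intro mult_left_mono add_left_mono) auto
      finally show "\<bar>LINT x|lebesgue. u x * \<phi> x\<bar> \<le> c * (r powr ?q + r powr - ?m * (2 ^ CARD('n) * (?F + E)))" .
    qed
    also have "\<dots> = c * ?C + s powr ?q * ?U + K * E" by (simp add: K_def algebra_simps)
    also have "\<dots> \<le> c * ?C + e / 2 + e / 2"
      using sq E K by (intro add_mono) (auto simp: pos_less_divide_eq mult.commute less_imp_le)
    finally show "\<bar>LINT x|lebesgue. u x * f x\<bar> \<le> c * ?C + e" by simp
  qed
  have v0: "variation u \<ge> 0" by (rule variation_nonneg[OF u])
  have C0: "?C > 0" using r by (intro add_pos_nonneg) auto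
  show ?thesis
  proof (rule field_le_epsilon)
    fix e :: real assume e: "e > 0"
    have "\<bar>LINT x|lebesgue. u x * f x\<bar> \<le> (variation u + e / ?C) * ?C"
      using e C0 v0 by (intro key) (auto intro: add_nonneg_pos)
    also have "\<dots> = variation u * ?C + e" using C0 by (simp add: distrib_right)
    finally show "\<bar>LINT x|lebesgue. u x * f x\<bar> \<le> variation u * ?C + e" .
  qed
qed

text \<open>\<open>\<delta>\<close> does not depend on \<open>u\<close>: the scale is fixed by
  \<open>r powr ?q = e / 2\<close>, and the other term is at most \<open>e / 2\<close> once the
  integral of the power of \<open>f\<close> is small. This is continuity of the pairing in the dual
  norm.\<close>

lemma BV_Lm_small:
  assumes e: "e > 0"
  obtains \<delta> where "\<delta> > 0" "\<And>u f :: (real, 'n::card2) vec \<Rightarrow> real. u \<in> BV_fun \<Longrightarrow> f \<in> Lp (real CARD('n)) \<Longrightarrow>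
    (LINT x|lebesgue. \<bar>f x\<bar> ^ CARD('n)) \<le> \<delta> \<Longrightarrow> \<bar>LINT x|lebesgue. u x * f x\<bar> \<le> e * variation u"
proof -
  let ?q = "conj_exp TYPE('n)" and ?m = "real CARD('n)"
  define r where "r = (e / 2) powr (1 / ?q)"
  have r: "r > 0" using e by (simp add: r_def)
  have rq: "r powr ?q = e / 2" using e conj_exp_gt_1[where 'n='n] by (simp add: r_def powr_powr)
  define \<delta> where "\<delta> = e / 2 / (r powr - ?m * 2 ^ CARD('n))"
  show ?thesis
  proof
    show "\<delta> > 0" using e r by (simp add: \<delta>_def)
    fix u f :: "(real, 'n::card2) vec \<Rightarrow> real"
    assume u: "u \<in> BV_fun" and f: "f \<in> Lp ?m" and le: "(LINT x|lebesgue. \<bar>f x\<bar> ^ CARD('n)) \<le> \<delta>"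
    have "\<bar>LINT x|lebesgue. u x * f x\<bar> \<le> variation u * (r powr ?q + r powr - ?m * (2 ^ CARD('n) * (LINT x|lebesgue. \<bar>f x\<bar> ^ CARD('n))))"
      by (rule BV_Lm_pairing[OF u f r])
    also have "\<dots> \<le> variation u * (r powr ?q + r powr - ?m * (2 ^ CARD('n) * \<delta>))"
      using le variation_nonneg[OF u] by (intro mult_left_mono add_left_mono) auto
    also have "r powr - ?m * (2 ^ CARD('n) * \<delta>) = e / 2" using r by (simp add: \<delta>_def)
    finally show "\<bar>LINT x|lebesgue. u x * f x\<bar> \<le> e * variation u" by (simp add: rq mult.commute)
  qed
qed

lemma test_fun_add: "test_fun f \<Longrightarrow> test_fun g \<Longrightarrow> test_fun (\<lambda>x. f x + g x)" for f g :: "real^'n \<Rightarrow> real"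
proof -
  assume f: "test_fun f" and g: "test_fun g"
  obtain R B where R: "R > 0" "B > 0" "\<And>x. norm x \<ge> R \<Longrightarrow> f x = 0" "\<And>x. \<bar>f x\<bar> \<le> B" using Cc_obtain[OF test_fun_Cc[OF f]] by metis
  obtain S C where S: "S > 0" "C > 0" "\<And>x. norm x \<ge> S \<Longrightarrow> g x = 0" "\<And>x. \<bar>g x\<bar> \<le> C" using Cc_obtain[OF test_fun_Cc[OF g]] by metis
  show "test_fun (\<lambda>x. f x + g x)"
  proof (rule test_funI)
    show "smooth (\<lambda>x. f x + g x)" using f g by (simp add: test_fun_def smooth_add)
    show "f x + g x = 0" if "norm x \<ge> max R S" for x using that R(3)[of x] S(3)[of x] by simp
  qed
qed

lemma test_fun_zero: "test_fun (\<lambda>_. 0)"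
  by (rule test_funI[of _ 0]) auto

lemma test_fun_sum:
  fixes f :: "'i \<Rightarrow> real^'n \<Rightarrow> real"
  shows "(\<And>i. i \<in> I \<Longrightarrow> test_fun (f i)) \<Longrightarrow> test_fun (\<lambda>x. \<Sum>i\<in>I. f i x)"
  by (induction I rule: infinite_finite_induct) (auto intro: test_fun_add test_fun_zero)

lemma test_field_comp: "test_field v \<Longrightarrow> test_fun (\<lambda>x. v x $ i)"
  by (simp add: test_field_def)

lemma test_fun_divergence: "test_field v \<Longrightarrow> test_fun (divergence v)"
  unfolding divergence_def[abs_def] by (intro test_fun_sum test_fun_partial test_field_comp)

lemma test_fun_differentiable: "test_fun f \<Longrightarrow> f differentiable (at x)"
  by (simp add: test_fun_def smooth_differentiable)

lemma test_field_comb: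
  assumes v: "test_field v" and w: "test_field w"
  shows "test_field (\<lambda>x. a *\<^sub>R v x + b *\<^sub>R w x)"
    "divergence (\<lambda>x. a *\<^sub>R v x + b *\<^sub>R w x) x = a * divergence v x + b * divergence w x"
proof -
  show "test_field (\<lambda>x. a *\<^sub>R v x + b *\<^sub>R w x)"
    unfolding test_field_def using v w by (auto intro!: test_fun_add test_fun_cmult test_field_comp)
  have "partial_deriv i (\<lambda>y. a * v y $ i + b * w y $ i) x = a * partial_deriv i (\<lambda>y. v y $ i) x + b * partial_deriv i (\<lambda>y. w y $ i) x" for i
  proof -
    note V = test_field_comp[OF v, of i] and W = test_field_comp[OF w, of i]
    have "partial_deriv i (\<lambda>y. a * v y $ i + b * w y $ i) x = partial_deriv i (\<lambda>y. a * v y $ i) x + partial_deriv i (\<lambda>y. b * w y $ i) x"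
      by (intro partial_deriv_add test_fun_differentiable test_fun_cmult V W)
    then show ?thesis using partial_deriv_cmult[OF V] partial_deriv_cmult[OF W] by simp
  qed
  then show "divergence (\<lambda>x. a *\<^sub>R v x + b *\<^sub>R w x) x = a * divergence v x + b * divergence w x"
    by (simp add: divergence_def sum.distrib sum_distrib_left)
qed

lemma test_field_scale:
  assumes v: "test_field v"
  shows "test_field (\<lambda>x. a *\<^sub>R v x)" "divergence (\<lambda>x. a *\<^sub>R v x) x = a * divergence v x"
  using test_field_comb[OF v v, of a 0] by simp_all

lemma test_field_sum:
  assumes "\<And>i. i \<in> I \<Longrightarrow> test_field (v i)"
  shows "test_field (\<lambda>x. \<Sum>i\<in>I. v i x)"
  unfolding test_field_def sum_component
  using assms by (intro allI test_fun_sum test_field_comp)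

section \<open>The dual side: \<open>SCH\<^sub>0\<close>\<close>

lemma rep_bv_rel: "bv_rel (rep_bv u) (rep_bv u)"
  by (rule Quotient3_rep_reflp[OF Quotient3_bv])

lemma rep_abs_bv: "bv_rel w w \<Longrightarrow> bv_rel (rep_bv (abs_bv w)) w"
  by (rule Quotient3_rep_abs[OF Quotient3_bv])

lemma abs_rep_bv: "abs_bv (rep_bv u) = u"
  by (rule Quotient3_abs_rep[OF Quotient3_bv])

lemma rep_bv_BV: "rep_bv u \<in> BV_fun"
  using bv_rel_BV(1)[OF rep_bv_rel] .

lemma norm_bv_eq: "norm u = variation (rep_bv u)"
  using norm_bv.abs_eq[OF rep_bv_rel, of u] by (simp add: abs_rep_bv)

lemma rep_bv_add_AE: "AE x in lebesgue. rep_bv (u + v) x = rep_bv u x + rep_bv v x"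
proof -
  have "u + v = abs_bv (\<lambda>x. rep_bv u x + rep_bv v x)"
    using plus_bv.abs_eq[OF rep_bv_rel rep_bv_rel, of u v] by (simp add: abs_rep_bv)
  then show ?thesis
    using rep_abs_bv[OF bv_rel_add[OF rep_bv_rel rep_bv_rel], of u v] bv_rel_AE by metis
qed

lemma rep_bv_scale_AE: "AE x in lebesgue. rep_bv (c *\<^sub>R u) x = c * rep_bv u x"
proof -
  have "c *\<^sub>R u = abs_bv (\<lambda>x. c * rep_bv u x)"
    using scaleR_bv.abs_eq[OF rep_bv_rel, of c u] by (simp add: abs_rep_bv)
  then show ?thesis
    using rep_abs_bv[OF bv_rel_scale[OF rep_bv_rel], of c u] bv_rel_AE by metis
qed

text \<open>Informative for \<open>f\<close> in \<open>Lp (real CARD('n))\<close>, where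
  \<open>Lambda_apply\<close> establishes the boundedness that \<open>Blinfun\<close>
  presupposes.\<close>

definition Lambda :: "((real, 'n::card2) vec \<Rightarrow> real) \<Rightarrow> 'n bv \<Rightarrow>\<^sub>L real" where
  "Lambda f = Blinfun (\<lambda>u. LINT x|lebesgue. rep_bv u x * f x)"

text \<open>Boundedness is \<open>BV_Lm_pairing\<close> at scale 1. Representatives respect sums and
  multiples only almost everywhere, which the integral does not notice.\<close>

lemma Lambda_apply:
  fixes f :: "(real, 'n::card2) vec \<Rightarrow> real"
  assumes f: "f \<in> Lp (real CARD('n))"
  shows "blinfun_apply (Lambda f) u = (LINT x|lebesgue. rep_bv u x * f x)"
proof -
  let ?L = "\<lambda>u. LINT x|lebesgue. rep_bv u x * f x"
  note [measurable] = Lp_measurable[OF f] Lp_measurable[OF BV_fun_Lp[OF rep_bv_BV]]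
  note int = Lp_pairing(1)[OF BV_fun_Lp[OF rep_bv_BV] f]
  have "bounded_linear ?L"
  proof (rule bounded_linear_intro)
    fix u v :: "'n bv" and c :: real
    have "?L (u + v) = (LINT x|lebesgue. rep_bv u x * f x + rep_bv v x * f x)"
    proof (rule integral_cong_AE)
      show "AE x in lebesgue. rep_bv (u + v) x * f x = rep_bv u x * f x + rep_bv v x * f x"
        using rep_bv_add_AE[of u v] by eventually_elim (simp add: distrib_right)
    qed measurable
    then show "?L (u + v) = ?L u + ?L v" using int by simp
    have "?L (c *\<^sub>R u) = (LINT x|lebesgue. c * (rep_bv u x * f x))"
    proof (rule integral_cong_AE)
      show "AE x in lebesgue. rep_bv (c *\<^sub>R u) x * f x = c * (rep_bv u x * f x)"
        using rep_bv_scale_AE[of c u] by eventually_elim simp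
    qed measurable
    then show "?L (c *\<^sub>R u) = c *\<^sub>R ?L u" by simp
    show "norm (?L u) \<le> norm u * (1 powr conj_exp TYPE('n) + 1 powr - real CARD('n) * (2 ^ CARD('n) * (LINT x|lebesgue. \<bar>f x\<bar> ^ CARD('n))))"
      unfolding real_norm_def norm_bv_eq by (rule BV_Lm_pairing[OF rep_bv_BV f]) simp
  qed
  then show ?thesis unfolding Lambda_def by (simp add: bounded_linear_Blinfun_apply)
qed

lemma SCH0_eq: "(SCH0 :: ('n::card2 bv \<Rightarrow>\<^sub>L real) set) = closure (Lambda ` Lp (real CARD('n)))"
proof -
  have "{T :: 'n bv \<Rightarrow>\<^sub>L real. \<exists>f \<in> Lp (real CARD('n)). \<forall>u. blinfun_apply T u = (LINT x|lebesgue. rep_bv u x * f x)}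
     = Lambda ` Lp (real CARD('n))"
  proof (intro set_eqI iffI)
    fix T :: "'n bv \<Rightarrow>\<^sub>L real"
    assume "T \<in> {T. \<exists>f \<in> Lp (real CARD('n)). \<forall>u. blinfun_apply T u = (LINT x|lebesgue. rep_bv u x * f x)}"
    then obtain f where f: "f \<in> Lp (real CARD('n))" "\<And>u. blinfun_apply T u = (LINT x|lebesgue. rep_bv u x * f x)"
      by blast
    have "T = Lambda f" by (rule blinfun_eqI) (simp add: f Lambda_apply)
    with f show "T \<in> Lambda ` Lp (real CARD('n))" by blast
  qed (auto simp: Lambda_apply)
  then show ?thesis unfolding SCH0_def by simp
qed

lemma Lm_comb: "f \<in> Lp (real CARD('n)) \<Longrightarrow> g \<in> Lp (real CARD('n)) \<Longrightarrow> (\<lambda>x. a * f x + b * g x) \<in> Lp (real CARD('n))"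
  for f g :: "(real, 'n::card2) vec \<Rightarrow> real"
  by (intro Lp_add Lp_scale) auto

lemma Lambda_comb:
  fixes f g :: "(real, 'n::card2) vec \<Rightarrow> real"
  assumes f: "f \<in> Lp (real CARD('n))" and g: "g \<in> Lp (real CARD('n))"
  shows "Lambda (\<lambda>x. a * f x + b * g x) = a *\<^sub>R Lambda f + b *\<^sub>R Lambda g"
proof (rule blinfun_eqI)
  fix u :: "'n bv"
  have "(LINT x|lebesgue. rep_bv u x * (a * f x + b * g x)) = (LINT x|lebesgue. a * (rep_bv u x * f x) + b * (rep_bv u x * g x))"
    by (simp add: algebra_simps)
  then show "blinfun_apply (Lambda (\<lambda>x. a * f x + b * g x)) u = blinfun_apply (a *\<^sub>R Lambda f + b *\<^sub>R Lambda g) u"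
    using Lp_pairing(1)[OF BV_fun_Lp[OF rep_bv_BV] f, of u] Lp_pairing(1)[OF BV_fun_Lp[OF rep_bv_BV] g, of u]
    by (simp add: Lambda_apply[OF Lm_comb[OF f g]] Lambda_apply[OF f] Lambda_apply[OF g] blinfun.add_left blinfun.scaleR_left)
qed

lemma Lambda_diff:
  fixes f g :: "(real, 'n::card2) vec \<Rightarrow> real"
  assumes "f \<in> Lp (real CARD('n))" "g \<in> Lp (real CARD('n))"
  shows "Lambda (\<lambda>x. f x - g x) = Lambda f - Lambda g"
  using Lambda_comb[OF assms, of 1 "-1"] by simp

lemma Lambda_scale:
  fixes f :: "(real, 'n::card2) vec \<Rightarrow> real"
  assumes "f \<in> Lp (real CARD('n))"
  shows "Lambda (\<lambda>x. c * f x) = c *\<^sub>R Lambda f"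
  using Lambda_comb[OF assms assms, of c 0] by simp

lemma Lambda_small:
  assumes e: "e > 0"
  obtains \<delta> where "\<delta> > 0" "\<And>f :: (real, 'n::card2) vec \<Rightarrow> real. f \<in> Lp (real CARD('n)) \<Longrightarrow>
    (LINT x|lebesgue. \<bar>f x\<bar> ^ CARD('n)) \<le> \<delta> \<Longrightarrow> norm (Lambda f) \<le> e"
proof -
  obtain \<delta> where \<delta>: "\<delta> > 0" "\<And>u f :: (real, 'n::card2) vec \<Rightarrow> real. u \<in> BV_fun \<Longrightarrow> f \<in> Lp (real CARD('n)) \<Longrightarrow>
    (LINT x|lebesgue. \<bar>f x\<bar> ^ CARD('n)) \<le> \<delta> \<Longrightarrow> \<bar>LINT x|lebesgue. u x * f x\<bar> \<le> e * variation u"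
    by (rule BV_Lm_small[OF e, where 'n='n]) blast
  show ?thesis
  proof
    show "\<delta> > 0" by fact
    fix f :: "(real, 'n) vec \<Rightarrow> real" assume f: "f \<in> Lp (real CARD('n))" "(LINT x|lebesgue. \<bar>f x\<bar> ^ CARD('n)) \<le> \<delta>"
    show "norm (Lambda f) \<le> e"
      using e \<delta>(2)[OF rep_bv_BV f] by (intro norm_blinfun_bound) (auto simp: Lambda_apply[OF f(1)] norm_bv_eq)
  qed
qed

section \<open>Approximate solutions of the divergence equation\<close>

text \<open>The bound \<open>1 / real CARD('n)\<close> offsets the factor \<open>CARD('n)\<close>
  that \<open>conv_BV\<close> loses in the variation, so that exactly \<open>c\<close> comes back
  when \<open>f\<close> is paired with the regularised dual function.\<close>

lemma unit_field_approx:
  fixes f :: "(real, 'n::card2) vec \<Rightarrow> real"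
  assumes f: "test_fun f" and nf: "norm (Lambda f) \<le> 1 / real CARD('n)" and \<delta>: "\<delta> > 0"
  shows "\<exists>v\<in>unit_fields. (LINT x|lebesgue. \<bar>f x - divergence v x\<bar> ^ CARD('n)) < \<delta>"
proof -
  let ?m = "CARD('n)" and ?q = "conj_exp TYPE('n)"
  let ?K = "divergence ` (unit_fields :: ((real, 'n) vec \<Rightarrow> (real, 'n) vec) set)"
  have m: "?m \<ge> 2" by (rule two_le_card)
  note fL = test_fun_Lm[OF f]
  have f': "f \<in> borel_measurable lebesgue" "integrable lebesgue (\<lambda>x. \<bar>f x\<bar> ^ ?m)" using fL by (auto simp: Lm_iff)
  have KL: "g \<in> Lp (real ?m)" if "g \<in> ?K" for g
    using that by (auto simp: unit_fields_def intro!: test_fun_Lm test_fun_divergence)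
  have K: "g \<in> borel_measurable lebesgue" "integrable lebesgue (\<lambda>x. \<bar>g x\<bar> ^ ?m)" if "g \<in> ?K" for g
    using KL[OF that] by (auto simp: Lm_iff)
  have ne: "?K \<noteq> {}" using unit_fields_zero by blast
  have cv: "(\<lambda>x. (1 - t) * g x + t * g' x) \<in> ?K" if g: "g \<in> ?K" "g' \<in> ?K" and t: "0 \<le> t" "t \<le> 1" for g g' t
  proof -
    obtain v w where v: "v \<in> unit_fields" "g = divergence v" and w: "w \<in> unit_fields" "g' = divergence w"
      using g by auto
    have tf: "test_field v" "test_field w" using v w by (auto simp: unit_fields_def)
    have "norm ((1 - t) *\<^sub>R v x + t *\<^sub>R w x) \<le> 1" for x
    proof -
      have "norm ((1 - t) *\<^sub>R v x + t *\<^sub>R w x) \<le> (1 - t) * norm (v x) + t * norm (w x)"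
        using t norm_triangle_ineq[of "(1 - t) *\<^sub>R v x" "t *\<^sub>R w x"] by simp
      also have "\<dots> \<le> (1 - t) * 1 + t * 1"
        using t v w by (intro add_mono mult_left_mono) (auto simp: unit_fields_def)
      finally show ?thesis by simp
    qed
    then have "(\<lambda>x. (1 - t) *\<^sub>R v x + t *\<^sub>R w x) \<in> unit_fields"
      using test_field_comb(1)[OF tf] by (simp add: unit_fields_def)
    moreover have "(\<lambda>x. (1 - t) * g x + t * g' x) = divergence (\<lambda>x. (1 - t) *\<^sub>R v x + t *\<^sub>R w x)"
      using test_field_comb(2)[OF tf] v w by (simp add: fun_eq_iff)
    ultimately show ?thesis by blast
  qed
  obtain h where h: "h \<in> borel_measurable lebesgue" "integrable lebesgue (\<lambda>x. \<bar>h x\<bar> ^ ?m)"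
    "\<And>e. e > 0 \<Longrightarrow> \<exists>g\<in>?K. (LINT x|lebesgue. \<bar>f x - h x - g x\<bar> ^ ?m) < e"
    "\<And>g. g \<in> ?K \<Longrightarrow> (LINT x|lebesgue. psi ?m (h x) * (g x - (f x - h x))) \<le> 0"
    by (rule Lp_minimiser[OF m f' K ne cv]) (assumption | blast)+
  note [measurable] = h(1) f'(1)
  have [measurable]: "psi ?m \<in> borel_measurable borel" unfolding psi_def[abs_def] by measurable
  \<comment> \<open>Since \<open>(m - 1) * q = m\<close> for \<open>q = conj_exp TYPE('n)\<close>,
    the duality map sends \<open>h\<close> into the space of exponent \<open>q\<close>, which pairs
    with L_m.\<close>
  define u where "u x = psi ?m (h x)" for x
  have um[measurable]: "u \<in> borel_measurable lebesgue" unfolding u_def by measurable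
  have hL: "h \<in> Lp (real ?m)" using h by (simp add: Lm_iff)
  have uL: "u \<in> Lp ?q"
  proof -
    have "\<bar>u x\<bar> powr ?q = \<bar>h x\<bar> ^ ?m" for x
    proof (cases "h x = 0")
      case False
      have "\<bar>u x\<bar> = \<bar>h x\<bar> powr real (?m - 1)" using False abs_psi[OF m, of "h x"] by (simp add: u_def powr_realpow del: of_nat_diff)
      then have "\<bar>u x\<bar> powr ?q = \<bar>h x\<bar> powr (real (?m - 1) * ?q)" by (simp only: powr_powr)
      also have "real (?m - 1) * ?q = real ?m" using m by (simp add: conj_exp_def of_nat_diff)
      finally show ?thesis using False by (simp add: powr_realpow)
    qed (use m in \<open>simp add: u_def psi_def\<close>)
    then show ?thesis using h(2) by (simp add: Lp_def)
  qed
  note uint = Lp_pairing(1)[OF uL]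
  \<comment> \<open>In this notation the variational inequality says that \<open>u\<close> pairs
    with the divergence of every unit field to at most \<open>c\<close>.\<close>
  define c where "c = (LINT x|lebesgue. u x * f x) - (LINT x|lebesgue. u x * h x)"
  have uK: "(LINT x|lebesgue. u x * divergence v x) \<le> c" if v: "v \<in> unit_fields" for v
  proof -
    have gK: "divergence v \<in> ?K" using v by blast
    have "(LINT x|lebesgue. u x * (divergence v x - (f x - h x)))
      = (LINT x|lebesgue. u x * divergence v x - (u x * f x - u x * h x))" by (simp add: algebra_simps)
    also have "\<dots> = (LINT x|lebesgue. u x * divergence v x) - c"
      using uint[OF KL[OF gK]] uint[OF fL] uint[OF hL] by (simp add: c_def)
    finally show ?thesis using h(4)[OF gK] by (simp add: u_def)
  qed
  obtain u' where u': "u' \<in> borel_measurable borel" "AE x in lebesgue. u x = u' x"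
    using ae_borel_version[OF um] by metis
  have ui: "integrable lborel (\<lambda>x. \<bar>u' x\<bar> powr ?q)"
  proof -
    note [measurable] = u'(1)
    have "u' \<in> Lp ?q" using u' by (intro Lp_cong_AE[OF uL]) (auto simp: measurable_completion)
    then show ?thesis by (simp add: Lp_def borel_lborel_lebesgue(2))
  qed
  have li: "loc_int u'" by (rule Lp_loc_int[OF u'(1) conj_exp_gt_1 ui])
  have tb: "(LINT x|lborel. u' x * partial_deriv i \<psi> x) \<le> c" if \<psi>: "test_fun \<psi>" "\<And>x. \<bar>\<psi> x\<bar> \<le> 1" for i \<psi>
    using uK[OF unit_field_axis[OF \<psi>]] integral_ae_borel[OF um u' test_fun_borel[OF test_fun_partial[OF \<psi>(1)]]]
    by (simp add: test_field_axis(2)[OF \<psi>(1)])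
  have wb: "(LINT x|lborel. conv u' \<rho> x * f x) \<le> c" if \<rho>: "mollifier d \<rho>" for d \<rho>
  proof -
    let ?w = "conv u' \<rho>"
    note B = conv_BV[OF u'(1) ui tb \<rho>]
    have rel: "bv_rel ?w ?w" by (rule bv_rel_refl[OF B(1)])
    note [measurable] = B(4) test_fun_borel[OF f] Lp_measurable[OF BV_fun_Lp[OF rep_bv_BV]]
    have wl[measurable]: "?w \<in> borel_measurable lebesgue" using B(4) by (simp add: measurable_completion)
    have "(LINT x|lborel. ?w x * f x) = (LINT x|lebesgue. ?w x * f x)"
      by (rule borel_lborel_lebesgue(1)[symmetric]) measurable
    also have "\<dots> = (LINT x|lebesgue. rep_bv (abs_bv ?w) x * f x)"
      using bv_rel_AE[OF rep_abs_bv[OF rel]] by (intro integral_cong_AE) (auto elim!: eventually_mono)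
    also have "\<dots> = blinfun_apply (Lambda f) (abs_bv ?w)" by (simp add: Lambda_apply[OF fL])
    also have "\<dots> \<le> norm (Lambda f) * norm (abs_bv ?w)"
      using norm_blinfun[of "Lambda f" "abs_bv ?w"] by simp
    also have "norm (abs_bv ?w) = variation ?w" by (rule norm_bv.abs_eq[OF rel])
    also have "norm (Lambda f) * variation ?w \<le> 1 / real ?m * (real ?m * c)"
      using nf B(2) variation_nonneg[OF B(1)] by (intro mult_mono) auto
    finally show ?thesis by simp
  qed
  have "(LINT x|lborel. u' x * f x) \<le> c"
  proof (rule field_le_epsilon)
    fix e :: real assume e: "e > 0"
    obtain d where d: "d > 0" "\<And>\<rho>. mollifier d \<rho> \<Longrightarrow> \<bar>(LINT x|lborel. conv u' \<rho> x * f x) - (LINT x|lborel. u' x * f x)\<bar> \<le> e"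
      using conv_pairing_tendsto[OF li test_fun_Cc[OF f] e] by metis
    obtain \<rho> :: "(real, 'n) vec \<Rightarrow> real" where \<rho>: "mollifier d \<rho>" using mollifier_exists[OF d(1)] by blast
    show "(LINT x|lborel. u' x * f x) \<le> c + e" using d(2)[OF \<rho>] wb[OF \<rho>] by linarith
  qed
  then have "(LINT x|lebesgue. u x * f x) \<le> c"
    using integral_ae_borel[OF um u' test_fun_borel[OF f]] by simp
  \<comment> \<open>\<open>c\<close> is the pairing with \<open>f\<close> minus the pairing with
    \<open>h\<close>; the former cancels, and \<open>u x * h x = \<bar>h x\<bar> ^ ?m\<close> is
    left.\<close>
  then have "(LINT x|lebesgue. \<bar>h x\<bar> ^ ?m) \<le> 0"
    by (simp add: c_def u_def psi_mult_self[OF m])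
  then have "(LINT x|lebesgue. \<bar>h x\<bar> ^ ?m) = 0" by (intro antisym) auto
  then have h0: "AE x in lebesgue. h x = 0"
    using integral_nonneg_eq_0_iff_AE[OF h(2)] by simp
  obtain g where g: "g \<in> ?K" "(LINT x|lebesgue. \<bar>f x - h x - g x\<bar> ^ ?m) < \<delta>" using h(3)[OF \<delta>] by blast
  note [measurable] = K(1)[OF g(1)]
  have "(LINT x|lebesgue. \<bar>f x - h x - g x\<bar> ^ ?m) = (LINT x|lebesgue. \<bar>f x - g x\<bar> ^ ?m)"
    using h0 by (intro integral_cong_AE) auto
  then show ?thesis using g by auto
qed

text \<open>Reduction to \<open>unit_field_approx\<close>: \<open>T\<close> is replaced by a test
  function, which is divided by \<open>CARD('n)\<close> times a bound for its norm; the field found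
  for the quotient is multiplied back.\<close>

lemma SCH0_approx:
  fixes T :: "'n::card2 bv \<Rightarrow>\<^sub>L real"
  assumes T: "T \<in> SCH0" and e: "e > 0"
  shows "\<exists>v. test_field v \<and> (\<forall>x. norm (v x) \<le> real CARD('n) * norm T + e) \<and> norm (T - Lambda (divergence v)) \<le> e"
proof -
  let ?m = "real CARD('n)"
  have m: "?m > 0" by simp
  \<comment> \<open>Three errors \<open>e1\<close> add up in the functional, and
    \<open>2 * e1\<close> is multiplied by \<open>?m\<close> in the bound of the field; the divisor
    \<open>4 * (?m + 1)\<close> covers both.\<close>
  define e1 where "e1 = e / (4 * (?m + 1))"
  have e1: "e1 > 0" "?m * (3 * e1) \<le> e" "3 * e1 \<le> e"
  proof -
    show "e1 > 0" using e m by (simp add: e1_def add_pos_pos)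
    then show "?m * (3 * e1) \<le> e" "3 * e1 \<le> e"
    proof -
      have "e = 4 * (?m + 1) * e1" using m by (simp add: e1_def)
      moreover have "?m * e1 > 0" using m \<open>e1 > 0\<close> by simp
      ultimately show "?m * (3 * e1) \<le> e" "3 * e1 \<le> e" using \<open>e1 > 0\<close> by (simp_all add: algebra_simps)
    qed
  qed
  obtain f where f: "f \<in> Lp ?m" "dist (Lambda f) T < e1"
    using T e1 unfolding SCH0_eq closure_approachable by auto
  obtain \<delta> where \<delta>: "\<delta> > 0" "\<And>f :: (real, 'n) vec \<Rightarrow> real. f \<in> Lp ?m \<Longrightarrow>
    (LINT x|lebesgue. \<bar>f x\<bar> ^ CARD('n)) \<le> \<delta> \<Longrightarrow> norm (Lambda f) \<le> e1"
    by (rule Lambda_small[OF e1(1), where 'n='n]) blast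
  obtain \<phi> where \<phi>: "test_fun \<phi>" "(LINT x|lebesgue. \<bar>f x - \<phi> x\<bar> powr ?m) < \<delta>"
    by (rule Lp_test_dense[OF m f(1) \<delta>(1)])
  note \<phi>L = test_fun_Lm[OF \<phi>(1)]
  have dL: "(\<lambda>x. f x - \<phi> x) \<in> Lp ?m" using Lm_comb[OF f(1) \<phi>L, of 1 "-1"] by simp
  have "norm (Lambda (\<lambda>x. f x - \<phi> x)) \<le> e1"
    using \<phi>(2) by (intro \<delta>(2)[OF dL]) (simp add: abs_powr_nat)
  then have f\<phi>: "norm (Lambda f - Lambda \<phi>) \<le> e1" by (simp add: Lambda_diff[OF f(1) \<phi>L])
  have T\<phi>: "norm (T - Lambda \<phi>) \<le> 2 * e1"
    using norm_triangle_ineq[of "T - Lambda f" "Lambda f - Lambda \<phi>"] f(2) f\<phi>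
    by (simp add: dist_norm norm_minus_commute)
  \<comment> \<open>The added \<open>2 * e1\<close> accounts for the distance from \<open>T\<close>
    to the test function and keeps \<open>N\<close> positive when \<open>T = 0\<close>.\<close>
  define N where "N = norm T + 2 * e1"
  have N: "N > 0" using e1 by (simp add: N_def add_nonneg_pos)
  have \<phi>N: "norm (Lambda \<phi>) \<le> N"
    using norm_triangle_ineq4[of T "T - Lambda \<phi>"] T\<phi> by (simp add: N_def)
  define f1 where "f1 x = inverse (?m * N) * \<phi> x" for x
  have f1: "test_fun f1" unfolding f1_def[abs_def] by (rule test_fun_cmult[OF \<phi>(1)])
  note f1L = test_fun_Lm[OF f1]
  have Lf1: "Lambda f1 = inverse (?m * N) *\<^sub>R Lambda \<phi>"
    unfolding f1_def[abs_def] by (rule Lambda_scale[OF \<phi>L])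
  have n1: "norm (Lambda f1) \<le> 1 / ?m"
  proof -
    have "norm (Lambda f1) = inverse (?m * N) * norm (Lambda \<phi>)" using m N by (simp add: Lf1)
    also have "\<dots> \<le> inverse (?m * N) * N" using \<phi>N m N by (intro mult_left_mono) auto
    also have "\<dots> = 1 / ?m" using N by (simp add: field_simps)
    finally show ?thesis .
  qed
  have e1': "e1 / (?m * N) > 0" using e1 m N by simp
  obtain \<delta>' where \<delta>': "\<delta>' > 0" "\<And>f :: (real, 'n) vec \<Rightarrow> real. f \<in> Lp ?m \<Longrightarrow>
    (LINT x|lebesgue. \<bar>f x\<bar> ^ CARD('n)) \<le> \<delta>' \<Longrightarrow> norm (Lambda f) \<le> e1 / (?m * N)"
    by (rule Lambda_small[OF e1', where 'n='n]) blast
  obtain v where v: "v \<in> unit_fields" "(LINT x|lebesgue. \<bar>f1 x - divergence v x\<bar> ^ CARD('n)) < \<delta>'"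
    using unit_field_approx[OF f1 n1 \<delta>'(1)] by blast
  have tv: "test_field v" and v1: "\<And>x. norm (v x) \<le> 1" using v by (auto simp: unit_fields_def)
  note gL = test_fun_Lm[OF test_fun_divergence[OF tv]]
  have "(\<lambda>x. f1 x - divergence v x) \<in> Lp ?m" using Lm_comb[OF f1L gL, of 1 "-1"] by simp
  then have "norm (Lambda (\<lambda>x. f1 x - divergence v x)) \<le> e1 / (?m * N)" using v(2) by (intro \<delta>'(2)) auto
  then have A: "norm (Lambda f1 - Lambda (divergence v)) \<le> e1 / (?m * N)" by (simp add: Lambda_diff[OF f1L gL])
  define v' where "v' x = (?m * N) *\<^sub>R v x" for x
  have tv': "test_field v'" and dv': "divergence v' = (\<lambda>x. (?m * N) * divergence v x)"
    using test_field_scale[OF tv, of "?m * N"] by (auto simp: v'_def[abs_def])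
  have "Lambda \<phi> - Lambda (divergence v') = (?m * N) *\<^sub>R (Lambda f1 - Lambda (divergence v))"
  proof -
    have nz: "(?m * N) * inverse (?m * N) = 1" using N by (intro right_inverse) simp
    show ?thesis by (simp only: dv' Lambda_scale[OF gL] Lf1 scaleR_diff_right scaleR_scaleR nz scaleR_one)
  qed
  then have "norm (Lambda \<phi> - Lambda (divergence v')) = (?m * N) * norm (Lambda f1 - Lambda (divergence v))"
    using m N by simp
  also have "\<dots> \<le> (?m * N) * (e1 / (?m * N))" using A m N by (intro mult_left_mono) auto
  also have "\<dots> = e1" using m N by simp
  finally have B: "norm (Lambda \<phi> - Lambda (divergence v')) \<le> e1" .
  have "norm (T - Lambda (divergence v')) \<le> e"
    using norm_triangle_ineq[of "T - Lambda \<phi>" "Lambda \<phi> - Lambda (divergence v')"] T\<phi> B e1 by simp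
  moreover have "norm (v' x) \<le> ?m * norm T + e" for x
  proof -
    have "norm (v' x) = (?m * N) * norm (v x)" using m N by (simp add: v'_def)
    also have "\<dots> \<le> (?m * N) * 1" using v1 m N by (intro mult_left_mono) auto
    also have "\<dots> = ?m * norm T + ?m * (2 * e1)" by (simp add: N_def algebra_simps)
    also have "?m * (2 * e1) \<le> ?m * (3 * e1)" using e1 by (intro mult_left_mono) auto
    finally show ?thesis using e1(2) by simp
  qed
  ultimately show ?thesis using tv' by blast
qed

section \<open>Summation of corrections\<close>

text \<open>The remainder after \<open>k\<close> steps is at most \<open>L * (1/2) ^ k\<close> and
  is solved up to an error half as large, so the fields decrease geometrically. The class
  \<open>P\<close> and the size \<open>N\<close> are abstract because the scheme serves both the sup
  norm and the L_1 norm.\<close>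

lemma summing_scheme:
  fixes D :: "'v \<Rightarrow> 'f::real_normed_vector"
  assumes T: "T \<in> S" and C: "C \<ge> 0"
    and step: "\<And>T e. T \<in> S \<Longrightarrow> e > 0 \<Longrightarrow> \<exists>v. P v \<and> N v \<le> C * norm T + e \<and> norm (T - D v) \<le> e \<and> T - D v \<in> S"
  shows "\<exists>(v :: nat \<Rightarrow> 'v) K. K > 0 \<and> (\<forall>k. P (v k) \<and> N (v k) \<le> K * (1/2) ^ k \<and> norm (T - (\<Sum>j<k. D (v j))) \<le> K * (1/2) ^ k)"
proof -
  define L where "L = norm T + 1"
  have L: "L > 0" "norm T \<le> L" by (auto simp: L_def add_nonneg_pos)
  \<comment> \<open>A state consists of the current remainder and the field that produced it. At
    stage 0 the field is \<open>undefined\<close>; \<open>v k\<close> is read off at stage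
    \<open>Suc k\<close>.\<close>
  define Q where "Q k X = (fst X \<in> S \<and> norm (fst X) \<le> L * (1/2) ^ k)" for k :: nat and X :: "'f \<times> 'v"
  define R where "R k X Y = (P (snd Y) \<and> N (snd Y) \<le> (C + 1) * L * (1/2) ^ k \<and> fst Y = fst X - D (snd Y))"
    for k :: nat and X Y :: "'f \<times> 'v"
  have "\<exists>X. X 0 = (T, undefined) \<and> (\<forall>k. Q k (X k) \<and> R k (X k) (X (Suc k)))"
  proof -
    have "\<exists>X. \<forall>k. (Q k (X k) \<and> (k = 0 \<longrightarrow> X k = (T, undefined))) \<and> R k (X k) (X (Suc k))"
    proof (rule dependent_nat_choice)
      show "\<exists>x. Q 0 x \<and> (0 = (0::nat) \<longrightarrow> x = (T, undefined))"
        by (rule exI[of _ "(T, undefined)"]) (use T L in \<open>simp add: Q_def\<close>)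
      fix X k assume X: "Q k X \<and> (k = 0 \<longrightarrow> X = (T, undefined))"
      have "L * (1/2) ^ Suc k > 0" using L by simp
      then obtain v where v: "P v" "N v \<le> C * norm (fst X) + L * (1/2) ^ Suc k"
        "norm (fst X - D v) \<le> L * (1/2) ^ Suc k" "fst X - D v \<in> S"
        using step[of "fst X" "L * (1/2) ^ Suc k"] X by (auto simp: Q_def)
      have "C * norm (fst X) \<le> C * (L * (1/2) ^ k)" using X C by (intro mult_left_mono) (auto simp: Q_def)
      moreover have "L * (1/2) ^ Suc k \<le> L * (1/2) ^ k" using L by simp
      ultimately have "N v \<le> C * (L * (1/2) ^ k) + L * (1/2) ^ k" using v(2) by linarith
      then have "N v \<le> (C + 1) * L * (1/2) ^ k" by (simp add: algebra_simps)
      then show "\<exists>Y. (Q (Suc k) Y \<and> (Suc k = 0 \<longrightarrow> Y = (T, undefined))) \<and> R k X Y"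
        using v by (intro exI[of _ "(fst X - D v, v)"]) (simp add: Q_def R_def)
    qed
    then show ?thesis by blast
  qed
  then obtain X where X0: "X 0 = (T, undefined)" and Q: "\<And>k. Q k (X k)" and R: "\<And>k. R k (X k) (X (Suc k))" by blast
  define v where "v k = snd (X (Suc k))" for k
  have res: "fst (X k) = T - (\<Sum>j<k. D (v j))" for k
    by (induction k) (use R in \<open>auto simp: X0 v_def R_def\<close>)
  show ?thesis
  proof (intro exI[of _ v] exI[of _ "(C + 1) * L"] conjI allI)
    show "(C + 1) * L > 0" using C L by simp
    fix k
    show "P (v k)" "N (v k) \<le> (C + 1) * L * (1/2) ^ k" using R[of k] by (auto simp: R_def v_def)
    have "norm (T - (\<Sum>j<k. D (v j))) \<le> 1 * (L * (1/2) ^ k)" using Q[of k] res[of k] by (simp add: Q_def)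
    also have "1 * (L * (1/2) ^ k) \<le> (C + 1) * (L * (1/2) ^ k)"
      by (rule mult_right_mono) (use C L in auto)
    finally show "norm (T - (\<Sum>j<k. D (v j))) \<le> (C + 1) * L * (1/2) ^ k" by (simp add: mult.assoc)
  qed
qed

section \<open>The divergence on fields vanishing at infinity\<close>

lemma distr_deriv: "is_distr_deriv i (rep_bv u) (distr_deriv i u)"
proof -
  have "\<exists>\<sigma>. is_distr_deriv i (rep_bv u) \<sigma>" using rep_bv_BV[of u] unfolding BV_fun_def by blast
  then show ?thesis unfolding distr_deriv_def by (rule someI_ex)
qed

lemma signed_borel_distr_deriv:
  obtains \<mu> \<nu> where "distr_deriv i u = (\<mu>, \<nu>)" "finite_measure \<mu>" "sets \<mu> = sets borel" "finite_measure \<nu>" "sets \<nu> = sets borel"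
  using distr_deriv[of i u] by (cases "distr_deriv i u") (auto simp: is_distr_deriv_def signed_borel_measure_def)

lemma integrable_finite_cont:
  fixes g :: "real^'n \<Rightarrow> real"
  assumes "continuous_on UNIV g" "\<And>x. \<bar>g x\<bar> \<le> B" "finite_measure \<mu>" "sets \<mu> = sets borel"
  shows "integrable \<mu> g"
proof -
  have "g \<in> borel_measurable borel" using assms(1) by (rule borel_measurable_continuous_onI)
  then have "g \<in> borel_measurable \<mu>" using assms(4) by (simp cong: measurable_cong_sets)
  then show ?thesis
    using assms by (intro finite_measure.integrable_const_bound[where B=B]) auto
qed

lemma signed_integral_diff:
  fixes g h :: "(real, 'n::card2) vec \<Rightarrow> real"
  assumes "continuous_on UNIV g" "\<And>x. \<bar>g x\<bar> \<le> B" "continuous_on UNIV h" "\<And>x. \<bar>h x\<bar> \<le> C"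
  shows "signed_integral (distr_deriv i u) (\<lambda>x. g x - h x) = signed_integral (distr_deriv i u) g - signed_integral (distr_deriv i u) h"
proof -
  obtain \<mu> \<nu> where s: "distr_deriv i u = (\<mu>, \<nu>)" "finite_measure \<mu>" "sets \<mu> = sets borel" "finite_measure \<nu>" "sets \<nu> = sets borel"
    by (rule signed_borel_distr_deriv)
  show ?thesis
    using integrable_finite_cont[OF assms(1,2)] integrable_finite_cont[OF assms(3,4)] s
    by (simp add: signed_integral_def)
qed

text \<open>A crude bound by the total masses of the chosen pair of measures. It depends on this
  choice and expresses continuity under uniform limits; the bound by the norm of \<open>u\<close> is
  derived from it by density.\<close>

lemma signed_integral_bounded:
  fixes u :: "'n::card2 bv"
  obtains M where "M \<ge> 0" "\<And>g B. continuous_on UNIV g \<Longrightarrow> (\<And>x. \<bar>g x\<bar> \<le> B) \<Longrightarrow> \<bar>signed_integral (distr_deriv i u) g\<bar> \<le> B * M"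
proof -
  obtain \<mu> \<nu> where s: "distr_deriv i u = (\<mu>, \<nu>)" "finite_measure \<mu>" "sets \<mu> = sets borel" "finite_measure \<nu>" "sets \<nu> = sets borel"
    by (rule signed_borel_distr_deriv)
  have b: "\<bar>LINT x|M. g x\<bar> \<le> B * measure M (space M)"
    if "finite_measure M" "sets M = sets borel" "continuous_on UNIV g" "\<And>x. \<bar>g x\<bar> \<le> B" for M and g :: "(real, 'n) vec \<Rightarrow> real" and B
  proof -
    have "\<bar>LINT x|M. g x\<bar> \<le> (LINT x|M. B)"
      using that integrable_finite_cont[OF that(3,4,1,2)]
      by (intro order_trans[OF integral_abs_bound] integral_mono) (auto simp: finite_measure.integrable_const)
    then show ?thesis by (simp add: mult.commute)
  qed
  show ?thesis
  proof
    show "measure \<mu> (space \<mu>) + measure \<nu> (space \<nu>) \<ge> 0" by simp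
    fix g :: "(real, 'n) vec \<Rightarrow> real" and B assume g: "continuous_on UNIV g" "\<And>x. \<bar>g x\<bar> \<le> B"
    show "\<bar>signed_integral (distr_deriv i u) g\<bar> \<le> B * (measure \<mu> (space \<mu>) + measure \<nu> (space \<nu>))"
      using b[OF s(2,3) g] b[OF s(4,5) g] s(1) by (simp add: signed_integral_def distrib_left)
  qed
qed

lemma at_infinity_small:
  assumes "(f \<longlongrightarrow> 0) at_infinity" "e > 0"
  shows "\<exists>b. \<forall>x. norm x \<ge> b \<longrightarrow> norm (f x) < e"
  using assms unfolding Lim_at_infinity by simp

lemma C0_test_approx:
  fixes g :: "real^'n \<Rightarrow> real"
  assumes g: "continuous_on UNIV g" and lim: "(g \<longlongrightarrow> 0) at_infinity" and B: "\<And>x. \<bar>g x\<bar> \<le> B" and e: "e > 0"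
  shows "\<exists>\<phi>. test_fun \<phi> \<and> (\<forall>x. \<bar>\<phi> x - g x\<bar> \<le> e \<and> \<bar>\<phi> x\<bar> \<le> B)"
proof -
  obtain R where R: "\<And>x. norm x \<ge> R \<Longrightarrow> \<bar>g x\<bar> < e / 2"
    using at_infinity_small[OF lim half_gt_zero[OF e]] by auto
  define cut where "cut x = max 0 (min 1 (R + 1 - norm x))" for x :: "real^'n"
  have cut: "0 \<le> cut x" "cut x \<le> 1" for x by (auto simp: cut_def)
  have G0: "g x * cut x = 0" if "norm x \<ge> R + 1" for x using that by (simp add: cut_def)
  have Gc: "Cc (\<lambda>x. g x * cut x)"
    by (rule CcI[OF _ G0]) (auto simp: cut_def intro!: continuous_intros g)
  have GB: "\<bar>g x * cut x\<bar> \<le> B" for x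
  proof -
    have "\<bar>g x\<bar> * \<bar>cut x\<bar> \<le> \<bar>g x\<bar> * 1" using cut[of x] by (intro mult_left_mono) auto
    then show ?thesis using B[of x] by (simp add: abs_mult)
  qed
  have near: "\<bar>g x * cut x - g x\<bar> \<le> e / 2" for x
  proof (cases "norm x \<ge> R")
    case True
    have "g x * cut x - g x = - (g x * (1 - cut x))" by (simp add: algebra_simps)
    then have "\<bar>g x * cut x - g x\<bar> = \<bar>g x\<bar> * \<bar>1 - cut x\<bar>" by (simp only: abs_minus_cancel abs_mult)
    also have "\<bar>1 - cut x\<bar> = 1 - cut x" using cut[of x] by simp
    also have "\<bar>g x\<bar> * (1 - cut x) \<le> \<bar>g x\<bar> * 1" using cut[of x] by (intro mult_left_mono) auto
    finally show ?thesis using R[OF True] by simp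
  next
    case False
    then have "cut x = 1" by (simp add: cut_def)
    then show ?thesis using e by simp
  qed
  have "\<exists>\<phi>. test_fun \<phi> \<and> (\<forall>x. \<bar>\<phi> x - g x * cut x\<bar> \<le> e / 2 \<and> \<bar>\<phi> x\<bar> \<le> B) \<and> (\<forall>x. norm x \<ge> R + 1 + 1 \<longrightarrow> \<phi> x = 0)"
    by (rule Cc_test_approx[OF Gc GB G0]) (use e in auto)
  then obtain \<phi> where \<phi>: "test_fun \<phi>" "\<And>x. \<bar>\<phi> x - g x * cut x\<bar> \<le> e / 2" "\<And>x. \<bar>\<phi> x\<bar> \<le> B" by blast
  have "\<bar>\<phi> x - g x\<bar> \<le> e" for x using \<phi>(2)[of x] near[of x] by linarith
  then show ?thesis using \<phi> by blast
qed

lemma signed_integral_test: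
  assumes "test_fun \<phi>"
  shows "signed_integral (distr_deriv i u) \<phi> = - (LINT x|lebesgue. rep_bv u x * partial_deriv i \<phi> x)"
  using distr_deriv[of i u] assms by (simp add: is_distr_deriv_def)

text \<open>For tests this is the definition of the variation, applied to a coordinate field.
  Uniform approximation extends it to \<open>g\<close>, the error being controlled by the crude
  bound \<open>M\<close>.\<close>

lemma signed_integral_C0_bound:
  fixes u :: "'n::card2 bv"
  assumes g: "continuous_on UNIV g" "(g \<longlongrightarrow> 0) at_infinity" "\<And>x. \<bar>g x\<bar> \<le> B" and B: "B > 0"
  shows "\<bar>signed_integral (distr_deriv i u) g\<bar> \<le> B * norm u"
proof (rule field_le_epsilon)
  fix e :: real assume e: "e > 0"
  obtain M where M: "M \<ge> 0" "\<And>g B. continuous_on UNIV g \<Longrightarrow> (\<And>x. \<bar>g x\<bar> \<le> B) \<Longrightarrow> \<bar>signed_integral (distr_deriv i u) g\<bar> \<le> B * M"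
    by (rule signed_integral_bounded[of i u]) blast
  have e': "e / (M + 1) > 0" using e M by simp
  obtain \<phi> where \<phi>: "test_fun \<phi>" "\<And>x. \<bar>\<phi> x - g x\<bar> \<le> e / (M + 1)" "\<And>x. \<bar>\<phi> x\<bar> \<le> B"
    using C0_test_approx[OF g e'] by blast
  have c\<phi>: "continuous_on UNIV \<phi>" using \<phi>(1) by (simp add: test_fun_def smooth_continuous)
  have "\<bar>signed_integral (distr_deriv i u) (\<lambda>x. g x - \<phi> x)\<bar> \<le> e / (M + 1) * M"
    by (rule M(2)) (use \<phi>(2) in \<open>auto intro!: continuous_intros g c\<phi> simp: abs_minus_commute\<close>)
  also have "\<dots> \<le> e" using e M by (simp add: field_simps)
  finally have 1: "\<bar>signed_integral (distr_deriv i u) g - signed_integral (distr_deriv i u) \<phi>\<bar> \<le> e"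
    using signed_integral_diff[OF g(1,3) c\<phi> \<phi>(3)] by simp
  have b: "(LINT x|lebesgue. rep_bv u x * partial_deriv i (\<lambda>x. s / B * \<phi> x) x) \<le> norm u" if "\<bar>s\<bar> = 1" for s
    unfolding norm_bv_eq
  proof (rule BV_fun_test_bound[OF rep_bv_BV test_fun_cmult[OF \<phi>(1)]])
    show "\<bar>s / B * \<phi> x\<bar> \<le> 1" for x using that B \<phi>(3)[of x] by (simp add: abs_mult divide_le_eq)
  qed
  have "s / B * (LINT x|lebesgue. rep_bv u x * partial_deriv i \<phi> x) \<le> norm u" if "\<bar>s\<bar> = 1" for s
  proof -
    have "(LINT x|lebesgue. rep_bv u x * partial_deriv i (\<lambda>x. s / B * \<phi> x) x) = s / B * (LINT x|lebesgue. rep_bv u x * partial_deriv i \<phi> x)"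
      by (simp only: partial_deriv_cmult[OF \<phi>(1)] mult.left_commute[of _ "s / B"] integral_mult_right_zero)
    then show ?thesis using b[OF that] by simp
  qed
  from this[of 1] this[of "-1"] have "\<bar>LINT x|lebesgue. rep_bv u x * partial_deriv i \<phi> x\<bar> \<le> B * norm u"
    using B by (simp add: field_simps abs_le_iff)
  then have "\<bar>signed_integral (distr_deriv i u) \<phi>\<bar> \<le> B * norm u" by (simp add: signed_integral_test[OF \<phi>(1)])
  then show "\<bar>signed_integral (distr_deriv i u) g\<bar> \<le> B * norm u + e" using 1 by linarith
qed

lemma C0_fields_comp:
  assumes "v \<in> C0_fields"
  shows "continuous_on UNIV (\<lambda>x. v x $ i)" "((\<lambda>x. v x $ i) \<longlongrightarrow> 0) at_infinity"
proof -
  have c: "continuous_on UNIV v" and l: "(v \<longlongrightarrow> 0) at_infinity" using assms by (auto simp: C0_fields_def)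
  show "continuous_on UNIV (\<lambda>x. v x $ i)" by (rule continuous_on_component[OF c])
  show "((\<lambda>x. v x $ i) \<longlongrightarrow> 0) at_infinity" using tendsto_vec_nth[OF l, of i] by simp
qed

lemma C0_fields_bounded:
  fixes v :: "real^'n \<Rightarrow> real^'n"
  assumes v: "v \<in> C0_fields"
  obtains B where "B > 0" "\<And>x i. \<bar>v x $ i\<bar> \<le> B"
proof -
  have c: "continuous_on UNIV v" and l: "(v \<longlongrightarrow> 0) at_infinity" using v by (auto simp: C0_fields_def)
  obtain b where b: "\<And>x. norm x \<ge> b \<Longrightarrow> norm (v x) < 1"
    using at_infinity_small[OF l zero_less_one] by blast
  have "compact (v ` cball 0 b)" using c by (meson compact_continuous_image continuous_on_subset subset_UNIV compact_cball)
  then obtain B where B: "B > 0" "\<forall>y\<in>v ` cball 0 b. norm y \<le> B"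
    using bounded_pos compact_imp_bounded by blast
  show ?thesis
  proof
    show "B + 1 > 0" using B by simp
    fix x i
    have "norm (v x) \<le> B + 1"
    proof (cases "norm x \<ge> b")
      case True
      then show ?thesis using b[of x] B(1) by simp
    next
      case False
      then have "norm (v x) \<le> B" using B(2) by auto
      then show ?thesis by simp
    qed
    then show "\<bar>v x $ i\<bar> \<le> B + 1" using component_le_norm_cart[of "v x" i] by linarith
  qed
qed

lemma C0_fields_diff: "v \<in> C0_fields \<Longrightarrow> w \<in> C0_fields \<Longrightarrow> (\<lambda>x. v x - w x) \<in> C0_fields"
  unfolding C0_fields_def using tendsto_diff[of v 0 at_infinity w 0] by (auto intro!: continuous_intros)

lemma div_C0_diff:
  fixes v w :: "(real, 'n::card2) vec \<Rightarrow> (real, 'n) vec"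
  assumes v: "v \<in> C0_fields" and w: "w \<in> C0_fields"
  shows "div_C0 (\<lambda>x. v x - w x) u = div_C0 v u - div_C0 w u"
proof -
  obtain B where B: "B > 0" "\<And>x i. \<bar>v x $ i\<bar> \<le> B" by (rule C0_fields_bounded[OF v]) blast
  obtain C where C: "C > 0" "\<And>x i. \<bar>w x $ i\<bar> \<le> C" by (rule C0_fields_bounded[OF w]) blast
  show ?thesis
    unfolding div_C0_def vector_minus_component
    using signed_integral_diff[OF C0_fields_comp(1)[OF v] B(2) C0_fields_comp(1)[OF w] C(2)]
    by (simp add: sum_subtractf)
qed

lemma div_C0_bound:
  fixes v :: "(real, 'n::card2) vec \<Rightarrow> (real, 'n) vec"
  assumes v: "v \<in> C0_fields" and B: "B > 0" "\<And>x. norm (v x) \<le> B"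
  shows "\<bar>div_C0 v u\<bar> \<le> real CARD('n) * B * norm u"
proof -
  have "\<bar>div_C0 v u\<bar> \<le> (\<Sum>i\<in>UNIV. \<bar>signed_integral (distr_deriv i u) (\<lambda>x. v x $ i)\<bar>)"
    by (simp add: div_C0_def sum_abs)
  also have "\<dots> \<le> (\<Sum>i\<in>(UNIV::'n set). B * norm u)"
    using order_trans[OF component_le_norm_cart B(2)]
    by (intro sum_mono signed_integral_C0_bound C0_fields_comp[OF v] B(1)) 
  finally show ?thesis by (simp add: mult.assoc)
qed

lemma test_field_C0: "test_field v \<Longrightarrow> v \<in> C0_fields" for v :: "real^'n \<Rightarrow> real^'n"
proof -
  assume v: "test_field v"
  have l: "((\<lambda>x. v x $ i) \<longlongrightarrow> 0) at_infinity" for i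
  proof -
    have c: "Cc (\<lambda>x. v x $ i)" by (rule test_fun_Cc[OF test_field_comp[OF v]])
    obtain R B where R: "R > 0" "B > 0" "\<And>x. norm x \<ge> R \<Longrightarrow> v x $ i = 0" "\<And>x. \<bar>v x $ i\<bar> \<le> B"
      by (rule Cc_obtain[OF c]) (rule that)
    show ?thesis unfolding Lim_at_infinity
    proof (intro allI impI exI[of _ R])
      fix e :: real and x :: "real^'n" assume "e > 0" "R \<le> norm x"
      then show "dist (v x $ i) 0 < e" using R(3)[of x] by simp
    qed
  qed
  have "continuous_on UNIV (\<lambda>x. \<chi> i. v x $ i)"
    using Cc_cont[OF test_fun_Cc[OF test_field_comp[OF v]]] by (intro continuous_on_vec_lambda)
  moreover have "((\<lambda>x. \<chi> i. v x $ i) \<longlongrightarrow> (\<chi> i. 0)) at_infinity" by (intro tendsto_vec_lambda l)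
  moreover have "(\<chi> i. 0) = (0 :: real^'n)" by (simp add: vec_eq_iff)
  ultimately show "v \<in> C0_fields" by (simp add: C0_fields_def)
qed

lemma div_C0_test:
  fixes v :: "(real, 'n::card2) vec \<Rightarrow> (real, 'n) vec"
  assumes v: "test_field v"
  shows "div_C0 v u = blinfun_apply (Lambda (divergence v)) u"
proof -
  have i: "integrable lebesgue (\<lambda>x. rep_bv u x * partial_deriv i (\<lambda>y. v y $ i) x)" for i
    by (intro Lp_pairing(1)[OF BV_fun_Lp[OF rep_bv_BV]] test_fun_Lm test_fun_partial test_field_comp v)
  have "div_C0 v u = (\<Sum>i\<in>UNIV. LINT x|lebesgue. rep_bv u x * partial_deriv i (\<lambda>y. v y $ i) x)"
    by (simp add: div_C0_def signed_integral_test[OF test_field_comp[OF v]] sum_negf)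
  also have "\<dots> = (LINT x|lebesgue. rep_bv u x * divergence v x)"
    unfolding divergence_def sum_distrib_left using i by (rule Bochner_Integration.integral_sum[symmetric])
  finally show ?thesis by (simp add: Lambda_apply[OF test_fun_Lm[OF test_fun_divergence[OF v]]])
qed

lemma C0_field_approx:
  fixes v :: "real^'n \<Rightarrow> real^'n"
  assumes v: "v \<in> C0_fields" and e: "e > 0"
  shows "\<exists>w. test_field w \<and> (\<forall>x. norm (v x - w x) \<le> e)"
proof -
  let ?m = "real CARD('n)"
  have e': "e / ?m > 0" using e by simp
  obtain B where B: "B > 0" "\<And>x i. \<bar>v x $ i\<bar> \<le> B" by (rule C0_fields_bounded[OF v]) blast
  have "\<forall>i. \<exists>\<phi>. test_fun \<phi> \<and> (\<forall>x. \<bar>\<phi> x - v x $ i\<bar> \<le> e / ?m \<and> \<bar>\<phi> x\<bar> \<le> B)"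
    using C0_test_approx[OF C0_fields_comp[OF v] B(2) e'] by blast
  then obtain \<phi> where \<phi>: "\<And>i. test_fun (\<phi> i)" "\<And>i x. \<bar>\<phi> i x - v x $ i\<bar> \<le> e / ?m" by metis
  define w where "w x = (\<chi> i. \<phi> i x)" for x
  have "norm (v x - w x) \<le> e" for x
  proof -
    have "norm (v x - w x) \<le> (\<Sum>i\<in>UNIV. \<bar>(v x - w x) $ i\<bar>)" by (rule norm_le_l1_cart)
    also have "\<dots> \<le> (\<Sum>i\<in>(UNIV::'n set). e / ?m)"
      using \<phi>(2) by (intro sum_mono) (simp add: w_def abs_minus_commute)
    finally show ?thesis by simp
  qed
  moreover have "test_field w" using \<phi>(1) by (simp add: test_field_def w_def)
  ultimately show ?thesis by blast
qed

text \<open>\<open>div_C0 v\<close> is so far a bare function. The functionals of approximating test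
  fields form a Cauchy sequence by \<open>div_C0_bound\<close>; its limit lies in the closure and
  agrees with \<open>div_C0 v\<close> pointwise.\<close>

lemma div_C0_in_SCH0:
  fixes v :: "(real, 'n::card2) vec \<Rightarrow> (real, 'n) vec"
  assumes v: "v \<in> C0_fields"
  shows "\<exists>T\<in>SCH0. blinfun_apply T = div_C0 v"
proof -
  let ?m = "real CARD('n)"
  have "\<forall>k. \<exists>w. test_field w \<and> (\<forall>x. norm (v x - w x) \<le> 1 / real (Suc k))"
    using C0_field_approx[OF v] by (metis of_nat_0_less_iff zero_less_Suc zero_less_divide_1_iff)
  then obtain w where w: "\<And>k. test_field (w k)" "\<And>k x. norm (v x - w k x) \<le> 1 / real (Suc k)" by metis
  define T where "T k = Lambda (divergence (w k))" for k
  have dv: "\<bar>div_C0 v u - blinfun_apply (T k) u\<bar> \<le> ?m * (1 / real (Suc k)) * norm u" for k u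
  proof -
    have "div_C0 v u - blinfun_apply (T k) u = div_C0 (\<lambda>x. v x - w k x) u"
      by (simp add: T_def div_C0_test[OF w(1), symmetric] div_C0_diff[OF v test_field_C0[OF w(1)]])
    then show ?thesis using div_C0_bound[OF C0_fields_diff[OF v test_field_C0[OF w(1)]] _ w(2)] by simp
  qed
  have z: "(\<lambda>k. 1 / real (Suc k)) \<longlonglongrightarrow> 0" by (rule LIMSEQ_Suc) (rule lim_1_over_n)
  have "Cauchy T"
  proof (rule CauchyI)
    fix e :: real assume e: "e > 0"
    have e2: "e / (4 * ?m) > 0" using e by simp
    obtain N where N: "\<And>k. k \<ge> N \<Longrightarrow> 1 / real (Suc k) < e / (4 * ?m)"
      using order_tendstoD(2)[OF z e2] unfolding eventually_sequentially by blast
    have half: "?m * (1 / real (Suc k)) \<le> e / 4" if "k \<ge> N" for k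
    proof -
      have "?m * (1 / real (Suc k)) \<le> ?m * (e / (4 * ?m))" using N[OF that] by (intro mult_left_mono) auto
      then show ?thesis by simp
    qed
    have "norm (T j - T k) < e" if jk: "j \<ge> N" "k \<ge> N" for j k
    proof -
      have "norm (T j - T k) \<le> e / 2"
      proof (rule norm_blinfun_bound)
        fix u :: "'n bv"
        have "?m * (1 / real (Suc j)) * norm u \<le> e / 4 * norm u" "?m * (1 / real (Suc k)) * norm u \<le> e / 4 * norm u"
          by (rule mult_right_mono[OF half[OF jk(1)]], simp, rule mult_right_mono[OF half[OF jk(2)]], simp)
        then have "\<bar>div_C0 v u - blinfun_apply (T j) u\<bar> \<le> e / 4 * norm u" "\<bar>div_C0 v u - blinfun_apply (T k) u\<bar> \<le> e / 4 * norm u"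
          using dv[of u j] dv[of u k] by linarith+
        then have "\<bar>blinfun_apply (T j) u - blinfun_apply (T k) u\<bar> \<le> e / 4 * norm u + e / 4 * norm u" by linarith
        also have "\<dots> = e / 2 * norm u" by simp
        finally show "norm (blinfun_apply (T j - T k) u) \<le> e / 2 * norm u"
          by (simp add: blinfun.diff_left)
      qed (use e in simp)
      then show ?thesis using e by simp
    qed
    then show "\<exists>M. \<forall>m\<ge>M. \<forall>n\<ge>M. norm (T m - T n) < e" by blast
  qed
  then obtain T' where T': "T \<longlonglongrightarrow> T'" using Cauchy_convergent convergent_def by blast
  have "blinfun_apply T' u = div_C0 v u" for u :: "'n bv"
  proof -
    have "(\<lambda>k. blinfun_apply (T k) u) \<longlonglongrightarrow> blinfun_apply T' u"
      by (intro tendsto_intros T')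
    moreover have "(\<lambda>k. blinfun_apply (T k) u) \<longlonglongrightarrow> div_C0 v u"
    proof (rule LIM_zero_cancel, rule Lim_null_comparison)
      show "\<forall>\<^sub>F k in sequentially. norm (blinfun_apply (T k) u - div_C0 v u) \<le> ?m * (1 / real (Suc k)) * norm u"
        using dv by (simp add: abs_minus_commute)
      have "(\<lambda>k. ?m * (1 / real (Suc k)) * norm u) \<longlonglongrightarrow> ?m * 0 * norm u" by (intro tendsto_intros z)
      then show "(\<lambda>k. ?m * (1 / real (Suc k)) * norm u) \<longlonglongrightarrow> 0" by simp
    qed
    ultimately show ?thesis by (rule LIMSEQ_unique)
  qed
  moreover have "T' \<in> SCH0"
    unfolding SCH0_eq closure_sequential
    using T' test_fun_Lm[OF test_fun_divergence[OF w(1)]] by (intro exI[of _ T]) (auto simp: T_def)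
  ultimately show ?thesis by (auto simp: fun_eq_iff)
qed

lemma SCH0_diff_Lambda:
  fixes T :: "'n::card2 bv \<Rightarrow>\<^sub>L real"
  assumes T: "T \<in> SCH0" and g: "g \<in> Lp (real CARD('n))"
  shows "T - Lambda g \<in> SCH0"
proof -
  obtain X where X: "\<And>k. X k \<in> Lambda ` Lp (real CARD('n))" "X \<longlonglongrightarrow> T"
    using T unfolding SCH0_eq closure_sequential by blast
  have "X k - Lambda g \<in> Lambda ` Lp (real CARD('n))" for k
  proof -
    obtain f where f: "f \<in> Lp (real CARD('n))" "X k = Lambda f" using X(1)[of k] by blast
    have "(\<lambda>x. f x - g x) \<in> Lp (real CARD('n))" using Lm_comb[OF f(1) g, of 1 "-1"] by simp
    then show ?thesis unfolding f(2) Lambda_diff[OF f(1) g, symmetric] by blast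
  qed
  moreover have "(\<lambda>k. X k - Lambda g) \<longlonglongrightarrow> T - Lambda g" by (intro tendsto_intros X)
  ultimately show ?thesis unfolding SCH0_eq closure_sequential
    by (intro exI[of _ "\<lambda>k. X k - Lambda g"]) blast
qed

text \<open>The corrections decrease geometrically in the sup norm, so their sum is a uniform limit
  of test fields. Continuity and decay at infinity pass to this limit, and by
  \<open>div_C0_bound\<close> so does the divergence.\<close>

lemma SCH0_div_C0:
  fixes T :: "'n::card2 bv \<Rightarrow>\<^sub>L real"
  assumes T: "T \<in> SCH0"
  shows "\<exists>v\<in>C0_fields. div_C0 v = blinfun_apply T"
proof -
  let ?m = "real CARD('n)"
  \<comment> \<open>\<open>summing_scheme\<close> measures a field by one number; the boundedness
    \<open>bdd\<close> of test fields recovers the pointwise bound from the supremum.\<close>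
  define N where "N v = (SUP x. norm (v x))" for v :: "(real, 'n) vec \<Rightarrow> (real, 'n) vec"
  have bdd: "bdd_above (range (\<lambda>x. norm (v x)))" if v: "test_field v" for v :: "(real, 'n) vec \<Rightarrow> (real, 'n) vec"
  proof -
    obtain B where B: "B > 0" "\<And>x i. \<bar>v x $ i\<bar> \<le> B" by (rule C0_fields_bounded[OF test_field_C0[OF v]]) blast
    have "norm (v x) \<le> ?m * B" for x
      using order_trans[OF norm_le_l1_cart[of "v x"] sum_mono[of UNIV "\<lambda>i. \<bar>v x $ i\<bar>" "\<lambda>_. B"]] B(2) by simp
    then show ?thesis by (intro bdd_aboveI2)
  qed
  have "\<exists>(v :: nat \<Rightarrow> (real, 'n) vec \<Rightarrow> (real, 'n) vec) K. K > 0 \<and> (\<forall>k. test_field (v k) \<and> N (v k) \<le> K * (1/2) ^ k \<and> norm (T - (\<Sum>j<k. Lambda (divergence (v j)))) \<le> K * (1/2) ^ k)"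
  proof (rule summing_scheme[where S=SCH0 and C="?m"])
    fix T :: "'n bv \<Rightarrow>\<^sub>L real" and e :: real assume T: "T \<in> SCH0" "e > 0"
    obtain v where v: "test_field v" "\<And>x. norm (v x) \<le> ?m * norm T + e" "norm (T - Lambda (divergence v)) \<le> e"
      using SCH0_approx[OF T] by blast
    have "N v \<le> ?m * norm T + e" unfolding N_def using v(2) by (intro cSUP_least) auto
    moreover have "T - Lambda (divergence v) \<in> SCH0"
      by (rule SCH0_diff_Lambda[OF T(1) test_fun_Lm[OF test_fun_divergence[OF v(1)]]])
    ultimately show "\<exists>v. test_field v \<and> N v \<le> ?m * norm T + e \<and> norm (T - Lambda (divergence v)) \<le> e \<and> T - Lambda (divergence v) \<in> SCH0"
      using v by blast
  qed (use T in auto)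
  then obtain v K where K: "K > 0" and v: "\<And>k. test_field (v k)" "\<And>k. N (v k) \<le> K * (1/2) ^ k"
    "\<And>k. norm (T - (\<Sum>j<k. Lambda (divergence (v j)))) \<le> K * (1/2) ^ k" by blast
  have nv: "norm (v k x) \<le> K * (1/2) ^ k" for k x
    using cSUP_upper[OF UNIV_I bdd[OF v(1)[of k]], of x] v(2)[of k] unfolding N_def by linarith
  have sK: "summable (\<lambda>k. K * (1/2::real) ^ k)" by (intro summable_mult summable_geometric) simp
  define V where "V x = (\<Sum>k. v k x)" for x
  define W where "W k x = (\<Sum>j<k. v j x)" for k x
  have tW: "test_field (W k)" for k unfolding W_def[abs_def] by (intro test_field_sum v)
  have uni: "uniform_limit UNIV W V sequentially"
    unfolding W_def[abs_def] V_def[abs_def] by (rule Weierstrass_m_test[OF nv sK])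
  have cV: "continuous_on UNIV V"
    using test_field_C0[OF tW] by (intro uniform_limit_theorem[OF _ uni]) (auto simp: C0_fields_def)
  have app: "\<exists>k. \<forall>k'\<ge>k. \<forall>x. norm (V x - W k' x) \<le> e" if "e > 0" for e
    using uniform_limitD[OF uni that] unfolding eventually_sequentially
    by (metis UNIV_I dist_norm dist_commute less_imp_le)
  have V: "V \<in> C0_fields"
    unfolding C0_fields_def
  proof (intro CollectI conjI cV)
    show "(V \<longlongrightarrow> 0) at_infinity"
      unfolding Lim_at_infinity
    proof (intro allI impI)
      fix e :: real assume e: "e > 0"
      obtain k where k: "\<And>x. norm (V x - W k x) \<le> e / 2" using app[of "e / 2"] e by fastforce
      have "(W k \<longlongrightarrow> 0) at_infinity" using test_field_C0[OF tW] by (simp add: C0_fields_def)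
      then obtain b where b: "\<And>x. norm x \<ge> b \<Longrightarrow> norm (W k x) < e / 2"
        using at_infinity_small[OF _ half_gt_zero[OF e]] by blast
      have "norm (V x) < e" if "norm x \<ge> b" for x
        using k[of x] b[OF that] norm_triangle_ineq[of "V x - W k x" "W k x"] by simp
      then show "\<exists>b. \<forall>x. norm x \<ge> b \<longrightarrow> dist (V x) 0 < e" by (auto simp: dist_norm)
    qed
  qed
  have dW: "div_C0 (W k) u = blinfun_apply (\<Sum>j<k. Lambda (divergence (v j))) u" for k u
  proof -
    have "divergence (W k) = (\<lambda>x. \<Sum>j<k. divergence (v j) x)"
    proof (induction k)
      case 0
      then show ?case by (simp add: W_def[abs_def])
    next
      case (Suc k)
      have "W (Suc k) = (\<lambda>x. 1 *\<^sub>R W k x + 1 *\<^sub>R v k x)" by (simp add: W_def fun_eq_iff)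
      then show ?case using test_field_comb(2)[OF tW[of k] v(1)[of k], of 1 1] Suc by (simp add: fun_eq_iff)
    qed
    moreover have "blinfun_apply (Lambda (\<lambda>x. \<Sum>j<k. divergence (v j) x)) u = blinfun_apply (\<Sum>j<k. Lambda (divergence (v j))) u"
    proof (induction k)
      case 0
      show ?case using Lambda_apply[OF Lp_zero, of u] by simp
    next
      case (Suc k)
      have L: "(\<lambda>x. \<Sum>j<k. divergence (v j) x) \<in> Lp (real CARD('n))"
        by (intro test_fun_Lm test_fun_sum test_fun_divergence v)
      have "Lambda (\<lambda>x. 1 * (\<Sum>j<k. divergence (v j) x) + 1 * divergence (v k) x) = 1 *\<^sub>R Lambda (\<lambda>x. \<Sum>j<k. divergence (v j) x) + 1 *\<^sub>R Lambda (divergence (v k))"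
        by (rule Lambda_comb[OF L test_fun_Lm[OF test_fun_divergence[OF v(1)]]])
      then show ?case using Suc by (simp add: blinfun.add_left)
    qed
    ultimately show ?thesis by (simp add: div_C0_test[OF tW])
  qed
  have "div_C0 V u = blinfun_apply T u" for u
  proof -
    have "\<bar>div_C0 V u - blinfun_apply T u\<bar> \<le> 0 + e" if e: "e > 0" for e
    proof -
      \<comment> \<open>\<open>norm u + 1\<close> in place of \<open>norm u\<close> keeps
        \<open>P\<close> positive, so that \<open>\<eta>\<close> can be defined by division.\<close>
      define P where "P = ?m * (norm u + 1)"
      define \<eta> where "\<eta> = e / 2 / P"
      have pos: "P > 0" unfolding P_def by (intro mult_pos_pos) (auto intro: add_nonneg_pos)
      have \<eta>: "\<eta> > 0" using e pos by (simp add: \<eta>_def)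
      obtain k0 where k0: "\<And>k x. k \<ge> k0 \<Longrightarrow> norm (V x - W k x) \<le> \<eta>" using app[OF \<eta>] by blast
      have "(\<lambda>k. K * (1/2) ^ k * norm u) \<longlonglongrightarrow> K * 0 * norm u"
        by (intro tendsto_intros LIMSEQ_realpow_zero) auto
      then have "\<forall>\<^sub>F k in sequentially. K * (1/2) ^ k * norm u < e / 2"
        using order_tendstoD(2)[of _ 0 sequentially "e / 2"] e by simp
      then obtain k1 where k1: "\<And>k. k \<ge> k1 \<Longrightarrow> K * (1/2) ^ k * norm u < e / 2" unfolding eventually_sequentially by blast
      define k where "k = max k0 k1"
      have "\<bar>div_C0 (\<lambda>x. V x - W k x) u\<bar> \<le> ?m * \<eta> * norm u"
        by (rule div_C0_bound[OF C0_fields_diff[OF V test_field_C0[OF tW]] \<eta> k0]) (simp add: k_def)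
      also have "\<dots> \<le> \<eta> * P" using \<eta> by (simp add: P_def algebra_simps)
      also have "\<dots> = e / 2" using pos by (simp add: \<eta>_def)
      finally have 1: "\<bar>div_C0 V u - div_C0 (W k) u\<bar> \<le> e / 2"
        by (simp add: div_C0_diff[OF V test_field_C0[OF tW]])
      have "\<bar>blinfun_apply (T - (\<Sum>j<k. Lambda (divergence (v j)))) u\<bar> \<le> norm (T - (\<Sum>j<k. Lambda (divergence (v j)))) * norm u"
        using norm_blinfun[of "T - (\<Sum>j<k. Lambda (divergence (v j)))" u] by simp
      also have "\<dots> \<le> K * (1/2) ^ k * norm u" using v(3) by (intro mult_right_mono) auto
      also have "\<dots> \<le> e / 2" using k1[of k] by (simp add: k_def)
      finally have "\<bar>blinfun_apply T u - div_C0 (W k) u\<bar> \<le> e / 2" by (simp add: dW blinfun.diff_left)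
      then show ?thesis using 1 by linarith
    qed
    then have "\<bar>div_C0 V u - blinfun_apply T u\<bar> \<le> 0" by (rule field_le_epsilon)
    then show ?thesis by simp
  qed
  then show ?thesis using V by (intro bexI[of _ V]) (auto simp: fun_eq_iff)
qed

lemma div_C0_image:
  "div_C0 ` (C0_fields :: ((real, 'n::card2) vec \<Rightarrow> (real, 'n) vec) set) = blinfun_apply ` (SCH0 :: ('n bv \<Rightarrow>\<^sub>L real) set)"
proof (intro set_eqI iffI)
  fix F assume "F \<in> div_C0 ` (C0_fields :: ((real, 'n) vec \<Rightarrow> (real, 'n) vec) set)"
  then obtain v where "v \<in> C0_fields" "F = div_C0 v" by blast
  then show "F \<in> blinfun_apply ` SCH0" using div_C0_in_SCH0[of v] by (metis image_eqI)
next
  fix F assume "F \<in> blinfun_apply ` (SCH0 :: ('n bv \<Rightarrow>\<^sub>L real) set)"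
  then obtain T where "T \<in> SCH0" "F = blinfun_apply T" by blast
  then show "F \<in> div_C0 ` C0_fields" using SCH0_div_C0[of T] by (metis image_eqI)
qed

section \<open>Rademacher's theorem\<close>

text \<open>Continuity excludes atoms, so an open interval is measured by the increment, and the two
  increments add up to \<open>u - l\<close>. Each measure is thereby dominated by Lebesgue measure,
  which yields absolute continuity without covering arguments.\<close>

lemma nonneg_sum_interval_measure:
  fixes F G :: "real \<Rightarrow> real"
  assumes F: "\<And>x y. x \<le> y \<Longrightarrow> F x \<le> F y" "continuous_on UNIV F"
    and G: "\<And>x y. x \<le> y \<Longrightarrow> G x \<le> G y" "continuous_on UNIV G" and FG: "\<And>x. F x + G x = x"
  shows "sum_measure (interval_measure F) (interval_measure G) = lborel"
proof (rule lborel_eqI[symmetric])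
  have Ioo: "emeasure (interval_measure H) {l<..<u} = ennreal (H u - H l)"
    if H: "\<And>x y. x \<le> y \<Longrightarrow> H x \<le> H y" "continuous_on UNIV H" and lu: "l \<le> u" for H :: "real \<Rightarrow> real" and l u
  proof (cases "l = u")
    case False
    then have lt: "l < u" using lu by simp
    have "emeasure (interval_measure H) {u..u} = ennreal (H u - H u)"
      by (rule emeasure_interval_measure_Icc[OF _ H]) auto
    then have 0: "{u} \<in> null_sets (interval_measure H)" by auto
    have "emeasure (interval_measure H) {l<..u} = ennreal (H u - H l)"
      using lu H by (intro emeasure_interval_measure_Ioc) (auto simp: continuous_on_eq_continuous_within intro: continuous_within_subset)
    moreover have "{l<..u} = {l<..<u} \<union> {u}" using lt by auto
    ultimately show ?thesis using emeasure_Un_null_set[OF _ 0, of "{l<..<u}"] by simp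
  qed simp
  show "emeasure (sum_measure (interval_measure F) (interval_measure G)) (box l u) = ennreal (\<Prod>b\<in>Basis. (u - l) \<bullet> b)"
    if "\<And>b. b \<in> Basis \<Longrightarrow> l \<bullet> b \<le> u \<bullet> b" for l u
  proof -
    have lu: "l \<le> u" using that by simp
    have "emeasure (sum_measure (interval_measure F) (interval_measure G)) {l<..<u} = ennreal (F u - F l) + ennreal (G u - G l)"
      by (simp add: emeasure_sum_measure Ioo[OF F lu] Ioo[OF G lu])
    also have "\<dots> = ennreal ((F u - F l) + (G u - G l))"
      using F(1)[OF lu] G(1)[OF lu] by (intro ennreal_plus[symmetric]) auto
    also have "(F u - F l) + (G u - G l) = u - l" using FG[of u] FG[of l] by linarith
    finally show ?thesis by simp
  qed
qed simp

text \<open>\<open>f = F - G\<close> with \<open>F\<close> and \<open>G\<close> increasing and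
  \<open>F + G\<close> the identity. By domination the Stieltjes measure of \<open>F\<close> has a
  density \<open>g\<close>; \<open>F\<close> is an indefinite integral of \<open>g\<close>, and
  Lebesgue's differentiation theorem applies.\<close>

lemma lipschitz_real_AE_differentiable_1:
  fixes f :: "real \<Rightarrow> real"
  assumes f: "1-lipschitz_on UNIV f"
  shows "AE x in lborel. f differentiable (at x)"
proof -
  define F where "F x = (x + f x) / 2" for x
  define G where "G x = (x - f x) / 2" for x
  have lip: "\<bar>f x - f y\<bar> \<le> \<bar>x - y\<bar>" for x y using lipschitz_onD[OF f, of x y] by (simp add: dist_real_def)
  have Fm: "F x \<le> F y" and Gm: "G x \<le> G y" if "x \<le> y" for x y
    using lip[of x y] that by (auto simp: F_def G_def)
  have cf: "continuous_on UNIV f" using f by (rule lipschitz_on_continuous_on)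
  have Fc: "continuous_on UNIV F" and Gc: "continuous_on UNIV G"
    unfolding F_def G_def by (auto intro!: continuous_intros cf)
  let ?\<mu> = "interval_measure F"
  have sum: "sum_measure ?\<mu> (interval_measure G) = lborel"
    by (rule nonneg_sum_interval_measure[OF Fm Fc Gm Gc]) (auto simp: F_def G_def field_simps)
  have ac: "absolutely_continuous lborel ?\<mu>"
    unfolding absolutely_continuous_def
  proof
    fix N :: "real set" assume N: "N \<in> null_sets lborel"
    then have "emeasure (sum_measure ?\<mu> (interval_measure G)) N = 0" by (simp add: sum null_setsD1)
    moreover have "N \<in> sets borel" using N by auto
    ultimately have "emeasure ?\<mu> N = 0" by (simp add: emeasure_sum_measure)
    then show "N \<in> null_sets ?\<mu>" using \<open>N \<in> sets borel\<close> by auto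
  qed
  have sf: "sigma_finite_measure ?\<mu>"
    by (rule sigma_finite_interval_measure) (use Fm Fc in \<open>auto simp: continuous_on_eq_continuous_within intro: continuous_within_subset\<close>)
  define r where "r = RN_deriv lborel ?\<mu>"
  have [measurable]: "r \<in> borel_measurable borel" unfolding r_def using borel_measurable_RN_deriv[of lborel ?\<mu>] by simp
  have dr: "density lborel r = ?\<mu>" unfolding r_def by (rule sigma_finite_measure.density_RN_deriv[OF sigma_finite_lborel ac]) simp
  have fin: "AE x in lborel. r x \<noteq> \<infinity>" unfolding r_def by (rule sigma_finite_measure.RN_deriv_finite[OF sigma_finite_lborel sf ac]) simp
  define g where "g x = enn2real (r x)" for x
  have [measurable]: "g \<in> borel_measurable borel" unfolding g_def by measurable
  have g0: "g x \<ge> 0" for x by (simp add: g_def)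
  have hi: "(g has_integral (F b - F a)) {a..b}" if ab: "a \<le> b" for a b
  proof -
    have "(\<integral>\<^sup>+x. ennreal (g x * indicator {a..b} x) \<partial>lborel) = (\<integral>\<^sup>+x. r x * indicator {a..b} x \<partial>lborel)"
    proof (rule nn_integral_cong_AE)
      show "AE x in lborel. ennreal (g x * indicator {a..b} x) = r x * indicator {a..b} x"
        using fin by eventually_elim (auto simp: g_def indicator_def less_top)
    qed
    also have "\<dots> = emeasure (density lborel r) {a..b}" by (simp add: emeasure_density)
    also have "\<dots> = ennreal (F b - F a)" unfolding dr by (rule emeasure_interval_measure_Icc[OF ab Fm Fc])
    finally have "((\<lambda>x. g x * indicator {a..b} x) has_integral (F b - F a)) UNIV"
      using Fm[OF ab] g0 by (intro nn_integral_has_integral) auto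
    moreover have "(\<lambda>x. g x * indicator {a..b} x) = (\<lambda>x. if x \<in> {a..b} then g x else 0)" by auto
    ultimately show ?thesis by (simp only: has_integral_restrict_UNIV)
  qed
  \<comment> \<open>The differentiation theorem used concerns intervals \<open>[x, x + h]\<close>
    with \<open>h > 0\<close>; left-hand quotients of \<open>F\<close> become right-hand ones for
    the reflected density.\<close>
  have hi': "((\<lambda>x. g (- x)) has_integral (F b - F a)) {-b..-a}" if "a \<le> b" for a b
    using hi[OF that] by simp
  have ex1: "g integrable_on cbox a b" for a b :: real
    using hi[of a b] by (cases "a \<le> b") (auto simp: cbox_interval)
  have ex2: "(\<lambda>x. g (- x)) integrable_on cbox a b" for a b :: real
    using hi'[of "-b" "-a"] by (cases "a \<le> b") (auto simp: cbox_interval)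
  obtain N1 where N1: "negligible N1" "\<And>x e. \<lbrakk>x \<notin> N1; 0 < e\<rbrakk> \<Longrightarrow> \<exists>d>0. \<forall>h. 0 < h \<and> h < d \<longrightarrow>
      norm (integral (cbox x (x + h *\<^sub>R One)) g /\<^sub>R h ^ DIM(real) - g x) < e"
    using integrable_ccontinuous_explicit[OF ex1] by blast
  obtain N2 where N2: "negligible N2" "\<And>x e. \<lbrakk>x \<notin> N2; 0 < e\<rbrakk> \<Longrightarrow> \<exists>d>0. \<forall>h. 0 < h \<and> h < d \<longrightarrow>
      norm (integral (cbox x (x + h *\<^sub>R One)) (\<lambda>x. g (- x)) /\<^sub>R h ^ DIM(real) - g (- x)) < e"
    using integrable_ccontinuous_explicit[OF ex2] by blast
  have diffF: "(F has_real_derivative g x) (at x)" if x: "x \<notin> N1" "- x \<notin> N2" for x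
    unfolding DERIV_def
  proof (rule LIM_I)
    fix e :: real assume e: "e > 0"
    obtain d1 where d1: "d1 > 0" "\<And>h. 0 < h \<Longrightarrow> h < d1 \<Longrightarrow> norm (integral (cbox x (x + h *\<^sub>R One)) g /\<^sub>R h ^ DIM(real) - g x) < e"
      using N1(2)[OF x(1) e] by blast
    obtain d2 where d2: "d2 > 0" "\<And>h. 0 < h \<Longrightarrow> h < d2 \<Longrightarrow> norm (integral (cbox (- x) (- x + h *\<^sub>R One)) (\<lambda>x. g (- x)) /\<^sub>R h ^ DIM(real) - g (- (- x))) < e"
      using N2(2)[OF x(2) e] by blast
    have "\<bar>(F (x + h) - F x) / h - g x\<bar> < e" if h: "h \<noteq> 0" "\<bar>h\<bar> < min d1 d2" for h
    proof (cases "h > 0")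
      case True
      have "integral {x..x + h} g = F (x + h) - F x" using hi[of x "x + h"] True by (simp add: integral_unique)
      then show ?thesis using d1(2)[of h] True h by (simp add: cbox_interval divide_inverse mult.commute)
    next
      case False
      then have k: "- h > 0" using h by simp
      have "integral {- x..- (x + h)} (\<lambda>x. g (- x)) = F x - F (x + h)" using hi'[of "x + h" x] k by (simp add: integral_unique)
      then have "\<bar>(F x - F (x + h)) * inverse (- h) - g x\<bar> < e" using d2(2)[of "- h"] k h by (simp add: cbox_interval mult.commute)
      moreover have "(F x - F (x + h)) * inverse (- h) = (F (x + h) - F x) / h" using h by (simp add: field_simps)
      ultimately show ?thesis by simp
    qed
    then show "\<exists>s>0. \<forall>h. h \<noteq> 0 \<and> norm (h - 0) < s \<longrightarrow> norm ((F (x + h) - F x) / h - g x) < e"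
      using d1(1) d2(1) by (intro exI[of _ "min d1 d2"]) auto
  qed
  \<comment> \<open>The exceptional set of the reflected problem has to be reflected back, and stays
    negligible.\<close>
  have "uminus differentiable_on N2" unfolding differentiable_on_def by (intro ballI derivative_intros)
  then have "negligible (uminus ` N2)" using N2(1) by (intro negligible_differentiable_image_negligible) auto
  then have "AE x in lebesgue. x \<notin> N1" "AE x in lebesgue. x \<notin> uminus ` N2"
    using N1(1) unfolding negligible_iff_null_sets by (auto intro: AE_not_in)
  then have "AE x in lebesgue. f differentiable (at x)"
  proof eventually_elim
    case (elim x)
    then have "- x \<notin> N2" by (metis image_eqI minus_minus)
    then have "(F has_real_derivative g x) (at x)" using diffF elim by blast
    then have "((\<lambda>x. 2 * F x - x) has_real_derivative (2 * g x - 1)) (at x)"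
      by (auto intro!: derivative_eq_intros)
    moreover have "(\<lambda>x. 2 * F x - x) = f" by (simp add: F_def fun_eq_iff field_simps)
    ultimately show ?case by (auto simp: real_differentiable_def)
  qed
  then show ?thesis by (simp add: AE_completion_iff)
qed

lemma lipschitz_real_AE_differentiable:
  fixes f :: "real \<Rightarrow> real"
  assumes f: "L-lipschitz_on UNIV f"
  shows "AE x in lborel. f differentiable (at x)"
proof -
  have L: "L \<ge> 0" using f by (rule lipschitz_on_nonneg)
  \<comment> \<open>The divisor is \<open>L + 1\<close> because \<open>L\<close> may be 0.\<close>
  have "1-lipschitz_on UNIV (\<lambda>x. f x / (L + 1))"
  proof (rule lipschitz_onI)
    fix x y :: real
    have "dist (f x) (f y) \<le> L * dist x y" using lipschitz_onD[OF f] by auto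
    also have "\<dots> \<le> (L + 1) * dist x y" by (simp add: distrib_right)
    finally show "dist (f x / (L + 1)) (f y / (L + 1)) \<le> 1 * dist x y"
      using L by (simp add: dist_real_def diff_divide_distrib[symmetric] pos_divide_le_eq mult.commute)
  qed simp
  from lipschitz_real_AE_differentiable_1[OF this] show ?thesis
  proof eventually_elim
    case (elim x)
    then obtain D where "((\<lambda>x. f x / (L + 1)) has_real_derivative D) (at x)" by (auto simp: real_differentiable_def)
    then have "((\<lambda>x. (L + 1) * (f x / (L + 1))) has_real_derivative ((L + 1) * D)) (at x)" by (rule DERIV_cmult)
    then show ?case using L by (auto simp: real_differentiable_def)
  qed
qed

section \<open>Directional derivatives of Lipschitz functions\<close>

definition dquot :: "('a::real_normed_vector \<Rightarrow> real) \<Rightarrow> 'a \<Rightarrow> real \<Rightarrow> 'a \<Rightarrow> real" where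
  "dquot u e t x = (u (x + t *\<^sub>R e) - u x) / t"

text \<open>The Cauchy condition for the difference quotients as the step tends to 0. For continuous
  \<open>u\<close> the uncountable intersections run over closed sets and the other operations are
  countable, so the set is Borel.\<close>

definition ddiff :: "('a::real_normed_vector \<Rightarrow> real) \<Rightarrow> 'a \<Rightarrow> 'a set" where
  "ddiff u e = (\<Inter>k::nat. \<Union>n::nat. \<Inter>s\<in>{s. 0 < \<bar>s\<bar> \<and> \<bar>s\<bar> < 1 / real (Suc n)}. \<Inter>t\<in>{t. 0 < \<bar>t\<bar> \<and> \<bar>t\<bar> < 1 / real (Suc n)}.
     {x. \<bar>dquot u e s x - dquot u e t x\<bar> \<le> 1 / real (Suc k)})"

lemma ddiff_borel:
  fixes u :: "'a::euclidean_space \<Rightarrow> real"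
  assumes "continuous_on UNIV u"
  shows "ddiff u e \<in> sets borel"
proof -
  have cl: "closed {x. \<bar>dquot u e s x - dquot u e t x\<bar> \<le> c}" for s t c
    unfolding dquot_def divide_inverse
    by (intro closed_Collect_le continuous_intros continuous_on_compose2[OF assms]) auto
  show ?thesis unfolding ddiff_def
    by (intro sets.countable_INT'' sets.countable_UN'' countableI_type borel_closed closed_INT ballI cl) simp_all
qed

lemma ddiff_mem:
  "x \<in> ddiff u e \<longleftrightarrow> (\<forall>k. \<exists>n. \<forall>s. 0 < \<bar>s\<bar> \<and> \<bar>s\<bar> < 1 / real (Suc n) \<longrightarrow>
     (\<forall>t. 0 < \<bar>t\<bar> \<and> \<bar>t\<bar> < 1 / real (Suc n) \<longrightarrow> \<bar>dquot u e s x - dquot u e t x\<bar> \<le> 1 / real (Suc k)))"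
  unfolding ddiff_def by (simp only: INT_iff UN_iff mem_Collect_eq Ball_def Bex_def UNIV_I simp_thms)

lemma ddiff_iff: "x \<in> ddiff u e \<longleftrightarrow> (\<exists>D. ((\<lambda>t. dquot u e t x) \<longlongrightarrow> D) (at 0))"
proof
  assume x: "x \<in> ddiff u e"
  have ex: "\<exists>n. \<forall>s t. 0 < \<bar>s\<bar> \<and> \<bar>s\<bar> < 1 / real (Suc n) \<and> 0 < \<bar>t\<bar> \<and> \<bar>t\<bar> < 1 / real (Suc n) \<longrightarrow>
    \<bar>dquot u e s x - dquot u e t x\<bar> \<le> 1 / real (Suc k)" for k
    using x[unfolded ddiff_mem, rule_format, of k] by (elim exE) (intro exI allI impI, blast)
  then obtain n where n: "\<And>k s t. 0 < \<bar>s\<bar> \<Longrightarrow> \<bar>s\<bar> < 1 / real (Suc (n k)) \<Longrightarrow> 0 < \<bar>t\<bar> \<Longrightarrow> \<bar>t\<bar> < 1 / real (Suc (n k)) \<Longrightarrow>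
    \<bar>dquot u e s x - dquot u e t x\<bar> \<le> 1 / real (Suc k)" by metis
  have "\<exists>L. \<forall>\<epsilon>>0. \<exists>d>0. \<forall>t. t \<noteq> 0 \<and> \<bar>t\<bar> < d \<longrightarrow> \<bar>dquot u e t x - L\<bar> < \<epsilon>"
  proof -
    \<comment> \<open>\<open>Suc (Suc m)\<close> makes \<open>s m\<close> strictly smaller than
      \<open>1 / real (Suc m)\<close>, as the strict bounds in \<open>n\<close> require.\<close>
    define s where "s m = 1 / real (Suc (Suc m))" for m
    have s: "s m > 0" "s m < 1 / real (Suc m)" "m \<ge> k \<Longrightarrow> s m < 1 / real (Suc k)" for m k
      by (auto simp: s_def frac_less2)
    have "Cauchy (\<lambda>m. dquot u e (s m) x)"
    proof (rule CauchyI)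
      fix \<epsilon> :: real assume "\<epsilon> > 0"
      then obtain k where k: "1 / real (Suc k) < \<epsilon>" using nat_approx_posE by blast
      have "norm (dquot u e (s i) x - dquot u e (s j) x) < \<epsilon>" if "i \<ge> n k" "j \<ge> n k" for i j
        using n[of "s i" k "s j"] s(1)[of i] s(1)[of j] s(3)[OF that(1)] s(3)[OF that(2)] k by simp
      then show "\<exists>M. \<forall>i\<ge>M. \<forall>j\<ge>M. norm (dquot u e (s i) x - dquot u e (s j) x) < \<epsilon>" by blast
    qed
    then obtain D where D: "(\<lambda>m. dquot u e (s m) x) \<longlonglongrightarrow> D" using Cauchy_convergent convergent_def by blast
    show ?thesis
    proof (rule exI[of _ D], intro allI impI)
      fix \<epsilon> :: real assume "\<epsilon> > 0"
      then obtain k where k: "1 / real (Suc k) < \<epsilon>" using nat_approx_posE by blast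
      have "\<bar>dquot u e t x - D\<bar> \<le> 1 / real (Suc k)" if t: "t \<noteq> 0" "\<bar>t\<bar> < 1 / real (Suc (n k))" for t
      proof (rule LIMSEQ_le_const2)
        show "(\<lambda>m. \<bar>dquot u e t x - dquot u e (s m) x\<bar>) \<longlonglongrightarrow> \<bar>dquot u e t x - D\<bar>" by (intro tendsto_intros D)
        have "\<bar>dquot u e t x - dquot u e (s m) x\<bar> \<le> 1 / real (Suc k)" if "m \<ge> n k" for m
          using n[of t k "s m"] t s(1)[of m] s(3)[OF that] by simp
        then show "\<exists>N. \<forall>m\<ge>N. \<bar>dquot u e t x - dquot u e (s m) x\<bar> \<le> 1 / real (Suc k)" by blast
      qed
      then show "\<exists>d>0. \<forall>t. t \<noteq> 0 \<and> \<bar>t\<bar> < d \<longrightarrow> \<bar>dquot u e t x - D\<bar> < \<epsilon>"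
        using k by (intro exI[of _ "1 / real (Suc (n k))"]) force
    qed
  qed
  then show "\<exists>D. ((\<lambda>t. dquot u e t x) \<longlongrightarrow> D) (at 0)" by (auto simp: LIM_def dist_real_def)
next
  assume "\<exists>D. ((\<lambda>t. dquot u e t x) \<longlongrightarrow> D) (at 0)"
  then obtain D where D: "((\<lambda>t. dquot u e t x) \<longlongrightarrow> D) (at 0)" by blast
  show "x \<in> ddiff u e" unfolding ddiff_mem
  proof
    fix k :: nat
    have k2: "1 / real (Suc k) / 2 > 0" by simp
    obtain d where d: "d > 0" "\<And>t. t \<noteq> 0 \<Longrightarrow> \<bar>t\<bar> < d \<Longrightarrow> \<bar>dquot u e t x - D\<bar> < 1 / real (Suc k) / 2"
      using LIM_D[OF D k2] unfolding real_norm_def diff_0_right by blast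
    obtain n where n: "1 / real (Suc n) < d" using d(1) nat_approx_posE by blast
    have "\<bar>dquot u e s x - dquot u e t x\<bar> \<le> 1 / real (Suc k)"
      if "0 < \<bar>s\<bar>" "\<bar>s\<bar> < 1 / real (Suc n)" "0 < \<bar>t\<bar>" "\<bar>t\<bar> < 1 / real (Suc n)" for s t
    proof -
      have "s \<noteq> 0" "\<bar>s\<bar> < d" "t \<noteq> 0" "\<bar>t\<bar> < d" using that n by auto
      then have "\<bar>dquot u e s x - D\<bar> < 1 / real (Suc k) / 2" "\<bar>dquot u e t x - D\<bar> < 1 / real (Suc k) / 2" using d(2) by blast+
      then have "\<bar>dquot u e s x - D\<bar> + \<bar>dquot u e t x - D\<bar> < 1 / real (Suc k)" by (rule less_le_trans[OF add_strict_mono]) (simp only: field_sum_of_halves order_refl)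
      then show ?thesis by arith
    qed
    then show "\<exists>n. \<forall>s. 0 < \<bar>s\<bar> \<and> \<bar>s\<bar> < 1 / real (Suc n) \<longrightarrow>
     (\<forall>t. 0 < \<bar>t\<bar> \<and> \<bar>t\<bar> < 1 / real (Suc n) \<longrightarrow> \<bar>dquot u e s x - dquot u e t x\<bar> \<le> 1 / real (Suc k))"
      by (intro exI[of _ n] allI impI) blast
  qed
qed

text \<open>On every line parallel to \<open>e\<close> the bad set has length 0 by the
  one-dimensional case. Averaging over the translations by \<open>t *\<^sub>R e\<close> and Fubini
  turn this into measure 0, without coordinates adapted to \<open>e\<close>.\<close>

lemma AE_ddiff:
  fixes u :: "'a::euclidean_space \<Rightarrow> real"
  assumes u: "L-lipschitz_on UNIV u"
  shows "AE x in lborel. x \<in> ddiff u e"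
proof -
  let ?B = "- ddiff u e"
  have B[measurable]: "?B \<in> sets borel"
    using ddiff_borel[OF lipschitz_on_continuous_on[OF u]] by auto
  have line: "(\<integral>\<^sup>+t. indicator ?B (x + t *\<^sub>R e) \<partial>lborel) = 0" for x
  proof -
    have "(L * norm e)-lipschitz_on UNIV (\<lambda>t. u (x + t *\<^sub>R e))"
    proof (rule lipschitz_onI)
      fix s t :: real
      have "dist (u (x + s *\<^sub>R e)) (u (x + t *\<^sub>R e)) \<le> L * dist (x + s *\<^sub>R e) (x + t *\<^sub>R e)"
        by (rule lipschitz_onD[OF u UNIV_I UNIV_I])
      also have "dist (x + s *\<^sub>R e) (x + t *\<^sub>R e) = norm e * dist s t"
        by (simp add: dist_norm scaleR_diff_left[symmetric] mult.commute)
      finally show "dist (u (x + s *\<^sub>R e)) (u (x + t *\<^sub>R e)) \<le> L * norm e * dist s t" by (simp add: mult.assoc)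
    qed (use lipschitz_on_nonneg[OF u] in simp)
    then have "AE t in lborel. (\<lambda>t. u (x + t *\<^sub>R e)) differentiable (at t)"
      by (rule lipschitz_real_AE_differentiable)
    then have "AE t in lborel. indicator ?B (x + t *\<^sub>R e) = (0 :: ennreal)"
    proof eventually_elim
      case (elim t)
      then obtain D where "((\<lambda>t. u (x + t *\<^sub>R e)) has_real_derivative D) (at t)" by (auto simp: real_differentiable_def)
      then have "((\<lambda>h. dquot u e h (x + t *\<^sub>R e)) \<longlongrightarrow> D) (at 0)"
        by (simp add: DERIV_def dquot_def scaleR_add_left add.assoc)
      then have "x + t *\<^sub>R e \<in> ddiff u e" using ddiff_iff by blast
      then show ?case by simp
    qed
    then show ?thesis by (subst nn_integral_0_iff_AE) auto
  qed
  have sh: "(\<integral>\<^sup>+x. indicator ?B (x + t *\<^sub>R e) \<partial>lborel) = emeasure lborel ?B" for t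
  proof -
    have "(\<integral>\<^sup>+x. indicator ?B x \<partial>distr lborel borel ((+) (t *\<^sub>R e))) = (\<integral>\<^sup>+x. indicator ?B (t *\<^sub>R e + x) \<partial>lborel)"
      by (rule nn_integral_distr) auto
    then show ?thesis by (simp add: lborel_distr_plus add.commute)
  qed
  \<comment> \<open>By translation invariance the measure of \<open>?B\<close> is an average over
    \<open>t\<close> in the unit interval, whose length is 1.\<close>
  have "emeasure lborel ?B = (\<integral>\<^sup>+t. emeasure lborel ?B * indicator {0..1::real} t \<partial>lborel)"
    by (subst nn_integral_cmult_indicator) auto
  also have "\<dots> = (\<integral>\<^sup>+t. \<integral>\<^sup>+x. indicator ?B (x + t *\<^sub>R e) * indicator {0..1} t \<partial>lborel \<partial>lborel)"
    by (intro nn_integral_cong) (simp add: nn_integral_multc sh)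
  also have "\<dots> = (\<integral>\<^sup>+x. \<integral>\<^sup>+t. indicator ?B (x + t *\<^sub>R e) * indicator {0..1} t \<partial>lborel \<partial>lborel)"
    by (rule lborel_pair.Fubini') measurable
  also have "\<dots> \<le> (\<integral>\<^sup>+x. \<integral>\<^sup>+t. indicator ?B (x + t *\<^sub>R e) \<partial>lborel \<partial>lborel)"
    by (intro nn_integral_mono) (auto simp: indicator_def)
  also have "\<dots> = 0" by (simp add: line)
  finally have "?B \<in> null_sets lborel" by auto
  then show ?thesis by (auto dest: AE_not_in)
qed

text \<open>A limit along the steps \<open>1 / real (Suc n)\<close>, hence Borel, and 0 off
  \<open>ddiff\<close>, so that \<open>dlim_bound\<close> holds at every point and not just almost
  everywhere.\<close>

definition dlim :: "('a::real_normed_vector \<Rightarrow> real) \<Rightarrow> 'a \<Rightarrow> 'a \<Rightarrow> real" where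
  "dlim u e x = lim (\<lambda>n. dquot u e (1 / real (Suc n)) x) * indicator (ddiff u e) x"

lemma dlim_tendsto:
  assumes "x \<in> ddiff u e"
  shows "((\<lambda>t. dquot u e t x) \<longlongrightarrow> dlim u e x) (at 0)" "(\<lambda>n. dquot u e (1 / real (Suc n)) x) \<longlonglongrightarrow> dlim u e x"
proof -
  obtain D where D: "((\<lambda>t. dquot u e t x) \<longlongrightarrow> D) (at 0)" using assms ddiff_iff by blast
  have z: "filterlim (\<lambda>n. 1 / real (Suc n)) (at 0) sequentially"
    unfolding filterlim_at by (intro conjI LIMSEQ_Suc lim_1_over_n) (simp add: eventually_sequentially)
  have l: "(\<lambda>n. dquot u e (1 / real (Suc n)) x) \<longlonglongrightarrow> D"
    by (rule filterlim_compose[OF D z])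
  then have "dlim u e x = D" unfolding dlim_def using assms by (simp add: limI)
  then show "((\<lambda>t. dquot u e t x) \<longlongrightarrow> dlim u e x) (at 0)" "(\<lambda>n. dquot u e (1 / real (Suc n)) x) \<longlonglongrightarrow> dlim u e x"
    using D l by auto
qed

lemma dquot_bound:
  assumes u: "L-lipschitz_on UNIV u" shows "\<bar>dquot u e t x\<bar> \<le> L * norm e"
proof (cases "t = 0")
  case False
  have "\<bar>u (x + t *\<^sub>R e) - u x\<bar> \<le> L * norm (t *\<^sub>R e)"
    using lipschitz_onD[OF u, of "x + t *\<^sub>R e" x] by (simp add: dist_norm)
  then show ?thesis using False by (simp add: dquot_def abs_divide pos_divide_le_eq mult_ac)
qed (use lipschitz_on_nonneg[OF u] in \<open>simp add: dquot_def\<close>)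

lemma dlim_bound:
  assumes u: "L-lipschitz_on UNIV u" shows "\<bar>dlim u e x\<bar> \<le> L * norm e"
proof (cases "x \<in> ddiff u e")
  case True
  have "(\<lambda>n. \<bar>dquot u e (1 / real (Suc n)) x\<bar>) \<longlonglongrightarrow> \<bar>dlim u e x\<bar>" by (intro tendsto_intros dlim_tendsto True)
  then show ?thesis by (rule LIMSEQ_le_const2) (use dquot_bound[OF u] in auto)
qed (use lipschitz_on_nonneg[OF u] in \<open>simp add: dlim_def\<close>)

lemma dlim_borel:
  fixes u :: "'a::euclidean_space \<Rightarrow> real"
  assumes u: "continuous_on UNIV u"
  shows "dlim u e \<in> borel_measurable borel"
proof -
  have [measurable]: "u \<in> borel_measurable borel" using u by (rule borel_measurable_continuous_onI)
  have [measurable]: "ddiff u e \<in> sets borel" by (rule ddiff_borel[OF u])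
  have "(\<lambda>x. lim (\<lambda>n. dquot u e (1 / real (Suc n)) x)) \<in> borel_measurable borel"
    by (rule borel_measurable_lim_metric) (simp add: dquot_def)
  then show ?thesis unfolding dlim_def[abs_def] by (intro borel_measurable_times borel_measurable_indicator) simp_all
qed

text \<open>The difference quotients converge to \<open>dlim\<close> almost everywhere and
  boundedly, while their pairings with \<open>\<phi>\<close> also converge to the integral against
  the derivative of \<open>\<phi>\<close>; the two limits agree.\<close>

lemma lipschitz_weak_derivative:
  fixes u :: "real^'n \<Rightarrow> real"
  assumes u: "L-lipschitz_on UNIV u" and \<phi>: "test_fun \<phi>"
  shows "(LINT x|lborel. dlim u e x * \<phi> x) = - (LINT x|lborel. u x * (\<Sum>i\<in>UNIV. e $ i * partial_deriv i \<phi> x))"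
proof -
  have cu: "continuous_on UNIV u" by (rule lipschitz_on_continuous_on[OF u])
  note [measurable] = dlim_borel[OF cu, of e] test_fun_borel[OF \<phi>] borel_measurable_continuous_onI[OF cu]
  have "(\<lambda>n. LINT x|lborel. dquot u e (1 / real (Suc n)) x * \<phi> x) \<longlonglongrightarrow> (LINT x|lborel. dlim u e x * \<phi> x)"
  proof (rule integral_dominated_convergence[where w="\<lambda>x. L * norm e * \<bar>\<phi> x\<bar>"])
    show "integrable lborel (\<lambda>x. L * norm e * \<bar>\<phi> x\<bar>)" using Cc_integrable[OF test_fun_Cc[OF \<phi>]] by simp
    show "AE x in lborel. (\<lambda>n. dquot u e (1 / real (Suc n)) x * \<phi> x) \<longlonglongrightarrow> dlim u e x * \<phi> x"
      using AE_ddiff[OF u, of e] by eventually_elim (intro tendsto_intros dlim_tendsto)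
    show "AE x in lborel. norm (dquot u e (1 / real (Suc n)) x * \<phi> x) \<le> L * norm e * \<bar>\<phi> x\<bar>" for n
      by (intro AE_I2) (simp add: abs_mult mult_right_mono dquot_bound[OF u])
  qed (simp_all add: dquot_def)
  moreover have "(\<lambda>n. LINT x|lborel. dquot u e (1 / real (Suc n)) x * \<phi> x) \<longlonglongrightarrow> - (LINT x|lborel. u x * (\<Sum>i\<in>UNIV. e $ i * partial_deriv i \<phi> x))"
    using difference_quotient_tendsto[OF continuous_loc_int[OF cu] \<phi>, of e] by (simp add: dquot_def)
  ultimately show ?thesis by (rule LIMSEQ_unique)
qed

lemma loc_int_bounded:
  fixes f :: "real^'n \<Rightarrow> real"
  assumes [measurable]: "f \<in> borel_measurable borel" and "\<And>x. \<bar>f x\<bar> \<le> B"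
  shows "loc_int f"
  unfolding loc_int_def
proof (intro conjI allI impI)
  fix K :: "(real^'n) set" assume K: "compact K"
  have [measurable]: "K \<in> sets borel" using K by (simp add: compact_imp_closed borel_closed)
  have "integrable lborel (\<lambda>x. indicator K x * B)" using loc_int_const[of B] K unfolding loc_int_def by blast
  then show "integrable lborel (\<lambda>x. indicator K x * f x)"
    by (rule Bochner_Integration.integrable_bound) (use assms(2) in \<open>auto simp: indicator_def intro!: AE_I2 intro: order_trans[OF _ abs_ge_self]\<close>)
qed simp

text \<open>Both sides are weak derivatives of \<open>u\<close> in direction \<open>e\<close>,
  because the derivative of a test is linear in the direction; hence all tests annihilate their
  difference.\<close>

lemma dlim_linear_AE:
  fixes u :: "real^'n \<Rightarrow> real"
  assumes u: "L-lipschitz_on UNIV u"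
  shows "AE x in lborel. dlim u e x = (\<Sum>i\<in>UNIV. e $ i * dlim u (axis i 1) x)"
proof -
  have cu: "continuous_on UNIV u" by (rule lipschitz_on_continuous_on[OF u])
  note [measurable] = dlim_borel[OF cu] borel_measurable_continuous_onI[OF cu]
  define a where "a x = dlim u e x - (\<Sum>i\<in>UNIV. e $ i * dlim u (axis i 1) x)" for x
  have [measurable]: "a \<in> borel_measurable borel" unfolding a_def by measurable
  have ld: "loc_int (dlim u e')" for e' by (rule loc_int_bounded[OF _ dlim_bound[OF u]]) measurable
  have "\<bar>a x\<bar> \<le> L * norm e + (\<Sum>i\<in>(UNIV::'n set). \<bar>e $ i\<bar> * (L * 1))" for x
  proof -
    have "\<bar>\<Sum>i\<in>UNIV. e $ i * dlim u (axis i 1) x\<bar> \<le> (\<Sum>i\<in>(UNIV::'n set). \<bar>e $ i\<bar> * (L * 1))"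
      using dlim_bound[OF u, of "axis i 1" x for i]
      by (intro order_trans[OF sum_abs] sum_mono) (simp add: abs_mult mult_left_mono)
    then show ?thesis using dlim_bound[OF u, of e x] unfolding a_def by linarith
  qed
  then have la: "loc_int a" by (intro loc_int_bounded) auto
  have "(LINT x|lborel. a x * \<phi> x) \<le> 0" if \<phi>: "test_fun \<phi>" for \<phi>
  proof -
    note int = loc_int_mult[OF ld test_fun_Cc[OF \<phi>]]
    have iu: "integrable lborel (\<lambda>x. u x * partial_deriv i \<phi> x)" for i
      by (rule loc_int_mult[OF continuous_loc_int[OF cu] test_fun_Cc[OF test_fun_partial[OF \<phi>]]])
    have "(LINT x|lborel. a x * \<phi> x) = (LINT x|lborel. dlim u e x * \<phi> x - (\<Sum>i\<in>UNIV. e $ i * (dlim u (axis i 1) x * \<phi> x)))"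
      by (simp add: a_def left_diff_distrib sum_distrib_right mult.assoc)
    also have "\<dots> = (LINT x|lborel. dlim u e x * \<phi> x) - (\<Sum>i\<in>UNIV. e $ i * (LINT x|lborel. dlim u (axis i 1) x * \<phi> x))"
      using int by (simp add: Bochner_Integration.integral_sum)
    also have "\<dots> = - (LINT x|lborel. u x * (\<Sum>i\<in>UNIV. e $ i * partial_deriv i \<phi> x)) + (\<Sum>i\<in>UNIV. e $ i * (LINT x|lborel. u x * partial_deriv i \<phi> x))"
      by (simp add: lipschitz_weak_derivative[OF u \<phi>] sum_axis sum_negf)
    also have "(LINT x|lborel. u x * (\<Sum>i\<in>UNIV. e $ i * partial_deriv i \<phi> x)) = (LINT x|lborel. (\<Sum>i\<in>UNIV. e $ i * (u x * partial_deriv i \<phi> x)))"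
      by (simp add: sum_distrib_left mult.left_commute)
    also have "\<dots> = (\<Sum>i\<in>UNIV. e $ i * (LINT x|lborel. u x * partial_deriv i \<phi> x))"
      using iu by (simp add: Bochner_Integration.integral_sum)
    finally show ?thesis by simp
  qed
  then have "integrable lborel a" "(LINT x|lborel. \<bar>a x\<bar>) \<le> 0" using integrable_from_tests[OF la, of 0] by blast+
  then have "(LINT x|lborel. \<bar>a x\<bar>) = 0" "integrable lborel (\<lambda>x. \<bar>a x\<bar>)" by (auto intro: antisym)
  then have "AE x in lborel. \<bar>a x\<bar> = 0" using integral_nonneg_eq_0_iff_AE[of lborel "\<lambda>x. \<bar>a x\<bar>"] by simp
  then show ?thesis by eventually_elim (simp add: a_def)
qed

text \<open>Compactness of the unit sphere leaves finitely many directions of \<open>E\<close> to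
  consider, along which the convergence is uniform; the Lipschitz condition carries the estimate to
  the directions nearby.\<close>

lemma directional_imp_has_derivative:
  fixes u :: "real^'n \<Rightarrow> real"
  assumes u: "L-lipschitz_on UNIV u" and E: "\<And>X. open X \<Longrightarrow> X \<noteq> {} \<Longrightarrow> \<exists>e\<in>E. e \<in> X"
    and d: "\<And>e. e \<in> E \<Longrightarrow> ((\<lambda>t. dquot u e t x) \<longlongrightarrow> e \<bullet> g) (at 0)"
  shows "(u has_derivative (\<lambda>h. h \<bullet> g)) (at x)"
  unfolding has_derivative_at_alt
proof (intro conjI allI impI)
  show "bounded_linear (\<lambda>h. h \<bullet> g)" by (rule bounded_linear_inner_left)
  fix \<epsilon> :: real assume \<epsilon>: "\<epsilon> > 0"
  have L: "L \<ge> 0" by (rule lipschitz_on_nonneg[OF u])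
  \<comment> \<open>Errors per unit of length: \<open>L * \<eta>\<close> from changing the direction
    in \<open>u\<close>, \<open>\<eta>\<close> from the quotient, and \<open>\<eta> * norm g\<close>
    from changing the direction in the linear part.\<close>
  define \<eta> where "\<eta> = \<epsilon> / (L + 1 + norm g)"
  have pos: "L + 1 + norm g > 0" using L norm_ge_zero[of g] by linarith
  have \<eta>: "\<eta> > 0" "\<eta> * (L + 1 + norm g) = \<epsilon>" using \<epsilon> pos by (simp_all add: \<eta>_def)
  have "sphere (0::real^'n) 1 \<subseteq> (\<Union>e\<in>E. ball e \<eta>)"
  proof
    fix \<xi> :: "real^'n"
    obtain e where "e \<in> E" "e \<in> ball \<xi> \<eta>" using E[OF open_ball, of \<xi> \<eta>] \<eta>(1) by auto
    then show "\<xi> \<in> (\<Union>e\<in>E. ball e \<eta>)" by (auto simp: dist_commute)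
  qed
  then obtain E' where E': "E' \<subseteq> E" "finite E'" "sphere (0::real^'n) 1 \<subseteq> (\<Union>e\<in>E'. ball e \<eta>)"
    using compactE_image[OF compact_sphere, of E "\<lambda>e. ball e \<eta>"] by (metis open_ball)
  have "\<forall>e\<in>E'. \<exists>d>0. \<forall>t. t \<noteq> 0 \<and> \<bar>t\<bar> < d \<longrightarrow> \<bar>dquot u e t x - e \<bullet> g\<bar> < \<eta>"
  proof
    fix e assume "e \<in> E'"
    then have "((\<lambda>t. dquot u e t x) \<longlongrightarrow> e \<bullet> g) (at 0)" using d E'(1) by blast
    then show "\<exists>d>0. \<forall>t. t \<noteq> 0 \<and> \<bar>t\<bar> < d \<longrightarrow> \<bar>dquot u e t x - e \<bullet> g\<bar> < \<eta>"
      using \<eta>(1) by (auto simp: LIM_def dist_real_def)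
  qed
  then obtain D where D: "\<And>e. e \<in> E' \<Longrightarrow> D e > 0" "\<And>e t. e \<in> E' \<Longrightarrow> t \<noteq> 0 \<Longrightarrow> \<bar>t\<bar> < D e \<Longrightarrow> \<bar>dquot u e t x - e \<bullet> g\<bar> < \<eta>" by metis
  define r where "r = Min (insert 1 (D ` E'))"
  have r: "r > 0" "\<And>e. e \<in> E' \<Longrightarrow> r \<le> D e" using D(1) E'(2) by (auto simp: r_def)
  show "\<exists>d>0. \<forall>y. norm (y - x) < d \<longrightarrow> norm (u y - u x - (y - x) \<bullet> g) \<le> \<epsilon> * norm (y - x)"
  proof (intro exI[of _ r] conjI allI impI r(1))
    fix y assume y: "norm (y - x) < r"
    show "norm (u y - u x - (y - x) \<bullet> g) \<le> \<epsilon> * norm (y - x)"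
    proof (cases "y = x")
      case False
      define t where "t = norm (y - x)"
      define \<xi> where "\<xi> = (1 / t) *\<^sub>R (y - x)"
      have t: "t > 0" "y = x + t *\<^sub>R \<xi>" "y - x = t *\<^sub>R \<xi>" using False by (auto simp: t_def \<xi>_def)
      have "norm \<xi> = 1" using t(1) by (simp add: \<xi>_def t_def)
      then obtain e where e: "e \<in> E'" "norm (e - \<xi>) < \<eta>" using E'(3) by (force simp: dist_norm)
      have "\<bar>u y - u (x + t *\<^sub>R e)\<bar> \<le> L * norm (t *\<^sub>R (e - \<xi>))"
        using lipschitz_onD[OF u, of "x + t *\<^sub>R e" y] t by (simp add: dist_norm algebra_simps abs_minus_commute norm_minus_commute)
      also have "\<dots> = L * (t * norm (e - \<xi>))" using t(1) by simp
      also have "\<dots> \<le> L * (t * \<eta>)" using e(2) t(1) L by (intro mult_left_mono) auto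
      finally have 1: "\<bar>u y - u (x + t *\<^sub>R e)\<bar> \<le> L * (t * \<eta>)" .
      have "\<bar>dquot u e t x - e \<bullet> g\<bar> < \<eta>" using D(2)[OF e(1), of t] t(1) y r(2)[OF e(1)] by (simp add: t_def)
      then have "t * \<bar>dquot u e t x - e \<bullet> g\<bar> \<le> t * \<eta>" using t(1) by (intro mult_left_mono) auto
      moreover have "t * \<bar>dquot u e t x - e \<bullet> g\<bar> = \<bar>t * (dquot u e t x - e \<bullet> g)\<bar>" using t(1) by (simp add: abs_mult)
      moreover have "t * (dquot u e t x - e \<bullet> g) = u (x + t *\<^sub>R e) - u x - t * (e \<bullet> g)" using t(1) by (simp add: dquot_def field_simps)
      ultimately have 2: "\<bar>u (x + t *\<^sub>R e) - u x - t * (e \<bullet> g)\<bar> \<le> t * \<eta>" by simp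
      have "\<bar>(e - \<xi>) \<bullet> g\<bar> \<le> norm (e - \<xi>) * norm g" by (rule Cauchy_Schwarz_ineq2)
      also have "\<dots> \<le> \<eta> * norm g" using e(2) by (intro mult_right_mono) auto
      finally have "t * \<bar>(e - \<xi>) \<bullet> g\<bar> \<le> t * (\<eta> * norm g)" using t(1) by (intro mult_left_mono) auto
      then have 3: "\<bar>t * (e \<bullet> g) - t * (\<xi> \<bullet> g)\<bar> \<le> t * (\<eta> * norm g)"
        using t(1) by (simp add: inner_diff_left abs_mult right_diff_distrib[symmetric])
      have "\<bar>u y - u x - t * (\<xi> \<bullet> g)\<bar> \<le> L * (t * \<eta>) + t * \<eta> + t * (\<eta> * norm g)"
        using 1 2 3 by linarith
      also have "\<dots> = (\<eta> * (L + 1 + norm g)) * t" by (simp add: algebra_simps)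
      finally show ?thesis unfolding \<eta>(2) t(3) using t(1) \<open>norm \<xi> = 1\<close> by simp
    qed simp
  qed
qed

text \<open>A countable dense set of directions is enough, so the exceptional sets of
  differentiability and of linearity unite to a single null set.\<close>

theorem Rademacher:
  fixes u :: "real^'n \<Rightarrow> real"
  assumes u: "L-lipschitz_on UNIV u"
  shows "AE x in lborel. (u has_derivative (\<lambda>h. h \<bullet> (\<chi> i. dlim u (axis i 1) x))) (at x)"
proof -
  obtain E :: "(real^'n) set" where E: "countable E" "\<And>X. open X \<Longrightarrow> X \<noteq> {} \<Longrightarrow> \<exists>e\<in>E. e \<in> X"
    using countable_dense_exists[where 'a="real^'n"] by blast
  have "AE x in lborel. \<forall>e\<in>E. x \<in> ddiff u e \<and> dlim u e x = (\<Sum>i\<in>UNIV. e $ i * dlim u (axis i 1) x)"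
    using AE_ddiff[OF u] dlim_linear_AE[OF u] by (intro AE_ball_countable'[OF _ E(1)]) auto
  then show ?thesis
  proof eventually_elim
    case (elim x)
    let ?g = "\<chi> i. dlim u (axis i 1) x"
    show ?case
    proof (rule directional_imp_has_derivative[OF u E(2)])
      fix e assume "e \<in> E"
      then have "x \<in> ddiff u e" "dlim u e x = e \<bullet> ?g" using elim by (auto simp: inner_vec_def)
      then show "((\<lambda>t. dquot u e t x) \<longlongrightarrow> e \<bullet> ?g) (at 0)" using dlim_tendsto(1)[of x u e] by simp
    qed
  qed
qed

section \<open>The primal side: the Lipschitz-free space\<close>

text \<open>The weight makes \<open>x \<mapsto> norm x\<close> square integrable, so that convergence in the dual weighted
  \<open>L\<^sub>2\<close> space controls the pairing with all Lipschitz functions vanishing at \<open>0\<close>.\<close>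

lemma second_moment_weight:
  obtains r :: "real^'n \<Rightarrow> real"
  where "r \<in> borel_measurable borel" "\<And>x. r x > 0" "integrable lborel (\<lambda>x. (norm x)\<^sup>2 * r x)"
    "\<And>R. \<exists>a>0. \<forall>x. norm x \<le> R \<longrightarrow> a \<le> r x"
proof -
  define V where "V k = measure lborel (cball (0::real^'n) (real k))" for k
  \<comment> \<open>\<open>P k\<close> dominates both 1 and \<open>(real k)\<^sup>2 * V k\<close>,
    so with \<open>a k = (1/2) ^ k / P k\<close> the weight and its second moment are bounded by
    geometric series.\<close>
  define P where "P k = (1 + (real k)\<^sup>2) * (1 + V k)" for k
  define a where "a k = (1/2) ^ k / P k" for k
  define r where "r x = (\<Sum>k. a k * indicator (cball (0::real^'n) (real k)) x)" for x
  have V: "V k \<ge> 0" for k by (simp add: V_def)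
  have P1: "P k \<ge> 1" for k
  proof -
    have "1 * 1 \<le> P k" unfolding P_def using V[of k] by (intro mult_mono) auto
    then show ?thesis by simp
  qed
  have P0: "P k > 0" for k using P1[of k] by linarith
  have a: "a k > 0" "a k \<le> (1/2) ^ k" for k
    using P1[of k] P0[of k] by (simp_all add: a_def pos_divide_le_eq mult_le_cancel_left1)
  have g: "summable (\<lambda>k. (1/2::real) ^ k)" by (rule summable_geometric) simp
  have sm: "summable (\<lambda>k. a k * indicator (cball (0::real^'n) (real k)) x)" for x
  proof (rule summable_comparison_test[OF _ g], intro exI allI impI)
    show "norm (a k * indicator (cball (0::real^'n) (real k)) x) \<le> (1/2) ^ k" for k
      using a[of k] by (simp add: indicator_def)
  qed
  \<comment> \<open>A single summand already bounds the weight from below on a ball; from this comes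
    the local integrability of \<open>1 / r\<close>.\<close>
  have lo: "a k \<le> r x" if "norm x \<le> real k" for k x
  proof -
    have "(\<Sum>j\<in>{k}. a j * indicator (cball (0::real^'n) (real j)) x) \<le> r x"
      unfolding r_def using a by (intro sum_le_suminf sm) (auto simp: indicator_def intro: less_imp_le)
    then show ?thesis using that by simp
  qed
  have [measurable]: "cball (0::real^'n) s \<in> sets borel" for s by (simp add: borel_closed)
  have rm: "r \<in> borel_measurable borel" unfolding r_def[abs_def] by measurable
  have pos: "r x > 0" for x
    using lo[of x "nat \<lceil>norm x\<rceil>"] a(1)[of "nat \<lceil>norm x\<rceil>"] of_nat_ceiling[of "norm x"] by linarith
  define F where "F k x = (norm x)\<^sup>2 * (a k * indicator (cball (0::real^'n) (real k)) x)" for k x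
  have ii: "integrable lborel (\<lambda>x. (real k)\<^sup>2 * a k * indicator (cball (0::real^'n) (real k)) x)" for k
    by (intro integrable_mult_right integrable_real_indicator emeasure_bounded_finite[OF bounded_cball, folded infinity_ennreal_def]) simp
  have Fle: "0 \<le> F k x" "F k x \<le> (real k)\<^sup>2 * a k * indicator (cball (0::real^'n) (real k)) x" for k x
    using a(1)[of k] by (auto simp: F_def indicator_def intro!: mult_right_mono power_mono)
  have [measurable]: "F k \<in> borel_measurable borel" for k unfolding F_def[abs_def] by measurable
  have Fi: "integrable lborel (F k)" for k
    by (rule Bochner_Integration.integrable_bound[OF ii]) (use Fle in \<open>auto intro!: AE_I2 order_trans[OF _ abs_ge_self]\<close>)
  have FI: "(LINT x|lborel. F k x) \<le> (1/2) ^ k" for k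
  proof -
    have "(LINT x|lborel. F k x) \<le> (LINT x|lborel. (real k)\<^sup>2 * a k * indicator (cball (0::real^'n) (real k)) x)"
      by (rule integral_mono[OF Fi ii]) (rule Fle(2))
    also have "\<dots> = (real k)\<^sup>2 * a k * V k" by (simp add: V_def)
    also have "\<dots> = ((real k)\<^sup>2 * V k) * a k" by (simp add: mult_ac)
    also have "\<dots> \<le> P k * a k" unfolding P_def
      using V[of k] less_imp_le[OF a(1)[of k]] by (intro mult_right_mono mult_mono) auto
    also have "\<dots> = (1/2) ^ k" using P0[of k] by (simp add: a_def)
    finally show ?thesis .
  qed
  have Fs: "summable (\<lambda>k. F k x)" for x unfolding F_def by (rule summable_mult[OF sm])
  have "integrable lborel (\<lambda>x. \<Sum>k. F k x)"
  proof (rule integrable_suminf[OF Fi])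
    show "AE x in lborel. summable (\<lambda>k. norm (F k x))"
      using Fle(1) Fs by (intro AE_I2) simp
    show "summable (\<lambda>k. LINT x|lborel. norm (F k x))"
      by (rule summable_comparison_test[OF _ g]) (use Fle(1) FI in \<open>auto intro!: exI[of _ 0]\<close>)
  qed
  moreover have "(\<Sum>k. F k x) = (norm x)\<^sup>2 * r x" for x
    unfolding F_def r_def by (rule suminf_mult[OF sm])
  ultimately have int: "integrable lborel (\<lambda>x. (norm x)\<^sup>2 * r x)" by simp
  have "\<exists>a>0. \<forall>x. norm x \<le> R \<longrightarrow> a \<le> r x" for R
    using lo a(1) of_nat_ceiling[of R] by (intro exI[of _ "a (nat \<lceil>R\<rceil>)"]) (meson order_trans)
  then show ?thesis by (rule that[OF rm pos int])
qed

lemma test_fun_abs_integrable: "test_fun \<phi> \<Longrightarrow> integrable lebesgue (\<lambda>x. \<bar>\<phi> x\<bar>)" "test_fun \<phi> \<Longrightarrow> integrable lebesgue \<phi>" for \<phi> :: "real^'n \<Rightarrow> real"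
proof -
  assume "test_fun \<phi>"
  then have "\<phi> \<in> borel_measurable borel" "integrable lborel \<phi>" using Cc_integrable[OF test_fun_Cc] test_fun_borel by auto
  then show "integrable lebesgue \<phi>" by (simp add: borel_lborel_lebesgue)
  then show "integrable lebesgue (\<lambda>x. \<bar>\<phi> x\<bar>)" by simp
qed

lemma mass_comb:
  assumes v: "test_field v" and w: "test_field w"
  shows "mass (\<lambda>x. a *\<^sub>R v x + b *\<^sub>R w x) \<le> \<bar>a\<bar> * mass v + \<bar>b\<bar> * mass w"
proof -
  note i = test_fun_abs_integrable[OF test_field_comp[OF v]] test_fun_abs_integrable[OF test_field_comp[OF w]]
  have "(LINT x|lebesgue. \<bar>(a *\<^sub>R v x + b *\<^sub>R w x) $ i\<bar>) \<le> (LINT x|lebesgue. \<bar>a\<bar> * \<bar>v x $ i\<bar> + \<bar>b\<bar> * \<bar>w x $ i\<bar>)" for i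
  proof (rule integral_mono)
    show "integrable lebesgue (\<lambda>x. \<bar>(a *\<^sub>R v x + b *\<^sub>R w x) $ i\<bar>)"
      by (rule test_fun_abs_integrable[OF test_field_comp[OF test_field_comb(1)[OF v w]]])
    show "\<bar>(a *\<^sub>R v x + b *\<^sub>R w x) $ i\<bar> \<le> \<bar>a\<bar> * \<bar>v x $ i\<bar> + \<bar>b\<bar> * \<bar>w x $ i\<bar>" for x
      using abs_triangle_ineq[of "a * v x $ i" "b * w x $ i"] by (simp add: abs_mult)
  qed (use i in simp)
  then have "mass (\<lambda>x. a *\<^sub>R v x + b *\<^sub>R w x) \<le> (\<Sum>i\<in>UNIV. LINT x|lebesgue. \<bar>a\<bar> * \<bar>v x $ i\<bar> + \<bar>b\<bar> * \<bar>w x $ i\<bar>)"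
    unfolding mass_def by (rule sum_mono)
  also have "\<dots> = \<bar>a\<bar> * mass v + \<bar>b\<bar> * mass w"
    using i by (simp add: mass_def sum.distrib sum_distrib_left)
  finally show ?thesis .
qed

lemma divergence_zero_field: "test_field (\<lambda>_. 0)" "divergence (\<lambda>_. 0) x = 0"
  by (simp_all add: test_field_def test_fun_zero divergence_def)

lemma weighted_loc_int:
  fixes W h :: "real^'n \<Rightarrow> real"
  assumes W: "loc_int W" "\<And>x. W x \<ge> 0" and [measurable]: "h \<in> borel_measurable borel" and h: "integrable lborel (\<lambda>x. W x * (h x)\<^sup>2)"
  shows "loc_int (\<lambda>x. W x * h x)"
  unfolding loc_int_def
proof (intro conjI allI impI)
  note [measurable] = loc_int_borel[OF W(1)]
  show "(\<lambda>x. W x * h x) \<in> borel_measurable borel" by measurable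
  fix K :: "(real^'n) set" assume K: "compact K"
  have [measurable]: "K \<in> sets borel" using K by (simp add: compact_imp_closed borel_closed)
  have i: "integrable lborel (\<lambda>x. indicator K x * W x)" using W(1) K unfolding loc_int_def by blast
  show "integrable lborel (\<lambda>x. indicator K x * (W x * h x))"
  proof (rule Bochner_Integration.integrable_bound)
    show "integrable lborel (\<lambda>x. indicator K x * W x + W x * (h x)\<^sup>2)" using i h by simp
    have "\<bar>s\<bar> \<le> 1 + s\<^sup>2" for s :: real using zero_le_power2[of "\<bar>s\<bar> - 1/2"] by (simp add: power2_eq_square algebra_simps)
    then have "W x * \<bar>h x\<bar> \<le> W x * (1 + (h x)\<^sup>2)" for x by (intro mult_left_mono W(2)) auto
    then show "AE x in lborel. norm (indicator K x * (W x * h x)) \<le> norm (indicator K x * W x + W x * (h x)\<^sup>2)"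
      using W(2) by (intro AE_I2) (auto simp: indicator_def abs_mult distrib_left intro: order_trans[OF _ abs_ge_self])
  qed measurable
qed

text \<open>Bounds on the single partial derivatives add up to \<open>CARD('n)\<close> times
  \<open>c\<close> for the gradient, the same loss as in \<open>conv_BV\<close>.\<close>

lemma conv_lipschitz:
  fixes u :: "real^'n \<Rightarrow> real"
  assumes u: "loc_int u" and \<rho>: "test_fun \<rho>" and c: "\<And>i x. \<bar>conv u (partial_deriv i \<rho>) x\<bar> \<le> c"
  shows "(real CARD('n) * c)-lipschitz_on UNIV (conv u \<rho>)"
proof (rule bounded_derivative_imp_lipschitz)
  have c0: "c \<ge> 0" using c[of undefined 0] by linarith
  then show "0 \<le> real CARD('n) * c" by simp
  fix x :: "real^'n"
  show "(conv u \<rho> has_derivative (\<lambda>h. \<Sum>i\<in>UNIV. h $ i * conv u (partial_deriv i \<rho>) x)) (at x within UNIV)"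
    by (rule has_derivative_conv[OF u \<rho>])
  show "onorm (\<lambda>h. \<Sum>i\<in>UNIV. h $ i * conv u (partial_deriv i \<rho>) x) \<le> real CARD('n) * c"
  proof (rule onorm_le)
    fix h :: "real^'n"
    have "norm (\<Sum>i\<in>UNIV. h $ i * conv u (partial_deriv i \<rho>) x) \<le> (\<Sum>i\<in>(UNIV::'n set). norm h * c)"
      using c c0 component_le_norm_cart[of h] by (intro sum_norm_le) (auto simp: abs_mult intro!: mult_mono)
    then show "norm (\<Sum>i\<in>UNIV. h $ i * conv u (partial_deriv i \<rho>) x) \<le> real CARD('n) * c * norm h" by (simp add: mult_ac)
  qed
qed simp

text \<open>A Lipschitz function vanishing at 0 is at most \<open>L * norm x\<close>, and a weighted
  Cauchy--Schwarz inequality, in additive form with a scale \<open>l\<close>, does the rest. The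
  first term is made small by \<open>l\<close>, the second by closeness in the weighted
  space.\<close>

lemma weighted_pairing_bound:
  fixes r f :: "real^'n \<Rightarrow> real"
  assumes [measurable]: "r \<in> borel_measurable borel" "f \<in> borel_measurable borel" and r: "\<And>x. r x > 0" and l: "l > 0"
    and I: "integrable lborel (\<lambda>x. (norm x)\<^sup>2 * r x)" and F: "integrable lborel (\<lambda>x. (f x)\<^sup>2 / r x)"
    and u: "L-lipschitz_on UNIV u" "u 0 = 0"
  shows "\<bar>LINT x|lborel. u x * f x\<bar> \<le> L * (l * (LINT x|lborel. (norm x)\<^sup>2 * r x) + (LINT x|lborel. (f x)\<^sup>2 / r x) / l)"
proof -
  have L: "L \<ge> 0" by (rule lipschitz_on_nonneg[OF u(1)])
  have [measurable]: "u \<in> borel_measurable borel" by (rule borel_measurable_continuous_onI[OF lipschitz_on_continuous_on[OF u(1)]])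
  define A where "A x = (norm x)\<^sup>2 * r x" for x
  define B where "B x = (f x)\<^sup>2 / r x" for x
  have AB: "integrable lborel A" "integrable lborel B" using I F by (simp_all add: A_def[abs_def] B_def[abs_def])
  define G where "G x = L * (l * A x + inverse l * B x)" for x
  have "\<bar>u x * f x\<bar> \<le> G x" for x
  proof -
    have "\<bar>u x\<bar> \<le> L * norm x" using lipschitz_onD[OF u(1) UNIV_I UNIV_I, of x 0] u(2) by (simp add: dist_norm)
    then have 1: "\<bar>u x * f x\<bar> \<le> (L * norm x) * \<bar>f x\<bar>" unfolding abs_mult by (intro mult_right_mono) auto
    \<comment> \<open>The elementary estimate is \<open>norm x * \<bar>f x\<bar> \<le> (norm
      x)\<^sup>2 * s + (f x)\<^sup>2 / s\<close>, with scale and weight absorbed in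
      \<open>s\<close>.\<close>
    define s where "s = l * r x"
    have s: "s > 0" using l r by (simp add: s_def)
    have "0 \<le> (norm x * s - \<bar>f x\<bar>)\<^sup>2 + (norm x * s)\<^sup>2 + \<bar>f x\<bar>\<^sup>2" by simp
    then have "norm x * \<bar>f x\<bar> * s \<le> (norm x)\<^sup>2 * s * s + (f x)\<^sup>2" by (simp add: power2_eq_square algebra_simps)
    also have "\<dots> = ((norm x)\<^sup>2 * s + (f x)\<^sup>2 / s) * s" using s by (simp add: field_simps)
    finally have "norm x * \<bar>f x\<bar> \<le> (norm x)\<^sup>2 * s + (f x)\<^sup>2 / s" using s by simp
    then have "L * (norm x * \<bar>f x\<bar>) \<le> G x" unfolding G_def using L by (intro mult_left_mono) (simp_all add: s_def A_def B_def divide_inverse mult_ac)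
    then show ?thesis using 1 by (simp add: mult_ac)
  qed
  then have le: "norm (u x * f x) \<le> G x" for x by simp
  have Gi: "integrable lborel G" unfolding G_def using AB by (intro integrable_mult_right Bochner_Integration.integrable_add)
  have "integrable lborel (\<lambda>x. u x * f x)"
    by (rule Bochner_Integration.integrable_bound[OF Gi]) (use le in \<open>auto intro!: AE_I2 order_trans[OF _ abs_ge_self]\<close>)
  then have "norm (LINT x|lborel. u x * f x) \<le> (LINT x|lborel. G x)"
    using Gi le by (intro order_trans[OF integral_norm_bound integral_mono]) auto
  also have "\<dots> = L * (l * (LINT x|lborel. A x) + inverse l * (LINT x|lborel. B x))"
    unfolding G_def using AB by simp
  finally show ?thesis unfolding A_def B_def by (simp add: divide_inverse mult.commute)
qed

lemma weight_loc_int: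
  fixes r :: "real^'n \<Rightarrow> real"
  assumes [measurable]: "r \<in> borel_measurable borel" and rp: "\<And>x. r x > 0" and rl: "\<And>R. \<exists>a>0. \<forall>x. norm x \<le> R \<longrightarrow> a \<le> r x"
  shows "loc_int (\<lambda>x. 1 / r x)"
  unfolding loc_int_def
proof (intro conjI allI impI)
  fix K :: "(real^'n) set" assume K: "compact K"
  have [measurable]: "K \<in> sets borel" using K by (simp add: compact_imp_closed borel_closed)
  obtain R where R: "\<And>x. x \<in> K \<Longrightarrow> norm x \<le> R" using compact_imp_bounded[OF K] unfolding bounded_iff by blast
  obtain a where a: "a > 0" "\<And>x. norm x \<le> R \<Longrightarrow> a \<le> r x" using rl by blast
  have i: "integrable lborel (\<lambda>x. indicator K x * (1 / a))" using loc_int_const[of "1 / a"] K unfolding loc_int_def by blast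
  show "integrable lborel (\<lambda>x. indicator K x * (1 / r x))"
  proof (rule Bochner_Integration.integrable_bound[OF i])
    have "1 / r x \<le> 1 / a" if "x \<in> K" for x using a R[OF that] by (intro divide_left_mono) (auto simp: rp)
    then show "AE x in lborel. norm (indicator K x * (1 / r x)) \<le> norm (indicator K x * (1 / a))"
      using rp a(1) by (intro AE_I2) (simp add: indicator_def less_imp_le)
  qed measurable
qed measurable

text \<open>The counterpart of \<open>unit_field_approx\<close>: \<open>\<tau>\<close> bounds the
  dual norm of the pairing with \<open>f\<close>, as spelled out in \<open>dual\<close>. The measure
  \<open>M\<close> has density \<open>1 / r\<close>, so closeness in its L_2 space controls pairings
  with Lipschitz functions through \<open>weighted_pairing_bound\<close>.\<close>

lemma weighted_approx:
  fixes f :: "real^'n \<Rightarrow> real"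
  assumes f: "test_fun f" and f0: "(LINT x|lborel. f x) = 0" and \<tau>: "\<tau> > 0"
    and dual: "\<And>u L. L-lipschitz_on UNIV u \<Longrightarrow> u 0 = 0 \<Longrightarrow> (LINT x|lborel. u x * f x) \<le> L * \<tau>"
    and r[measurable]: "r \<in> borel_measurable borel" and rp: "\<And>x. r x > 0" and rl: "\<And>R. \<exists>a>0. \<forall>x. norm x \<le> R \<longrightarrow> a \<le> r x"
    and e: "e > 0"
  shows "\<exists>v. test_field v \<and> mass v \<le> real CARD('n) * \<tau> \<and> (LINT x|lborel. (f x - divergence v x)\<^sup>2 / r x) < e"
proof -
  define W where "W x = 1 / r x" for x
  define M where "M = density lborel (\<lambda>x. ennreal (W x))"
  define m where "m = real CARD('n)"
  have m: "m > 0" by (simp add: m_def)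
  have W0: "W x > 0" for x by (simp add: W_def rp)
  have [measurable]: "W \<in> borel_measurable borel" unfolding W_def[abs_def] by measurable
  have sM[measurable_cong]: "sets M = sets borel" by (simp add: M_def)
  have dI: "integrable M g \<longleftrightarrow> integrable lborel (\<lambda>x. W x * g x)" and dE: "(LINT x|M. g x) = (LINT x|lborel. W x * g x)"
    if "g \<in> borel_measurable borel" for g :: "real^'n \<Rightarrow> real"
    unfolding M_def using that W0 by (simp_all add: integrable_density integral_density less_imp_le)
  have lW: "loc_int W" unfolding W_def[abs_def] by (rule weight_loc_int[OF r rp rl])
  have Cc2: "integrable M (\<lambda>x. \<bar>g x\<bar> ^ 2)" if "test_fun g" for g
  proof -
    have g: "Cc g" using that by (rule test_fun_Cc)
    note [measurable] = Cc_borel[OF g]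
    have "integrable lborel (\<lambda>x. W x * (g x * g x))" by (rule loc_int_mult[OF lW Cc_mult[OF g Cc_cont[OF g]]])
    then show ?thesis by (subst dI) (simp_all add: power2_eq_square)
  qed
  \<comment> \<open>The factor \<open>m\<close> in the radius makes up for the factor
    \<open>m\<close> between the partial derivatives and the Lipschitz constant in
    \<open>conv_lipschitz\<close>.\<close>
  define K where "K = {divergence v | v :: real^'n \<Rightarrow> real^'n. test_field v \<and> mass v \<le> m * \<tau>}"
  have Kt: "test_fun g" if "g \<in> K" for g using that by (auto simp: K_def test_fun_divergence)
  have fb[measurable]: "f \<in> borel_measurable borel" by (rule test_fun_borel[OF f])
  have z: "(\<lambda>_. 0) \<in> K"
    unfolding K_def using divergence_zero_field \<tau> m by (intro CollectI exI[of _ "\<lambda>_. 0"]) (auto simp: mass_def fun_eq_iff)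
  have conv: "(\<lambda>x. (1 - t) * g x + t * g' x) \<in> K" if K: "g \<in> K" "g' \<in> K" and t: "0 \<le> t" "t \<le> 1" for g g' t
  proof -
    obtain v v' where v: "g = divergence v" "test_field v" "mass v \<le> m * \<tau>" "g' = divergence v'" "test_field v'" "mass v' \<le> m * \<tau>"
      using K by (auto simp: K_def)
    have "mass (\<lambda>x. (1 - t) *\<^sub>R v x + t *\<^sub>R v' x) \<le> \<bar>1 - t\<bar> * mass v + \<bar>t\<bar> * mass v'" by (rule mass_comb[OF v(2,5)])
    also have "\<dots> \<le> (1 - t) * (m * \<tau>) + t * (m * \<tau>)" using t v(3,6) by (intro add_mono) (auto intro: mult_left_mono)
    also have "\<dots> = m * \<tau>" by (simp add: algebra_simps)
    finally show ?thesis unfolding K_def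
      using test_field_comb[OF v(2,5)] v(1,4) by (intro CollectI exI[of _ "\<lambda>x. (1 - t) *\<^sub>R v x + t *\<^sub>R v' x"]) (auto simp: fun_eq_iff)
  qed
  obtain h where hM: "h \<in> borel_measurable M" and h2: "integrable M (\<lambda>x. \<bar>h x\<bar> ^ 2)"
    and hK: "\<And>e. e > 0 \<Longrightarrow> \<exists>g\<in>K. (LINT x|M. \<bar>f x - h x - g x\<bar> ^ 2) < e"
    and hv: "\<And>g. g \<in> K \<Longrightarrow> (LINT x|M. psi 2 (h x) * (g x - (f x - h x))) \<le> 0"
  proof (rule Lp_minimiser[of 2 f M K])
    show "f \<in> borel_measurable M" by measurable
    show "integrable M (\<lambda>x. \<bar>f x\<bar> ^ 2)" by (rule Cc2[OF f])
    show "g \<in> borel_measurable M" "integrable M (\<lambda>x. \<bar>g x\<bar> ^ 2)" if "g \<in> K" for g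
      using Cc2[OF Kt[OF that]] test_fun_borel[OF Kt[OF that]] by (simp_all cong: measurable_cong_sets[OF sM refl])
    show "K \<noteq> {}" using z by blast
  qed (use conv that in auto)
  have hb[measurable]: "h \<in> borel_measurable borel" using hM by (simp cong: measurable_cong_sets[OF sM refl])
  have Wh: "integrable lborel (\<lambda>x. W x * (h x)\<^sup>2)" using h2 by (simp add: dI)
  \<comment> \<open>The duality map is the identity for \<open>p = 2\<close>; the factor
    \<open>W\<close> turns pairings with respect to \<open>M\<close> into pairings with respect to
    \<open>lborel\<close>.\<close>
  define u where "u x = W x * h x" for x
  have lu: "loc_int u" unfolding u_def[abs_def] using lW W0 by (intro weighted_loc_int Wh) (auto intro: less_imp_le)
  have uf: "integrable lborel (\<lambda>x. u x * f x)" by (rule loc_int_mult[OF lu test_fun_Cc[OF f]])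
  have uh: "integrable lborel (\<lambda>x. u x * h x)" using Wh by (simp add: u_def power2_eq_square mult.assoc)
  define c where "c = (LINT x|lborel. u x * f x) - (LINT x|lborel. u x * h x)"
  have uK: "(LINT x|lborel. u x * g x) \<le> c" if g: "g \<in> K" for g
  proof -
    note [measurable] = test_fun_borel[OF Kt[OF g]]
    have ug: "integrable lborel (\<lambda>x. u x * g x)" by (rule loc_int_mult[OF lu test_fun_Cc[OF Kt[OF g]]])
    have "(LINT x|lborel. W x * (h x * (g x - (f x - h x)))) \<le> 0"
      using hv[OF g] by (subst (asm) dE) (simp_all add: psi_def)
    also have "(\<lambda>x. W x * (h x * (g x - (f x - h x)))) = (\<lambda>x. u x * g x - (u x * f x - u x * h x))"
      by (simp add: u_def fun_eq_iff algebra_simps)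
    finally show ?thesis using ug uf uh by (simp add: c_def)
  qed
  have c0: "c \<ge> 0" using uK[OF z] by simp
  have Lip: "\<bar>conv u (partial_deriv i \<rho>) x\<bar> \<le> c / (m * \<tau>)" if \<rho>: "mollifier d \<rho>" for d \<rho> i x
  proof -
    note R = mollifierD[OF \<rho>]
    have "s * (m * \<tau>) * conv u (partial_deriv i \<rho>) x \<le> c" if s: "\<bar>s\<bar> = 1" for s :: real
    proof -
      \<comment> \<open>The coordinate field with this component has mass exactly
        \<open>m * \<tau>\<close>, since the mollifier has integral 1. The minus sign undoes the one
        that reflection produces in the derivative.\<close>
      define \<phi> where "\<phi> y = (- s * (m * \<tau>)) * \<rho> (x - y)" for y
      have t: "test_fun (\<lambda>y. \<rho> (x - y))" by (rule test_fun_reflect[OF R(1)])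
      have \<phi>: "test_fun \<phi>" unfolding \<phi>_def by (rule test_fun_cmult[OF t])
      have pd: "partial_deriv i \<phi> = (\<lambda>y. s * (m * \<tau>) * partial_deriv i \<rho> (x - y))"
        unfolding \<phi>_def[abs_def] partial_deriv_cmult[OF t] partial_deriv_reflect[OF R(1)] by simp
      have dv: "divergence (\<lambda>x. \<phi> x *\<^sub>R axis i 1) = (\<lambda>y. s * (m * \<tau>) * partial_deriv i \<rho> (x - y))"
        using test_field_axis(2)[OF \<phi>] pd by (simp add: fun_eq_iff)
      note [measurable] = test_fun_borel[OF \<phi>] test_fun_borel[OF R(1)]
      have ab: "\<bar>\<phi> y\<bar> = (m * \<tau>) * \<rho> (x - y)" for y using s m \<tau> R(2) by (simp add: \<phi>_def abs_mult)
      have "(LINT y|lebesgue. \<bar>\<phi> y\<bar>) = (LINT y|lborel. (m * \<tau>) * \<rho> (x - y))" unfolding ab[symmetric] by (rule borel_lborel_lebesgue) measurable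
      also have "\<dots> = m * \<tau>" using integral_lborel_reflect[of \<rho> x] R(3) by simp
      finally have I: "(LINT y|lebesgue. \<bar>\<phi> y\<bar>) = m * \<tau>" .
      have "mass (\<lambda>x. \<phi> x *\<^sub>R axis i 1) = (\<Sum>j\<in>UNIV. if j = i then (LINT y|lebesgue. \<bar>\<phi> y\<bar>) else 0)"
        unfolding mass_def by (intro sum.cong) (auto simp: axis_def)
      then have "mass (\<lambda>x. \<phi> x *\<^sub>R axis i 1) = m * \<tau>" using I by simp
      then have "divergence (\<lambda>x. \<phi> x *\<^sub>R axis i 1) \<in> K" unfolding K_def using test_field_axis(1)[OF \<phi>] by fastforce
      from uK[OF this] have "(LINT y|lborel. u y * (s * (m * \<tau>) * partial_deriv i \<rho> (x - y))) \<le> c" unfolding dv .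
      then show ?thesis by (simp add: conv_def mult.left_commute[of "u _"] mult.assoc)
    qed
    from this[of 1] this[of "-1"] have "\<bar>(m * \<tau>) * conv u (partial_deriv i \<rho>) x\<bar> \<le> c" by simp
    then show ?thesis using m \<tau> by (simp add: abs_mult pos_le_divide_eq mult.commute)
  qed
  have "(LINT x|lborel. u x * f x) \<le> c + e'" if e': "e' > 0" for e'
  proof -
    obtain d where d: "d > 0" "\<And>\<rho>. mollifier d \<rho> \<Longrightarrow> \<bar>(LINT x|lborel. conv u \<rho> x * f x) - (LINT x|lborel. u x * f x)\<bar> \<le> e'"
      by (rule conv_pairing_tendsto[OF lu test_fun_Cc[OF f] e']) (rule that)
    obtain \<rho> :: "real^'n \<Rightarrow> real" where \<rho>: "mollifier d \<rho>" using mollifier_exists[OF d(1)] by blast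
    note R = mollifierD[OF \<rho>]
    \<comment> \<open>\<open>dual\<close> speaks of functions vanishing at 0; the constant
      subtracted does not change the pairing because \<open>f\<close> has integral 0.\<close>
    define w where "w x = conv u \<rho> x - conv u \<rho> 0" for x
    have cl: "(m * (c / (m * \<tau>)))-lipschitz_on UNIV (conv u \<rho>)" unfolding m_def by (rule conv_lipschitz[OF lu R(1) Lip[OF \<rho>, unfolded m_def]])
    then have "(c / \<tau>)-lipschitz_on UNIV (conv u \<rho>)" using m by simp
    then have "(c / \<tau>)-lipschitz_on UNIV w" unfolding w_def lipschitz_on_def by (simp add: dist_norm)
    then have "(LINT x|lborel. w x * f x) \<le> c / \<tau> * \<tau>" by (rule dual) (simp add: w_def)
    then have "(LINT x|lborel. w x * f x) \<le> c" using \<tau> by simp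
    moreover have "(LINT x|lborel. w x * f x) = (LINT x|lborel. conv u \<rho> x * f x)"
    proof -
      have "continuous_on UNIV (conv u \<rho>)" by (rule lipschitz_on_continuous_on[OF cl])
      then have "integrable lborel (\<lambda>x. conv u \<rho> x * f x)" by (rule loc_int_mult[OF continuous_loc_int test_fun_Cc[OF f]])
      then show ?thesis using Cc_integrable[OF test_fun_Cc[OF f]] f0 by (simp add: w_def left_diff_distrib)
    qed
    ultimately show ?thesis using d(2)[OF \<rho>] by linarith
  qed
  then have "(LINT x|lborel. u x * f x) \<le> c" by (rule field_le_epsilon)
  then have "(LINT x|lborel. W x * (h x)\<^sup>2) \<le> 0" by (simp add: c_def u_def power2_eq_square mult.assoc)
  moreover have "(LINT x|lborel. W x * (h x)\<^sup>2) \<ge> 0" using W0 by (intro integral_nonneg_AE AE_I2) (simp add: less_imp_le)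
  ultimately have "(LINT x|lborel. W x * (h x)\<^sup>2) = 0" by linarith
  then have "AE x in lborel. W x * (h x)\<^sup>2 = 0"
    using integral_nonneg_eq_0_iff_AE[OF Wh] W0 by (simp add: less_imp_le)
  then have h0: "AE x in lborel. h x = 0" using W0 by (auto simp: less_imp_neq[symmetric])
  obtain g where g: "g \<in> K" "(LINT x|M. \<bar>f x - h x - g x\<bar> ^ 2) < e" using hK[OF e] by blast
  note [measurable] = test_fun_borel[OF Kt[OF g(1)]]
  obtain v where v: "g = divergence v" "test_field v" "mass v \<le> m * \<tau>" using g(1) by (auto simp: K_def)
  have "(LINT x|M. \<bar>f x - h x - g x\<bar> ^ 2) = (LINT x|lborel. W x * (f x - h x - g x)\<^sup>2)" by (subst dE) simp_all
  also have "\<dots> = (LINT x|lborel. (f x - g x)\<^sup>2 / r x)"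
    using h0 by (intro integral_cong_AE) (auto simp: W_def)
  finally show ?thesis using v g(2) unfolding m_def by (intro exI[of _ v]) auto
qed

section \<open>The divergence of integrable fields\<close>

lemma Rep_lip0_lipschitz: "(norm U)-lipschitz_on UNIV (Rep_lip0 U)"
  using Rep_lip0[of U] Lip_lipschitz[of _ "Rep_lip0 U"] by (auto simp: norm_lip0.rep_eq)

lemma Rep_lip0_zero [simp]: "Rep_lip0 U 0 = 0"
  using Rep_lip0[of U] by auto

lemma Rep_lip0_cont: "continuous_on UNIV (Rep_lip0 U)"
  by (rule lipschitz_on_continuous_on[OF Rep_lip0_lipschitz])

lemma Rep_lip0_diff_le: "\<bar>Rep_lip0 U x - Rep_lip0 U y\<bar> \<le> norm U * norm (x - y)"
  using lipschitz_onD[OF Rep_lip0_lipschitz UNIV_I UNIV_I, of U x y] by (simp add: dist_norm)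

lemma Rep_lip0_le: "\<bar>Rep_lip0 U x\<bar> \<le> norm U * norm x"
  using Rep_lip0_diff_le[of U x 0] by simp

text \<open>Replaces the pointwise gradient, whose measurability is not evident, by the bounded
  Borel functions \<open>dlim\<close>.\<close>

lemma gradient_lip0:
  fixes U :: "'n::finite lip0"
  shows "AE x in lebesgue. Rep_lip0 U differentiable (at x) \<and> gradient (Rep_lip0 U) x = (\<chi> i. dlim (Rep_lip0 U) (axis i 1) x)"
proof -
  let ?u = "Rep_lip0 U"
  have "AE x in lebesgue. (?u has_derivative (\<lambda>h. h \<bullet> (\<chi> i. dlim ?u (axis i 1) x))) (at x)"
    by (rule AE_completion[OF Rademacher[OF Rep_lip0_lipschitz]])
  then show ?thesis
  proof eventually_elim
    case (elim x)
    have "partial_deriv i ?u x = dlim ?u (axis i 1) x" for i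
      using partial_deriv_eq[OF elim, of i] by (simp add: inner_axis')
    then show ?case using elim by (auto simp: gradient_def differentiable_def)
  qed
qed

lemma lip0_differentiable:
  fixes U :: "'n::finite lip0"
  shows "AE x in lebesgue. Rep_lip0 U differentiable (at x)"
  using gradient_lip0[of U] by eventually_elim blast

lemma gradient_lip0_bound:
  fixes U :: "'n::finite lip0"
  shows "AE x in lebesgue. \<forall>w. \<bar>gradient (Rep_lip0 U) x \<bullet> w\<bar> \<le> norm U * (\<Sum>i\<in>UNIV. \<bar>w $ i\<bar>)"
  using gradient_lip0[of U]
proof eventually_elim
  case (elim x)
  show ?case
  proof
    fix w :: "real^'n"
    have "\<bar>gradient (Rep_lip0 U) x \<bullet> w\<bar> \<le> (\<Sum>i\<in>(UNIV::'n set). \<bar>dlim (Rep_lip0 U) (axis i 1) x * w $ i\<bar>)"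
      using elim by (simp add: inner_vec_def sum_abs)
    also have "\<dots> \<le> (\<Sum>i\<in>(UNIV::'n set). norm U * \<bar>w $ i\<bar>)"
      using dlim_bound[OF Rep_lip0_lipschitz, of U "axis i 1" x for i]
      by (intro sum_mono) (simp add: abs_mult mult_right_mono)
    finally show "\<bar>gradient (Rep_lip0 U) x \<bullet> w\<bar> \<le> norm U * (\<Sum>i\<in>UNIV. \<bar>w $ i\<bar>)" by (simp add: sum_distrib_left)
  qed
qed

lemma integrable_component:
  fixes v :: "'a \<Rightarrow> real^'n"
  shows "integrable M v \<Longrightarrow> integrable M (\<lambda>x. v x $ i)"
  by (rule integrable_bounded_linear[OF bounded_linear_vec_nth])

lemma gradient_pairing_integrable:
  fixes v :: "real^'n \<Rightarrow> real^'n"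
  assumes v: "integrable lebesgue v"
  shows "integrable lebesgue (\<lambda>x. gradient (Rep_lip0 U) x \<bullet> v x)"
    "(LINT x|lebesgue. \<bar>gradient (Rep_lip0 U) x \<bullet> v x\<bar>) \<le> norm U * mass v"
proof -
  let ?D = "\<lambda>i x. dlim (Rep_lip0 U) (axis i 1) x"
  have [measurable]: "?D i \<in> borel_measurable lebesgue" for i
    using dlim_borel[OF Rep_lip0_cont, of U "axis i 1"] by (intro measurable_completion) simp
  have vi: "integrable lebesgue (\<lambda>x. v x $ i)" for i by (rule integrable_component[OF v])
  have [measurable]: "(\<lambda>x. v x $ i) \<in> borel_measurable lebesgue" for i using vi by (rule borel_measurable_integrable)
  \<comment> \<open>By completeness of \<open>lebesgue\<close>, a function that agrees almost
    everywhere with a measurable one is measurable.\<close>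
  have m: "(\<lambda>x. gradient (Rep_lip0 U) x \<bullet> v x) \<in> borel_measurable lebesgue"
  proof (rule borel_measurable_AE)
    show "(\<lambda>x. \<Sum>i\<in>UNIV. ?D i x * v x $ i) \<in> borel_measurable lebesgue" by measurable
    show "AE x in lebesgue. (\<Sum>i\<in>UNIV. ?D i x * v x $ i) = gradient (Rep_lip0 U) x \<bullet> v x"
      using gradient_lip0[of U] by eventually_elim (simp add: inner_vec_def)
  qed
  have bi: "integrable lebesgue (\<lambda>x. norm U * (\<Sum>i\<in>UNIV. \<bar>v x $ i\<bar>))" using vi by simp
  have ae: "AE x in lebesgue. \<bar>gradient (Rep_lip0 U) x \<bullet> v x\<bar> \<le> norm U * (\<Sum>i\<in>UNIV. \<bar>v x $ i\<bar>)"
    using gradient_lip0_bound[of U] by eventually_elim blast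
  show gi: "integrable lebesgue (\<lambda>x. gradient (Rep_lip0 U) x \<bullet> v x)"
    by (rule Bochner_Integration.integrable_bound[OF bi m]) (use ae in \<open>eventually_elim, auto intro: order_trans[OF _ abs_ge_self]\<close>)
  have "(LINT x|lebesgue. \<bar>gradient (Rep_lip0 U) x \<bullet> v x\<bar>) \<le> (LINT x|lebesgue. norm U * (\<Sum>i\<in>UNIV. \<bar>v x $ i\<bar>))"
    by (rule integral_mono_AE[OF integrable_abs[OF gi] bi ae])
  also have "\<dots> = norm U * mass v" using vi by (simp add: mass_def Bochner_Integration.integral_sum)
  finally show "(LINT x|lebesgue. \<bar>gradient (Rep_lip0 U) x \<bullet> v x\<bar>) \<le> norm U * mass v" .
qed

lemma div_L1_bound:
  assumes v: "integrable lebesgue v" shows "\<bar>div_L1 v U\<bar> \<le> mass v * norm U"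
proof -
  have "\<bar>div_L1 v U\<bar> \<le> (LINT x|lebesgue. \<bar>gradient (Rep_lip0 U) x \<bullet> v x\<bar>)"
    unfolding div_L1_def abs_minus_cancel by (rule integral_abs_bound)
  then show ?thesis using gradient_pairing_integrable(2)[OF v, of U] by (simp add: mult.commute)
qed

lemma bounded_linear_div_L1:
  assumes v: "integrable lebesgue v" shows "bounded_linear (div_L1 v)"
proof (rule bounded_linear_intro)
  note gi = gradient_pairing_integrable(1)[OF v]
  show "div_L1 v (U + V) = div_L1 v U + div_L1 v V" for U V
  proof -
    have ae: "AE x in lebesgue. gradient (Rep_lip0 (U + V)) x \<bullet> v x = gradient (Rep_lip0 U) x \<bullet> v x + gradient (Rep_lip0 V) x \<bullet> v x"
      using lip0_differentiable[of U] lip0_differentiable[of V]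
      by eventually_elim (simp add: gradient_def plus_lip0.rep_eq partial_deriv_add inner_vec_def distrib_right sum.distrib)
    have "(LINT x|lebesgue. gradient (Rep_lip0 (U + V)) x \<bullet> v x)
      = (LINT x|lebesgue. gradient (Rep_lip0 U) x \<bullet> v x + gradient (Rep_lip0 V) x \<bullet> v x)"
      by (rule integral_cong_AE[OF borel_measurable_integrable[OF gi] borel_measurable_integrable[OF Bochner_Integration.integrable_add[OF gi gi]] ae])
    then show ?thesis using gi by (simp add: div_L1_def)
  qed
  show "div_L1 v (c *\<^sub>R U) = c *\<^sub>R div_L1 v U" for c U
  proof -
    have ae: "AE x in lebesgue. gradient (Rep_lip0 (c *\<^sub>R U)) x \<bullet> v x = c * (gradient (Rep_lip0 U) x \<bullet> v x)"
      using lip0_differentiable[of U]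
    proof eventually_elim
      case (elim x)
      then have "partial_deriv i (\<lambda>y. c * Rep_lip0 U y) x = c * partial_deriv i (Rep_lip0 U) x" for i
        using partial_deriv_mult[of "\<lambda>_. c" x "Rep_lip0 U" i] by simp
      then show ?case by (simp add: gradient_def scaleR_lip0.rep_eq inner_vec_def mult.assoc sum_distrib_left)
    qed
    have "(LINT x|lebesgue. gradient (Rep_lip0 (c *\<^sub>R U)) x \<bullet> v x) = (LINT x|lebesgue. c * (gradient (Rep_lip0 U) x \<bullet> v x))"
      by (rule integral_cong_AE[OF borel_measurable_integrable[OF gi] borel_measurable_integrable[OF integrable_mult_right[OF gi]] ae])
    then show ?thesis by (simp add: div_L1_def)
  qed
  show "norm (div_L1 v U) \<le> norm U * mass v" for U using div_L1_bound[OF v, of U] by (simp add: mult.commute)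
qed

definition divop :: "(real^'n \<Rightarrow> real^'n) \<Rightarrow> ('n::finite lip0 \<Rightarrow>\<^sub>L real)" where
  "divop v = Blinfun (div_L1 v)"

lemma divop_apply: "integrable lebesgue v \<Longrightarrow> blinfun_apply (divop v) = div_L1 v"
  unfolding divop_def by (rule bounded_linear_Blinfun_apply[OF bounded_linear_div_L1])

lemma mass_nonneg: "0 \<le> mass v"
  unfolding mass_def by (intro sum_nonneg) simp

lemma norm_divop: "integrable lebesgue v \<Longrightarrow> norm (divop v) \<le> mass v"
  using div_L1_bound mass_nonneg by (intro norm_blinfun_bound) (auto simp: divop_apply)

lemma divop_diff:
  assumes "integrable lebesgue v" "integrable lebesgue w"
  shows "divop (\<lambda>x. v x - w x) = divop v - divop w"
  using assms gradient_pairing_integrable(1)[OF assms(1)] gradient_pairing_integrable(1)[OF assms(2)]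
  by (intro blinfun_eqI) (simp add: divop_apply blinfun.diff_left div_L1_def inner_diff_right)

lemma test_field_integrable:
  assumes "test_field v" shows "integrable lebesgue v"
proof -
  have "v = (\<lambda>x. \<Sum>i\<in>UNIV. v x $ i *\<^sub>R axis i 1)"
    by (simp add: fun_eq_iff vec_eq_iff axis_def if_distrib[of "\<lambda>t. _ * t"] cong: if_cong)
  moreover have "integrable lebesgue (\<lambda>x. \<Sum>i\<in>UNIV. v x $ i *\<^sub>R axis i (1::real))"
    by (intro Bochner_Integration.integrable_sum integrable_scaleR_left) (use test_fun_abs_integrable(2)[OF test_field_comp[OF assms]] in simp)
  ultimately show ?thesis by simp
qed

lemma lip0_test_integrable: "Cc g \<Longrightarrow> integrable lborel (\<lambda>x. Rep_lip0 U x * g x)"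
  by (rule loc_int_mult[OF continuous_loc_int[OF Rep_lip0_cont]])

lemma Cc_first_moment:
  fixes g :: "real^'n \<Rightarrow> real"
  assumes "Cc g" shows "integrable lborel (\<lambda>x. norm x * \<bar>g x\<bar>)"
proof -
  have "loc_int (\<lambda>x::real^'n. norm x)" by (intro continuous_loc_int continuous_intros)
  from integrable_abs[OF loc_int_mult[OF this assms]] show ?thesis by (simp add: abs_mult)
qed

section \<open>Functionals given by test functions\<close>

definition pairing :: "(real^'n \<Rightarrow> real) \<Rightarrow> ('n::finite lip0 \<Rightarrow>\<^sub>L real)" where
  "pairing g = Blinfun (\<lambda>U. LINT x|lborel. Rep_lip0 U x * g x)"

lemma pairing_apply:
  fixes g :: "real^'n \<Rightarrow> real"
  assumes g: "Cc g"
  shows "blinfun_apply (pairing g) = (\<lambda>U. LINT x|lborel. Rep_lip0 U x * g x)"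
  unfolding pairing_def
proof (rule bounded_linear_Blinfun_apply, rule bounded_linear_intro)
  note gi = lip0_test_integrable[OF g]
  fix U V :: "'n lip0" and c :: real
  show "(LINT x|lborel. Rep_lip0 (U + V) x * g x) = (LINT x|lborel. Rep_lip0 U x * g x) + (LINT x|lborel. Rep_lip0 V x * g x)"
    using gi by (simp add: plus_lip0.rep_eq distrib_right)
  show "(LINT x|lborel. Rep_lip0 (c *\<^sub>R U) x * g x) = c *\<^sub>R (LINT x|lborel. Rep_lip0 U x * g x)"
    by (simp add: scaleR_lip0.rep_eq mult.assoc)
  have "norm (LINT x|lborel. Rep_lip0 U x * g x) \<le> (LINT x|lborel. norm U * (norm x * \<bar>g x\<bar>))"
  proof (intro order_trans[OF integral_norm_bound integral_mono])
    show "norm (Rep_lip0 U x * g x) \<le> norm U * (norm x * \<bar>g x\<bar>)" for x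
      using mult_right_mono[OF Rep_lip0_le[of U x], of "\<bar>g x\<bar>"] by (simp add: abs_mult mult.assoc)
  qed (use gi Cc_first_moment[OF g] in auto)
  then show "norm (LINT x|lborel. Rep_lip0 U x * g x) \<le> norm U * (LINT x|lborel. norm x * \<bar>g x\<bar>)" by simp
qed

text \<open>Almost everywhere the pointwise gradient is the weak one, so integration by parts
  against test fields holds for Lipschitz functions; its minus sign cancels the one in
  \<open>div_L1\<close>.\<close>

lemma divop_test_field:
  fixes v :: "real^'n \<Rightarrow> real^'n"
  assumes v: "test_field v"
  shows "divop v = pairing (divergence v)"
proof (rule blinfun_eqI)
  fix U :: "'n lip0"
  let ?u = "Rep_lip0 U" and ?D = "\<lambda>i x. dlim (Rep_lip0 U) (axis i 1) x"
  note vi = test_field_integrable[OF v]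
  have [measurable]: "?D i \<in> borel_measurable borel" "(\<lambda>x. v x $ i) \<in> borel_measurable borel" for i
    using dlim_borel[OF Rep_lip0_cont, of U "axis i 1"] test_fun_borel[OF test_field_comp[OF v]] by simp_all
  have Di: "integrable lborel (\<lambda>x. ?D i x * v x $ i)" for i
    by (rule loc_int_mult[OF loc_int_bounded[OF _ dlim_bound[OF Rep_lip0_lipschitz]] test_fun_Cc[OF test_field_comp[OF v]]]) measurable
  have ui: "integrable lborel (\<lambda>x. ?u x * partial_deriv i (\<lambda>y. v y $ i) x)" for i
    by (rule lip0_test_integrable[OF test_fun_Cc[OF test_fun_partial[OF test_field_comp[OF v]]]])
  have Sm: "(\<lambda>x. \<Sum>i\<in>UNIV. ?D i x * v x $ i) \<in> borel_measurable borel" by measurable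
  have "(LINT x|lebesgue. gradient ?u x \<bullet> v x) = (LINT x|lebesgue. (\<Sum>i\<in>UNIV. ?D i x * v x $ i))"
  proof (rule integral_cong_AE)
    show "(\<lambda>x. gradient ?u x \<bullet> v x) \<in> borel_measurable lebesgue"
      by (rule borel_measurable_integrable[OF gradient_pairing_integrable(1)[OF vi]])
    show "(\<lambda>x. \<Sum>i\<in>UNIV. ?D i x * v x $ i) \<in> borel_measurable lebesgue" by (intro measurable_completion) (use Sm in simp)
    show "AE x in lebesgue. gradient ?u x \<bullet> v x = (\<Sum>i\<in>UNIV. ?D i x * v x $ i)"
      using gradient_lip0[of U] by eventually_elim (simp add: inner_vec_def)
  qed
  also have "\<dots> = (LINT x|lborel. (\<Sum>i\<in>UNIV. ?D i x * v x $ i))" by (rule borel_lborel_lebesgue(1)[OF Sm])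
  also have "\<dots> = (\<Sum>i\<in>UNIV. LINT x|lborel. ?D i x * v x $ i)" using Di by (rule Bochner_Integration.integral_sum)
  also have "\<dots> = (\<Sum>i\<in>UNIV. - (LINT x|lborel. ?u x * partial_deriv i (\<lambda>y. v y $ i) x))"
    by (simp add: lipschitz_weak_derivative[OF Rep_lip0_lipschitz test_field_comp[OF v]] sum_axis)
  also have "\<dots> = - (LINT x|lborel. ?u x * divergence v x)"
    using ui by (simp add: divergence_def sum_negf sum_distrib_left Bochner_Integration.integral_sum)
  finally show "blinfun_apply (divop v) U = blinfun_apply (pairing (divergence v)) U"
    by (simp add: divop_apply[OF vi] pairing_apply[OF test_fun_Cc[OF test_fun_divergence[OF v]]] div_L1_def)
qed

lemma pairing_lincomb:
  fixes f g :: "real^'n \<Rightarrow> real"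
  assumes f: "test_fun f" and g: "test_fun g"
  shows "pairing (\<lambda>x. c * f x + g x) = c *\<^sub>R pairing f + pairing g"
proof (rule blinfun_eqI)
  fix U :: "'n lip0"
  have t: "test_fun (\<lambda>x. c * f x + g x)" by (intro test_fun_add test_fun_cmult f g)
  show "blinfun_apply (pairing (\<lambda>x. c * f x + g x)) U = blinfun_apply (c *\<^sub>R pairing f + pairing g) U"
    using lip0_test_integrable[OF test_fun_Cc[OF f], of U] lip0_test_integrable[OF test_fun_Cc[OF g], of U]
    by (simp add: pairing_apply[OF test_fun_Cc[OF t]] pairing_apply[OF test_fun_Cc[OF f]] pairing_apply[OF test_fun_Cc[OF g]]
        blinfun.add_left blinfun.scaleR_left distrib_left mult.left_commute[of _ c])
qed

text \<open>Replacing \<open>x\<close> by a simple function \<open>F i x\<close> inside a Lipschitz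
  function turns the integral into a finite combination of evaluations. The error is at most
  \<open>norm U\<close> times the integral of \<open>norm (x - F i x) * \<bar>g x\<bar>\<close>,
  hence uniform on the unit ball.\<close>

lemma pairing_free:
  fixes g :: "real^'n \<Rightarrow> real"
  assumes g: "Cc g"
  shows "pairing g \<in> lipschitz_free_space"
  unfolding lipschitz_free_space_def closure_approachable
proof (intro allI impI)
  fix e :: real assume e: "e > 0"
  note [measurable] = Cc_borel[OF g]
  have gi: "integrable lborel g" by (rule Cc_integrable[OF g])
  \<comment> \<open>Simple functions approximating the identity map; the bound
    \<open>2 * norm x\<close> leads to the integrable majorant
    \<open>3 * (norm x * \<bar>g x\<bar>)\<close>.\<close>
  obtain F :: "nat \<Rightarrow> real^'n \<Rightarrow> real^'n" where F: "\<And>i. simple_function lborel (F i)" "\<And>x. (\<lambda>i. F i x) \<longlonglongrightarrow> x"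
    "\<And>i x. norm (F i x) \<le> 2 * norm x"
    using borel_measurable_implies_sequence_metric[of "\<lambda>x::real^'n. x" lborel 0] by auto
  have Fm[measurable]: "F i \<in> borel_measurable borel" for i using borel_measurable_simple_function[OF F(1)[of i]] by simp
  have ff: "finite (range (F i))" for i using simple_functionD(1)[OF F(1)[of i]] by simp
  have "(\<lambda>i. LINT x|lborel. norm (x - F i x) * \<bar>g x\<bar>) \<longlonglongrightarrow> (LINT x::real^'n|lborel. (0::real))"
  proof (rule integral_dominated_convergence[where w="\<lambda>x. 3 * (norm x * \<bar>g x\<bar>)"])
    show "integrable lborel (\<lambda>x. 3 * (norm x * \<bar>g x\<bar>))" using Cc_first_moment[OF g] by simp
    have "(\<lambda>i. norm (x - F i x) * \<bar>g x\<bar>) \<longlonglongrightarrow> norm (x - x) * \<bar>g x\<bar>" for x by (intro tendsto_intros F)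
    then show "AE x in lborel. (\<lambda>i. norm (x - F i x) * \<bar>g x\<bar>) \<longlonglongrightarrow> 0" by simp
    show "AE x in lborel. norm (norm (x - F i x) * \<bar>g x\<bar>) \<le> 3 * (norm x * \<bar>g x\<bar>)" for i
    proof (rule AE_I2)
      fix x :: "real^'n"
      have "norm (x - F i x) \<le> 3 * norm x" using norm_triangle_ineq4[of x "F i x"] F(3)[of i x] by linarith
      then have "norm (x - F i x) * \<bar>g x\<bar> \<le> 3 * norm x * \<bar>g x\<bar>" by (rule mult_right_mono) simp
      then show "norm (norm (x - F i x) * \<bar>g x\<bar>) \<le> 3 * (norm x * \<bar>g x\<bar>)" by (simp add: mult.assoc)
    qed
  qed measurable
  then have "eventually (\<lambda>i. (LINT x|lborel. norm (x - F i x) * \<bar>g x\<bar>) < e) sequentially"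
    using order_tendstoD(2)[of _ 0 sequentially e] e by simp
  then obtain i where i: "(LINT x|lborel. norm (x - F i x) * \<bar>g x\<bar>) < e" by (auto simp: eventually_sequentially)
  define a where "a p = (LINT x|lborel. indicator (F i -` {p}) x * g x)" for p
  define S where "S = (\<Sum>p\<in>range (F i). a p *\<^sub>R (lip_eval p :: 'n lip0 \<Rightarrow>\<^sub>L real))"
  have [measurable]: "F i -` {p} \<in> sets borel" for p
    using measurable_sets[OF Fm[of i], of "{p}"] by simp
  have indi: "integrable lborel (\<lambda>x. indicator (F i -` {p}) x * g x)" for p
    by (rule Bochner_Integration.integrable_bound[OF gi]) (auto simp: indicator_def intro!: AE_I2)
  have S: "blinfun_apply S U = (LINT x|lborel. Rep_lip0 U (F i x) * g x)" "integrable lborel (\<lambda>x. Rep_lip0 U (F i x) * g x)" for U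
  proof -
    have eq: "(\<lambda>x. Rep_lip0 U (F i x) * g x) = (\<lambda>x. \<Sum>p\<in>range (F i). Rep_lip0 U p * (indicator (F i -` {p}) x * g x))"
    proof
      fix x
      have "(\<Sum>p\<in>range (F i). Rep_lip0 U p * (indicator (F i -` {p}) x * g x)) = (\<Sum>p\<in>range (F i). if p = F i x then Rep_lip0 U p * g x else 0)"
        by (intro sum.cong) (auto simp: indicator_def)
      also have "\<dots> = Rep_lip0 U (F i x) * g x" using ff[of i] by simp
      finally show "Rep_lip0 U (F i x) * g x = (\<Sum>p\<in>range (F i). Rep_lip0 U p * (indicator (F i -` {p}) x * g x))" by simp
    qed
    show "integrable lborel (\<lambda>x. Rep_lip0 U (F i x) * g x)" unfolding eq using indi by simp
    show "blinfun_apply S U = (LINT x|lborel. Rep_lip0 U (F i x) * g x)"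
      unfolding eq S_def using indi
      by (simp add: Bochner_Integration.integral_sum a_def blinfun.sum_left blinfun.scaleR_left lip_eval.rep_eq mult.commute)
  qed
  have "norm (S - pairing g) \<le> (LINT x|lborel. norm (x - F i x) * \<bar>g x\<bar>)"
  proof (rule norm_blinfun_bound)
    show "0 \<le> (LINT x|lborel. norm (x - F i x) * \<bar>g x\<bar>)" by simp
    fix U :: "'n lip0"
    note ui = lip0_test_integrable[OF g, of U]
    have xi: "integrable lborel (\<lambda>x. norm (x - F i x) * \<bar>g x\<bar>)"
    proof (rule Bochner_Integration.integrable_bound)
      show "integrable lborel (\<lambda>x. 3 * (norm x * \<bar>g x\<bar>))" using Cc_first_moment[OF g] by simp
      show "AE x in lborel. norm (norm (x - F i x) * \<bar>g x\<bar>) \<le> norm (3 * (norm x * \<bar>g x\<bar>))"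
      proof (rule AE_I2)
        fix x :: "real^'n"
        have "norm (x - F i x) \<le> 3 * norm x" using norm_triangle_ineq4[of x "F i x"] F(3)[of i x] by linarith
        then have "norm (x - F i x) * \<bar>g x\<bar> \<le> 3 * norm x * \<bar>g x\<bar>" by (rule mult_right_mono) simp
        then show "norm (norm (x - F i x) * \<bar>g x\<bar>) \<le> norm (3 * (norm x * \<bar>g x\<bar>))" by (simp add: mult.assoc)
      qed
    qed measurable
    have "blinfun_apply (S - pairing g) U = (LINT x|lborel. Rep_lip0 U (F i x) * g x - Rep_lip0 U x * g x)"
      using S[of U] ui by (simp add: blinfun.diff_left pairing_apply[OF g])
    also have "norm \<dots> \<le> (LINT x|lborel. norm U * (norm (x - F i x) * \<bar>g x\<bar>))"
    proof (intro order_trans[OF integral_norm_bound integral_mono])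
      show "integrable lborel (\<lambda>x. norm (Rep_lip0 U (F i x) * g x - Rep_lip0 U x * g x))"
        by (intro integrable_norm Bochner_Integration.integrable_diff S(2) ui)
      show "integrable lborel (\<lambda>x. norm U * (norm (x - F i x) * \<bar>g x\<bar>))" using xi by simp
      show "norm (Rep_lip0 U (F i x) * g x - Rep_lip0 U x * g x) \<le> norm U * (norm (x - F i x) * \<bar>g x\<bar>)" for x
        using mult_right_mono[OF Rep_lip0_diff_le[of U "F i x" x], of "\<bar>g x\<bar>"]
        by (simp add: abs_mult left_diff_distrib[symmetric] norm_minus_commute mult.assoc)
    qed
    finally show "norm (blinfun_apply (S - pairing g) U) \<le> (LINT x|lborel. norm (x - F i x) * \<bar>g x\<bar>) * norm U"
      by (simp add: mult.commute)
  qed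
  moreover have "S \<in> span (range lip_eval)" unfolding S_def by (intro span_sum span_scale span_base) auto
  ultimately show "\<exists>y\<in>span (range lip_eval). dist y (pairing g) < e"
    using i by (intro bexI[of _ S]) (simp_all add: dist_norm)
qed

text \<open>A mollifier centred at \<open>x\<close> minus the same mollifier centred at 0. The
  second one is close to evaluation at 0, which is the zero functional, and brings the integral to
  0. Each of the two smearings costs \<open>e / 2\<close>.\<close>

lemma lip_eval_approx:
  fixes x :: "real^'n"
  assumes e: "e > 0"
  shows "\<exists>f. test_fun f \<and> (LINT x|lborel. f x) = 0 \<and> norm (lip_eval x - pairing f) \<le> e"
proof -
  obtain \<rho> :: "real^'n \<Rightarrow> real" where \<rho>: "mollifier (e / 2) \<rho>" using mollifier_exists[of "e / 2"] e by auto
  note R = mollifierD[OF \<rho>]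
  note [measurable] = test_fun_borel[OF R(1)]
  define f where "f z = \<rho> (z + - x) + (- 1) * \<rho> z" for z
  have t: "test_fun (\<lambda>z. \<rho> (z + - x))" by (rule test_fun_shift[OF R(1)])
  have f: "test_fun f" unfolding f_def by (intro test_fun_add test_fun_cmult t R(1))
  have i: "integrable lborel \<rho>" "integrable lborel (\<lambda>z. \<rho> (z + - x))"
    by (intro Cc_integrable test_fun_Cc R(1) t)+
  have avg: "\<bar>Rep_lip0 U y - (LINT z|lborel. Rep_lip0 U z * \<rho> (z + - y))\<bar> \<le> norm U * (e / 2)" for U y
  proof -
    have ty: "test_fun (\<lambda>z. \<rho> (z + - y))" by (rule test_fun_shift[OF R(1)])
    have iy: "integrable lborel (\<lambda>z. \<rho> (z + - y))" by (intro Cc_integrable test_fun_Cc ty)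
    have uy: "integrable lborel (\<lambda>z. Rep_lip0 U z * \<rho> (z + - y))" by (intro lip0_test_integrable test_fun_Cc ty)
    have one: "(LINT z|lborel. \<rho> (z + - y)) = 1" using integral_lborel_shift[of \<rho> "- y"] R(3) by simp
    have "Rep_lip0 U y - (LINT z|lborel. Rep_lip0 U z * \<rho> (z + - y)) = (LINT z|lborel. Rep_lip0 U y * \<rho> (z + - y) - Rep_lip0 U z * \<rho> (z + - y))"
      using iy uy one by simp
    also have "norm \<dots> \<le> (LINT z|lborel. norm U * (e / 2) * \<rho> (z + - y))"
    proof (intro order_trans[OF integral_norm_bound integral_mono])
      show "norm (Rep_lip0 U y * \<rho> (z + - y) - Rep_lip0 U z * \<rho> (z + - y)) \<le> norm U * (e / 2) * \<rho> (z + - y)" for z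
      proof (cases "norm (z + - y) \<ge> e / 2")
        case False
        then have "\<bar>Rep_lip0 U y - Rep_lip0 U z\<bar> \<le> norm U * (e / 2)"
          by (intro order_trans[OF Rep_lip0_diff_le] mult_left_mono) (auto simp: norm_minus_commute)
        from mult_right_mono[OF this R(2)[of "z + - y"]] show ?thesis
          using R(2)[of "z + - y"] unfolding left_diff_distrib[symmetric] real_norm_def abs_mult by simp
      qed (simp add: R(4))
    qed (use iy uy in auto)
    also have "\<dots> = norm U * (e / 2)" using one by simp
    finally show ?thesis by simp
  qed
  have "norm (lip_eval x - pairing f) \<le> e"
  proof (rule norm_blinfun_bound)
    fix U :: "'n lip0"
    have ui: "integrable lborel (\<lambda>z. Rep_lip0 U z * \<rho> (z + - x))" "integrable lborel (\<lambda>z. Rep_lip0 U z * \<rho> z)"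
      by (intro lip0_test_integrable test_fun_Cc t R(1))+
    have eq: "blinfun_apply (lip_eval x - pairing f) U
      = (Rep_lip0 U x - (LINT z|lborel. Rep_lip0 U z * \<rho> (z + - x))) - (Rep_lip0 U 0 - (LINT z|lborel. Rep_lip0 U z * \<rho> (z + - 0)))"
      using ui by (simp add: blinfun.diff_left lip_eval.rep_eq pairing_apply[OF test_fun_Cc[OF f]] f_def right_diff_distrib)
    have "norm (blinfun_apply (lip_eval x - pairing f) U) \<le> norm U * (e / 2) + norm U * (e / 2)"
      unfolding eq real_norm_def by (rule order_trans[OF abs_triangle_ineq4 add_mono[OF avg avg]])
    also have "\<dots> = e * norm U" by simp
    finally show "norm (blinfun_apply (lip_eval x - pairing f) U) \<le> e * norm U" .
  qed (use e in simp)
  moreover have "(LINT x|lborel. f x) = 0"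
    using i integral_lborel_shift[of \<rho> "- x"] by (simp add: f_def)
  ultimately show ?thesis using f by blast
qed

text \<open>Approximability is stable under linear combinations and so passes from evaluations to
  their span by induction; the closure costs one more error.\<close>

lemma free_test_approx:
  fixes T :: "'n::finite lip0 \<Rightarrow>\<^sub>L real"
  assumes T: "T \<in> lipschitz_free_space" and e: "e > 0"
  shows "\<exists>f. test_fun f \<and> (LINT x|lborel. f x) = 0 \<and> norm (T - pairing f) \<le> e"
proof -
  define A where "A = {T :: 'n lip0 \<Rightarrow>\<^sub>L real. \<forall>e>0. \<exists>f. test_fun f \<and> (LINT x|lborel. f x) = 0 \<and> norm (T - pairing f) \<le> e}"
  have AD: "\<exists>f. test_fun f \<and> (LINT x|lborel. f x) = 0 \<and> norm (T - pairing f) \<le> e" if "T \<in> A" "e > 0" for T e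
    using that by (simp add: A_def)
  obtain S where S: "S \<in> span (range lip_eval)" "dist S T < e / 2"
    using T half_gt_zero[OF e] unfolding lipschitz_free_space_def closure_approachable by blast
  from S(1) have "S \<in> A"
  proof (induction rule: span_induct_alt)
    case base
    have z: "Cc (\<lambda>_::real^'n. 0)" by (rule test_fun_Cc[OF test_fun_zero])
    have "norm (0 - pairing (\<lambda>_::real^'n. 0)) \<le> 0"
      by (intro norm_blinfun_bound) (simp_all add: blinfun.diff_left blinfun.minus_left pairing_apply[OF z])
    then show ?case unfolding A_def using test_fun_zero by (auto intro!: exI[of _ "\<lambda>_. 0"])
  next
    case (step c y T')
    obtain x where x: "y = lip_eval x" using step(1) by blast
    show ?case unfolding A_def
    proof (intro CollectI allI impI)
      fix e :: real assume e: "e > 0"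
      \<comment> \<open>\<open>\<bar>c\<bar> + 1\<close> keeps the divisor positive when
        \<open>c = 0\<close>.\<close>
      define q where "q = e / (2 * (\<bar>c\<bar> + 1))"
      have q: "q > 0" "\<bar>c\<bar> * q \<le> e / 2" using e by (auto simp: q_def field_simps)
      obtain f where f: "test_fun f" "(LINT x|lborel. f x) = 0" "norm (lip_eval x - pairing f) \<le> q" using lip_eval_approx[OF q(1)] by blast
      obtain g where g: "test_fun g" "(LINT x|lborel. g x) = 0" "norm (T' - pairing g) \<le> e / 2" using AD[OF step(2), of "e / 2"] e by auto
      have "norm (c *\<^sub>R y + T' - pairing (\<lambda>x. c * f x + g x)) = norm (c *\<^sub>R (lip_eval x - pairing f) + (T' - pairing g))"
        unfolding pairing_lincomb[OF f(1) g(1)] x by (simp add: algebra_simps)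
      also have "\<dots> \<le> \<bar>c\<bar> * norm (lip_eval x - pairing f) + norm (T' - pairing g)"
        using norm_triangle_ineq[of "c *\<^sub>R (lip_eval x - pairing f)" "T' - pairing g"] by simp
      also have "\<dots> \<le> \<bar>c\<bar> * q + e / 2" using f(3) g(3) by (intro add_mono mult_left_mono) auto
      finally have "norm (c *\<^sub>R y + T' - pairing (\<lambda>x. c * f x + g x)) \<le> e" using q(2) by linarith
      moreover have "(LINT x|lborel. c * f x + g x) = 0"
        using Cc_integrable[OF test_fun_Cc[OF f(1)]] Cc_integrable[OF test_fun_Cc[OF g(1)]] f(2) g(2) by simp
      moreover have "test_fun (\<lambda>x. c * f x + g x)" by (intro test_fun_add test_fun_cmult f g)
      ultimately show "\<exists>f. test_fun f \<and> (LINT x|lborel. f x) = 0 \<and> norm (c *\<^sub>R y + T' - pairing f) \<le> e" by blast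
    qed
  qed
  then obtain f where f: "test_fun f" "(LINT x|lborel. f x) = 0" "norm (S - pairing f) \<le> e / 2" using AD half_gt_zero[OF e] by blast
  have "norm (T - pairing f) \<le> norm (T - S) + norm (S - pairing f)" using norm_triangle_ineq[of "T - S" "S - pairing f"] by simp
  then have "norm (T - pairing f) \<le> e" using S(2) f(3) by (simp add: dist_norm norm_minus_commute)
  then show ?thesis using f by blast
qed

lemma free_diff:
  assumes "S \<in> lipschitz_free_space" "T \<in> lipschitz_free_space"
  shows "S - T \<in> lipschitz_free_space"
proof -
  obtain X Y where "\<And>k. X k \<in> span (range lip_eval)" "X \<longlonglongrightarrow> S" "\<And>k. Y k \<in> span (range lip_eval)" "Y \<longlonglongrightarrow> T"
    using assms unfolding lipschitz_free_space_def closure_sequential by blast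
  then show ?thesis unfolding lipschitz_free_space_def closure_sequential
    by (intro exI[of _ "\<lambda>k. X k - Y k"] conjI allI span_diff tendsto_diff)
qed

lemma divop_test_field_free: "test_field v \<Longrightarrow> divop v \<in> lipschitz_free_space"
  using pairing_free[OF test_fun_Cc[OF test_fun_divergence]] by (simp add: divop_test_field)


section \<open>Solving the equation in the Lipschitz-free space\<close>

text \<open>Passing to a test function of integral 0 makes \<open>weighted_approx\<close>
  applicable; its hypothesis \<open>dual\<close> is the norm bound for \<open>pairing f\<close>,
  read for all Lipschitz functions vanishing at 0.\<close>

lemma free_approx:
  fixes T :: "'n::finite lip0 \<Rightarrow>\<^sub>L real"
  assumes T: "T \<in> lipschitz_free_space" and e: "e > 0"
  shows "\<exists>v. test_field v \<and> mass v \<le> real CARD('n) * norm T + e \<and> norm (T - divop v) \<le> e \<and> T - divop v \<in> lipschitz_free_space"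
proof -
  define m where "m = real CARD('n)"
  have m: "m \<ge> 1" by (simp add: m_def Suc_leI)
  define q where "q = e / (2 * m)"
  have q: "q > 0" "m * (2 * q) = e" "q \<le> e / 2" using e m by (auto simp: q_def field_simps)
  obtain f where f: "test_fun f" "(LINT x|lborel. f x) = 0" "norm (T - pairing f) \<le> q" using free_test_approx[OF T q(1)] by blast
  \<comment> \<open>The added \<open>2 * q\<close> exceeds the approximation error and keeps
    \<open>\<tau>\<close> positive; multiplied by \<open>m\<close> it is exactly
    \<open>e\<close>.\<close>
  define \<tau> where "\<tau> = norm T + 2 * q"
  have \<tau>0: "\<tau> > 0" using q(1) by (simp add: \<tau>_def add_nonneg_pos)
  have pf: "norm (pairing f) \<le> \<tau>"
    using norm_triangle_ineq4[of T "T - pairing f"] f(3) q(1) by (simp add: \<tau>_def)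
  have lip: "\<exists>U :: 'n lip0. Rep_lip0 U = u \<and> norm U \<le> L" if "L-lipschitz_on UNIV u" "u 0 = 0" for u :: "real^'n \<Rightarrow> real" and L
  proof -
    have "Rep_lip0 (Abs_lip0 u) = u" using that by (intro Abs_lip0_inverse) auto
    then show ?thesis using Lip_le[OF that(1)] by (metis norm_lip0.rep_eq)
  qed
  have dual: "(LINT x|lborel. u x * f x) \<le> L * \<tau>" if uL: "L-lipschitz_on UNIV u" "u 0 = 0" for u L
  proof -
    obtain U :: "'n lip0" where U: "Rep_lip0 U = u" "norm U \<le> L" using lip[OF uL] by blast
    have "blinfun_apply (pairing f) U \<le> norm (pairing f) * norm U" using norm_blinfun[of "pairing f" U] by (simp add: abs_le_iff)
    also have "\<dots> \<le> \<tau> * L" using pf U(2) \<tau>0 by (intro mult_mono) auto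
    finally show ?thesis using U(1) by (simp add: pairing_apply[OF test_fun_Cc[OF f(1)]] mult.commute)
  qed
  obtain r :: "real^'n \<Rightarrow> real" where r: "r \<in> borel_measurable borel" "\<And>x. r x > 0" "integrable lborel (\<lambda>x. (norm x)\<^sup>2 * r x)"
    "\<And>R. \<exists>a>0. \<forall>x. norm x \<le> R \<longrightarrow> a \<le> r x"
    by (rule second_moment_weight) (rule that)
  define I where "I = (LINT x|lborel. (norm x)\<^sup>2 * r x)"
  have I0: "I \<ge> 0" unfolding I_def using r(2) by (intro integral_nonneg_AE AE_I2) (simp add: less_imp_le)
  \<comment> \<open>This scale makes the moment term of \<open>weighted_pairing_bound\<close> at
    most \<open>e / 4\<close>; the accuracy \<open>l * (e / 4)\<close> then asked of
    \<open>v\<close> bounds the other term by \<open>e / 4\<close> as well.\<close>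
  define l where "l = e / (4 * (I + 1))"
  have l: "l > 0" "l * I \<le> e / 4" using e I0 by (auto simp: l_def field_simps)
  obtain v where v: "test_field v" "mass v \<le> real CARD('n) * \<tau>" "(LINT x|lborel. (f x - divergence v x)\<^sup>2 / r x) < l * (e / 4)"
    using weighted_approx[OF f(1,2) \<tau>0 dual r(1,2,4), of "l * (e / 4)"] l(1) e by auto
  define g where "g x = f x + (- 1) * divergence v x" for x
  have g: "test_fun g" unfolding g_def by (intro test_fun_add test_fun_cmult f test_fun_divergence v)
  note [measurable] = test_fun_borel[OF g] r(1)
  have lr: "loc_int (\<lambda>x. 1 / r x)" by (rule weight_loc_int[OF r(1,2,4)])
  have gi: "integrable lborel (\<lambda>x. (g x)\<^sup>2 / r x)"
    using loc_int_mult[OF lr Cc_mult[OF test_fun_Cc[OF g] Cc_cont[OF test_fun_Cc[OF g]]]] by (simp add: power2_eq_square)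
  have "norm (pairing g) \<le> e / 2"
  proof (rule norm_blinfun_bound)
    fix U :: "'n lip0"
    have "\<bar>LINT x|lborel. Rep_lip0 U x * g x\<bar> \<le> norm U * (l * I + (LINT x|lborel. (g x)\<^sup>2 / r x) / l)"
      unfolding I_def by (rule weighted_pairing_bound[OF r(1) _ r(2) l(1) r(3) gi Rep_lip0_lipschitz Rep_lip0_zero]) measurable
    also have "\<dots> \<le> norm U * (e / 4 + e / 4)"
    proof (intro mult_left_mono add_mono l(2))
      show "(LINT x|lborel. (g x)\<^sup>2 / r x) / l \<le> e / 4" using v(3) l(1) by (simp add: g_def pos_divide_le_eq mult.commute less_imp_le)
    qed simp
    finally show "norm (blinfun_apply (pairing g) U) \<le> e / 2 * norm U"
      by (simp add: pairing_apply[OF test_fun_Cc[OF g]] mult.commute)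
  qed (use e in simp)
  moreover have "pairing g = pairing f - divop v"
  proof -
    have "g = (\<lambda>x. (- 1) * divergence v x + f x)" by (simp add: g_def fun_eq_iff)
    then show ?thesis using pairing_lincomb[OF test_fun_divergence[OF v(1)] f(1), of "- 1"] by (simp add: divop_test_field[OF v(1)])
  qed
  moreover have "norm (T - divop v) \<le> norm (T - pairing f) + norm (pairing f - divop v)"
    using norm_triangle_ineq[of "T - pairing f" "pairing f - divop v"] by simp
  ultimately have "norm (T - divop v) \<le> e" using f(3) q(3) by simp
  moreover have "mass v \<le> real CARD('n) * norm T + e"
    using v(2) q(2) by (simp add: \<tau>_def m_def distrib_left)
  ultimately show ?thesis using v(1) free_diff[OF T divop_test_field_free[OF v(1)]] by blast
qed

text \<open>Test fields are dense in L_1 and the norm of \<open>divop\<close> is bounded by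
  \<open>mass\<close>, so the divergence of an integrable field is a limit of elements of a closed
  set.\<close>

lemma divop_free:
  fixes v :: "real^'n \<Rightarrow> real^'n"
  assumes v: "integrable lebesgue v"
  shows "divop v \<in> lipschitz_free_space"
proof -
  have "divop v \<in> closure lipschitz_free_space"
    unfolding closure_approachable
  proof (intro allI impI)
    fix e :: real assume e: "e > 0"
    define q where "q = e / real CARD('n)"
    have q: "q > 0" "real CARD('n) * q = e" using e by (simp_all add: q_def)
    have "\<exists>\<phi>. test_fun \<phi> \<and> (LINT x|lebesgue. \<bar>v x $ i - \<phi> x\<bar>) < q" for i
    proof -
      have "integrable lebesgue (\<lambda>x. v x $ i)" by (rule integrable_component[OF v])
      then have "(\<lambda>x. v x $ i) \<in> Lp 1" by (simp add: Lp_def)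
      from Lp_test_dense[OF _ this q(1)] show ?thesis by force
    qed
    then obtain \<phi> where \<phi>: "\<And>i. test_fun (\<phi> i)" "\<And>i. (LINT x|lebesgue. \<bar>v x $ i - \<phi> i x\<bar>) < q" by metis
    define w where "w x = (\<chi> i. \<phi> i x)" for x
    have w: "test_field w" using \<phi>(1) by (simp add: test_field_def w_def)
    note wi = test_field_integrable[OF w]
    have "norm (divop w - divop v) \<le> mass (\<lambda>x. v x - w x)"
      using norm_divop[OF Bochner_Integration.integrable_diff[OF v wi]] by (simp add: divop_diff[OF v wi] norm_minus_commute)
    also have "\<dots> < (\<Sum>i\<in>(UNIV::'n set). q)"
      unfolding mass_def by (intro sum_strict_mono) (simp_all add: w_def \<phi>(2))
    finally have "dist (divop w) (divop v) < e" using q(2) by (simp add: dist_norm)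
    then show "\<exists>y\<in>lipschitz_free_space. dist y (divop v) < e" using divop_test_field_free[OF w] by blast
  qed
  then show ?thesis by (simp add: lipschitz_free_space_def)
qed

text \<open>The series converges absolutely almost everywhere and in L_1, so summation commutes with
  the inner product and with the integral.\<close>

lemma divop_sum:
  fixes v :: "nat \<Rightarrow> real^'n \<Rightarrow> real^'n"
  assumes v: "\<And>k. integrable lebesgue (v k)"
    and s: "AE x in lebesgue. summable (\<lambda>k. norm (v k x))" "summable (\<lambda>k. LINT x|lebesgue. norm (v k x))" "summable (\<lambda>k. mass (v k))"
  shows "integrable lebesgue (\<lambda>x. \<Sum>k. v k x)" "(\<lambda>k. blinfun_apply (divop (v k)) U) sums div_L1 (\<lambda>x. \<Sum>k. v k x) U"
proof -
  show "integrable lebesgue (\<lambda>x. \<Sum>k. v k x)" by (rule integrable_suminf[OF v s(1,2)])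
  let ?G = "gradient (Rep_lip0 U)"
  note gi = gradient_pairing_integrable[OF v, of U]
  have "(\<lambda>k. LINT x|lebesgue. ?G x \<bullet> v k x) sums (LINT x|lebesgue. (\<Sum>k. ?G x \<bullet> v k x))"
  proof (rule sums_integral[OF gi(1)])
    show "AE x in lebesgue. summable (\<lambda>k. norm (?G x \<bullet> v k x))"
      using s(1)
    proof eventually_elim
      case (elim x)
      show ?case
        by (rule summable_comparison_test[OF _ summable_mult[OF elim, of "norm (?G x)"]]) (simp add: Cauchy_Schwarz_ineq2)
    qed
    show "summable (\<lambda>k. LINT x|lebesgue. norm (?G x \<bullet> v k x))"
      by (rule summable_comparison_test[OF _ summable_mult[OF s(3), of "norm U"]]) (use gi(2) in \<open>simp add: abs_of_nonneg\<close>)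
  qed
  moreover have "(LINT x|lebesgue. (\<Sum>k. ?G x \<bullet> v k x)) = (LINT x|lebesgue. ?G x \<bullet> (\<Sum>k. v k x))"
  proof -
    have ae: "AE x in lebesgue. (\<Sum>k. ?G x \<bullet> v k x) = ?G x \<bullet> (\<Sum>k. v k x)"
      using s(1) by eventually_elim (rule bounded_linear.suminf[OF bounded_linear_inner_right summable_norm_cancel, symmetric])
    have m: "(\<lambda>x. ?G x \<bullet> (\<Sum>k. v k x)) \<in> borel_measurable lebesgue"
      by (rule borel_measurable_integrable[OF gradient_pairing_integrable(1)[OF integrable_suminf[OF v s(1,2)]]])
    have "(\<lambda>x. \<Sum>k. ?G x \<bullet> v k x) \<in> borel_measurable lebesgue"
      by (rule borel_measurable_AE[OF m]) (use ae in \<open>eventually_elim, simp\<close>)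
    then show ?thesis using m ae by (rule integral_cong_AE)
  qed
  ultimately show "(\<lambda>k. blinfun_apply (divop (v k)) U) sums div_L1 (\<lambda>x. \<Sum>k. v k x) U"
    by (simp add: divop_apply[OF v] div_L1_def sums_minus)
qed

lemma norm_integral_le_mass:
  fixes v :: "real^'n \<Rightarrow> real^'n"
  assumes v: "integrable lebesgue v" shows "(LINT x|lebesgue. norm (v x)) \<le> mass v"
proof -
  note i = integrable_component[OF v]
  have "(LINT x|lebesgue. norm (v x)) \<le> (LINT x|lebesgue. (\<Sum>i\<in>UNIV. \<bar>v x $ i\<bar>))"
    using v i by (intro integral_mono norm_le_l1_cart) simp_all
  then show ?thesis using i by (simp add: mass_def Bochner_Integration.integral_sum)
qed

text \<open>The corrections are summable in L_1, hence absolutely summable almost everywhere. The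
  partial sums of their divergences tend to \<open>T\<close> because the remainders tend to 0, and
  \<open>divop_sum\<close> identifies the limit.\<close>

lemma free_divop:
  fixes T :: "'n::finite lip0 \<Rightarrow>\<^sub>L real"
  assumes T: "T \<in> lipschitz_free_space"
  shows "\<exists>v. integrable lebesgue v \<and> div_L1 v = blinfun_apply T"
proof -
  have "\<exists>(v :: nat \<Rightarrow> real^'n \<Rightarrow> real^'n) K. K > 0 \<and> (\<forall>k. test_field (v k) \<and> mass (v k) \<le> K * (1/2) ^ k
      \<and> norm (T - (\<Sum>j<k. divop (v j))) \<le> K * (1/2) ^ k)"
    by (rule summing_scheme[OF T _ free_approx]) simp_all
  then obtain v :: "nat \<Rightarrow> real^'n \<Rightarrow> real^'n" and K where v: "\<And>k. test_field (v k)" "\<And>k. mass (v k) \<le> K * (1/2) ^ k"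
    and res: "\<And>k. norm (T - (\<Sum>j<k. divop (v j))) \<le> K * (1/2) ^ k" by blast
  note vi = test_field_integrable[OF v(1)]
  have sK: "summable (\<lambda>k. K * (1/2::real) ^ k)" by (intro summable_mult summable_geometric) simp
  have sm: "summable (\<lambda>k. mass (v k))"
    by (rule summable_comparison_test[OF _ sK]) (use v(2) in \<open>simp add: mass_nonneg\<close>)
  have sn: "summable (\<lambda>k. LINT x|lebesgue. norm (v k x))"
    by (rule summable_comparison_test[OF _ sm]) (use norm_integral_le_mass[OF vi] in simp)
  have ae: "AE x in lebesgue. summable (\<lambda>k. norm (v k x))" using vi sn by (intro AE_summable) auto
  note V = divop_sum[OF vi ae sn sm]
  have "(\<lambda>k. K * (1/2::real) ^ k) \<longlonglongrightarrow> 0" by (rule summable_LIMSEQ_zero[OF sK])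
  then have "(\<lambda>k. T - (\<Sum>j<k. divop (v j))) \<longlonglongrightarrow> 0" by (rule Lim_null_comparison[rotated]) (use res in simp)
  then have "(\<lambda>k. T - (T - (\<Sum>j<k. divop (v j)))) \<longlonglongrightarrow> T - 0" by (intro tendsto_diff tendsto_const)
  then have lim: "(\<lambda>k. \<Sum>j<k. divop (v j)) \<longlonglongrightarrow> T" by simp
  have "div_L1 (\<lambda>x. \<Sum>k. v k x) U = blinfun_apply T U" for U
  proof -
    have "(\<lambda>k. blinfun_apply (\<Sum>j<k. divop (v j)) U) \<longlonglongrightarrow> blinfun_apply T U" by (intro tendsto_intros lim)
    then have "(\<lambda>j. blinfun_apply (divop (v j)) U) sums blinfun_apply T U" by (simp add: sums_def blinfun.sum_left)
    then show ?thesis using V(2)[of U] sums_unique2 by blast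
  qed
  then show ?thesis using V(1) by blast
qed

lemma div_L1_image:
  "div_L1 ` {v :: real^'n \<Rightarrow> real^'n. integrable lebesgue v} = blinfun_apply ` (lipschitz_free_space :: ('n lip0 \<Rightarrow>\<^sub>L real) set)"
proof (intro set_eqI iffI)
  fix F assume "F \<in> div_L1 ` {v :: real^'n \<Rightarrow> real^'n. integrable lebesgue v}"
  then obtain v where v: "integrable lebesgue v" "F = div_L1 v" by blast
  then show "F \<in> blinfun_apply ` lipschitz_free_space" using divop_free[OF v(1)] divop_apply[OF v(1)] by (metis image_eqI)
next
  fix F assume "F \<in> blinfun_apply ` (lipschitz_free_space :: ('n lip0 \<Rightarrow>\<^sub>L real) set)"
  then obtain T where "T \<in> lipschitz_free_space" "F = blinfun_apply T" by blast
  then show "F \<in> div_L1 ` {v. integrable lebesgue v}" using free_divop[of T] by force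
qed

text \<open>Equality of each image with the space comprises both that the operator takes its values
  there and that it is onto. The class \<open>card2\<close> expresses
  \<open>m \<ge> 2\<close>.\<close>

theorem theoremA:
  shows "div_L1 ` {v :: real^'n::card2 \<Rightarrow> real^'n::card2. integrable lebesgue v}
           = blinfun_apply ` (lipschitz_free_space :: ('n lip0 \<Rightarrow>\<^sub>L real) set)
       \<and> div_C0 ` (C0_fields :: (real^'n::card2 \<Rightarrow> real^'n::card2) set)
           = blinfun_apply ` (SCH0 :: ('n bv \<Rightarrow>\<^sub>L real) set)"
  using div_L1_image div_C0_image by blast

end
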